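(* Let $M=\bigoplus_{n\ge 0}M_n=\mathbb{Z}[x,y]$ be the graded $B_3$-module described in the context. Then: 1. for every prime $p\neq 2,3$ there are isomorphisms of graded abelian groups (graded by the degree in $M$) $$H^2(B_3;M)_{(p)}\cong H^1(B_3;M)_{(p)}\cong\Gamma_p^+[\mathcal{P}_p,\mathcal{Q}_p];$$ 2. for every $n>0$, $FH^2(B_3;M_n)\cong FH^1(B_3;M_n)\cong\mathbb{Z}^{f_n}$, where $$\sum_{n=0}^\infty f_nt^n=\frac{t^4(1+t^4-t^{12}+t^{16})}{(1-t^8)(1-t^{12})}.$$
   Context: $B_3=\langle\sigma_1,\sigma_2:\sigma_1\sigma_2\sigma_1=\sigma_2\sigma_1\sigma_2\rangle$ is the braid group on 3 strands, and $\lambda:B_3\to SL_2(\mathbb{Z})$ is the surjection $\sigma_1\mapsto\begin{bmatrix}1&0\\-1&1\end{bmatrix}$, $\sigma_2\mapsto\begin{bmatrix}1&1\\0&1\end{bmatrix}$. The group $SL_2(\mathbb{Z})$ acts on $M=\mathbb{Z}[x,y]$ by graded ring automorphisms determined by $\sigma_1:x\mapsto x-y,\ y\mapsto y$ and $\sigma_2:x\mapsto x,\ y\mapsto x+y$; $B_3$ acts through $\lambda$. The grading is $\deg x=\deg y=2$, $M_n$ is the homogeneous component of degree $n$ (zero for $n$ odd), and $H^*(B_3;M)=\bigoplus_nH^*(B_3;M_n)$. For an abelian group $L$ and a prime $p$, $L_{(p)}=\{a\in L: p^ka=0\text{ for some }k\}$; for $L$ finitely generated $FL$ is the free part of $L$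 (the isomorphism class of a maximal free direct summand). $\Gamma[z]\subset\mathbb{Q}[z]$ is the divided polynomial algebra, spanned over $\mathbb{Z}$ by $z_i=z^i/i!$, $i\ge0$. With $v$ the $p$-adic valuation, $I_p=(p^{v(i)+1}z_i,\ i\ge1)$ is an ideal of $\Gamma[z]$ and $\Gamma_p[z]=\Gamma[z]/I_p$. Also $\Gamma_p[z,z']=\Gamma_p[z]\otimes_{\mathbb{Z}}\Gamma_p[z']$, and $\Gamma_p^+[z,z']$ is its part of degree $>0$. Here the formal variables are called $\mathcal{P}_p$ and $\mathcal{Q}_p$, with degrees $\deg\mathcal{P}_p=2(p+1)$, $\deg\mathcal{Q}_p=2p(p-1)$. *)

theory Defs
  imports
    "HOL-Analysis.Determinants"
    "HOL-Analysis.Cartesian_Space"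
    "HOL-Algebra.QuotRing"
    "HOL-Algebra.Free_Abelian_Groups"
    "HOL-Computational_Algebra.Polynomial"
    "HOL-Computational_Algebra.Primes"
    "HOL-Computational_Algebra.Formal_Power_Series"
begin

section \<open>Groups given by a presentation\<close>

text \<open>
  A word is a list of letters; \<open>(x, True)\<close> stands for the generator \<open>x\<close> and \<open>(x, False)\<close>
  for its formal inverse.  The presented group is the set of words modulo the
  congruence generated by free cancellation and by the given relations \<open>u = v\<close>.
\<close>

type_synonym 'a word = "('a \<times> bool) list"

inductive word_cong :: "('a word \<times> 'a word) set \<Rightarrow> 'a word \<Rightarrow> 'a word \<Rightarrow> bool"
  for R where
  refl: "word_cong R u u"
| sym: "word_cong R u v \<Longrightarrow> word_cong R v u"
| trans: "word_cong R u v \<Longrightarrow> word_cong R v w \<Longrightarrow> word_cong R u w"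
| cancel: "word_cong R (a @ [(x, s), (x, \<not> s)] @ b) (a @ b)"
| rel: "(u, v) \<in> R \<Longrightarrow> word_cong R (a @ u @ b) (a @ v @ b)"

definition word_class :: "('a word \<times> 'a word) set \<Rightarrow> 'a word \<Rightarrow> 'a word set"
  where "word_class R w = {v. word_cong R w v}"

definition presented_group :: "('a word \<times> 'a word) set \<Rightarrow> 'a word set monoid"
  where "presented_group R =
    \<lparr>carrier = range (word_class R),
     monoid.mult = (\<lambda>A B. \<Union>u\<in>A. \<Union>v\<in>B. word_class R (u @ v)),
     one = word_class R []\<rparr>"

primrec word_value :: "('g, 'm) monoid_scheme \<Rightarrow> ('a \<Rightarrow> 'g) \<Rightarrow> 'a word \<Rightarrow> 'g"
  where
    "word_value G \<phi> [] = \<one>\<^bsub>G\<^esub>"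
  | "word_value G \<phi> (l # w) =
      (if snd l then \<phi> (fst l) else inv\<^bsub>G\<^esub> (\<phi> (fst l))) \<otimes>\<^bsub>G\<^esub> word_value G \<phi> w"

text \<open>
  The homomorphism out of a presented group that is determined by the images \<open>\<phi>\<close> of the
  generators.  If \<open>\<phi>\<close> respects the relations, then \<open>word_value\<close> is constant on each class.
\<close>

definition presented_hom :: "('g, 'm) monoid_scheme \<Rightarrow> ('a \<Rightarrow> 'g) \<Rightarrow> 'a word set \<Rightarrow> 'g"
  where "presented_hom G \<phi> A = the_elem (word_value G \<phi> ` A)"

lemma word_cong_append:
  assumes "word_cong R u u'" "word_cong R v v'"
  shows "word_cong R (u @ v) (u' @ v')"
proof -
  have left: "word_cong R (a @ w) (a @ w')" if "word_cong R w w'" for a w w'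
    using that
  proof induction
    case (cancel b x s c)
    show ?case using word_cong.cancel[of R "a @ b" x s c] by simp
  next
    case (rel u v b c)
    then show ?case using word_cong.rel[of u v R "a @ b" c] by simp
  next
    case (refl u)
    show ?case by (rule word_cong.refl)
  next
    case (sym u v)
    show ?case by (rule word_cong.sym[OF sym.IH])
  next
    case (trans u v w)
    show ?case by (rule word_cong.trans[OF trans.IH])
  qed
  have right: "word_cong R (w @ a) (w' @ a)" if "word_cong R w w'" for a w w'
    using that
  proof induction
    case (cancel b x s c)
    show ?case using word_cong.cancel[of R b x s "c @ a"] by simp
  next
    case (rel u v b c)
    then show ?case using word_cong.rel[of u v R b "c @ a"] by simp
  next
    case (refl u)
    show ?case by (rule word_cong.refl)
  next
    case (sym u v)
    show ?case by (rule word_cong.sym[OF sym.IH])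
  next
    case (trans u v w)
    show ?case by (rule word_cong.trans[OF trans.IH])
  qed
  show ?thesis
    by (rule word_cong.trans[OF left[OF assms(2)] right[OF assms(1)]])
qed

lemma word_class_eq_iff: "word_class R u = word_class R v \<longleftrightarrow> word_cong R u v"
proof
  assume "word_class R u = word_class R v"
  then show "word_cong R u v"
    using word_cong.refl[of R v] by (simp add: word_class_def set_eq_iff)
next
  assume uv: "word_cong R u v"
  show "word_class R u = word_class R v"
    unfolding word_class_def
    using word_cong.trans[OF uv] word_cong.trans[OF word_cong.sym[OF uv]]
    by (intro Collect_cong iffI)
qed

lemma mult_presented_group [simp]:
  "word_class R u \<otimes>\<^bsub>presented_group R\<^esub> word_class R v = word_class R (u @ v)"
proof -
  have "word_class R (u' @ v') = word_class R (u @ v)"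
    if "u' \<in> word_class R u" "v' \<in> word_class R v" for u' v'
    using that unfolding word_class_eq_iff
    by (metis mem_Collect_eq word_class_def word_cong.sym word_cong_append)
  moreover have "u \<in> word_class R u" "v \<in> word_class R v"
    by (auto simp: word_class_def word_cong.refl)
  ultimately have "(\<Union>u'\<in>word_class R u. \<Union>v'\<in>word_class R v. word_class R (u' @ v'))
      = word_class R (u @ v)"
    by blast
  then show ?thesis
    by (simp add: presented_group_def)
qed

lemma carrier_presented_group: "carrier (presented_group R) = range (word_class R)"
  by (simp add: presented_group_def)

lemma one_presented_group: "\<one>\<^bsub>presented_group R\<^esub> = word_class R []"
  by (simp add: presented_group_def)

lemma word_cong_inverse:
  "word_cong R (map (\<lambda>l. (fst l, \<not> snd l)) (rev w) @ w) []"
proof (induction w)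
  case Nil
  show ?case by (simp add: word_cong.refl)
next
  case (Cons l w)
  obtain x s where l: "l = (x, s)" by fastforce
  show ?case
    using word_cong.trans[OF word_cong.cancel[of R "map (\<lambda>l. (fst l, \<not> snd l)) (rev w)" x "\<not> s" w] Cons.IH]
    by (simp add: l)
qed

lemma group_presented_group: "group (presented_group R)"
proof (rule groupI)
  fix A assume "A \<in> carrier (presented_group R)"
  then obtain w where w: "A = word_class R w"
    by (auto simp: carrier_presented_group)
  let ?B = "word_class R (map (\<lambda>l. (fst l, \<not> snd l)) (rev w))"
  have "?B \<otimes>\<^bsub>presented_group R\<^esub> A = \<one>\<^bsub>presented_group R\<^esub>"
    unfolding w mult_presented_group one_presented_group word_class_eq_iff
    by (rule word_cong_inverse)
  moreover have "?B \<in> carrier (presented_group R)"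
    by (simp add: carrier_presented_group)
  ultimately show "\<exists>B\<in>carrier (presented_group R). B \<otimes>\<^bsub>presented_group R\<^esub> A = \<one>\<^bsub>presented_group R\<^esub>"
    by blast
qed (auto simp: carrier_presented_group one_presented_group)

lemma (in group) word_value_closed:
  assumes "\<And>x. \<phi> x \<in> carrier G"
  shows "word_value G \<phi> w \<in> carrier G"
  using assms by (induction w) auto

lemma (in group) word_value_append:
  assumes "\<And>x. \<phi> x \<in> carrier G"
  shows "word_value G \<phi> (u @ v) = word_value G \<phi> u \<otimes> word_value G \<phi> v"
  using assms by (induction u) (auto simp: word_value_closed m_assoc)

lemma (in group) word_value_cong:
  assumes "\<And>x. \<phi> x \<in> carrier G"
    and "\<And>u v. (u, v) \<in> R \<Longrightarrow> word_value G \<phi> u = word_value G \<phi> v"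
    and "word_cong R u v"
  shows "word_value G \<phi> u = word_value G \<phi> v"
  using assms(3)
proof induction
  case (cancel a x s b)
  have "word_value G \<phi> [(x, s), (x, \<not> s)] = \<one>"
    using assms(1) by (cases s) auto
  then show ?case
    using word_value_append[of \<phi>, OF assms(1)] word_value_closed[of \<phi>, OF assms(1)]
    by (metis l_one)
next
  case (rel u v a b)
  then show ?case
    using assms by (simp add: word_value_append)
qed auto

lemma (in group) presented_hom_class:
  assumes "\<And>x. \<phi> x \<in> carrier G"
    and "\<And>u v. (u, v) \<in> R \<Longrightarrow> word_value G \<phi> u = word_value G \<phi> v"
  shows "presented_hom G \<phi> (word_class R w) = word_value G \<phi> w"
proof -
  have "word_value G \<phi> ` word_class R w = {word_value G \<phi> w}"
  proof (intro equalityI subsetI)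
    fix g assume "g \<in> word_value G \<phi> ` word_class R w"
    then obtain v where "word_cong R w v" "g = word_value G \<phi> v"
      by (auto simp: word_class_def)
    then show "g \<in> {word_value G \<phi> w}"
      using word_value_cong[of \<phi> R w v] assms by simp
  next
    fix g assume "g \<in> {word_value G \<phi> w}"
    then show "g \<in> word_value G \<phi> ` word_class R w"
      by (simp add: word_class_def word_cong.refl)
  qed
  then show ?thesis by (simp add: presented_hom_def)
qed

lemma (in group) presented_hom_hom:
  assumes "\<And>x. \<phi> x \<in> carrier G"
    and "\<And>u v. (u, v) \<in> R \<Longrightarrow> word_value G \<phi> u = word_value G \<phi> v"
  shows "presented_hom G \<phi> \<in> hom (presented_group R) G"
proof (rule homI)
  have cls: "presented_hom G \<phi> (word_class R w) = word_value G \<phi> w" for w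
    by (rule presented_hom_class[OF assms])
  fix A assume "A \<in> carrier (presented_group R)"
  then obtain u where u: "A = word_class R u"
    by (auto simp: carrier_presented_group)
  show "presented_hom G \<phi> A \<in> carrier G"
    unfolding u cls
    by (rule word_value_closed[OF assms(1)])
  fix B assume "B \<in> carrier (presented_group R)"
  then obtain v where v: "B = word_class R v"
    by (auto simp: carrier_presented_group)
  show "presented_hom G \<phi> (A \<otimes>\<^bsub>presented_group R\<^esub> B) =
      presented_hom G \<phi> A \<otimes> presented_hom G \<phi> B"
    unfolding u v mult_presented_group cls
    by (rule word_value_append[OF assms(1)])
qed


section \<open>The braid group on three strands and its map to \<open>SL\<^sub>2(\<int>)\<close>\<close>

datatype braid_gen = Sigma1 | Sigma2

definition braid_rel :: "(braid_gen word \<times> braid_gen word) set"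
  where "braid_rel =
    {([(Sigma1, True), (Sigma2, True), (Sigma1, True)],
      [(Sigma2, True), (Sigma1, True), (Sigma2, True)])}"

definition B3 :: "braid_gen word set monoid"
  where "B3 = presented_group braid_rel"

definition braid :: "braid_gen \<Rightarrow> braid_gen word set"
  where "braid g = word_class braid_rel [(g, True)]"

definition SL2Z :: "(int^2^2) monoid"
  where "SL2Z = \<lparr>carrier = {A. det A = 1}, monoid.mult = (**), one = mat 1\<rparr>"

primrec gen_matrix :: "braid_gen \<Rightarrow> int^2^2"
  where
    "gen_matrix Sigma1 = vector [vector [1, 0], vector [-1, 1]]"
  | "gen_matrix Sigma2 = vector [vector [1, 1], vector [0, 1]]"

definition braid_to_SL2Z :: "braid_gen word set \<Rightarrow> int^2^2"
  where "braid_to_SL2Z = presented_hom SL2Z gen_matrix"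

lemma group_SL2Z: "group SL2Z"
proof (rule groupI)
  fix A assume "A \<in> carrier SL2Z"
  then have d: "A$1$1 * A$2$2 - A$1$2 * A$2$1 = 1"
    by (simp add: SL2Z_def det_2)
  let ?B = "vector [vector [A$2$2, - A$1$2], vector [- A$2$1, A$1$1]] :: int^2^2"
  have "?B ** A = mat 1"
    using d by (auto simp: vec_eq_iff forall_2 matrix_matrix_mult_def sum_2 mat_def algebra_simps)
  moreover have "det ?B = 1"
    using d by (simp add: det_2 algebra_simps)
  ultimately show "\<exists>B\<in>carrier SL2Z. B \<otimes>\<^bsub>SL2Z\<^esub> A = \<one>\<^bsub>SL2Z\<^esub>"
    by (auto simp: SL2Z_def)
qed (auto simp: SL2Z_def det_mul matrix_mul_assoc)

lemma gen_matrix_SL2Z: "gen_matrix g \<in> carrier SL2Z"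
  by (cases g) (auto simp: SL2Z_def det_2)

lemma braid_to_SL2Z_wd:
  assumes "(u, v) \<in> braid_rel"
  shows "word_value SL2Z gen_matrix u = word_value SL2Z gen_matrix v"
  using assms
  by (auto simp: braid_rel_def SL2Z_def vec_eq_iff forall_2 matrix_matrix_mult_def sum_2 mat_def)

lemma group_B3: "group B3"
  unfolding B3_def by (rule group_presented_group)

lemma braid_to_SL2Z_hom: "braid_to_SL2Z \<in> hom B3 SL2Z"
  unfolding braid_to_SL2Z_def B3_def
  by (rule group.presented_hom_hom[OF group_SL2Z gen_matrix_SL2Z braid_to_SL2Z_wd])

lemma braid_to_SL2Z_braid: "braid_to_SL2Z (braid g) = gen_matrix g"
proof -
  interpret group SL2Z by (rule group_SL2Z)
  show ?thesis
    unfolding braid_to_SL2Z_def braid_def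
    using presented_hom_class[of gen_matrix braid_rel "[(g, True)]",
        OF gen_matrix_SL2Z braid_to_SL2Z_wd]
    by (simp add: gen_matrix_SL2Z)
qed


section \<open>The module \<open>M = \<int>[x, y]\<close>\<close>

text \<open>
  \<open>\<int>[x, y]\<close> is \<open>\<int>[y][x]\<close>: the coefficient of \<open>x\<^sup>i y\<^sup>j\<close> in \<open>f\<close> is \<open>coeff (coeff f i) j\<close>.
\<close>

definition var_x :: "int poly poly"
  where "var_x = [:0, 1:]"

definition var_y :: "int poly poly"
  where "var_y = [:[:0, 1:]:]"

text \<open>\<open>f(u, v)\<close>\<close>

definition subst_xy :: "int poly poly \<Rightarrow> int poly poly \<Rightarrow> int poly poly \<Rightarrow> int poly poly"
  where "subst_xy f u v = poly (map_poly (\<lambda>c. poly (map_poly of_int c) v) f) u"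

text \<open>The columns of the matrix are the images of \<open>x\<close> and \<open>y\<close>.\<close>

definition SL2Z_action :: "int^2^2 \<Rightarrow> int poly poly \<Rightarrow> int poly poly"
  where "SL2Z_action A f = subst_xy f
    (of_int (A$1$1) * var_x + of_int (A$2$1) * var_y)
    (of_int (A$1$2) * var_x + of_int (A$2$2) * var_y)"

definition B3_action :: "braid_gen word set \<Rightarrow> int poly poly \<Rightarrow> int poly poly"
  where "B3_action g = SL2Z_action (braid_to_SL2Z g)"

text \<open>\<open>M\<^sub>n\<close>, with \<open>deg x = deg y = 2\<close>\<close>

definition M_component :: "nat \<Rightarrow> int poly poly set"
  where "M_component n = {f. \<forall>i j. Polynomial.coeff (Polynomial.coeff f i) j \<noteq> 0 \<longrightarrow> 2 * (i + j) = n}"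

lemma poly_map_poly_hom:
  fixes h :: "'a::comm_ring_1 \<Rightarrow> 'b::comm_ring_1"
  assumes h: "h 0 = 0" "h 1 = 1" "\<And>a b. h (a + b) = h a + h b" "\<And>a b. h (a * b) = h a * h b"
  shows "poly (map_poly h 1) u = 1"
    and "poly (map_poly h (p + q)) u = poly (map_poly h p) u + poly (map_poly h q) u"
    and "poly (map_poly h (p * q)) u = poly (map_poly h p) u * poly (map_poly h q) u"
proof -
  have step: "poly (map_poly h (Polynomial.pCons a p)) u = h a + u * poly (map_poly h p) u" for a p
    using h(1) by (simp add: map_poly_pCons)
  show "poly (map_poly h 1) u = 1"
    using h by (simp add: one_pCons step)
  have add: "poly (map_poly h (p + q)) u = poly (map_poly h p) u + poly (map_poly h q) u" for p q
  proof (induction p arbitrary: q)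
    case (pCons a p)
    obtain b q' where q: "q = Polynomial.pCons b q'" by (cases q)
    show ?case by (simp add: q pCons.IH h(3) step algebra_simps)
  qed simp
  then show "poly (map_poly h (p + q)) u = poly (map_poly h p) u + poly (map_poly h q) u" .
  have smult: "poly (map_poly h (Polynomial.smult a q)) u = h a * poly (map_poly h q) u" for a q
    by (induction q) (use h in \<open>simp_all add: step algebra_simps\<close>)
  show "poly (map_poly h (p * q)) u = poly (map_poly h p) u * poly (map_poly h q) u"
    by (induction p) (use h in \<open>simp_all add: step add smult algebra_simps\<close>)
qed

lemma subst_xy_one: "subst_xy 1 u v = 1"
  and subst_xy_add: "subst_xy (f + g) u v = subst_xy f u v + subst_xy g u v"
  and subst_xy_mult: "subst_xy (f * g) u v = subst_xy f u v * subst_xy g u v"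
proof -
  let ?h = "\<lambda>c. poly (map_poly of_int c) v"
  have h: "?h 0 = 0" "?h 1 = 1" "?h (a + b) = ?h a + ?h b" "?h (a * b) = ?h a * ?h b" for a b
    using poly_map_poly_hom[of of_int] by simp_all
  show "subst_xy 1 u v = 1" "subst_xy (f + g) u v = subst_xy f u v + subst_xy g u v"
    "subst_xy (f * g) u v = subst_xy f u v * subst_xy g u v"
    unfolding subst_xy_def using poly_map_poly_hom[of ?h, OF h] by auto
qed

lemma subst_xy_var: "subst_xy var_x u v = u" "subst_xy var_y u v = v"
  by (simp_all add: subst_xy_def var_x_def var_y_def map_poly_pCons)

lemma B3_action_Sigma1:
  "B3_action (braid Sigma1) var_x = var_x - var_y" "B3_action (braid Sigma1) var_y = var_y"
  by (simp_all add: B3_action_def SL2Z_action_def braid_to_SL2Z_braid subst_xy_var)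

lemma B3_action_Sigma2:
  "B3_action (braid Sigma2) var_x = var_x" "B3_action (braid Sigma2) var_y = var_x + var_y"
  by (simp_all add: B3_action_def SL2Z_action_def braid_to_SL2Z_braid subst_xy_var)


section \<open>Group cohomology\<close>

text \<open>
  \<open>H\<^sup>n(G; A)\<close> by inhomogeneous cochains, for a \<open>G\<close>-module \<open>A\<close> that is an additive subgroup of
  some type, with action \<open>\<alpha>\<close>.  A cochain takes an \<open>n\<close>-tuple of elements of \<open>G\<close>, represented as a
  list, and is \<open>0\<close> on all other lists.
\<close>

definition cochains ::
  "('g, 'm) monoid_scheme \<Rightarrow> 'a::ab_group_add set \<Rightarrow> nat \<Rightarrow> ('g list \<Rightarrow> 'a) set"
  where "cochains G A n =
    {f. (\<forall>gs. length gs = n \<and> set gs \<subseteq> carrier G \<longrightarrow> f gs \<in> A) \<and>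
        (\<forall>gs. \<not> (length gs = n \<and> set gs \<subseteq> carrier G) \<longrightarrow> f gs = 0)}"

definition merge_at :: "('g, 'm) monoid_scheme \<Rightarrow> nat \<Rightarrow> 'g list \<Rightarrow> 'g list"
  where "merge_at G i gs = take i gs @ [gs ! i \<otimes>\<^bsub>G\<^esub> gs ! Suc i] @ drop (i + 2) gs"

definition signed :: "nat \<Rightarrow> 'a::ab_group_add \<Rightarrow> 'a"
  where "signed i a = (if even i then a else - a)"

definition coboundary_map ::
  "('g, 'm) monoid_scheme \<Rightarrow> ('g \<Rightarrow> 'a \<Rightarrow> 'a) \<Rightarrow> nat \<Rightarrow> ('g list \<Rightarrow> 'a) \<Rightarrow> 'g list \<Rightarrow> 'a::ab_group_add"
  where "coboundary_map G \<alpha> n f gs =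
    (if length gs = Suc n \<and> set gs \<subseteq> carrier G
     then \<alpha> (hd gs) (f (tl gs))
        + (\<Sum>i<n. signed (Suc i) (f (merge_at G i gs)))
        + signed (Suc n) (f (butlast gs))
     else 0)"

definition cocycle_group ::
  "('g, 'm) monoid_scheme \<Rightarrow> 'a::ab_group_add set \<Rightarrow> ('g \<Rightarrow> 'a \<Rightarrow> 'a) \<Rightarrow> nat \<Rightarrow> ('g list \<Rightarrow> 'a) monoid"
  where "cocycle_group G A \<alpha> n =
    \<lparr>carrier = {f \<in> cochains G A n. coboundary_map G \<alpha> n f = (\<lambda>_. 0)},
     monoid.mult = (\<lambda>f f' gs. f gs + f' gs),
     one = (\<lambda>_. 0)\<rparr>"

primrec coboundaries ::
  "('g, 'm) monoid_scheme \<Rightarrow> 'a::ab_group_add set \<Rightarrow> ('g \<Rightarrow> 'a \<Rightarrow> 'a) \<Rightarrow> nat \<Rightarrow> ('g list \<Rightarrow> 'a) set"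
  where
    "coboundaries G A \<alpha> 0 = {\<lambda>_. 0}"
  | "coboundaries G A \<alpha> (Suc n) = coboundary_map G \<alpha> n ` cochains G A n"

definition group_cohomology ::
  "('g, 'm) monoid_scheme \<Rightarrow> 'a::ab_group_add set \<Rightarrow> ('g \<Rightarrow> 'a \<Rightarrow> 'a) \<Rightarrow> nat \<Rightarrow> ('g list \<Rightarrow> 'a) set monoid"
  where "group_cohomology G A \<alpha> n = cocycle_group G A \<alpha> n Mod coboundaries G A \<alpha> n"


section \<open>Graded abelian groups\<close>

text \<open>Abelian groups are written multiplicatively, as everywhere in \<open>HOL-Algebra\<close>.\<close>

record 'a graded_group = "'a monoid" +
  homog :: "nat \<Rightarrow> 'a set"

definition graded_iso :: "'a graded_group \<Rightarrow> 'b graded_group \<Rightarrow> bool"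
  where "graded_iso G H \<longleftrightarrow> (\<exists>h \<in> iso G H. \<forall>n. h ` homog G n = homog H n)"

definition graded_direct_sum :: "(nat \<Rightarrow> 'a monoid) \<Rightarrow> (nat \<Rightarrow> 'a) graded_group"
  where "graded_direct_sum L =
    \<lparr>carrier = carrier (sum_group UNIV L),
     monoid.mult = monoid.mult (sum_group UNIV L),
     one = \<one>\<^bsub>sum_group UNIV L\<^esub>,
     homog = (\<lambda>n. {a \<in> carrier (sum_group UNIV L). \<forall>m. m \<noteq> n \<longrightarrow> a m = \<one>\<^bsub>L m\<^esub>})\<rparr>"

definition primary_part :: "nat \<Rightarrow> ('a, 'm) monoid_scheme \<Rightarrow> 'a set"
  where "primary_part p L = {a \<in> carrier L. \<exists>k::nat. a [^]\<^bsub>L\<^esub> (p ^ k) = \<one>\<^bsub>L\<^esub>}"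

definition graded_primary_part :: "nat \<Rightarrow> 'a graded_group \<Rightarrow> 'a graded_group"
  where "graded_primary_part p L =
    L\<lparr>carrier := primary_part p L, homog := (\<lambda>n. homog L n \<inter> primary_part p L)\<rparr>"

definition positive_part :: "'a graded_group \<Rightarrow> 'a graded_group"
  where "positive_part L =
    L\<lparr>carrier := generate L (\<Union>n\<in>{0<..}. homog L n),
      homog := (\<lambda>n. if n = 0 then {\<one>\<^bsub>L\<^esub>} else homog L n)\<rparr>"

text \<open>
  \<open>A \<otimes>\<^sub>\<int> B\<close> is the free abelian group on \<open>A \<times> B\<close> modulo the bilinearity relations.
\<close>

definition tensor_relations ::
  "('a, 'm) monoid_scheme \<Rightarrow> ('b, 'n) monoid_scheme \<Rightarrow> ('a \<times> 'b \<Rightarrow>\<^sub>0 int) set"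
  where "tensor_relations A B =
    {frag_of (a \<otimes>\<^bsub>A\<^esub> a', b) - frag_of (a, b) - frag_of (a', b) | a a' b.
       a \<in> carrier A \<and> a' \<in> carrier A \<and> b \<in> carrier B} \<union>
    {frag_of (a, b \<otimes>\<^bsub>B\<^esub> b') - frag_of (a, b) - frag_of (a, b') | a b b'.
       a \<in> carrier A \<and> b \<in> carrier B \<and> b' \<in> carrier B}"

definition tensor_kernel ::
  "('a, 'm) monoid_scheme \<Rightarrow> ('b, 'n) monoid_scheme \<Rightarrow> ('a \<times> 'b \<Rightarrow>\<^sub>0 int) set"
  where "tensor_kernel A B =
    generate (free_Abelian_group (carrier A \<times> carrier B)) (tensor_relations A B)"

definition tensor_group ::
  "('a, 'm) monoid_scheme \<Rightarrow> ('b, 'n) monoid_scheme \<Rightarrow> ('a \<times> 'b \<Rightarrow>\<^sub>0 int) set monoid"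
  where "tensor_group A B = free_Abelian_group (carrier A \<times> carrier B) Mod tensor_kernel A B"

definition pure_tensor ::
  "('a, 'm) monoid_scheme \<Rightarrow> ('b, 'n) monoid_scheme \<Rightarrow> 'a \<Rightarrow> 'b \<Rightarrow> ('a \<times> 'b \<Rightarrow>\<^sub>0 int) set"
  where "pure_tensor A B a b =
    tensor_kernel A B #>\<^bsub>free_Abelian_group (carrier A \<times> carrier B)\<^esub> frag_of (a, b)"

definition graded_tensor ::
  "'a graded_group \<Rightarrow> 'b graded_group \<Rightarrow> ('a \<times> 'b \<Rightarrow>\<^sub>0 int) set graded_group"
  where "graded_tensor A B =
    \<lparr>carrier = carrier (tensor_group A B),
     monoid.mult = monoid.mult (tensor_group A B),
     one = \<one>\<^bsub>tensor_group A B\<^esub>,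
     homog = (\<lambda>n. generate (tensor_group A B)
       {pure_tensor A B a b | a b i j. a \<in> homog A i \<and> b \<in> homog B j \<and> i + j = n})\<rparr>"


section \<open>Divided polynomial algebras\<close>

definition divided_power :: "nat \<Rightarrow> rat poly"
  where "divided_power i = Polynomial.monom (1 / fact i) i"

definition Gamma_ring :: "rat poly ring"
  where "Gamma_ring =
    \<lparr>carrier = {\<Sum>i\<le>N. of_int (c i) * divided_power i | (c :: nat \<Rightarrow> int) (N :: nat). True},
     monoid.mult = (*), one = 1, ring.zero = 0, ring.add = (+)\<rparr>"

definition Gamma_ideal :: "nat \<Rightarrow> rat poly set"
  where "Gamma_ideal p =
    Idl\<^bsub>Gamma_ring\<^esub> {of_nat (p ^ (multiplicity p i + 1)) * divided_power i | i. i \<ge> 1}"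

definition Gamma_p_ring :: "nat \<Rightarrow> rat poly set ring"
  where "Gamma_p_ring p = Gamma_ring Quot Gamma_ideal p"

text \<open>The additive group of \<open>\<Gamma>\<^sub>p[z]\<close>, graded by \<open>deg z = d\<close>\<close>

definition Gamma_p :: "nat \<Rightarrow> nat \<Rightarrow> rat poly set graded_group"
  where "Gamma_p p d =
    \<lparr>carrier = carrier (Gamma_p_ring p),
     monoid.mult = ring.add (Gamma_p_ring p),
     one = ring.zero (Gamma_p_ring p),
     homog = (\<lambda>n. generate (add_monoid (Gamma_p_ring p))
       {Gamma_ideal p +>\<^bsub>Gamma_ring\<^esub> divided_power i | i. d * i = n})\<rparr>"

text \<open>\<open>\<Gamma>\<^sub>p\<^sup>+[z, z']\<close> with \<open>deg z = d\<close> and \<open>deg z' = d'\<close>\<close>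

definition Gamma_p_plus ::
  "nat \<Rightarrow> nat \<Rightarrow> nat \<Rightarrow> (rat poly set \<times> rat poly set \<Rightarrow>\<^sub>0 int) set graded_group"
  where "Gamma_p_plus p d d' = positive_part (graded_tensor (Gamma_p p d) (Gamma_p p d'))"


section \<open>The free part of a finitely generated abelian group\<close>

definition finitely_generated_group :: "('a, 'm) monoid_scheme \<Rightarrow> bool"
  where "finitely_generated_group L \<longleftrightarrow>
    (\<exists>S. finite S \<and> S \<subseteq> carrier L \<and> generate L S = carrier L)"

definition direct_summand :: "('a, 'm) monoid_scheme \<Rightarrow> 'a set \<Rightarrow> bool"
  where "direct_summand L F \<longleftrightarrow> subgroup F L \<and>
    (\<exists>C. subgroup C L \<and> F \<inter> C = {\<one>\<^bsub>L\<^esub>} \<and> F <#>\<^bsub>L\<^esub> C = carrier L)"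

definition free_abelian :: "('a, 'm) monoid_scheme \<Rightarrow> bool"
  where "free_abelian L \<longleftrightarrow> (\<exists>B \<subseteq> carrier L. L \<cong> free_Abelian_group B)"

definition free_summand :: "('a, 'm) monoid_scheme \<Rightarrow> 'a set \<Rightarrow> bool"
  where "free_summand L F \<longleftrightarrow> direct_summand L F \<and> free_abelian (L\<lparr>carrier := F\<rparr>)"

text \<open>The representatives inside \<open>L\<close> of the isomorphism class \<open>FL\<close>\<close>

definition free_parts :: "('a, 'm) monoid_scheme \<Rightarrow> ('a, 'm) monoid_scheme set"
  where "free_parts L =
    {L\<lparr>carrier := F\<rparr> | F. free_summand L F \<and> (\<forall>F'. free_summand L F' \<and> F \<subseteq> F' \<longrightarrow> F' = F)}"


section \<open>The cohomology of \<open>B\<^sub>3\<close> with coefficients in \<open>M\<close>\<close>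

definition H_B3 :: "nat \<Rightarrow> nat \<Rightarrow> (braid_gen word set list \<Rightarrow> int poly poly) set monoid"
  where "H_B3 k n = group_cohomology B3 (M_component n) B3_action k"

definition H_B3_M ::
  "nat \<Rightarrow> (nat \<Rightarrow> (braid_gen word set list \<Rightarrow> int poly poly) set) graded_group"
  where "H_B3_M k = graded_direct_sum (H_B3 k)"

end

theory Submission
  imports Defs "HOL-Number_Theory.Residue_Primitive_Roots"
begin

text \<open>
 Let \<open>v = \<sigma>\<^sub>1\<sigma>\<^sub>2\<close>, \<open>u = v\<sigma>\<^sub>1\<close>, so that \<open>c = v\<^sup>3 = u\<^sup>2\<close> is central and acts on \<open>M\<^sub>2\<^sub>k\<close> by \<open>(-1)\<^sup>k\<close>.
 For odd \<open>k\<close> this makes cohomology 2-torsion.  For even \<open>k > 0\<close> the cup product with the abelianization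
 \<open>H\<^sup>1 \<rightarrow> H\<^sup>2\<close> and the contraction with \<open>c\<close> in the other direction are inverse up to multiplication by 6.

 As there are no invariants, a torsion class of \<open>H\<^sup>1\<close> is \<open>g \<mapsto> (g h - h) / p\<^sup>s\<close> for a form \<open>h\<close> invariant
 modulo \<open>p\<^sup>s\<close>.  By Dickson such \<open>h\<close> is modulo \<open>p\<close> a polynomial in the invariants \<open>P\<close> and \<open>Q\<close>, and lifting
 further shows that \<open>P\<^sup>i Q\<^sup>j\<close>, with \<open>p\<^sup>a\<close> the largest \<open>p\<close>-power dividing \<open>i\<close> and \<open>j\<close>, contributes exactly
 \<open>\<int>/p\<^sup>a\<^sup>+\<^sup>1\<close>, which is also the order of \<open>z\<^sub>i \<otimes> z'\<^sub>j\<close>.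

 Rationally \<open>H\<^sup>1\<close> is the space of forms with \<open>u f = - f\<close> modulo \<open>(u - 1)\<close> applied to the \<open>v\<close>-invariant forms;
 the latter are counted by dividing by \<open>x\<^sup>2 - x y + y\<^sup>2\<close>.
\<close>

text \<open>The braid group is handled through its presentation: a 2-cocycle is a coboundary as soon
  as the two generators lift to the corresponding group extension so that the braid relation holds
  there. So H^1 is governed by two forms and H^2 by one, and all computations are with explicit
  forms. The 6 is the exponent sum of c; it is the reason why 2 and 3 are excluded. The hard part is
  the exact order of the torsion. That P^i Q^j is invariant modulo p^(a+1) is clear, since it is a
  p^a-th power. That no more can be gained is visible on sigma_2 alone: at x = 1 it becomes y -> y +
  1, P becomes N = y^p - y, and N turns into N + p eta with eta of degree p - 1. To first order the
  defect of a monomial is eta times a polynomial in N, essentially a logarithmic derivative, and a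
  multiple of eta by a nonzero polynomial in N is never of the form g(y + 1) - g(y) modulo p. No map
  between the torsion of H^1 and the divided polynomial side is written down: both are quotients of
  the free abelian group on the pairs (i, j) other than (0, 0), by the same subgroup.\<close>

hide_const (open) UnivPoly.coeff UnivPoly.monom up_ring.coeff up_ring.monom module.smult
alias lookup = Poly_Mapping.lookup
alias keys = Poly_Mapping.keys

abbreviation B3_mult (infixl \<open>\<cdot>\<close> 70)
 where "B3_mult \<equiv> monoid.mult B3"

section \<open>Invariants modulo prime powers\<close>

lemma of_nat_dvd_poly_iff: "of_nat m dvd (f :: int poly) \<longleftrightarrow> (\<forall>i. int m dvd coeff f i)"
 by (simp add: of_nat_poly const_poly_dvd_iff)

lemma of_nat_dvd_poly_poly_iff:
 "of_nat m dvd (f :: int poly poly) \<longleftrightarrow> (\<forall>i j. int m dvd coeff (coeff f i) j)"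
 by (simp add: of_nat_poly[where ?'a = "int poly"] const_poly_dvd_iff)
   (simp add: of_nat_poly const_poly_dvd_iff)

lemma prime_elem_of_nat_poly:
 assumes "prime p"
 shows "prime_elem (of_nat p :: int poly)"
 using assms by (simp add: of_nat_poly prime_elem_const_poly_iff)

lemma prime_elem_of_nat_poly_poly:
 assumes "prime p"
 shows "prime_elem (of_nat p :: int poly poly)"
 using prime_elem_of_nat_poly[OF assms]
 by (simp add: of_nat_poly[where ?'a = "int poly"] prime_elem_const_poly_iff)

text \<open>Over the integers only pseudo-division is available; its scaling factor is a power of
  the leading coefficient, here 1.\<close>

lemma monic_poly_division:
 fixes f g :: "int poly"
 assumes "lead_coeff g = 1"
 obtains a b where "f = g * a + b" "b = 0 \<or> degree b < degree g"
proof -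
 obtain a b where ab: "pseudo_divmod f g = (a, b)" by fastforce
 have "g \<noteq> 0" using assms by auto
 show ?thesis
  using pseudo_divmod[OF \<open>g \<noteq> 0\<close> ab] assms that[of a b] by simp
qed

text \<open>Dividing (g a + b) / m by g and multiplying back by m gives a second division of g a + b
  by g; quotient and remainder are unique because g is monic.\<close>

lemma monic_dvd_split:
 fixes a b g :: "int poly"
 assumes g: "lead_coeff g = 1" and b: "degree b < degree g" and d: "of_nat m dvd g * a + b"
 shows "of_nat m dvd a" "of_nat m dvd b"
proof -
 obtain c where c: "g * a + b = of_nat m * c" using d by (auto simp: dvd_def)
 obtain c1 c2 where cc: "c = g * c1 + c2" "c2 = 0 \<or> degree c2 < degree g"
  by (rule monic_poly_division[OF g, of c])
 have dc2: "degree c2 < degree g" using b cc by auto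
 have eq: "g * (of_nat m * c1 - a) = b - of_nat m * c2"
  using c cc by (simp add: algebra_simps)
 have "degree (b - of_nat m * c2) < degree g"
  using b dc2 degree_mult_le[of "of_nat m" c2]
  by (intro degree_diff_less) (auto simp: of_nat_poly)
 with eq have "degree (g * (of_nat m * c1 - a)) < degree g" by simp
 moreover have "degree (g * h) \<ge> degree g" if "h \<noteq> 0" for h
  using that g by (subst degree_mult_eq) auto
 ultimately have "of_nat m * c1 - a = 0" by (meson linorder_not_less)
 with eq show "of_nat m dvd a" "of_nat m dvd b"
  by (auto intro: dvd_triv_left)
qed

section \<open>The translation y -> y + 1 modulo p\<close>

lemma coeff_translate:
 fixes f :: "int poly"
 assumes "degree f \<le> n"
 shows "coeff (pcompose f [:1, 1:]) j = (\<Sum>i\<le>n. of_nat (i choose j) * coeff f i)"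
proof -
 have "pcompose f [:1, 1:] = (\<Sum>i\<le>degree f. smult (coeff f i) ([:1, 1:] ^ i))"
  by (simp add: pcompose_altdef poly_altdef coeff_map_poly degree_map_poly)
 also have "\<dots> = (\<Sum>i\<le>n. smult (coeff f i) ([:1, 1:] ^ i))"
  using assms by (intro sum.mono_neutral_left) (auto simp: coeff_eq_0)
 finally have "pcompose f [:1, 1:] = (\<Sum>i\<le>n. smult (coeff f i) ([:1, 1:] ^ i))" .
 then have "coeff (pcompose f [:1, 1:]) j = (\<Sum>i\<le>n. coeff f i * coeff ([:1, 1:] ^ i) j)"
  by (simp add: coeff_sum)
 moreover have "coeff ([:1, 1 :: int:] ^ i) j = of_nat (i choose j)" for i
  by (cases "j \<le> i") (auto simp: coeff_linear_poly_power coeff_eq_0 degree_linear_power binomial_eq_0)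
 ultimately show ?thesis
  by (simp add: mult.commute)
qed

text \<open>If d > 0 is the highest degree whose coefficient survives modulo p, then r(y + 1) - r
  has coefficient d * \<open>coeff r d\<close> in degree d - 1, and p does not divide d because d <
  p.\<close>

lemma translate_invariant_small_degree:
 fixes r :: "int poly"
 assumes p: "prime p" and deg: "degree r < p" and inv: "of_nat p dvd pcompose r [:1, 1:] - r"
 shows "of_nat p dvd r - [:coeff r 0:]"
proof (rule ccontr)
 define S where "S = {j. j > 0 \<and> \<not> int p dvd coeff r j}"
 assume "\<not> ?thesis"
 then obtain j where "\<not> int p dvd coeff (r - [:coeff r 0:]) j"
  by (auto simp: of_nat_dvd_poly_iff)
 then have "j \<in> S" unfolding S_def by (cases j) auto
 have sub: "S \<subseteq> {..<p}"
  using deg unfolding S_def by (auto simp: not_less) (metis coeff_eq_0 dvd_0_right le_less_trans not_le)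
 then have "finite S" by (rule finite_subset) simp
 define d where "d = Max S"
 have dS: "d \<in> S" using \<open>finite S\<close> \<open>j \<in> S\<close> unfolding d_def by (intro Max_in) auto
 then have d: "d > 0" "d < p" "\<not> int p dvd coeff r d" using sub by (auto simp: S_def)
 have big: "int p dvd coeff r i" if "i > d" for i
  using Max_ge[OF \<open>finite S\<close>, of i] that unfolding d_def[symmetric] by (auto simp: S_def)
 have "int p dvd coeff (pcompose r [:1, 1:] - r) (d - 1)"
  using inv by (simp add: of_nat_dvd_poly_iff)
 also have "coeff (pcompose r [:1, 1:] - r) (d - 1)
   = (\<Sum>i\<le>p. of_nat (i choose (d - 1)) * coeff r i) - coeff r (d - 1)"
  using deg by (simp add: coeff_translate[of r p])
 also have "(\<Sum>i\<le>p. of_nat (i choose (d - 1)) * coeff r i)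
   = (\<Sum>i\<in>{d - 1, d}. of_nat (i choose (d - 1)) * coeff r i)
    + (\<Sum>i\<in>{..p} - {d - 1, d}. of_nat (i choose (d - 1)) * coeff r i)"
  using d by (subst add.commute, intro sum.subset_diff) auto
 also have "(\<Sum>i\<in>{d - 1, d}. of_nat (i choose (d - 1)) * coeff r i)
   = coeff r (d - 1) + int d * coeff r d"
  using d binomial_symmetric[of "d - 1" d] by (simp add: sum.insert_if)
 also have "coeff r (d - 1) + int d * coeff r d
   + (\<Sum>i\<in>{..p} - {d - 1, d}. of_nat (i choose (d - 1)) * coeff r i) - coeff r (d - 1)
   = int d * coeff r d + (\<Sum>i\<in>{..p} - {d - 1, d}. of_nat (i choose (d - 1)) * coeff r i)"
  by (rule diff_eq_eq[THEN iffD2]) (simp only: ac_simps)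
 finally have "int p dvd int d * coeff r d
   + (\<Sum>i\<in>{..p} - {d - 1, d}. of_nat (i choose (d - 1)) * coeff r i)" .
 moreover have "int p dvd (\<Sum>i\<in>{..p} - {d - 1, d}. of_nat (i choose (d - 1)) * coeff r i)"
 proof (rule dvd_sum)
  fix i assume i: "i \<in> {..p} - {d - 1, d}"
  show "int p dvd of_nat (i choose (d - 1)) * coeff r i"
  proof (cases "i > d")
   case True then show ?thesis using big by simp
  next
   case False
   then have "i < d - 1" using i by auto
   then show ?thesis by (simp add: binomial_eq_0)
  qed
 qed
 ultimately have "int p dvd int d * coeff r d" by (rule dvd_add_left_iff[THEN iffD1, rotated])
 then have "p dvd d" using p d(3) by (simp add: prime_dvd_mult_iff)
 then show False using d by (auto dest: dvd_imp_le)
qed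

text \<open>The dehomogenized Dickson invariant \<open>P\<close>.\<close>

definition artin_schreier :: "nat \<Rightarrow> int poly"
 where "artin_schreier p = monom 1 p - [:0, 1:]"

lemma artin_schreier_monic:
 assumes "p \<ge> 2"
 shows "degree (artin_schreier p) = p" "lead_coeff (artin_schreier p) = 1"
proof -
 have "degree (monom (1::int) p) = p" by (simp add: degree_monom_eq)
 then have *: "degree (artin_schreier p) = p"
  unfolding artin_schreier_def diff_conv_add_uminus using assms
  by (subst degree_add_eq_left) (auto simp: degree_monom_eq)
 then show "degree (artin_schreier p) = p" "lead_coeff (artin_schreier p) = 1"
  using assms by (auto simp: artin_schreier_def coeff_pCons split: nat.splits)
qed

lemma poly_artin_schreier_0: "p > 0 \<Longrightarrow> poly (artin_schreier p) 0 = 0"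
 by (simp add: artin_schreier_def poly_monom)

lemma pcompose_monom: "pcompose (monom c n) q = smult c (q ^ n)"
 by (induction n) (simp_all add: monom_0 monom_Suc pcompose_pCons)

text \<open>Modulo p the polynomial y^p - y is fixed by the translation; eta is its defect at the
  next order. The coefficients of eta are the numbers (p choose i) / p for 0 < i < p, so the one in
  degree p - 1 is 1.\<close>

lemma translate_artin_schreier:
 assumes p: "prime p"
 obtains \<eta> where "pcompose (artin_schreier p) [:1, 1:] = artin_schreier p + of_nat p * \<eta>"
  "degree \<eta> < p" "coeff \<eta> (p - 1) = 1"
proof -
 have p2: "p \<ge> 2" using p by (rule prime_ge_2_nat)
 have pc: "pcompose (artin_schreier p) [:1, 1:] - artin_schreier p = [:1, 1:] ^ p - 1 - monom 1 p"
  by (simp add: artin_schreier_def pcompose_diff pcompose_pCons pcompose_monom one_pCons)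
 have co: "coeff ([:1, 1:] ^ p - 1 - monom 1 p) i
   = (if 0 < i \<and> i < p then int (p choose i) else 0)" for i
  using p2 by (cases "i \<le> p") (auto simp: coeff_linear_poly_power coeff_eq_0 degree_linear_power)
 have "of_nat p dvd ([:1, 1:] ^ p - 1 - monom 1 p :: int poly)"
  unfolding of_nat_dvd_poly_iff co using p dvd_choose_prime[of _ p] p2
  by auto
 then obtain \<eta> where eta: "[:1, 1 :: int:] ^ p - 1 - monom 1 p = of_nat p * \<eta>" by (elim dvdE)
 have co2: "int p * coeff \<eta> i = (if 0 < i \<and> i < p then int (p choose i) else 0)" for i
  using co[of i] unfolding eta by (simp add: of_nat_poly)
 have "degree \<eta> \<le> p - 1"
  using co2 p2 by (intro degree_le) (metis (no_types, lifting) Suc_pred' less_not_refl mult_eq_0_iff not_less_eq of_nat_0_eq_iff prime_gt_0_nat p)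
 moreover have "coeff \<eta> (p - 1) = 1"
  using co2[of "p - 1"] p2 binomial_symmetric[of "p - 1" p] by simp
 ultimately show ?thesis
  using that[of \<eta>] pc eta p2 by (simp add: algebra_simps)
qed

text \<open>y^p - y is transcendental modulo p: the constant coefficient of Z is the remainder of
  Z(N) on division by the monic N, and the quotient is treated by induction.\<close>

lemma dvd_pcompose_artin_schreier:
 assumes p: "prime p" and d: "of_nat p dvd pcompose Z (artin_schreier p)"
 shows "of_nat p dvd Z"
 using d
proof (induction Z)
 case (pCons a Z)
 note p2 = prime_ge_2_nat[OF p]
 have d: "of_nat p dvd [:a:] + artin_schreier p * pcompose Z (artin_schreier p)"
  using pCons.prems by (simp add: pcompose_pCons)
 have "degree [:a:] < degree (artin_schreier p)"
  using p2 by (simp add: artin_schreier_monic)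
 note s = monic_dvd_split[OF artin_schreier_monic(2)[OF p2] this d[unfolded add.commute[of "[:a:]"]]]
 then have "of_nat p dvd Z" "of_nat p dvd [:a:]" using pCons.IH by auto
 then show ?case by (auto simp: of_nat_dvd_poly_iff coeff_pCons split: nat.splits)
qed simp

text \<open>The coinvariants of \<open>\<F>\<^sub>p[y]\<close> under \<open>y \<mapsto> y + 1\<close> contain a free \<open>\<F>\<^sub>p[y\<^sup>p - y]\<close>-module generated by
 any \<open>\<eta>\<close> of degree \<open>p - 1\<close>; the invariants are \<open>\<F>\<^sub>p[y\<^sup>p - y]\<close>.\<close>

lemma translate_coinvariants:
 fixes g Z \<eta> :: "int poly"
 assumes p: "prime p" and eta: "degree \<eta> < p" "coeff \<eta> (p - 1) = 1"
  and d: "of_nat p dvd pcompose g [:1, 1:] - g - \<eta> * pcompose Z (artin_schreier p)"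
 shows "of_nat p dvd Z \<and> (\<exists>G. of_nat p dvd g - pcompose G (artin_schreier p) \<and>
      p * degree G \<le> degree g \<and> (g = 0 \<longrightarrow> G = 0))"
 using d
\<comment> \<open>The measure puts the zero polynomial below the nonzero constants, so that passing
  to the quotient by N always makes progress.\<close>
proof (induction "if g = 0 then 0 else Suc (degree g)" arbitrary: g Z rule: less_induct)
 case less
 let ?N = "artin_schreier p" and ?\<tau> = "\<lambda>f. pcompose f [:1, 1 :: int:]"
 note p2 = prime_ge_2_nat[OF p]
 note N = artin_schreier_monic[OF p2]
 have neta: "\<not> of_nat p dvd \<eta>"
  using eta(2) p2 unfolding of_nat_dvd_poly_iff by (intro notI) (auto dest: spec[of _ "p - 1"])
 show ?case
 proof (cases "g = 0")
  case True
  then have "of_nat p dvd \<eta> * pcompose Z ?N" using less.prems by simp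
  then have "of_nat p dvd pcompose Z ?N"
   using neta prime_elem_of_nat_poly[OF p] by (simp add: prime_elem_dvd_mult_iff)
  then have "of_nat p dvd Z" by (rule dvd_pcompose_artin_schreier[OF p])
  then show ?thesis using True by (auto intro!: exI[of _ 0])
 next
  case False
  obtain g1 r where g: "g = ?N * g1 + r" "r = 0 \<or> degree r < degree ?N"
   using monic_poly_division[OF N(2), of g] by metis
  have dr: "degree r < p" using g(2) N p2 by auto
  have dg: "degree g = p + degree g1" if "g1 \<noteq> 0"
  proof -
   have "?N \<noteq> 0" using N p2 by auto
   then have "degree (?N * g1) = p + degree g1"
    using that N(1) by (simp add: degree_mult_eq)
   moreover have "degree (?N * g1 + r) = degree (?N * g1)"
    using dr calculation by (intro degree_add_eq_left) simp
   ultimately show ?thesis by (simp only: g(1))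
  qed
  obtain \<theta> where th: "?\<tau> ?N = ?N + of_nat p * \<theta>" by (rule translate_artin_schreier[OF p])
  obtain z0 Z1 where Z: "Z = pCons z0 Z1" by (cases Z)
  \<comment> \<open>Modulo p the translation commutes with multiplication by N, so the hypothesis
    splits into one for the quotient g1, with Z1 in place of Z, and one for the remainder r.\<close>
  have "?\<tau> g - g - \<eta> * pcompose Z ?N
    = (?N * (?\<tau> g1 - g1 - \<eta> * pcompose Z1 ?N) + (?\<tau> r - r - smult z0 \<eta>))
     + of_nat p * (\<theta> * ?\<tau> g1)"
   unfolding g(1) Z
   by (simp add: pcompose_add pcompose_mult th pcompose_pCons algebra_simps)
  then have dd: "of_nat p dvd ?N * (?\<tau> g1 - g1 - \<eta> * pcompose Z1 ?N) + (?\<tau> r - r - smult z0 \<eta>)"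
   using less.prems by (metis dvd_add_left_iff dvd_triv_left)
  have "degree (?\<tau> r) < p" using dr degree_pcompose_le[of r "[:1,1:]"] by simp
  then have "degree (?\<tau> r - r - smult z0 \<eta>) < degree ?N"
   using dr eta unfolding N(1) by (intro degree_diff_less) (auto intro: le_less_trans[OF degree_smult_le])
  note s = monic_dvd_split[OF N(2) this dd]
  \<comment> \<open>Since r has degree below p, the translation does not change its coefficient of
    degree p - 1. In this degree only eta is left, which isolates z0.\<close>
  have "coeff (?\<tau> r) (p - 1) = (\<Sum>i\<le>p - 1. of_nat (i choose (p - 1)) * coeff r i)"
   using dr by (intro coeff_translate) simp
  also have "\<dots> = (\<Sum>i\<in>{p - 1}. of_nat (i choose (p - 1)) * coeff r i)"
   by (intro sum.mono_neutral_right) (auto simp: binomial_eq_0)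
  finally have "coeff (?\<tau> r - r - smult z0 \<eta>) (p - 1) = - z0" using eta by simp
  then have z0: "int p dvd z0" using s(2) by (metis dvd_minus_iff of_nat_dvd_poly_iff)
  then have "of_nat p dvd smult z0 \<eta>" by (auto simp: of_nat_dvd_poly_iff)
  then have "of_nat p dvd ?\<tau> r - r" using s(2) by (metis diff_add_cancel dvd_add)
  then have r: "of_nat p dvd r - [:coeff r 0:]"
   using translate_invariant_small_degree[OF p dr] by simp
  have "(if g1 = 0 then 0 else Suc (degree g1)) < (if g = 0 then 0 else Suc (degree g))"
   using False dg p2 by auto
  from less.hyps[OF this s(1)] obtain G1 where
   IH: "of_nat p dvd Z1" "of_nat p dvd g1 - pcompose G1 ?N" "p * degree G1 \<le> degree g1"
    "g1 = 0 \<longrightarrow> G1 = 0" by auto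
  have "of_nat p dvd Z" unfolding Z
   using IH(1) z0 by (auto simp: of_nat_dvd_poly_iff coeff_pCons split: nat.splits)
  moreover have "g - pcompose (pCons (coeff r 0) G1) ?N
    = ?N * (g1 - pcompose G1 ?N) + (r - [:coeff r 0:])"
   unfolding g(1) by (simp add: pcompose_pCons algebra_simps)
  then have "of_nat p dvd g - pcompose (pCons (coeff r 0) G1) ?N"
   using IH(2) r by (metis dvd_add dvd_mult)
  moreover have "p * degree (pCons (coeff r 0) G1) \<le> degree g"
   using IH(3,4) dg by (cases "G1 = 0") auto
  ultimately show ?thesis using False by blast
 qed
qed

section \<open>Congruences modulo an integer in a commutative ring\<close>

definition eqm :: "nat \<Rightarrow> 'a::comm_ring_1 \<Rightarrow> 'a \<Rightarrow> bool"
 where "eqm m a b \<longleftrightarrow> of_nat m dvd a - b"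

lemma eqm_refl [simp, intro]: "eqm m a a"
 by (simp add: eqm_def)

lemma eqm_sym: "eqm m a b \<Longrightarrow> eqm m b a"
 unfolding eqm_def by (metis dvd_minus_iff minus_diff_eq)

lemma eqm_trans [trans]: "eqm m a b \<Longrightarrow> eqm m b c \<Longrightarrow> eqm m a c"
 unfolding eqm_def by (metis diff_add_cancel dvd_add add_diff_eq)

lemma eqm_add: "eqm m a b \<Longrightarrow> eqm m c d \<Longrightarrow> eqm m (a + c) (b + d)"
 unfolding eqm_def by (metis add_diff_add dvd_add)

lemma eqm_diff: "eqm m a b \<Longrightarrow> eqm m c d \<Longrightarrow> eqm m (a - c) (b - d)"
 unfolding eqm_def by (metis diff_diff_add add_diff_add diff_add_eq diff_diff_eq2 dvd_diff add.commute)

lemma eqm_mult: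
 assumes "eqm m a b" "eqm m c d"
 shows "eqm m (a * c) (b * d)"
proof -
 have "a * c - b * d = (a - b) * c + b * (c - d)" by (simp add: algebra_simps)
 then show ?thesis using assms unfolding eqm_def by simp
qed

lemma eqm_pow: "eqm m a b \<Longrightarrow> eqm m (a ^ n) (b ^ n)"
 by (induction n) (auto intro: eqm_mult)

lemma eqm_sum: "(\<And>i. i \<in> I \<Longrightarrow> eqm m (f i) (g i)) \<Longrightarrow> eqm m (sum f I) (sum g I)"
 unfolding eqm_def by (simp add: sum_subtractf[symmetric] dvd_sum)

lemma eqm_0_iff: "eqm m a 0 \<longleftrightarrow> of_nat m dvd a"
 by (simp add: eqm_def)

lemma eqm_dvd: "n dvd m \<Longrightarrow> eqm m a b \<Longrightarrow> eqm n a b"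
 unfolding eqm_def by (metis dvd_def dvd_mult_left of_nat_mult)

lemma eqm_frobenius:
 assumes p: "prime p"
 shows "eqm p ((a + b) ^ p) (a ^ p + b ^ p :: 'a :: comm_ring_1)"
proof -
 have p0: "p > 0" using p by (rule prime_gt_0_nat)
 have "(a + b) ^ p = (\<Sum>k\<in>{0, p}. of_nat (p choose k) * a ^ k * b ^ (p - k))
   + (\<Sum>k\<in>{..p} - {0, p}. of_nat (p choose k) * a ^ k * b ^ (p - k))"
  unfolding binomial_ring by (subst add.commute, intro sum.subset_diff) auto
 also have "(\<Sum>k\<in>{0, p}. of_nat (p choose k) * a ^ k * b ^ (p - k)) = a ^ p + b ^ p"
  using p0 by (simp add: add.commute)
 finally have "(a + b) ^ p - (a ^ p + b ^ p)
   = (\<Sum>k\<in>{..p} - {0, p}. of_nat (p choose k) * a ^ k * b ^ (p - k))" by simp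
 moreover have "of_nat p dvd (of_nat (p choose k) * a ^ k * b ^ (p - k))" if "k \<in> {..p} - {0, p}" for k
 proof -
  have "p dvd p choose k" using that p p0 by (intro dvd_choose_prime) auto
  then have "(of_nat p :: 'a) dvd of_nat (p choose k)" by (auto simp: dvd_def)
  then show ?thesis by simp
 qed
 ultimately show ?thesis unfolding eqm_def by (simp only: dvd_sum)
qed

lemma eqm_frobenius2:
 assumes p: "prime p"
 shows "eqm p ((a + b) ^ (p * p)) (a ^ (p * p) + b ^ (p * p) :: 'a :: comm_ring_1)"
 using eqm_trans[OF eqm_pow[OF eqm_frobenius[OF p, of a b], of p] eqm_frobenius[OF p, of "a ^ p" "b ^ p"]]
 by (simp add: power_mult)

text \<open>If u and v agree modulo p, the cofactor of u - v in u^p - v^p is congruent to p v^(p-1),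
  hence divisible by p. Each p-th power therefore gains one factor p.\<close>

lemma eqm_power_lift:
 fixes a b :: "'a :: comm_ring_1"
 assumes p: "prime p" and e: "eqm p a b"
 shows "eqm (p ^ Suc t) (a ^ (p ^ t)) (b ^ (p ^ t))"
proof (induction t)
 case (Suc t)
 define u v where "u = a ^ (p ^ t)" and "v = b ^ (p ^ t)"
 have uv: "eqm (p ^ Suc t) u v" using Suc.IH by (simp add: u_def v_def)
 then have uv1: "eqm p u v" by (rule eqm_dvd[rotated]) simp
 have "eqm p (\<Sum>i<p. v ^ (p - Suc i) * u ^ i) (\<Sum>i<p. v ^ (p - 1))"
 proof (rule eqm_sum)
  fix i assume "i \<in> {..<p}"
  then have "v ^ (p - 1) = v ^ (p - Suc i) * v ^ i" by (simp flip: power_add)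
  then show "eqm p (v ^ (p - Suc i) * u ^ i) (v ^ (p - 1))"
   by (auto intro!: eqm_mult eqm_pow uv1)
 qed
 then have "of_nat p dvd (\<Sum>i<p. v ^ (p - Suc i) * u ^ i) - of_nat p * v ^ (p - 1)"
  by (simp add: eqm_def)
 then have "of_nat p dvd (\<Sum>i<p. v ^ (p - Suc i) * u ^ i)"
  by (metis dvd_diff_left_iff dvd_triv_left)
 then have "of_nat p ^ Suc t * of_nat p dvd (u - v) * (\<Sum>i<p. v ^ (p - Suc i) * u ^ i)"
  using uv unfolding eqm_def by (intro mult_dvd_mono) auto
 also have "(u - v) * (\<Sum>i<p. v ^ (p - Suc i) * u ^ i) = u ^ p - v ^ p"
  by (simp add: power_diff_sumr2)
 finally show ?case unfolding eqm_def u_def v_def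
  by (simp add: power_mult[symmetric] mult.commute)
qed (use e in simp)

section \<open>Substitutions and evaluations as ring homomorphisms on Z[x,y]\<close>

lemma bivariate_hom_eqI:
 fixes h h' :: "int poly poly \<Rightarrow> 'a :: comm_ring_1"
 assumes h: "h 1 = 1" "\<And>f g. h (f + g) = h f + h g" "\<And>f g. h (f * g) = h f * h g"
  and h': "h' 1 = 1" "\<And>f g. h' (f + g) = h' f + h' g" "\<And>f g. h' (f * g) = h' f * h' g"
  and var: "h var_x = h' var_x" "h var_y = h' var_y"
 shows "h f = h' f"
proof -
 have z: "g 0 = 0" "g (- a) = - g a" if "\<And>a b. g (a + b) = g a + g b"
  for g :: "int poly poly \<Rightarrow> 'a" and a
  using that[of 0 0] that[of a "- a"] by (auto simp: eq_neg_iff_add_eq_0 add.commute)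
 have nat: "h (of_nat n) = h' (of_nat n)" for n
  by (induction n) (auto simp: h h' z[of h] z[of h'])
 have int: "h (of_int n) = h' (of_int n)" for n
  using nat by (cases n rule: int_cases2) (auto simp: z[of h] z[of h'] h h')
 have con: "h [:a:] = h' [:a:]" for a
 proof (induction a)
  case (pCons c a)
  have "[:pCons c a:] = of_int c + var_y * [:a:]"
   by (simp add: var_y_def of_int_poly)
  then have "h [:pCons c a:] = h (of_int c) + h var_y * h [:a:]"
   "h' [:pCons c a:] = h' (of_int c) + h' var_y * h' [:a:]" by (simp_all only: h h')
  then show ?case using pCons.IH int var by simp
 qed (simp add: z[of h] z[of h'] h h')
 show ?thesis
 proof (induction f)
  case (pCons a f)
  have "pCons a f = [:a:] + var_x * f" by (simp add: var_x_def)
  then show ?case using pCons.IH con by (simp add: h h' var)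
 qed (simp add: z[of h] z[of h'] h h')
qed

text \<open>The actions of the two generators as bare substitutions, so that the invariant theory
  can be done without the braid group; \<open>B3_action_gen\<close> makes the connection.\<close>

definition act1 :: "int poly poly \<Rightarrow> int poly poly"
 where "act1 f = subst_xy f (var_x - var_y) var_y"

definition act2 :: "int poly poly \<Rightarrow> int poly poly"
 where "act2 f = subst_xy f var_x (var_x + var_y)"

lemma subst_xy_zero: "subst_xy 0 u v = 0"
 by (simp add: subst_xy_def)

lemma subst_xy_uminus: "subst_xy (- f) u v = - subst_xy f u v"
 using subst_xy_add[of f "- f" u v] by (simp add: subst_xy_zero eq_neg_iff_add_eq_0 add.commute)

lemma subst_xy_diff: "subst_xy (f - g) u v = subst_xy f u v - subst_xy g u v"
 using subst_xy_add[of f "- g" u v] by (simp add: subst_xy_uminus)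

lemma subst_xy_power: "subst_xy (f ^ n) u v = subst_xy f u v ^ n"
 by (induction n) (simp_all add: subst_xy_one subst_xy_mult)

lemma subst_xy_of_nat: "subst_xy (of_nat n) u v = of_nat n"
 by (induction n) (simp_all add: subst_xy_one subst_xy_add subst_xy_zero)

lemma subst_xy_of_int: "subst_xy (of_int n) u v = of_int n"
 by (cases n rule: int_cases2) (simp_all add: subst_xy_of_nat subst_xy_uminus)

lemma subst_xy_sum: "subst_xy (sum f I) u v = (\<Sum>i\<in>I. subst_xy (f i) u v)"
 by (induction I rule: infinite_finite_induct) (simp_all add: subst_xy_zero subst_xy_add)

lemmas subst_xy_hom = subst_xy_one subst_xy_zero subst_xy_add subst_xy_diff subst_xy_uminus
 subst_xy_mult subst_xy_power subst_xy_of_nat subst_xy_of_int subst_xy_sum subst_xy_var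

lemma eqm_subst_xy: "eqm m f g \<Longrightarrow> eqm m (subst_xy f u v) (subst_xy g u v)"
 unfolding eqm_def dvd_def by (metis subst_xy_diff subst_xy_mult subst_xy_of_nat)

definition eval_int :: "int poly poly \<Rightarrow> int \<Rightarrow> int \<Rightarrow> int"
 where "eval_int f a b = poly (poly f [:a:]) b"

lemma eval_int_subst_xy: "eval_int (subst_xy f u v) a b = eval_int f (eval_int u a b) (eval_int v a b)"
 by (rule bivariate_hom_eqI[of "\<lambda>f. eval_int (subst_xy f u v) a b"])
   (simp_all add: subst_xy_hom, simp_all add: eval_int_def var_x_def var_y_def)

lemma eval_int_act1: "eval_int (act1 f) a b = eval_int f (a - b) b"
 unfolding act1_def eval_int_subst_xy by (simp add: eval_int_def var_x_def var_y_def)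

lemma eval_int_act2: "eval_int (act2 f) a b = eval_int f a (a + b)"
 unfolding act2_def eval_int_subst_xy by (simp add: eval_int_def var_x_def var_y_def)

text \<open>sigma_2 fixes x, so setting x = 1 is compatible with it. For sigma_1 there is no such
  rule; it is used through values at integer points instead.\<close>

lemma dehomogenize_act2: "poly (act2 f) 1 = pcompose (poly f 1) [:1, 1:]"
 by (rule bivariate_hom_eqI[of "\<lambda>f. poly (act2 f) 1"])
   (simp_all add: subst_xy_hom act2_def pcompose_1 pcompose_add pcompose_mult,
   simp_all add: var_x_def var_y_def pcompose_1 pcompose_pCons one_pCons)

lemma eqm_eval_int: "eqm m f g \<Longrightarrow> eqm m (eval_int f a b) (eval_int g a b)"
 unfolding eqm_def dvd_def eval_int_def by (metis poly_diff poly_mult poly_of_nat)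

lemma eqm_poly: "eqm m f g \<Longrightarrow> eqm m (poly f a) (poly g a)"
 unfolding eqm_def dvd_def by (metis poly_diff poly_mult poly_of_nat)

lemma eqm_poly_arg: "eqm m a b \<Longrightarrow> eqm m (poly f a) (poly f b)"
 by (induction f) (auto intro!: eqm_add eqm_mult)

lemma eqm_eval_int_arg:
 assumes "eqm m a a'"
 shows "eqm m (eval_int f a b) (eval_int f a' b)"
 unfolding eval_int_def
proof (intro eqm_poly eqm_poly_arg)
 show "eqm m [:a:] [:a':]"
  using assms by (auto simp: eqm_def of_nat_dvd_poly_iff coeff_pCons split: nat.splits)
qed

section \<open>Forms invariant modulo m\<close>

definition invariant_mod :: "nat \<Rightarrow> int poly poly \<Rightarrow> bool"
 where "invariant_mod m f \<longleftrightarrow> eqm m (act1 f) f \<and> eqm m (act2 f) f"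

lemma invariant_mod_add: "invariant_mod m f \<Longrightarrow> invariant_mod m g \<Longrightarrow> invariant_mod m (f + g)"
 and invariant_mod_diff: "invariant_mod m f \<Longrightarrow> invariant_mod m g \<Longrightarrow> invariant_mod m (f - g)"
 and invariant_mod_mult: "invariant_mod m f \<Longrightarrow> invariant_mod m g \<Longrightarrow> invariant_mod m (f * g)"
 and invariant_mod_power: "invariant_mod m f \<Longrightarrow> invariant_mod m (f ^ n)"
 and invariant_mod_of_int: "invariant_mod m (of_int c)"
 by (auto simp: invariant_mod_def act1_def act2_def subst_xy_hom intro: eqm_add eqm_diff eqm_mult eqm_pow)

lemma invariant_mod_sum:
 "(\<And>i. i \<in> I \<Longrightarrow> invariant_mod m (f i)) \<Longrightarrow> invariant_mod m (sum f I)"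
 by (auto simp: invariant_mod_def act1_def act2_def subst_xy_hom intro!: eqm_sum)

lemma invariant_mod_eqm:
 assumes "eqm m f g" "invariant_mod m f"
 shows "invariant_mod m g"
 using assms eqm_subst_xy[OF assms(1)] unfolding invariant_mod_def act1_def act2_def
 by (meson eqm_sym eqm_trans)

lemma invariant_mod_power_lift:
 assumes "prime p" "invariant_mod p f"
 shows "invariant_mod (p ^ Suc t) (f ^ (p ^ t))"
 using assms(2) eqm_power_lift[OF assms(1)]
 unfolding invariant_mod_def act1_def act2_def subst_xy_power by blast

lemma invariant_mod_of_nat_mult:
 assumes "invariant_mod m f"
 shows "invariant_mod (n * m) (of_nat n * f)"
 using assms unfolding invariant_mod_def act1_def act2_def eqm_def
 by (auto simp: subst_xy_hom right_diff_distrib[symmetric] intro!: mult_dvd_mono)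

text \<open>Z[x,y] modulo p is a domain, so an invariant factor that is nonzero modulo p can be
  cancelled. This gives the invariance of Q and drives the induction in
  \<open>dickson_invariants\<close>.\<close>

lemma invariant_mod_cancel:
 assumes p: "prime p" and nd: "\<not> of_nat p dvd f" and inv: "invariant_mod p f" "invariant_mod p (f * g)"
 shows "invariant_mod p g"
proof -
 have "eqm p (subst_xy g u v) g"
  if "eqm p (subst_xy f u v) f" "eqm p (subst_xy (f * g) u v) (f * g)" for u v
 proof -
  have "eqm p (f * subst_xy g u v) (subst_xy f u v * subst_xy g u v)"
   using that by (auto intro: eqm_mult eqm_sym)
  also have "eqm p \<dots> (f * g)" using that by (simp add: subst_xy_mult)
  finally have "of_nat p dvd f * (subst_xy g u v - g)"
   by (simp add: eqm_def right_diff_distrib)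
  then show ?thesis
   using nd prime_elem_of_nat_poly_poly[OF p] by (simp add: eqm_def prime_elem_dvd_mult_iff)
 qed
 then show ?thesis using inv unfolding invariant_mod_def act1_def act2_def by blast
qed

section \<open>Homogeneous forms and setting x = 1\<close>

lemma M_componentD: "f \<in> M_component n \<Longrightarrow> coeff (coeff f i) j \<noteq> 0 \<Longrightarrow> 2 * (i + j) = n"
 unfolding M_component_def by blast

lemma M_component_add: "f \<in> M_component n \<Longrightarrow> g \<in> M_component n \<Longrightarrow> f + g \<in> M_component n"
 unfolding M_component_def by (auto, metis add.right_neutral add_0)

lemma M_component_0: "0 \<in> M_component n"
 by (simp add: M_component_def)

lemma M_component_uminus: "f \<in> M_component n \<Longrightarrow> - f \<in> M_component n"
 by (simp add: M_component_def)

lemma M_component_diff: "f \<in> M_component n \<Longrightarrow> g \<in> M_component n \<Longrightarrow> f - g \<in> M_component n"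
 using M_component_add[of f n "- g"] M_component_uminus by simp

lemma M_component_mult:
 assumes "f \<in> M_component m" "g \<in> M_component n"
 shows "f * g \<in> M_component (m + n)"
 unfolding M_component_def
proof (intro CollectI allI impI)
 fix i j assume "coeff (coeff (f * g) i) j \<noteq> 0"
 then have "(\<Sum>a\<le>i. \<Sum>b\<le>j. coeff (coeff f a) b * coeff (coeff g (i - a)) (j - b)) \<noteq> 0"
  by (simp add: coeff_mult coeff_sum)
 then obtain a where a: "a \<le> i" "(\<Sum>b\<le>j. coeff (coeff f a) b * coeff (coeff g (i - a)) (j - b)) \<noteq> 0"
  by (metis (no_types, lifting) atMost_iff sum.neutral)
 then obtain b where b: "b \<le> j" "coeff (coeff f a) b * coeff (coeff g (i - a)) (j - b) \<noteq> 0"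
  by (metis (no_types, lifting) atMost_iff sum.neutral)
 then have "2 * (a + b) = m" "2 * (i - a + (j - b)) = n"
  using M_componentD[OF assms(1), of a b] M_componentD[OF assms(2), of "i - a" "j - b"] by auto
 then show "2 * (i + j) = m + n" using a(1) b(1) by arith
qed

lemma M_component_1: "1 \<in> M_component 0"
 by (auto simp: M_component_def coeff_1 one_pCons coeff_pCons split: nat.splits)

lemma M_component_power: "f \<in> M_component m \<Longrightarrow> f ^ n \<in> M_component (n * m)"
 by (induction n) (auto simp: M_component_1 intro: M_component_mult)

lemma M_component_var: "var_x \<in> M_component 2" "var_y \<in> M_component 2"
 by (auto simp: M_component_def var_x_def var_y_def coeff_pCons split: nat.splits)

lemma M_component_of_int_mult: "f \<in> M_component n \<Longrightarrow> of_int c * f \<in> M_component n"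
 by (auto simp: M_component_def of_int_poly)

lemma M_component_of_nat_mult: "f \<in> M_component n \<Longrightarrow> of_nat c * f \<in> M_component n"
 using M_component_of_int_mult[of f n "int c"] by simp

lemma M_component_sum: "(\<And>i. i \<in> I \<Longrightarrow> f i \<in> M_component n) \<Longrightarrow> sum f I \<in> M_component n"
 by (induction I rule: infinite_finite_induct) (auto simp: M_component_0 M_component_add)

lemma poly_map_poly_altdef:
 fixes h :: "'a :: zero \<Rightarrow> 'b :: comm_semiring_1"
 assumes "h 0 = 0"
 shows "poly (map_poly h f) u = (\<Sum>i\<le>degree f. h (coeff f i) * u ^ i)"
proof -
 have "degree (map_poly h f) \<le> degree f"
  using assms by (intro degree_le) (auto simp: coeff_map_poly coeff_eq_0)
 then show ?thesis
  unfolding poly_altdef using assms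
  by (intro sum.mono_neutral_cong_left) (auto simp: coeff_map_poly intro!: le_degree)
qed

lemma M_component_subst_xy:
 assumes f: "f \<in> M_component n" and u: "u \<in> M_component 2" and v: "v \<in> M_component 2"
 shows "subst_xy f u v \<in> M_component n"
proof -
 have eq: "subst_xy f u v = (\<Sum>i\<le>degree f. (\<Sum>j\<le>degree (coeff f i). of_int (coeff (coeff f i) j) * v ^ j) * u ^ i)"
  by (simp add: subst_xy_def poly_map_poly_altdef)
 show ?thesis
  unfolding eq sum_distrib_right
 proof (intro M_component_sum)
  fix i j
  show "of_int (coeff (coeff f i) j) * v ^ j * u ^ i \<in> M_component n"
  proof (cases "coeff (coeff f i) j = 0")
   case False
   have "v ^ j * u ^ i \<in> M_component (j * 2 + i * 2)"
    by (intro M_component_mult M_component_power u v)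
   moreover have "j * 2 + i * 2 = n" using M_componentD[OF f False] by simp
   ultimately show ?thesis
    using M_component_of_int_mult by (simp add: mult.assoc)
  qed (simp add: M_component_0)
 qed
qed

text \<open>In a form of degree k in x and y, that is, of degree 2 k in M, the exponent of y
  determines that of x, so nothing is lost by setting x = 1.\<close>

lemma coeff_dehomogenize:
 assumes "f \<in> M_component (2 * k)"
 shows "coeff (poly f 1) j = (if j \<le> k then coeff (coeff f (k - j)) j else 0)"
proof -
 have "coeff (poly f 1) j = (\<Sum>i\<le>degree f. coeff (coeff f i) j)"
  by (simp add: poly_altdef coeff_sum)
 also have "\<dots> = (\<Sum>i\<le>degree f. if j \<le> k \<and> i = k - j then coeff (coeff f i) j else 0)"
 proof (rule sum.cong)
  fix i
  show "coeff (coeff f i) j = (if j \<le> k \<and> i = k - j then coeff (coeff f i) j else 0)"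
   using M_componentD[OF assms, of i j] by (cases "coeff (coeff f i) j = 0") auto
 qed simp
 also have "\<dots> = (if j \<le> k then coeff (coeff f (k - j)) j else 0)"
  by (auto simp: sum.delta' coeff_eq_0)
 finally show ?thesis .
qed

lemma degree_dehomogenize: "f \<in> M_component (2 * k) \<Longrightarrow> degree (poly f 1) \<le> k"
 by (rule degree_le) (simp add: coeff_dehomogenize)

lemma of_nat_dvd_dehomogenize:
 assumes f: "f \<in> M_component (2 * k)"
 shows "of_nat m dvd poly f 1 \<longleftrightarrow> of_nat m dvd f"
proof
 assume d: "of_nat m dvd poly f 1"
 show "of_nat m dvd f"
  unfolding of_nat_dvd_poly_poly_iff
 proof (intro allI)
  fix i j
  show "int m dvd coeff (coeff f i) j"
  proof (cases "coeff (coeff f i) j = 0")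
   case False
   then have "i + j = k" using M_componentD[OF f False] by simp
   then have "coeff (coeff f i) j = coeff (poly f 1) j"
    unfolding coeff_dehomogenize[OF f] by auto
   then show ?thesis using d by (simp add: of_nat_dvd_poly_iff)
  qed simp
 qed
next
 assume "of_nat m dvd f"
 then show "of_nat m dvd poly f 1" by (auto simp: dvd_def)
qed

lemma eqm_dehomogenize:
 "f \<in> M_component (2 * k) \<Longrightarrow> g \<in> M_component (2 * k) \<Longrightarrow> eqm m (poly f 1) (poly g 1) \<longleftrightarrow> eqm m f g"
 using of_nat_dvd_dehomogenize[OF M_component_diff, of f k g m] by (simp add: eqm_def)

lemma dehomogenize_inject:
 assumes "f \<in> M_component (2 * k)" "g \<in> M_component (2 * k)" "poly f 1 = poly g 1"
 shows "f = g"
proof -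
 have "eqm 0 f g" using assms eqm_dehomogenize[of f k g 0] by simp
 then show ?thesis by (simp add: eqm_def)
qed

definition homogenize :: "nat \<Rightarrow> int poly \<Rightarrow> int poly poly"
 where "homogenize k g = (\<Sum>j\<le>k. monom (monom (coeff g j) j) (k - j))"

lemma homogenize_M_component: "homogenize k g \<in> M_component (2 * k)"
 unfolding homogenize_def
 by (intro M_component_sum) (auto simp: M_component_def split: if_splits)

lemma dehomogenize_homogenize: "degree g \<le> k \<Longrightarrow> poly (homogenize k g) 1 = g"
 unfolding homogenize_def
 by (subst (2) poly_as_sum_of_monoms'[of g k, symmetric]) (simp_all add: poly_sum poly_monom)

text \<open>The coefficient of y^k records the value at (0, 1), the point at infinity of the chart x
  = 1.\<close>

lemma eval_int_0_left:
 assumes f: "f \<in> M_component (2 * k)"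
 shows "eval_int f 0 b = coeff (poly f 1) k * b ^ k"
proof -
 have "coeff f 0 = monom (coeff (coeff f 0) k) k"
 proof (rule poly_eqI)
  fix j show "coeff (coeff f 0) j = coeff (monom (coeff (coeff f 0) k) k) j"
   using M_componentD[OF f, of 0 j] by auto
 qed
 then have "eval_int f 0 b = poly (monom (coeff (coeff f 0) k) k) b"
  by (simp add: eval_int_def poly_0_coeff_0)
 then show ?thesis by (simp add: coeff_dehomogenize[OF f] poly_monom)
qed

lemma eval_int_1_left: "eval_int f 1 b = poly (poly f 1) b"
 by (simp add: eval_int_def one_pCons)

section \<open>The Dickson invariants and the ring they generate modulo p\<close>

definition dickson_P :: "nat \<Rightarrow> int poly poly"
 where "dickson_P p = var_x * var_y ^ p - var_x ^ p * var_y"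

text \<open>Modulo p, P is the product of x and the linear forms y - a x for a in F_p, and Q is the
  quotient of x y^(p^2) - x^(p^2) y by P. This shape of Q becomes N^(p-1) + 1 at x = 1, a polynomial
  in N = y^p - y.\<close>

definition dickson_Q :: "nat \<Rightarrow> int poly poly"
 where "dickson_Q p = (var_y ^ p - var_x ^ (p - 1) * var_y) ^ (p - 1) + var_x ^ (p * (p - 1))"

lemma dickson_P_homogeneous: "dickson_P p \<in> M_component (2 * (p + 1))"
 unfolding dickson_P_def
 using M_component_mult[OF M_component_var(1) M_component_power[OF M_component_var(2), of p]]
  M_component_mult[OF M_component_power[OF M_component_var(1), of p] M_component_var(2)]
 by (intro M_component_diff) (simp_all add: mult.commute)

lemma dickson_Q_homogeneous:
 assumes "p > 0"
 shows "dickson_Q p \<in> M_component (2 * (p * (p - 1)))"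
proof -
 have "var_x ^ (p - 1) * var_y \<in> M_component ((p - 1) * 2 + 2)"
  by (intro M_component_mult M_component_power M_component_var)
 moreover have "(p - 1) * 2 + 2 = p * 2" using assms by simp
 ultimately have "var_y ^ p - var_x ^ (p - 1) * var_y \<in> M_component (p * 2)"
  using M_component_power[OF M_component_var(2), of p]
  by (intro M_component_diff) auto
 then have "(var_y ^ p - var_x ^ (p - 1) * var_y) ^ (p - 1) \<in> M_component ((p - 1) * (p * 2))"
  by (rule M_component_power)
 moreover have "var_x ^ (p * (p - 1)) \<in> M_component (p * (p - 1) * 2)"
  by (intro M_component_power M_component_var)
 ultimately show ?thesis unfolding dickson_Q_def
  by (intro M_component_add) (simp_all add: mult_ac)
qed

lemma dehomogenize_dickson_P: "poly (dickson_P p) 1 = artin_schreier p"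
 by (simp add: dickson_P_def artin_schreier_def var_x_def var_y_def monom_altdef)

lemma dehomogenize_dickson_Q: "poly (dickson_Q p) 1 = artin_schreier p ^ (p - 1) + 1"
 by (simp add: dickson_Q_def artin_schreier_def var_x_def var_y_def monom_altdef)

lemma eqm_frobenius_diff:
 assumes "prime p" "odd p"
 shows "eqm p ((a - b) ^ p) (a ^ p - b ^ p :: 'a :: comm_ring_1)"
 using eqm_frobenius[OF assms(1), of a "- b"] assms(2) by simp

lemma eqm_frobenius2_diff:
 assumes "prime p" "odd p"
 shows "eqm p ((a - b) ^ (p * p)) (a ^ (p * p) - b ^ (p * p) :: 'a :: comm_ring_1)"
 using eqm_frobenius2[OF assms(1), of a "- b"] assms(2) by simp

lemma invariant_dickson_P:
 assumes p: "prime p" "odd p"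
 shows "invariant_mod p (dickson_P p)"
proof -
 have "eqm p ((var_x - var_y) * var_y ^ p - (var_x - var_y) ^ p * var_y)
   ((var_x - var_y) * var_y ^ p - (var_x ^ p - var_y ^ p) * var_y)"
  by (intro eqm_diff eqm_mult eqm_refl eqm_frobenius_diff p)
 moreover have "eqm p (var_x * (var_x + var_y) ^ p - var_x ^ p * (var_x + var_y))
   (var_x * (var_x ^ p + var_y ^ p) - var_x ^ p * (var_x + var_y))"
  by (intro eqm_diff eqm_mult eqm_refl eqm_frobenius p)
 ultimately show ?thesis
  by (simp add: invariant_mod_def act1_def act2_def dickson_P_def subst_xy_hom algebra_simps)
qed

text \<open>With N = y^p - x^(p-1) y one has P = x N, so P Q = x (N^p + x^(p(p-1)) N); after
  Frobenius is applied to N^p the middle terms cancel.\<close>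

lemma dickson_PQ:
 assumes p: "prime p" "odd p"
 shows "eqm p (dickson_P p * dickson_Q p) (var_x * var_y ^ (p * p) - var_x ^ (p * p) * var_y)"
proof -
 obtain q where q: "p = Suc q" using prime_gt_0_nat[OF p(1)] by (cases p) auto
 let ?N = "var_y ^ p - var_x ^ q * var_y"
 have "dickson_P p * dickson_Q p = var_x * (?N ^ p + var_x ^ (p * q) * ?N)"
  unfolding dickson_P_def dickson_Q_def by (simp add: q algebra_simps)
 also have "eqm p \<dots> (var_x * (((var_y ^ p) ^ p - (var_x ^ q * var_y) ^ p) + var_x ^ (p * q) * ?N))"
  by (intro eqm_diff eqm_add eqm_mult eqm_refl eqm_frobenius_diff p)
 also have "var_x * (((var_y ^ p) ^ p - (var_x ^ q * var_y) ^ p) + var_x ^ (p * q) * ?N)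
   = var_x * var_y ^ (p * p) - var_x ^ (p * p) * var_y"
 proof -
  have e: "p * p = 1 + q + p * q" by (simp add: q)
  show ?thesis
   unfolding e by (simp add: power_mult_distrib power_mult[symmetric] power_add algebra_simps e)
 qed
 finally show ?thesis .
qed

lemma dickson_P_not_dvd:
 assumes "prime p"
 shows "\<not> of_nat p dvd dickson_P p"
proof
 assume "of_nat p dvd dickson_P p"
 then have "of_nat p dvd artin_schreier p"
  using of_nat_dvd_dehomogenize[OF dickson_P_homogeneous] by (simp add: dehomogenize_dickson_P)
 then have "int p dvd coeff (artin_schreier p) p" by (simp add: of_nat_dvd_poly_iff)
 then show False
  using artin_schreier_monic[of p] assms prime_ge_2_nat[OF assms] by simp
qed

text \<open>The form x y^(p^2) - x^(p^2) y is invariant because p^2-th powers are additive modulo p;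
  P is then cancelled from P Q.\<close>

lemma invariant_dickson_Q:
 assumes p: "prime p" "odd p"
 shows "invariant_mod p (dickson_Q p)"
proof (rule invariant_mod_cancel[OF p(1) dickson_P_not_dvd[OF p(1)] invariant_dickson_P[OF p]])
 have "eqm p ((var_x - var_y) * var_y ^ (p * p) - (var_x - var_y) ^ (p * p) * var_y)
   ((var_x - var_y) * var_y ^ (p * p) - (var_x ^ (p * p) - var_y ^ (p * p)) * var_y)"
  by (intro eqm_diff eqm_mult eqm_refl eqm_frobenius2_diff p)
 moreover have "eqm p (var_x * (var_x + var_y) ^ (p * p) - var_x ^ (p * p) * (var_x + var_y))
   (var_x * (var_x ^ (p * p) + var_y ^ (p * p)) - var_x ^ (p * p) * (var_x + var_y))"
  by (intro eqm_diff eqm_mult eqm_refl eqm_frobenius2 p)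
 ultimately have "invariant_mod p (var_x * var_y ^ (p * p) - var_x ^ (p * p) * var_y)"
  by (simp add: invariant_mod_def act1_def act2_def subst_xy_hom algebra_simps)
 then show "invariant_mod p (dickson_P p * dickson_Q p)"
  using invariant_mod_eqm[OF eqm_sym[OF dickson_PQ[OF p]]] by simp
qed

text \<open>The exponents for which P^i Q^j has degree k in x and y, hence degree 2 k in M.\<close>

definition dickson_index :: "nat \<Rightarrow> nat \<Rightarrow> (nat \<times> nat) set"
 where "dickson_index p k = {(i, j). (p + 1) * i + p * (p - 1) * j = k}"

lemma finite_dickson_index:
 assumes "p \<ge> 2"
 shows "finite (dickson_index p k)"
proof (rule finite_subset)
 show "dickson_index p k \<subseteq> {..k} \<times> {..k}"
 proof
  fix ij assume "ij \<in> dickson_index p k"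
  then obtain i j where ij: "ij = (i, j)" "(p + 1) * i + p * (p - 1) * j = k"
   by (auto simp: dickson_index_def)
  have "i \<le> (p + 1) * i" "j \<le> p * (p - 1) * j" using assms by auto
  then have "i \<le> k" "j \<le> k" using ij(2) by linarith+
  then show "ij \<in> {..k} \<times> {..k}" using ij(1) by simp
 qed
qed simp

definition dickson_mon :: "nat \<Rightarrow> nat \<times> nat \<Rightarrow> int poly poly"
 where "dickson_mon p ij = dickson_P p ^ fst ij * dickson_Q p ^ snd ij"

definition dickson_span :: "nat \<Rightarrow> nat \<Rightarrow> int poly poly set"
 where "dickson_span p k =
  {f. \<exists>c. eqm p f (\<Sum>ij\<in>dickson_index p k. of_int (c ij) * dickson_mon p ij)}"

lemma dickson_span_Q_power:
 assumes p: "p \<ge> 2"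
 shows "of_int a * dickson_Q p ^ j \<in> dickson_span p (p * (p - 1) * j)"
proof -
 let ?c = "\<lambda>ij. if ij = (0, j) then a else 0"
 have "(\<Sum>ij\<in>dickson_index p (p * (p - 1) * j). of_int (?c ij) * dickson_mon p ij)
   = (\<Sum>ij\<in>{(0, j)}. of_int (?c ij) * dickson_mon p ij)"
  using p by (intro sum.mono_neutral_right finite_dickson_index) (auto simp: dickson_index_def)
 then show ?thesis
  unfolding dickson_span_def by (intro CollectI exI[of _ ?c]) (simp add: dickson_mon_def)
qed

lemma dickson_span_add:
 assumes "f \<in> dickson_span p k" "g \<in> dickson_span p k"
 shows "f + g \<in> dickson_span p k"
proof -
 obtain c d where
  "eqm p f (\<Sum>ij\<in>dickson_index p k. of_int (c ij) * dickson_mon p ij)"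
  "eqm p g (\<Sum>ij\<in>dickson_index p k. of_int (d ij) * dickson_mon p ij)"
  using assms by (auto simp: dickson_span_def)
 from eqm_add[OF this] show ?thesis
  unfolding dickson_span_def
  by (intro CollectI exI[of _ "\<lambda>ij. c ij + d ij"]) (simp add: sum.distrib distrib_right)
qed

lemma dickson_span_P_mult:
 assumes p: "p \<ge> 2" and f: "f \<in> dickson_span p k"
 shows "dickson_P p * f \<in> dickson_span p (k + p + 1)"
proof -
 obtain c where c: "eqm p f (\<Sum>ij\<in>dickson_index p k. of_int (c ij) * dickson_mon p ij)"
  using f by (auto simp: dickson_span_def)
 let ?s = "\<lambda>ij :: nat \<times> nat. (Suc (fst ij), snd ij)"
 let ?d = "\<lambda>ij. if fst ij = 0 then 0 else c (fst ij - 1, snd ij)"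
 have "(\<Sum>ij\<in>dickson_index p (k + p + 1). of_int (?d ij) * dickson_mon p ij)
   = (\<Sum>ij\<in>?s ` dickson_index p k. of_int (?d ij) * dickson_mon p ij)"
 proof (intro sum.mono_neutral_right finite_dickson_index p ballI)
  show "?s ` dickson_index p k \<subseteq> dickson_index p (k + p + 1)"
   by (auto simp: dickson_index_def)
  fix ij assume "ij \<in> dickson_index p (k + p + 1) - ?s ` dickson_index p k"
  moreover have "ij = ?s (fst ij - 1, snd ij) \<and> (fst ij - 1, snd ij) \<in> dickson_index p k"
   if "ij \<in> dickson_index p (k + p + 1)" "fst ij \<noteq> 0"
   using that by (cases ij; cases "fst ij") (auto simp: dickson_index_def)
  ultimately have "fst ij = 0" by blast
  then show "of_int (?d ij) * dickson_mon p ij = 0" by simp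
 qed
 also have "\<dots> = (\<Sum>ij\<in>dickson_index p k. of_int (?d (?s ij)) * dickson_mon p (?s ij))"
  by (subst sum.reindex) (auto simp: inj_on_def o_def)
 also have "\<dots> = dickson_P p * (\<Sum>ij\<in>dickson_index p k. of_int (c ij) * dickson_mon p ij)"
  by (simp add: sum_distrib_left dickson_mon_def mult_ac)
 finally show ?thesis
  unfolding dickson_span_def using eqm_mult[OF eqm_refl c, of "dickson_P p"]
  by (intro CollectI exI[of _ ?d]) simp
qed

lemma dickson_span_eqm: "eqm p f g \<Longrightarrow> g \<in> dickson_span p k \<Longrightarrow> f \<in> dickson_span p k"
 unfolding dickson_span_def using eqm_trans by blast

text \<open>The two generators join the points (0, 1), (1, 1) and (1, 0).\<close>

lemma invariant_corner_values:
 assumes "invariant_mod m f"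
 shows "eqm m (eval_int f 0 1) (eval_int f 1 0)"
proof -
 have "eqm m (eval_int (act1 f) 1 1) (eval_int f 1 1)" "eqm m (eval_int (act2 f) 1 0) (eval_int f 1 0)"
  using assms unfolding invariant_mod_def by (auto intro: eqm_eval_int)
 then have "eqm m (eval_int f 0 1) (eval_int f 1 1)" "eqm m (eval_int f 1 1) (eval_int f 1 0)"
  by (simp_all add: eval_int_act1 eval_int_act2)
 then show ?thesis by (rule eqm_trans)
qed

lemma invariant_shear_values:
 assumes "invariant_mod m f"
 shows "eqm m (eval_int f 0 b) (eval_int f (of_nat s * b) b)"
proof (induction s)
 case (Suc s)
 have "eqm m (eval_int (act1 f) (of_nat (Suc s) * b) b) (eval_int f (of_nat (Suc s) * b) b)"
  using assms unfolding invariant_mod_def by (auto intro: eqm_eval_int)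
 then have "eqm m (eval_int f (of_nat s * b) b) (eval_int f (of_nat (Suc s) * b) b)"
  by (simp add: eval_int_act1 algebra_simps)
 with Suc.IH show ?case by (rule eqm_trans)
qed simp

text \<open>For s inverse to b modulo p, the s-fold shear relates the point (0, b) to (s b, b),
  which is (1, b) modulo p.\<close>

lemma invariant_value_0_1:
 assumes p: "prime p" and inv: "invariant_mod p f" and b: "\<not> p dvd b"
 shows "eqm p (eval_int f 0 (int b)) (eval_int f 1 (int b))"
proof -
 have "coprime p b" using p b by (rule prime_imp_coprime)
 then obtain s where s: "[b * s = 1] (mod p)"
  using cong_solve_coprime_nat[of b p] by (auto simp: coprime_commute)
 then have "[int b * int s = 1] (mod int p)" by (metis cong_int_iff of_nat_1 of_nat_mult)
 then have "eqm p (int s * int b) 1"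
  by (simp add: eqm_def cong_iff_dvd_diff mult.commute)
 then show ?thesis
  using eqm_trans[OF invariant_shear_values[OF inv, of "int b" s] eqm_eval_int_arg] by simp
qed

lemma degree_diff_lead:
 fixes g :: "int poly"
 assumes "degree g \<le> k" "k > 0"
 shows "degree (g - monom (coeff g k) k) < k"
proof -
 have "degree (g - monom (coeff g k) k) \<le> k - 1"
  using assms by (intro degree_le) (auto simp: coeff_eq_0)
 then show ?thesis using assms(2) by simp
qed

lemma prime_pred_dvd_exponent:
 assumes p: "prime p" and all: "\<And>b. \<not> p dvd b \<Longrightarrow> [b ^ k = 1] (mod p)"
 shows "p - 1 dvd k"
proof -
 obtain g where g: "residue_primroot p g"
  using prime_primitive_root_exists[of p] p prime_gt_1_nat by blast
 then have "coprime p g" "ord p g = totient p" by (auto simp: residue_primroot_def)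
 then have "\<not> p dvd g" using p by (metis coprime_absorb_left not_prime_unit)
 from all[OF this] have "ord p g dvd k" by (rule ord_divides[THEN iffD1])
 then show ?thesis using \<open>ord p g = totient p\<close> totient_prime[OF p] by simp
qed

text \<open>The ring of \<open>SL\<^sub>2(\<F>\<^sub>p)\<close>-invariants is \<open>\<F>\<^sub>p[P, Q]\<close>: an invariant vanishing at \<open>(0, 1)\<close> vanishes on all
 nonzero points of the plane over \<open>\<F>\<^sub>p\<close>, so \<open>P\<close> divides it; otherwise it is a nonzero constant on
 these points, and a multiple of a power of \<open>Q\<close> can be subtracted.\<close>

theorem dickson_invariants:
 assumes p: "prime p" "odd p" and f: "f \<in> M_component (2 * k)" "invariant_mod p f"
 shows "f \<in> dickson_span p k"
 using f
proof (induction k arbitrary: f rule: less_induct)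
 case (less k)
 note p2 = prime_ge_2_nat[OF p(1)]
 let ?N = "artin_schreier p"
 \<comment> \<open>Stated for any invariant h of the same degree k, as it is needed for f itself and
   for f minus a multiple of a power of Q.\<close>
 have vanishing: "h \<in> dickson_span p k"
  if h: "h \<in> M_component (2 * k)" "invariant_mod p h" "eqm p (coeff (poly h 1) k) 0" for h
 proof -
  \<comment> \<open>The coefficient of y^k is 0 modulo p and is removed. The strict inequality
    \<open>degree g < k\<close> leaves room for the factor x of P when the quotient is made
    homogeneous again.\<close>
  define g where "g = poly h 1 - monom (coeff (poly h 1) k) k"
  have eg: "eqm p (poly h 1) g"
   using h(3) unfolding g_def eqm_def by (auto simp: of_nat_dvd_poly_iff)
  have g0: "g = 0 \<or> degree g < k"
  proof (cases "k = 0")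
   case True
   have "poly h 1 = monom (coeff (poly h 1) k) k"
    using degree_dehomogenize[OF h(1)] unfolding True by (metis degree_eq_zeroE le_zero_eq coeff_pCons_0 monom_0)
   then show ?thesis by (simp add: g_def)
  qed (use degree_diff_lead[OF degree_dehomogenize[OF h(1)]] in \<open>auto simp: g_def\<close>)
  have "eqm p (pcompose (poly h 1) [:1, 1:]) (poly h 1)"
   using h(2) eqm_poly[of p "act2 h" h 1] by (simp add: invariant_mod_def dehomogenize_act2)
  moreover have "eqm p (pcompose (poly h 1) [:1, 1:]) (pcompose g [:1, 1:])"
   using eg unfolding eqm_def dvd_def pcompose_diff[symmetric]
   by (metis pcompose_mult pcompose_const of_nat_poly)
  ultimately have "eqm p (pcompose g [:1, 1:]) g" using eg by (meson eqm_sym eqm_trans)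
  moreover obtain \<eta> where "pcompose ?N [:1, 1:] = ?N + of_nat p * \<eta>" "degree \<eta> < p" "coeff \<eta> (p - 1) = 1"
   by (rule translate_artin_schreier[OF p(1)])
  ultimately obtain G where G: "eqm p g (pcompose G ?N)" "p * degree G \<le> degree g" "g = 0 \<longrightarrow> G = 0"
   using translate_coinvariants[OF p(1), of \<eta> g 0] by (auto simp: eqm_def)
  obtain a G' where GG: "G = pCons a G'" by (cases G)
  \<comment> \<open>h also vanishes at (1, 0), so the constant coefficient of G is 0 modulo p and N
    divides G(N) there.\<close>
  have "eqm p (eval_int h 1 0) 0"
   using h(3) invariant_corner_values[OF h(2)] eval_int_0_left[OF h(1), of 1]
   by (metis eqm_sym eqm_trans mult.right_neutral power_one)
  then have "eqm p (poly g 0) 0" using eqm_poly[OF eg, of 0]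
   unfolding eval_int_1_left by (meson eqm_sym eqm_trans)
  moreover have "eqm p (poly g 0) a" using eqm_poly[OF G(1), of 0] p2
   by (simp add: poly_pcompose poly_artin_schreier_0 GG)
  ultimately have a: "eqm p a 0" by (meson eqm_sym eqm_trans)
  have "eqm p (pcompose G ?N) (?N * pcompose G' ?N)"
   using a unfolding GG pcompose_pCons eqm_def by (auto simp: of_nat_dvd_poly_iff coeff_pCons split: nat.splits)
  then have hN: "eqm p (poly h 1) (?N * pcompose G' ?N)" using eg G(1) by (meson eqm_trans)
  show ?thesis
  proof (cases "G' = 0")
   case True
   then have "of_nat p dvd h" using hN of_nat_dvd_dehomogenize[OF h(1)] by (simp add: eqm_def)
   then show ?thesis unfolding dickson_span_def
    by (intro CollectI exI[of _ "\<lambda>_. 0"]) (simp add: eqm_def)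
  next
   case False
   then have "p * Suc (degree G') \<le> degree g" "g \<noteq> 0" using G(2,3) GG by auto
   then have le: "p * degree G' + p + 1 \<le> k" using g0 by (auto simp: algebra_simps)
   define k' where "k' = k - (p + 1)"
   have k': "k = k' + p + 1" "k' < k" "p * degree G' \<le> k'" using le by (auto simp: k'_def)
   define f' where "f' = homogenize k' (pcompose G' ?N)"
   have f': "f' \<in> M_component (2 * k')" unfolding f'_def by (rule homogenize_M_component)
   have "degree (pcompose G' ?N) \<le> k'"
    using k'(3) artin_schreier_monic(1)[OF p2] by (simp add: degree_pcompose mult.commute)
   then have ev: "poly f' 1 = pcompose G' ?N" unfolding f'_def by (rule dehomogenize_homogenize)
   have "dickson_P p * f' \<in> M_component (2 * (p + 1) + 2 * k')"
    by (intro M_component_mult dickson_P_homogeneous f')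
   then have PM: "dickson_P p * f' \<in> M_component (2 * k)"
    using k'(1) by (simp add: algebra_simps)
   have e: "eqm p h (dickson_P p * f')"
    using eqm_dehomogenize[OF h(1) PM, of p] hN by (simp add: ev dehomogenize_dickson_P)
   have "invariant_mod p f'"
    by (rule invariant_mod_cancel[OF p(1) dickson_P_not_dvd[OF p(1)] invariant_dickson_P[OF p]
       invariant_mod_eqm[OF e h(2)]])
   then have "f' \<in> dickson_span p k'" using less.IH[OF k'(2) f'] by simp
   then have "dickson_P p * f' \<in> dickson_span p k"
    using dickson_span_P_mult[OF p2] k'(1) by simp
   then show ?thesis using e dickson_span_eqm by blast
  qed
 qed
 define c where "c = coeff (poly f 1) k"
 show ?case
 proof (cases "eqm p c 0")
  case True
  then show ?thesis using vanishing less.prems by (simp add: c_def)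
 next
  case False
  then have pc: "\<not> int p dvd c" by (simp add: eqm_0_iff)
  have "eqm p (pcompose (poly f 1) [:1, 1:]) (poly f 1)"
   using less.prems(2) eqm_poly[of p "act2 f" f 1] by (simp add: invariant_mod_def dehomogenize_act2)
  moreover obtain \<eta> where "pcompose ?N [:1, 1:] = ?N + of_nat p * \<eta>" "degree \<eta> < p" "coeff \<eta> (p - 1) = 1"
   by (rule translate_artin_schreier[OF p(1)])
  ultimately obtain G where G: "eqm p (poly f 1) (pcompose G ?N)" "p * degree G \<le> degree (poly f 1)"
   using translate_coinvariants[OF p(1), of \<eta> "poly f 1" 0] by (auto simp: eqm_def)
  have dN: "degree (pcompose G ?N) = p * degree G"
   using artin_schreier_monic(1)[OF p2] by (simp add: degree_pcompose mult.commute)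
  \<comment> \<open>G(N) has a nonzero coefficient in degree k, so k is at most p *
    \<open>degree G\<close>; the other inequality comes from
    \<open>translate_coinvariants\<close>.\<close>
  have "int p dvd c - coeff (pcompose G ?N) k"
   using G(1) unfolding eqm_def of_nat_dvd_poly_iff c_def by (metis coeff_diff)
  then have "coeff (pcompose G ?N) k \<noteq> 0" using pc by auto
  then have "k \<le> p * degree G" using dN le_degree by metis
  moreover have "p * degree G \<le> k" using G(2) degree_dehomogenize[OF less.prems(1)] by simp
  ultimately have kG: "k = p * degree G" by simp
  \<comment> \<open>y^p - y vanishes on F_p, so a polynomial in it takes the same value at all
    points (1, b); at (1, 0) this value is c.\<close>
  have fb: "eqm p (eval_int f 1 (int b)) c" for b
  proof -
   have "eqm p (poly ?N (int b)) 0" "eqm p (poly ?N 0) 0"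
   proof -
    have "[b ^ p = b] (mod p)"
    proof (cases "p dvd b")
     case True
     then have "p dvd b ^ p" using p2 by (meson dvd_power dvd_trans not_less_eq_eq pos2 le_trans less_le_trans)
     then show ?thesis using True by (simp add: cong_def dvd_imp_mod_0)
    next
     case False
     then have "[b ^ (p - 1) = 1] (mod p)" by (rule fermat_theorem[OF p(1)])
     then have "[b ^ (p - 1) * b = 1 * b] (mod p)" by (rule cong_mult[OF _ cong_refl])
     moreover have "b ^ (p - 1) * b = b ^ p" using p2 by (metis power_minus_mult less_le_trans pos2)
     ultimately show ?thesis by simp
    qed
    then have "[int b ^ p = int b] (mod int p)" by (metis cong_int_iff of_nat_power)
    then show "eqm p (poly ?N (int b)) 0"
     by (simp add: artin_schreier_def poly_monom eqm_def cong_iff_dvd_diff)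
    show "eqm p (poly ?N 0) 0" using p2 by (simp add: poly_artin_schreier_0)
   qed
   then have "eqm p (poly ?N (int b)) (poly ?N 0)" by (meson eqm_sym eqm_trans)
   then have "eqm p (poly G (poly ?N (int b))) (poly G (poly ?N 0))" by (rule eqm_poly_arg)
   then have "eqm p (poly (poly f 1) (int b)) (poly (poly f 1) 0)"
    using eqm_poly[OF G(1), of "int b"] eqm_poly[OF G(1), of 0]
    unfolding poly_pcompose by (meson eqm_sym eqm_trans)
   moreover have "eqm p (eval_int f 1 0) c"
    using invariant_corner_values[OF less.prems(2)] eval_int_0_left[OF less.prems(1), of 1]
    by (simp add: c_def eqm_sym)
   ultimately show ?thesis unfolding eval_int_1_left by (rule eqm_trans)
  qed
  \<comment> \<open>Homogeneity gives c b^k at (0, b), and this point has the same value c as (1,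
    b); hence b^k = 1 for all b prime to p, in particular for a primitive root.\<close>
  have "p - 1 dvd k"
  proof (rule prime_pred_dvd_exponent[OF p(1)])
   fix b assume b: "\<not> p dvd b"
   have "eqm p (c * int b ^ k) c"
    using eqm_trans[OF invariant_value_0_1[OF p(1) less.prems(2) b] fb]
     eval_int_0_left[OF less.prems(1), of "int b"] by (simp add: c_def)
   then have "int p dvd c * (int b ^ k - 1)" by (simp add: eqm_def algebra_simps)
   then have "int p dvd int b ^ k - 1" using pc p(1) by (simp add: prime_dvd_mult_iff)
   then have "[int b ^ k = 1] (mod int p)" by (simp add: cong_iff_dvd_diff)
   then show "[b ^ k = 1] (mod p)" by (metis cong_int_iff of_nat_1 of_nat_power)
  qed
  moreover have "p dvd k" using kG by simp
  moreover have "coprime p (p - 1)" using p2 by (metis coprime_diff_one_right_nat pos2 less_le_trans)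
  ultimately obtain j where j: "k = p * (p - 1) * j" by (metis divides_mult dvdE)
  \<comment> \<open>Now k is a multiple of p (p - 1), the degree of Q. Since Q^j has coefficient 1
    at y^k, subtracting c Q^j cancels the value at (0, 1).\<close>
  define h where "h = f - of_int c * dickson_Q p ^ j"
  have Qj: "dickson_Q p ^ j \<in> M_component (2 * k)"
   using M_component_power[OF dickson_Q_homogeneous, of p j] p2 by (simp add: j mult_ac)
  have hM: "h \<in> M_component (2 * k)"
   unfolding h_def by (intro M_component_diff M_component_of_int_mult Qj less.prems)
  have hinv: "invariant_mod p h"
   unfolding h_def by (intro invariant_mod_diff invariant_mod_mult invariant_mod_of_int
     invariant_mod_power invariant_dickson_Q p less.prems)
  have "coeff (poly (dickson_Q p ^ j) 1) k = 1"
  proof -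
   have "?N \<noteq> 0" using artin_schreier_monic(2)[OF p2] by auto
   then have m2: "degree (?N ^ (p - 1)) = p * (p - 1)"
    using artin_schreier_monic[OF p2] by (simp add: degree_power_eq)
   have m1: "lead_coeff (?N ^ (p - 1)) = 1"
    by (simp only: lead_coeff_power artin_schreier_monic(2)[OF p2] power_one)
   note m = m1 m2
   have "degree (?N ^ (p - 1) + 1) = p * (p - 1)"
    using p2 m by (subst degree_add_eq_left) auto
   moreover have "coeff (?N ^ (p - 1) + 1) (p * (p - 1)) = 1"
    using p2 m by (auto simp: coeff_1)
   ultimately have l: "lead_coeff (?N ^ (p - 1) + 1) = 1" "degree (?N ^ (p - 1) + 1) = p * (p - 1)"
    by simp_all
   then have "?N ^ (p - 1) + 1 \<noteq> 0" by auto
   then have "degree ((?N ^ (p - 1) + 1) ^ j) = k" using l(2) by (simp add: degree_power_eq j)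
   moreover have "lead_coeff ((?N ^ (p - 1) + 1) ^ j) = 1"
    by (simp only: lead_coeff_power l(1) power_one)
   ultimately have "coeff ((?N ^ (p - 1) + 1) ^ j) k = 1" by simp
   then show ?thesis by (simp add: dehomogenize_dickson_Q)
  qed
  then have "coeff (poly h 1) k = 0"
   by (simp add: h_def c_def of_int_poly)
  then have "h \<in> dickson_span p k" using vanishing[OF hM hinv] by simp
  then have "h + of_int c * dickson_Q p ^ j \<in> dickson_span p k"
   using dickson_span_Q_power[OF p2, of c j] by (intro dickson_span_add) (simp_all add: j)
  then show ?thesis by (simp add: h_def)
 qed
qed

section \<open>Monomials in P and Q modulo higher powers of p\<close>

definition vp_gcd :: "nat \<Rightarrow> nat \<times> nat \<Rightarrow> nat"
 where "vp_gcd p ij = multiplicity p (gcd (fst ij) (snd ij))"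

text \<open>The p^a-th root of P^i Q^j, where a is \<open>vp_gcd p (i, j)\<close>; unless both
  exponents are 0, those of the root are not both divisible by p.\<close>

definition dickson_root :: "nat \<Rightarrow> nat \<times> nat \<Rightarrow> int poly poly"
 where "dickson_root p ij =
  dickson_mon p (fst ij div p ^ vp_gcd p ij, snd ij div p ^ vp_gcd p ij)"

lemma vp_gcd_dvd: "p ^ vp_gcd p ij dvd fst ij" "p ^ vp_gcd p ij dvd snd ij"
 unfolding vp_gcd_def by (meson dvd_trans gcd_dvd1 gcd_dvd2 multiplicity_dvd)+

lemma dickson_root_power: "dickson_root p ij ^ (p ^ vp_gcd p ij) = dickson_mon p ij"
 using vp_gcd_dvd[of p ij]
 by (simp add: dickson_root_def dickson_mon_def power_mult_distrib flip: power_mult)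

lemma vp_gcd_max:
 assumes "prime p" "ij \<noteq> (0, 0)"
  and "p dvd fst ij div p ^ vp_gcd p ij" "p dvd snd ij div p ^ vp_gcd p ij"
 shows False
proof -
 have "p ^ vp_gcd p ij * p dvd fst ij" "p ^ vp_gcd p ij * p dvd snd ij"
  using assms(3,4) vp_gcd_dvd[of p ij] by (metis dvd_mult_div_cancel mult_dvd_mono dvd_refl)+
 then have "p ^ Suc (vp_gcd p ij) dvd gcd (fst ij) (snd ij)" by (simp add: mult.commute)
 moreover have "gcd (fst ij) (snd ij) \<noteq> 0" using assms(2) by (cases ij) auto
 moreover have "\<not> is_unit p" using assms(1) by auto
 ultimately have "Suc (vp_gcd p ij) \<le> multiplicity p (gcd (fst ij) (snd ij))"
  by (intro multiplicity_geI)
 then show False by (simp add: vp_gcd_def)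
qed

lemma dickson_mon_homogeneous:
 assumes "p > 0" "ij \<in> dickson_index p k"
 shows "dickson_mon p ij \<in> M_component (2 * k)"
proof -
 have "dickson_mon p ij \<in> M_component (fst ij * (2 * (p + 1)) + snd ij * (2 * (p * (p - 1))))"
  unfolding dickson_mon_def
  by (intro M_component_mult M_component_power dickson_P_homogeneous dickson_Q_homogeneous assms)
 moreover have "fst ij * (2 * (p + 1)) + snd ij * (2 * (p * (p - 1))) = 2 * k"
 proof -
  have "(p + 1) * fst ij + p * (p - 1) * snd ij = k" using assms(2) by (auto simp: dickson_index_def)
  moreover have "x * (2 * a) + y * (2 * b) = 2 * (a * x + b * y)" for x y a b :: nat
   by (simp add: algebra_simps)
  ultimately show ?thesis by (simp only:)
 qed
 ultimately show ?thesis by simp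
qed

lemma invariant_dickson_mon_mod_p:
 assumes "prime p" "odd p"
 shows "invariant_mod p (dickson_mon p ij)"
 unfolding dickson_mon_def
 by (intro invariant_mod_mult invariant_mod_power invariant_dickson_P invariant_dickson_Q assms)

text \<open>The root is invariant modulo p, and raising to the power p^a adds a to the exponent of
  the modulus.\<close>

lemma invariant_dickson_mon:
 assumes "prime p" "odd p"
 shows "invariant_mod (p ^ Suc (vp_gcd p ij)) (dickson_mon p ij)"
proof -
 have "invariant_mod p (dickson_root p ij)"
  unfolding dickson_root_def by (rule invariant_dickson_mon_mod_p[OF assms])
 from invariant_mod_power_lift[OF assms(1) this, of "vp_gcd p ij"]
 show ?thesis unfolding dickson_root_power .
qed

text \<open>With \<open>x = 1\<close> the monomial \<open>P\<^sup>i Q\<^sup>j\<close> becomes \<open>dickson_t p (i, j)\<close> evaluated at \<open>y\<^sup>p - y\<close>.\<close>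

definition dickson_t :: "nat \<Rightarrow> nat \<times> nat \<Rightarrow> int poly"
 where "dickson_t p ij = monom 1 (fst ij) * (monom 1 (p - 1) + 1) ^ snd ij"

lemma pcompose_power: "pcompose (f ^ n) q = pcompose f q ^ n"
 by (induction n) (simp_all add: pcompose_1 pcompose_mult)

lemma dehomogenize_dickson_mon:
 "poly (dickson_mon p ij) 1 = pcompose (dickson_t p ij) (artin_schreier p)"
 by (simp add: dickson_mon_def dehomogenize_dickson_P dehomogenize_dickson_Q dickson_t_def
   pcompose_mult pcompose_power pcompose_add pcompose_1 pcompose_monom)

lemma dickson_t_low: "i < fst ij \<Longrightarrow> coeff (dickson_t p ij) i = 0"
 by (simp add: dickson_t_def coeff_monom_mult)

lemma dickson_t_lowest: "p \<ge> 2 \<Longrightarrow> coeff (dickson_t p ij) (fst ij) = 1"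
proof -
 assume p: "p \<ge> 2"
 have "coeff (dickson_t p ij) (fst ij) = poly ((monom 1 (p - 1) + 1) ^ snd ij) 0"
  by (simp add: dickson_t_def coeff_monom_mult poly_0_coeff_0)
 then show ?thesis using p by (auto simp: poly_monom power_0_left)
qed

lemma degree_dickson_t:
 assumes "p \<ge> 2"
 shows "degree (dickson_t p ij) = fst ij + (p - 1) * snd ij" "lead_coeff (dickson_t p ij) = 1"
proof -
 have "degree (monom 1 (p - 1) + 1 :: int poly) = p - 1"
  using assms by (subst degree_add_eq_left) (auto simp: degree_monom_eq)
 moreover have "coeff (monom 1 (p - 1) + 1 :: int poly) (p - 1) = 1"
  using assms by (auto simp: coeff_1)
 moreover have "monom 1 (p - 1) + 1 \<noteq> (0 :: int poly)" using calculation by auto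
 ultimately show "degree (dickson_t p ij) = fst ij + (p - 1) * snd ij"
  unfolding dickson_t_def by (auto simp: degree_mult_eq degree_power_eq degree_monom_eq)
 have "lead_coeff (monom 1 (p - 1) + 1 :: int poly) = 1"
  using \<open>degree (monom 1 (p - 1) + 1 :: int poly) = p - 1\<close>
   \<open>coeff (monom 1 (p - 1) + 1 :: int poly) (p - 1) = 1\<close> by simp
 then show "lead_coeff (dickson_t p ij) = 1"
  unfolding dickson_t_def by (simp only: lead_coeff_mult lead_coeff_power lead_coeff_monom power_one mult_1)
qed

text \<open>On the line (p + 1) i + p (p - 1) j = k, raising i by d lowers (p - 1) j by more than d.
  So within one degree the order in t and the degree in t of \<open>dickson_t\<close> run in
  opposite directions.\<close>

lemma dickson_index_less:
 assumes p: "p \<ge> 2" and ij: "ij \<in> dickson_index p k" and ij': "ij' \<in> dickson_index p k"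
  and ne: "ij \<noteq> ij'" and le: "fst ij \<le> fst ij'"
 shows "fst ij < fst ij'" "fst ij' + (p - 1) * snd ij' < fst ij + (p - 1) * snd ij"
proof -
 obtain i j i' j' where eq: "ij = (i, j)" "ij' = (i', j')" by (cases ij, cases ij')
 obtain q where q: "p = Suc q" "q > 0" using p by (cases p) auto
 have k: "(p + 1) * i + p * q * j = (p + 1) * i' + p * q * j'"
  using ij ij' unfolding eq dickson_index_def by (simp add: q)
 have "i \<noteq> i'"
 proof
  assume "i = i'"
  then have "p * q * j = p * q * j'" using k by simp
  then show False using ne q \<open>i = i'\<close> unfolding eq by simp
 qed
 then show lt: "fst ij < fst ij'" using le by (simp add: eq)
 then obtain d where d: "i' = i + d" "d > 0" unfolding eq by (auto dest: less_imp_add_positive)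
 have "(p + 1) * d + p * q * j' = p * q * j" using k d by (simp add: algebra_simps)
 moreover have "p * d < (p + 1) * d" using d by simp
 ultimately have "p * (d + q * j') < p * (q * j)" by (simp add: algebra_simps)
 then have "d + q * j' < q * j" by (metis mult_less_cancel1)
 then show "fst ij' + (p - 1) * snd ij' < fst ij + (p - 1) * snd ij"
  unfolding eq using d q by simp
qed

text \<open>Triangularity: \<open>dickson_t p ij\<close> starts at t^i with coefficient 1, and i
  determines the pair within a fixed degree. One looks at the least i among the coefficients not
  divisible by m.\<close>

lemma dickson_t_independent:
 assumes p: "p \<ge> 2" and d: "of_nat m dvd (\<Sum>ij\<in>dickson_index p k. of_int (e ij) * dickson_t p ij)"
  and ij: "ij \<in> dickson_index p k"
 shows "int m dvd e ij"
proof (rule ccontr)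
 define S where "S = {ij \<in> dickson_index p k. \<not> int m dvd e ij}"
 assume "\<not> int m dvd e ij"
 then have "ij \<in> S" using ij by (simp add: S_def)
 moreover have fin: "finite S" unfolding S_def using finite_dickson_index[OF p] by simp
 ultimately obtain mn where mn: "mn \<in> S" "\<And>a. a \<in> S \<Longrightarrow> fst mn \<le> fst a"
  by (metis arg_min_if_finite(1) arg_min_least empty_iff)
 have "int m dvd (\<Sum>a\<in>dickson_index p k. e a * coeff (dickson_t p a) (fst mn))"
  using d by (simp add: of_nat_dvd_poly_iff coeff_sum of_int_poly)
 also have "(\<Sum>a\<in>dickson_index p k. e a * coeff (dickson_t p a) (fst mn))
   = e mn * coeff (dickson_t p mn) (fst mn)
    + (\<Sum>a\<in>dickson_index p k - {mn}. e a * coeff (dickson_t p a) (fst mn))"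
  using mn(1) finite_dickson_index[OF p] by (intro sum.remove) (auto simp: S_def)
 finally have "int m dvd e mn * coeff (dickson_t p mn) (fst mn)
   + (\<Sum>a\<in>dickson_index p k - {mn}. e a * coeff (dickson_t p a) (fst mn))" .
 moreover have "int m dvd (\<Sum>a\<in>dickson_index p k - {mn}. e a * coeff (dickson_t p a) (fst mn))"
 proof (rule dvd_sum)
  fix a assume a: "a \<in> dickson_index p k - {mn}"
  show "int m dvd e a * coeff (dickson_t p a) (fst mn)"
  proof (cases "a \<in> S")
   case True
   then have "fst mn < fst a"
    using dickson_index_less(1)[OF p, of mn k a] mn a by (auto simp: S_def)
   then show ?thesis by (simp add: dickson_t_low)
  next
   case False
   then show ?thesis using a by (simp add: S_def)
  qed
 qed
 ultimately have "int m dvd e mn" using dickson_t_lowest[OF p] by (simp add: dvd_add_left_iff)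
 then show False using mn(1) by (simp add: S_def)
qed

lemma dickson_mon_independent:
 assumes p: "prime p" and d: "eqm p (\<Sum>ij\<in>dickson_index p k. of_int (e ij) * dickson_mon p ij) 0"
  and ij: "ij \<in> dickson_index p k"
 shows "int p dvd e ij"
proof -
 have "eqm p (poly (\<Sum>ij\<in>dickson_index p k. of_int (e ij) * dickson_mon p ij) 1) (poly 0 1)"
  using d by (rule eqm_poly)
 moreover have "poly (\<Sum>ij\<in>dickson_index p k. of_int (e ij) * dickson_mon p ij) 1
   = pcompose (\<Sum>ij\<in>dickson_index p k. of_int (e ij) * dickson_t p ij) (artin_schreier p)"
  by (simp add: poly_sum dehomogenize_dickson_mon pcompose_sum pcompose_smult of_int_poly)
 ultimately have "of_nat p dvd pcompose (\<Sum>ij\<in>dickson_index p k. of_int (e ij) * dickson_t p ij) (artin_schreier p)"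
  by (simp add: eqm_def)
 then show ?thesis
  using dvd_pcompose_artin_schreier[OF p] dickson_t_independent[OF prime_ge_2_nat[OF p] _ ij] by blast
qed

section \<open>The first-order defect of the monomials under translation\<close>

lemma pcompose_taylor_mod:
 fixes R :: "int poly"
 shows "eqm (m * m) (pcompose R (N + of_nat m * \<eta>))
      (pcompose R N + of_nat m * \<eta> * pcompose (pderiv R) N)"
proof (induction R)
 case (pCons a R)
 let ?M = "N + of_nat m * \<eta>"
 have "eqm (m * m) ([:a:] + ?M * pcompose R ?M)
   ([:a:] + ?M * (pcompose R N + of_nat m * \<eta> * pcompose (pderiv R) N))"
  by (intro eqm_add eqm_mult eqm_refl pCons.IH)
 also have "eqm (m * m) \<dots> ([:a:] + N * pcompose R N
   + of_nat m * \<eta> * (pcompose R N + N * pcompose (pderiv R) N))"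
  unfolding eqm_def by (intro dvdI[of _ _ "\<eta> * \<eta> * pcompose (pderiv R) N"]) (simp add: algebra_simps)
 finally show ?case
  by (simp add: pcompose_pCons pderiv_pCons pcompose_add)
qed simp

text \<open>One order beyond \<open>eqm_power_lift\<close>: in the p-th power of u^(p^t) + p^(t+1) V
  only the linear term survives modulo p^(t+3).\<close>

lemma eqm_pow_deriv:
 fixes u w :: "'a :: comm_ring_1"
 assumes p: "prime p" "odd p"
 shows "eqm (p ^ (t + 2)) ((u + of_nat p * w) ^ (p ^ t)) (u ^ (p ^ t) + of_nat (p ^ Suc t) * (w * u ^ (p ^ t - 1)))"
proof (induction t)
 case (Suc t)
 let ?n = "p ^ t" and ?m = "p ^ Suc t"
 define v where "v = w * u ^ (?n - 1)"
 have pn: "p > 0" "p ^ Suc t > 0" using prime_gt_0_nat[OF p(1)] by auto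
 obtain d where d: "(u + of_nat p * w) ^ ?n = u ^ ?n + of_nat ?m * (v + of_nat p * d)"
  using Suc.IH unfolding eqm_def v_def dvd_def by (auto simp: algebra_simps)
 define V where "V = v + of_nat p * d"
 have "(u + of_nat p * w) ^ (p ^ Suc t) = (u ^ ?n + of_nat ?m * V) ^ p"
  unfolding V_def d[symmetric] by (simp add: power_mult[symmetric] mult.commute)
 also have "eqm (p ^ (Suc t + 2)) \<dots> ((u ^ ?n) ^ p + of_nat p * (of_nat ?m * V) * (u ^ ?n) ^ (p - 1))"
 proof -
  have bin: "(u ^ ?n + of_nat ?m * V) ^ p
    = (\<Sum>k\<le>p. of_nat (p choose k) * (of_nat ?m * V) ^ k * (u ^ ?n) ^ (p - k))"
   by (subst add.commute) (rule binomial_ring)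
  have "p \<ge> 2" using prime_ge_2_nat[OF p(1)] .
  then have set: "{..p} = {0, 1} \<union> {2..p}" by auto
  have "(\<Sum>k\<le>p. of_nat (p choose k) * (of_nat ?m * V) ^ k * (u ^ ?n) ^ (p - k))
    = (u ^ ?n) ^ p + of_nat p * (of_nat ?m * V) * (u ^ ?n) ^ (p - 1)
     + (\<Sum>k\<in>{2..p}. of_nat (p choose k) * (of_nat ?m * V) ^ k * (u ^ ?n) ^ (p - k))"
   unfolding set by (subst sum.union_disjoint) auto
  moreover have "of_nat (p ^ (Suc t + 2)) dvd of_nat (p choose k) * (of_nat ?m * V) ^ k * (u ^ ?n) ^ (p - k)"
   if k: "k \<in> {2..p}" for k
  proof -
   have "p ^ (Suc t + 2) dvd (p choose k) * ?m ^ k"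
   proof (cases "k = p")
    case True
    \<comment> \<open>For the last binomial term the coefficient is 1, and only the power
      (p^(t+1))^p helps; its exponent reaches t + 3 for all t because p is at least 3.\<close>
    have "p \<ge> 3" using \<open>p \<ge> 2\<close> p(2) by (cases "p = 2") auto
    then have "Suc t + 2 \<le> Suc t * 3" "Suc t * 3 \<le> Suc t * p"
     by (simp, intro mult_le_mono2)
    then have "p ^ (Suc t + 2) dvd p ^ (Suc t * p)" by (meson le_imp_power_dvd le_trans)
    then show ?thesis using True by (simp only: power_mult binomial_n_n mult_1)
   next
    case False
    then have "p dvd p choose k" using k \<open>p \<ge> 2\<close> p by (intro dvd_choose_prime) auto
    moreover have "p ^ (Suc t + 1) dvd p ^ (Suc t * k)"
    proof (rule le_imp_power_dvd)
     have "Suc t * 2 \<le> Suc t * k" using k by (intro mult_le_mono2) auto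
     then show "Suc t + 1 \<le> Suc t * k" by simp
    qed
    ultimately have "p * p ^ (Suc t + 1) dvd (p choose k) * p ^ (Suc t * k)" by (rule mult_dvd_mono)
    moreover have "p * p ^ (Suc t + 1) = p ^ (Suc t + 2)" by simp
    ultimately show ?thesis by (simp only: power_mult)
   qed
   then obtain c where "(p choose k) * ?m ^ k = p ^ (Suc t + 2) * c" by (auto simp: dvd_def)
   then have "(of_nat (p choose k) * of_nat ?m ^ k :: 'a) = of_nat (p ^ (Suc t + 2)) * of_nat c"
    by (metis of_nat_mult of_nat_power)
   then have "of_nat (p choose k) * (of_nat ?m * V) ^ k * (u ^ ?n) ^ (p - k)
     = of_nat (p ^ (Suc t + 2)) * (of_nat c * V ^ k * (u ^ ?n) ^ (p - k))"
    by (simp only: power_mult_distrib mult.assoc[symmetric])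
   then show ?thesis by (rule dvdI)
  qed
  ultimately show ?thesis unfolding bin eqm_def by (simp only: add_diff_cancel_left' dvd_sum)
 qed
 also have "eqm (p ^ (Suc t + 2)) ((u ^ ?n) ^ p + of_nat p * (of_nat ?m * V) * (u ^ ?n) ^ (p - 1))
   (u ^ (p ^ Suc t) + of_nat (p ^ Suc (Suc t)) * (w * u ^ (p ^ Suc t - 1)))"
 proof -
  have "(p - 1) * ?n + (?n - 1) = p ^ Suc t - 1"
   using pn by (cases p) (auto simp: algebra_simps)
  then have "u ^ (?n - 1) * (u ^ ?n) ^ (p - 1) = u ^ (p ^ Suc t - 1)"
   by (simp only: power_mult[symmetric] power_add[symmetric] add.commute mult.commute)
  then have e: "w * u ^ (p ^ Suc t - 1) = v * (u ^ ?n) ^ (p - 1)"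
   by (simp add: v_def mult.assoc)
  have "(u ^ ?n) ^ p = u ^ (p ^ Suc t)" by (simp add: power_mult[symmetric] mult.commute)
  then show ?thesis
   unfolding e eqm_def V_def
   by (intro dvdI[of _ _ "d * (u ^ ?n) ^ (p - 1)"]) (simp add: algebra_simps)
 qed
 finally show ?case .
qed simp

text \<open>The logarithmic derivative i / t + j (p - 1) t^(p-2) / (t^(p-1) + 1), cleared of
  denominators.\<close>

lemma dickson_t_deriv:
 "monom 1 1 * (monom 1 (p - 1) + 1) * pderiv (dickson_t p (i, j))
  = dickson_t p (i, j) * ([:int i:] + monom (int i + int (p - 1) * int j) (p - 1))"
proof -
 define q :: "int poly" where "q = monom 1 (p - 1) + 1"
 have 1: "monom 1 1 * pderiv (monom 1 i) = of_nat i * (monom 1 i :: int poly)" for i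
  by (cases i) (simp_all add: pderiv_monom mult_monom of_nat_monom)
 have 2: "q * pderiv (q ^ j) = of_nat j * (q ^ j * pderiv q)"
 proof (cases j)
  case (Suc n)
  then show ?thesis by (simp only: pderiv_power_Suc) (simp add: algebra_simps of_nat_poly smult_add_left)
 qed simp
 have 3: "monom 1 1 * pderiv q = of_nat (p - 1) * monom 1 (p - 1)"
  using 1[of "p - 1"] by (simp add: q_def pderiv_add)
 have "monom 1 1 * q * pderiv (monom 1 i * q ^ j)
   = (monom 1 1 * pderiv (monom 1 i)) * q ^ j * q + monom 1 i * (q * pderiv (q ^ j)) * monom 1 1"
  by (simp add: pderiv_mult algebra_simps)
 also have "\<dots> = monom 1 i * q ^ j * (of_nat i * q + of_nat j * (monom 1 1 * pderiv q))"
  unfolding 1 2 by (simp add: algebra_simps)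
 also have "of_nat i * q + of_nat j * (monom 1 1 * pderiv q)
   = [:int i:] + monom (int i + int (p - 1) * int j) (p - 1)"
  unfolding 3 by (simp add: q_def algebra_simps of_nat_monom mult_monom add_monom[symmetric] monom_0 smult_monom)
 finally show ?thesis by (simp add: dickson_t_def q_def)
qed

text \<open>The second factor in \<open>dickson_t_deriv\<close> for the exponents of
  \<open>dickson_root\<close>, that is, i and j divided by p^a.\<close>

definition log_derivative_factor :: "nat \<Rightarrow> nat \<times> nat \<Rightarrow> int poly"
 where "log_derivative_factor p ij =
  (let i = fst ij div p ^ vp_gcd p ij; j = snd ij div p ^ vp_gcd p ij
   in [:int i:] + monom (int i + int (p - 1) * int j) (p - 1))"

lemma degree_log_derivative_factor: "degree (log_derivative_factor p ij) \<le> p - 1"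
 by (auto simp: log_derivative_factor_def Let_def intro!: degree_add_le degree_monom_le)

text \<open>Among the monomials of a fixed degree, the one with least exponent of \<open>P\<close> has both the lowest
 order and the highest degree in \<open>t\<close>; its two extreme coefficients show that both \<open>i\<close> and \<open>j\<close>,
 divided by their common \<open>p\<close>-power, would be multiples of \<open>p\<close>.\<close>

lemma log_derivative_independent:
 assumes p: "prime p" and k: "k > 0"
  and d: "of_nat p dvd (\<Sum>ij\<in>dickson_index p k. of_int (r ij) * (dickson_t p ij * log_derivative_factor p ij))"
  and ij: "ij \<in> dickson_index p k"
 shows "int p dvd r ij"
proof (rule ccontr)
 note p2 = prime_ge_2_nat[OF p]
 define S where "S = {ij \<in> dickson_index p k. \<not> int p dvd r ij}"
 assume "\<not> int p dvd r ij"
 then have "ij \<in> S" using ij by (simp add: S_def)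
 moreover have fin: "finite S" unfolding S_def using finite_dickson_index[OF p2] by simp
 ultimately obtain mn where mn: "mn \<in> S" "\<And>a. a \<in> S \<Longrightarrow> fst mn \<le> fst a"
  by (metis arg_min_if_finite(1) arg_min_least empty_iff)
 let ?f = "\<lambda>a. dickson_t p a * log_derivative_factor p a"
 \<comment> \<open>In a degree n where only the minimal pair mn contributes, the sum reduces modulo
   p to this one term. The lowest and the highest relevant degree are of this kind.\<close>
 have single: "int p dvd r mn * coeff (?f mn) n"
  if z: "\<And>a. a \<in> S \<Longrightarrow> a \<noteq> mn \<Longrightarrow> coeff (?f a) n = 0" for n
 proof -
  have "int p dvd (\<Sum>a\<in>dickson_index p k. r a * coeff (?f a) n)"
   using d by (simp add: of_nat_dvd_poly_iff coeff_sum of_int_poly)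
  also have "(\<Sum>a\<in>dickson_index p k. r a * coeff (?f a) n)
    = r mn * coeff (?f mn) n + (\<Sum>a\<in>dickson_index p k - {mn}. r a * coeff (?f a) n)"
   using mn(1) finite_dickson_index[OF p2] by (intro sum.remove) (auto simp: S_def)
  finally have "int p dvd r mn * coeff (?f mn) n + (\<Sum>a\<in>dickson_index p k - {mn}. r a * coeff (?f a) n)" .
  moreover have "int p dvd (\<Sum>a\<in>dickson_index p k - {mn}. r a * coeff (?f a) n)"
  proof (rule dvd_sum)
   fix a assume a: "a \<in> dickson_index p k - {mn}"
   show "int p dvd r a * coeff (?f a) n"
    using z[of a] a by (cases "a \<in> S") (auto simp: S_def)
  qed
  ultimately show ?thesis by (simp only: dvd_add_left_iff)
 qed
 define i where "i = fst mn div p ^ vp_gcd p mn"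
 define j where "j = snd mn div p ^ vp_gcd p mn"
 have F: "log_derivative_factor p mn = [:int i:] + monom (int i + int (p - 1) * int j) (p - 1)"
  by (simp add: log_derivative_factor_def Let_def i_def j_def)
 have "mn \<in> dickson_index p k" "\<not> int p dvd r mn" using mn(1) by (auto simp: S_def)
 have lower: "coeff (?f a) (fst mn) = 0" if "a \<in> S" "a \<noteq> mn" for a
 proof -
  have "fst mn < fst a"
   using dickson_index_less(1)[OF p2, of mn k a] mn that by (auto simp: S_def)
  then show ?thesis by (auto simp: coeff_mult dickson_t_low intro!: sum.neutral)
 qed
 have "coeff (?f mn) (fst mn) = coeff (dickson_t p mn) (fst mn) * coeff (log_derivative_factor p mn) 0"
 proof -
  have "coeff (?f mn) (fst mn)
    = (\<Sum>l\<le>fst mn. coeff (dickson_t p mn) l * coeff (log_derivative_factor p mn) (fst mn - l))"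
   by (simp add: coeff_mult)
  also have "\<dots> = (\<Sum>l\<in>{fst mn}. coeff (dickson_t p mn) l * coeff (log_derivative_factor p mn) (fst mn - l))"
   by (intro sum.mono_neutral_right) (auto simp: dickson_t_low)
  finally show ?thesis by simp
 qed
 also have "\<dots> = int i" using p2 by (auto simp: F dickson_t_lowest)
 finally have "int p dvd r mn * int i" using single[of "fst mn"] lower by simp
 then have i: "p dvd i" using \<open>\<not> int p dvd r mn\<close> p by (simp add: prime_dvd_mult_iff)
 define D where "D = fst mn + (p - 1) * snd mn"
 have upper: "coeff (?f a) (D + (p - 1)) = 0" if "a \<in> S" "a \<noteq> mn" for a
 proof -
  have "degree (?f a) \<le> degree (dickson_t p a) + degree (log_derivative_factor p a)"
   by (rule degree_mult_le)
  also have "\<dots> \<le> fst a + (p - 1) * snd a + (p - 1)"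
   using degree_log_derivative_factor[of p a] by (simp add: degree_dickson_t[OF p2])
  also have "\<dots> < D + (p - 1)"
   using dickson_index_less(2)[OF p2, of mn k a] mn that by (auto simp: S_def D_def)
  finally show ?thesis by (rule coeff_eq_0)
 qed
 have "coeff (?f mn) (D + (p - 1)) = int i + int (p - 1) * int j"
 proof -
  have "coeff (?f mn) (D + (p - 1)) = coeff (dickson_t p mn) D * coeff (log_derivative_factor p mn) (p - 1)"
  proof -
   have "coeff (?f mn) (D + (p - 1)) =
     (\<Sum>l\<le>D + (p - 1). coeff (dickson_t p mn) l * coeff (log_derivative_factor p mn) (D + (p - 1) - l))"
    by (simp add: coeff_mult)
   also have "\<dots> = (\<Sum>l\<in>{D}. coeff (dickson_t p mn) l * coeff (log_derivative_factor p mn) (D + (p - 1) - l))"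
   proof (intro sum.mono_neutral_right ballI)
    fix l assume l: "l \<in> {..D + (p - 1)} - {D}"
    show "coeff (dickson_t p mn) l * coeff (log_derivative_factor p mn) (D + (p - 1) - l) = 0"
    proof (cases "l < D")
     case True
     then have "degree (log_derivative_factor p mn) < D + (p - 1) - l"
      using degree_log_derivative_factor[of p mn] by linarith
     then show ?thesis by (simp add: coeff_eq_0)
    next
     case False
     then have "degree (dickson_t p mn) < l" using l by (auto simp: degree_dickson_t[OF p2] D_def)
     then show ?thesis by (simp add: coeff_eq_0)
    qed
   qed auto
   finally show ?thesis by simp
  qed
  moreover have "coeff (dickson_t p mn) D = 1"
   using degree_dickson_t[OF p2, of mn] by (simp add: D_def)
  moreover have "coeff (log_derivative_factor p mn) (p - 1) = int i + int (p - 1) * int j"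
   using p2 by (auto simp: F coeff_pCons split: nat.splits)
  ultimately show ?thesis by simp
 qed
 then have "int p dvd r mn * (int i + int (p - 1) * int j)" using single[of "D + (p - 1)"] upper by simp
 then have "int p dvd int i + int (p - 1) * int j"
  using \<open>\<not> int p dvd r mn\<close> p by (simp add: prime_dvd_mult_iff)
 \<comment> \<open>Modulo p this is i - j, so p divides j along with i.\<close>
 also have "int i + int (p - 1) * int j = int i + int p * int j - int j"
  using p2 by (simp add: of_nat_diff algebra_simps)
 finally have "int p dvd int j" using i
  by (metis dvd_add dvd_diff_right_iff dvd_triv_left of_nat_dvd_iff)
 then have j: "p dvd j" by simp
 have "mn \<noteq> (0, 0)" using \<open>mn \<in> dickson_index p k\<close> k by (auto simp: dickson_index_def)
 then show False using vp_gcd_max[OF p] i j unfolding i_def j_def by blast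
qed

text \<open>P^i Q^j is invariant modulo p^(a+1); the scaling makes all monomials invariant modulo
  the same p^S. It is used for S > a, where the subtraction is a true one.\<close>

definition dickson_scaled :: "nat \<Rightarrow> nat \<Rightarrow> nat \<times> nat \<Rightarrow> int poly poly"
 where "dickson_scaled p S ij = of_nat (p ^ (S - 1 - vp_gcd p ij)) * dickson_mon p ij"

lemma dehomogenize_dickson_root:
 "poly (dickson_root p ij) 1
  = pcompose (dickson_t p (fst ij div p ^ vp_gcd p ij, snd ij div p ^ vp_gcd p ij)) (artin_schreier p)"
 by (simp add: dickson_root_def dehomogenize_dickson_mon)

lemma eqm_of_nat_mult: "eqm m a b \<Longrightarrow> eqm (n * m) (of_nat n * a) (of_nat n * b)"
 unfolding eqm_def of_nat_mult by (simp add: right_diff_distrib[symmetric] mult_dvd_mono)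

text \<open>Z is R^(p^a - 1) R', where R is the root as a polynomial in t: by the chain rule
  replacing N by N + p eta changes R(N)^(p^a) by p^(a+1) eta Z(N). After scaling the defect has
  order p^S for every monomial.\<close>

lemma translate_dickson_scaled:
 assumes p: "prime p" "odd p" and S: "vp_gcd p ij < S"
  and eta: "pcompose (artin_schreier p) [:1, 1:] = artin_schreier p + of_nat p * \<eta>"
 shows "\<exists>Z. monom 1 1 * (monom 1 (p - 1) + 1) * Z = dickson_t p ij * log_derivative_factor p ij \<and>
  eqm (p ^ Suc S) (poly (act2 (dickson_scaled p S ij)) 1 - poly (dickson_scaled p S ij) 1)
   (of_nat (p ^ S) * (\<eta> * pcompose Z (artin_schreier p)))"
proof -
 define a where "a = vp_gcd p ij"
 define i where "i = fst ij div p ^ a"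
 define j where "j = snd ij div p ^ a"
 define R where "R = dickson_t p (i, j)"
 define Z where "Z = R ^ (p ^ a - 1) * pderiv R"
 let ?N = "artin_schreier p"
 have pa: "p ^ a > 0" using prime_gt_0_nat[OF p(1)] by simp
 have Rp: "R ^ (p ^ a) = dickson_t p ij"
 proof -
  have "i * p ^ a = fst ij" "j * p ^ a = snd ij" using vp_gcd_dvd[of p ij] by (simp_all add: i_def j_def a_def)
  then show ?thesis
   by (simp add: R_def dickson_t_def power_mult_distrib monom_power flip: power_mult)
 qed
 have "monom 1 1 * (monom 1 (p - 1) + 1) * Z
   = R ^ (p ^ a - 1) * (monom 1 1 * (monom 1 (p - 1) + 1) * pderiv R)"
  by (simp add: Z_def mult_ac)
 also have "\<dots> = R ^ (p ^ a - 1) * R * log_derivative_factor p ij"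
  unfolding R_def dickson_t_deriv
  by (simp add: log_derivative_factor_def Let_def i_def j_def a_def mult.assoc)
 also have "R ^ (p ^ a - 1) * R = R ^ (p ^ a)" using pa by (metis power_minus_mult)
 finally have 1: "monom 1 1 * (monom 1 (p - 1) + 1) * Z = dickson_t p ij * log_derivative_factor p ij"
  by (simp add: Rp)
 have root: "poly (dickson_root p ij) 1 = pcompose R ?N"
  by (simp add: dehomogenize_dickson_root R_def i_def j_def a_def)
 have mono: "dickson_mon p ij = dickson_root p ij ^ (p ^ a)" by (simp add: dickson_root_power a_def)
 have evB: "poly (dickson_scaled p S ij) 1 = of_nat (p ^ (S - 1 - a)) * pcompose R ?N ^ (p ^ a)"
  by (simp add: dickson_scaled_def mono root a_def)
 have evtB: "poly (act2 (dickson_scaled p S ij)) 1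
   = of_nat (p ^ (S - 1 - a)) * pcompose R (?N + of_nat p * \<eta>) ^ (p ^ a)"
 proof -
  have "poly (act2 (dickson_scaled p S ij)) 1 = pcompose (poly (dickson_scaled p S ij) 1) [:1, 1:]"
   by (rule dehomogenize_act2)
  also have "\<dots> = of_nat (p ^ (S - 1 - a)) * pcompose (pcompose R ?N) [:1, 1:] ^ (p ^ a)"
   unfolding evB by (simp only: pcompose_mult pcompose_power of_nat_poly pcompose_const)
  finally show ?thesis by (simp only: pcompose_assoc[symmetric] eta)
 qed
 \<comment> \<open>First R(N + p eta) is expanded to first order, then \<open>eqm_pow_deriv\<close>
   takes the p^a-th power. The second-order remainder d disappears modulo p^(a+2).\<close>
 obtain d where d: "pcompose R (?N + of_nat p * \<eta>)
   = pcompose R ?N + of_nat p * (\<eta> * pcompose (pderiv R) ?N + of_nat p * d)"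
  using pcompose_taylor_mod[of p R ?N \<eta>] unfolding eqm_def dvd_def by (auto simp: algebra_simps)
 define u where "u = pcompose R ?N"
 define w where "w = \<eta> * pcompose (pderiv R) ?N + of_nat p * d"
 have "eqm (p ^ (a + 2)) (pcompose R (?N + of_nat p * \<eta>) ^ (p ^ a))
   (u ^ (p ^ a) + of_nat (p ^ Suc a) * (w * u ^ (p ^ a - 1)))"
  unfolding d u_def[symmetric] w_def[symmetric] by (rule eqm_pow_deriv[OF p])
 also have "eqm (p ^ (a + 2)) (u ^ (p ^ a) + of_nat (p ^ Suc a) * (w * u ^ (p ^ a - 1)))
   (u ^ (p ^ a) + of_nat (p ^ Suc a) * (\<eta> * pcompose Z ?N))"
  unfolding eqm_def
  by (intro dvdI[of _ _ "d * u ^ (p ^ a - 1)"])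
    (simp add: w_def Z_def u_def pcompose_mult pcompose_power algebra_simps)
 finally have "eqm (p ^ (a + 2)) (pcompose R (?N + of_nat p * \<eta>) ^ (p ^ a) - u ^ (p ^ a))
   (u ^ (p ^ a) + of_nat (p ^ Suc a) * (\<eta> * pcompose Z ?N) - u ^ (p ^ a))"
  by (rule eqm_diff[OF _ eqm_refl])
 from eqm_of_nat_mult[OF this, of "p ^ (S - 1 - a)"]
 have "eqm (p ^ (S - 1 - a) * p ^ (a + 2)) (poly (act2 (dickson_scaled p S ij)) 1 - poly (dickson_scaled p S ij) 1)
   (of_nat (p ^ (S - 1 - a) * p ^ Suc a) * (\<eta> * pcompose Z ?N))"
  unfolding evB evtB u_def by (simp add: right_diff_distrib mult.assoc)
 moreover have "p ^ (S - 1 - a) * p ^ (a + 2) = p ^ Suc S" "p ^ (S - 1 - a) * p ^ Suc a = p ^ S"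
  using S unfolding a_def[symmetric] by (simp_all flip: power_add power_Suc)
 ultimately have "eqm (p ^ Suc S) (poly (act2 (dickson_scaled p S ij)) 1 - poly (dickson_scaled p S ij) 1)
   (of_nat (p ^ S) * (\<eta> * pcompose Z ?N))"
  by (simp only:)
 with 1 show ?thesis by blast
qed

text \<open>Divided by p^S, the hypothesis says that eta times a polynomial in N is a difference g(y
  + 1) - g(y) modulo p. By \<open>translate_coinvariants\<close> that polynomial vanishes, which is
  a linear relation between logarithmic derivatives.\<close>

lemma dickson_scaled_obstruction:
 assumes p: "prime p" "odd p" and k: "k > 0"
  and S: "\<And>ij. ij \<in> dickson_index p k \<Longrightarrow> vp_gcd p ij < S"
  and e: "eqm (p ^ Suc S) ((\<Sum>ij\<in>dickson_index p k. of_int (r ij) * (act2 (dickson_scaled p S ij) - dickson_scaled p S ij))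
       + of_nat (p ^ S) * (act2 g - g)) 0"
  and ij: "ij \<in> dickson_index p k"
 shows "int p dvd r ij"
proof -
 let ?N = "artin_schreier p" and ?I = "dickson_index p k"
 obtain \<eta> where eta: "pcompose ?N [:1, 1:] = ?N + of_nat p * \<eta>" "degree \<eta> < p" "coeff \<eta> (p - 1) = 1"
  by (rule translate_artin_schreier[OF p(1)])
 have "\<forall>ij\<in>?I. \<exists>Z. monom 1 1 * (monom 1 (p - 1) + 1) * Z = dickson_t p ij * log_derivative_factor p ij \<and>
  eqm (p ^ Suc S) (poly (act2 (dickson_scaled p S ij)) 1 - poly (dickson_scaled p S ij) 1)
   (of_nat (p ^ S) * (\<eta> * pcompose Z ?N))"
  using translate_dickson_scaled[OF p S eta(1)] by blast
 then obtain Z where Z: "\<And>ij. ij \<in> ?I \<Longrightarrow> monom 1 1 * (monom 1 (p - 1) + 1) * Z ij = dickson_t p ij * log_derivative_factor p ij"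
  "\<And>ij. ij \<in> ?I \<Longrightarrow> eqm (p ^ Suc S) (poly (act2 (dickson_scaled p S ij)) 1 - poly (dickson_scaled p S ij) 1)
   (of_nat (p ^ S) * (\<eta> * pcompose (Z ij) ?N))"
  by metis
 define h where "h = poly g 1"
 define ZZ where "ZZ = (\<Sum>ij\<in>?I. of_int (r ij) * Z ij)"
 have "eqm (p ^ Suc S) ((\<Sum>ij\<in>?I. of_int (r ij) * (of_nat (p ^ S) * (\<eta> * pcompose (Z ij) ?N)))
   + of_nat (p ^ S) * (pcompose h [:1, 1:] - h))
   ((\<Sum>ij\<in>?I. of_int (r ij) * (poly (act2 (dickson_scaled p S ij)) 1 - poly (dickson_scaled p S ij) 1))
   + of_nat (p ^ S) * (pcompose h [:1, 1:] - h))"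
  by (intro eqm_add eqm_sum eqm_mult eqm_refl eqm_sym[OF Z(2)])
 also have "\<dots> = poly ((\<Sum>ij\<in>?I. of_int (r ij) * (act2 (dickson_scaled p S ij) - dickson_scaled p S ij))
       + of_nat (p ^ S) * (act2 g - g)) 1"
  by (simp add: poly_sum h_def dehomogenize_act2 del: of_nat_power)
 also have "eqm (p ^ Suc S) \<dots> (poly 0 1)"
  using e by (rule eqm_poly)
 also have "(\<Sum>ij\<in>?I. of_int (r ij) * (of_nat (p ^ S) * (\<eta> * pcompose (Z ij) ?N)))
   + of_nat (p ^ S) * (pcompose h [:1, 1:] - h)
   = of_nat (p ^ S) * (pcompose h [:1, 1:] - h - \<eta> * pcompose (- ZZ) ?N)"
 proof -
  have "pcompose ZZ ?N = (\<Sum>ij\<in>?I. of_int (r ij) * pcompose (Z ij) ?N)"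
   by (simp add: ZZ_def pcompose_sum pcompose_smult of_int_poly)
  then show ?thesis
   by (simp add: pcompose_uminus sum_distrib_left algebra_simps)
 qed
 finally have "of_nat (p ^ S) * of_nat p dvd (of_nat (p ^ S) * (pcompose h [:1, 1:] - h - \<eta> * pcompose (- ZZ) ?N) :: int poly)"
  by (simp add: eqm_def mult.commute)
 moreover have "(of_nat (p ^ S) :: int poly) \<noteq> 0" using prime_gt_0_nat[OF p(1)] by simp
 ultimately have "of_nat p dvd (pcompose h [:1, 1:] - h - \<eta> * pcompose (- ZZ) ?N)"
  using dvd_mult_cancel_left by blast
 from translate_coinvariants[OF p(1) eta(2,3) this]
 have "of_nat p dvd ZZ" by simp
 then have "of_nat p dvd monom 1 1 * (monom 1 (p - 1) + 1) * ZZ" by simp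
 also have "monom 1 1 * (monom 1 (p - 1) + 1) * ZZ
   = (\<Sum>ij\<in>?I. of_int (r ij) * (monom 1 1 * (monom 1 (p - 1) + 1) * Z ij))"
  unfolding ZZ_def sum_distrib_left by (rule sum.cong[OF HOL.refl]) (rule mult.left_commute)
 also have "\<dots> = (\<Sum>ij\<in>?I. of_int (r ij) * (dickson_t p ij * log_derivative_factor p ij))"
  by (intro sum.cong HOL.refl) (simp only: Z(1))
 finally show ?thesis by (rule log_derivative_independent[OF p(1) k _ ij])
qed

section \<open>All invariants modulo p^S and all relations between them\<close>

lemma M_component_of_nat_cancel:
 assumes "m > 0" "of_nat m * g \<in> M_component n"
 shows "g \<in> M_component n"
 using assms by (auto simp: M_component_def of_nat_poly)

definition scaled_span :: "nat \<Rightarrow> nat \<Rightarrow> nat \<Rightarrow> int poly poly set"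
 where "scaled_span p S k =
  {f. \<exists>c. eqm (p ^ S) f (\<Sum>ij\<in>dickson_index p k. of_int (c ij) * dickson_scaled p S ij)}"

lemma dickson_scaled_invariant:
 assumes "prime p" "odd p" "vp_gcd p ij < S"
 shows "invariant_mod (p ^ S) (dickson_scaled p S ij)"
proof -
 have "p ^ (S - 1 - vp_gcd p ij) * p ^ Suc (vp_gcd p ij) = p ^ S"
  using assms(3) by (simp flip: power_add power_Suc)
 then show ?thesis
  using invariant_mod_of_nat_mult[OF invariant_dickson_mon[OF assms(1,2), of ij], of "p ^ (S - 1 - vp_gcd p ij)"]
  unfolding dickson_scaled_def by simp
qed

lemma dickson_scaled_homogeneous:
 "p > 0 \<Longrightarrow> ij \<in> dickson_index p k \<Longrightarrow> dickson_scaled p S ij \<in> M_component (2 * k)"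
 unfolding dickson_scaled_def by (intro M_component_of_nat_mult dickson_mon_homogeneous)

lemma p_power_scaled:
 assumes "vp_gcd p ij < S"
 shows "of_nat (p ^ vp_gcd p ij) * dickson_scaled p S ij = of_nat (p ^ (S - 1)) * dickson_mon p ij"
proof -
 have "p ^ vp_gcd p ij * p ^ (S - 1 - vp_gcd p ij) = p ^ (S - 1)"
  using assms by (simp flip: power_add)
 then have "(of_nat (p ^ vp_gcd p ij) * of_nat (p ^ (S - 1 - vp_gcd p ij)) :: int poly poly) = of_nat (p ^ (S - 1))"
  by (metis of_nat_mult)
 then show ?thesis unfolding dickson_scaled_def by (simp only: mult.assoc[symmetric])
qed

text \<open>The coefficients of p h are divided by p with remainder. The remainders are killed by
  the obstruction, and what is left of h is p^(S-1) times an invariant modulo p, to which Dickson's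
  theorem applies.\<close>

lemma scaled_span_divide:
 assumes p: "prime p" "odd p" and k: "k > 0" and S0: "S > 0"
  and S: "\<And>ij. ij \<in> dickson_index p k \<Longrightarrow> vp_gcd p ij < S"
  and h: "h \<in> M_component (2 * k)" "invariant_mod (p ^ S) h" "of_nat p * h \<in> scaled_span p S k"
 shows "h \<in> scaled_span p S k"
proof -
 let ?I = "dickson_index p k" and ?B = "dickson_scaled p S"
 have p0: "p > 0" using prime_gt_0_nat[OF p(1)] .
 obtain c g where g: "of_nat p * h = (\<Sum>ij\<in>?I. of_int (c ij) * ?B ij) + of_nat (p ^ S) * g"
  using h(3) unfolding scaled_span_def eqm_def dvd_def by (auto simp: algebra_simps)
 define q where "q ij = c ij div int p" for ij
 define r where "r ij = c ij mod int p" for ij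
 have c: "c ij = int p * q ij + r ij" for ij by (simp add: q_def r_def)
 define h' where "h' = h - (\<Sum>ij\<in>?I. of_int (q ij) * ?B ij)"
 have eq: "of_nat p * h' = (\<Sum>ij\<in>?I. of_int (r ij) * ?B ij) + of_nat (p ^ S) * g"
  unfolding h'_def right_diff_distrib g c
  by (simp add: sum_distrib_left sum.distrib[symmetric] algebra_simps)
 have inv: "invariant_mod (p ^ S) h'"
  unfolding h'_def by (intro invariant_mod_diff h invariant_mod_sum invariant_mod_mult
    invariant_mod_of_int dickson_scaled_invariant p S)
 have "eqm (p ^ S) (act2 h') h'" using inv by (simp add: invariant_mod_def)
 \<comment> \<open>p times an invariant modulo p^S is invariant modulo p^(S+1), one order more than
   the scaled monomials are known to be.\<close>
 from eqm_of_nat_mult[OF this, of p]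
 have "eqm (p ^ Suc S) (act2 (of_nat p * h') - of_nat p * h') 0"
  by (simp add: eqm_def act2_def subst_xy_hom)
 also have "act2 (of_nat p * h') - of_nat p * h'
   = (\<Sum>ij\<in>?I. of_int (r ij) * (act2 (?B ij) - ?B ij)) + of_nat (p ^ S) * (act2 g - g)"
  unfolding eq
  by (simp add: act2_def subst_xy_hom sum_subtractf right_diff_distrib del: of_nat_power)
 finally have "int p dvd r ij" if "ij \<in> ?I" for ij
  using dickson_scaled_obstruction[OF p k S] that by blast
 then have "r ij = 0" if "ij \<in> ?I" for ij
  using that unfolding r_def by (metis mod_mod_trivial mod_0_imp_dvd dvd_imp_mod_0)
 then have "of_nat p * h' = of_nat (p ^ S) * g" unfolding eq by simp
 also have "\<dots> = of_nat p * (of_nat (p ^ (S - 1)) * g)"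
  using S0 by (cases S) auto
 finally have h'g: "h' = of_nat (p ^ (S - 1)) * g" using p0 by simp
 have h'M: "h' \<in> M_component (2 * k)"
  unfolding h'_def by (intro M_component_diff h M_component_sum M_component_of_int_mult dickson_scaled_homogeneous p0)
 then have gM: "g \<in> M_component (2 * k)"
  unfolding h'g using p0 by (metis M_component_of_nat_cancel zero_less_power)
 \<comment> \<open>h' is p^(S-1) g, so invariance of h' modulo p^S is invariance of g modulo
   p.\<close>
 have "eqm p (subst_xy g u v) g" if "eqm (p ^ S) (subst_xy h' u v) h'" for u v
 proof -
  have "of_nat (p ^ (S - 1)) * of_nat p dvd of_nat (p ^ (S - 1)) * (subst_xy g u v - g)"
   using that S0 unfolding h'g eqm_def
   by (cases S) (auto simp: subst_xy_hom right_diff_distrib mult_ac)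
  moreover have "(of_nat (p ^ (S - 1)) :: int poly poly) \<noteq> 0" using p0 by simp
  ultimately show ?thesis unfolding eqm_def using dvd_mult_cancel_left by blast
 qed
 then have "invariant_mod p g" using inv by (simp add: invariant_mod_def act1_def act2_def)
 from dickson_invariants[OF p gM this]
 obtain e where e: "eqm p g (\<Sum>ij\<in>?I. of_int (e ij) * dickson_mon p ij)"
  by (auto simp: dickson_span_def)
 have "p ^ (S - 1) * p = p ^ S" using S0 by (cases S) auto
 with eqm_of_nat_mult[OF e, of "p ^ (S - 1)"]
 have "eqm (p ^ S) h' (of_nat (p ^ (S - 1)) * (\<Sum>ij\<in>?I. of_int (e ij) * dickson_mon p ij))"
  by (simp add: h'g)
 also have "of_nat (p ^ (S - 1)) * (\<Sum>ij\<in>?I. of_int (e ij) * dickson_mon p ij)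
   = (\<Sum>ij\<in>?I. of_int (e ij) * (of_nat (p ^ (S - 1)) * dickson_mon p ij))"
  unfolding sum_distrib_left by (intro sum.cong HOL.refl) (simp only: mult_ac)
 also have "\<dots> = (\<Sum>ij\<in>?I. of_int (e ij) * (of_nat (p ^ vp_gcd p ij) * ?B ij))"
  by (intro sum.cong HOL.refl) (simp only: p_power_scaled[OF S])
 finally have "eqm (p ^ S) (h' + (\<Sum>ij\<in>?I. of_int (q ij) * ?B ij))
   ((\<Sum>ij\<in>?I. of_int (e ij) * (of_nat (p ^ vp_gcd p ij) * ?B ij)) + (\<Sum>ij\<in>?I. of_int (q ij) * ?B ij))"
  by (intro eqm_add eqm_refl)
 then show ?thesis
  unfolding scaled_span_def h'_def
  by (intro CollectI exI[of _ "\<lambda>ij. e ij * int (p ^ vp_gcd p ij) + q ij"])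
    (simp add: sum.distrib algebra_simps)
qed

text \<open>p^S h lies in the span trivially, and \<open>scaled_span_divide\<close> removes the
  factors p one at a time.\<close>

theorem invariants_scaled_span:
 assumes p: "prime p" "odd p" and k: "k > 0" and S0: "S > 0"
  and S: "\<And>ij. ij \<in> dickson_index p k \<Longrightarrow> vp_gcd p ij < S"
  and h: "h \<in> M_component (2 * k)" "invariant_mod (p ^ S) h"
 shows "h \<in> scaled_span p S k"
proof -
 have "of_nat (p ^ t) * h \<in> scaled_span p S k \<Longrightarrow> h \<in> scaled_span p S k" for t
 proof (induction t)
  case (Suc t)
  have "invariant_mod (p ^ S) (of_int (int (p ^ t)) * h)"
   by (intro invariant_mod_mult invariant_mod_of_int h)
  then have "invariant_mod (p ^ S) (of_nat (p ^ t) * h)" by simp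
  moreover have "of_nat p * (of_nat (p ^ t) * h) \<in> scaled_span p S k"
   using Suc.prems by (simp add: mult.assoc)
  ultimately have "of_nat (p ^ t) * h \<in> scaled_span p S k"
   using scaled_span_divide[OF p k S0 S] M_component_of_nat_mult[OF h(1)] by blast
  then show ?case by (rule Suc.IH)
 qed simp
 moreover have "of_nat (p ^ S) * h \<in> scaled_span p S k"
  unfolding scaled_span_def by (intro CollectI exI[of _ "\<lambda>_. 0"]) (simp add: eqm_def)
 ultimately show ?thesis by blast
qed

text \<open>The relation is multiplied by p^n, with n descending from S to 0. When every coefficient
  contains p^a, it becomes p^(S-1) times a combination of the P^i Q^j, and their independence modulo
  p yields the missing factor p.\<close>

theorem scaled_relations:
 assumes p: "prime p" "odd p" and S0: "S > 0"
  and S: "\<And>ij. ij \<in> dickson_index p k \<Longrightarrow> vp_gcd p ij < S"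
  and rel: "eqm (p ^ S) (\<Sum>ij\<in>dickson_index p k. of_int (c ij) * dickson_scaled p S ij) 0"
  and ij: "ij \<in> dickson_index p k"
 shows "int (p ^ Suc (vp_gcd p ij)) dvd c ij"
proof -
 let ?I = "dickson_index p k" and ?B = "dickson_scaled p S"
 have p0: "p > 0" using prime_gt_0_nat[OF p(1)] .
 have "\<forall>ij\<in>?I. int (p ^ Suc (vp_gcd p ij)) dvd c ij * int p ^ n \<Longrightarrow> \<forall>ij\<in>?I. int (p ^ Suc (vp_gcd p ij)) dvd c ij" for n
 proof (induction n)
  case (Suc n)
  have "\<exists>e. c ij * int p ^ n = int (p ^ vp_gcd p ij) * e" if "ij \<in> ?I" for ij
  proof -
   have "int p * int (p ^ vp_gcd p ij) dvd int p * (c ij * int p ^ n)"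
    using bspec[OF Suc.prems that] by (simp only: power_Suc of_nat_mult mult_ac)
   then show ?thesis using p0 by (auto simp: dvd_def)
  qed
  then obtain e where e: "\<And>ij. ij \<in> ?I \<Longrightarrow> c ij * int p ^ n = int (p ^ vp_gcd p ij) * e ij"
   by metis
  have "eqm (p ^ S) (of_int (int p ^ n) * (\<Sum>ij\<in>?I. of_int (c ij) * ?B ij)) (of_int (int p ^ n) * 0)"
   by (intro eqm_mult eqm_refl rel)
  also have "of_int (int p ^ n) * (\<Sum>ij\<in>?I. of_int (c ij) * ?B ij)
    = (\<Sum>ij\<in>?I. of_int (c ij * int p ^ n) * ?B ij)"
   by (simp add: sum_distrib_left mult_ac)
  also have "\<dots> = (\<Sum>ij\<in>?I. of_int (e ij) * (of_nat (p ^ vp_gcd p ij) * ?B ij))"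
  proof (rule sum.cong[OF HOL.refl])
   fix ij assume "ij \<in> ?I"
   then show "of_int (c ij * int p ^ n) * ?B ij = of_int (e ij) * (of_nat (p ^ vp_gcd p ij) * ?B ij)"
    unfolding e[OF \<open>ij \<in> ?I\<close>] of_int_mult of_int_of_nat_eq by (simp only: mult_ac)
  qed
  also have "\<dots> = (\<Sum>ij\<in>?I. of_int (e ij) * (of_nat (p ^ (S - 1)) * dickson_mon p ij))"
   by (intro sum.cong HOL.refl) (simp only: p_power_scaled[OF S])
  also have "\<dots> = of_nat (p ^ (S - 1)) * (\<Sum>ij\<in>?I. of_int (e ij) * dickson_mon p ij)"
   unfolding sum_distrib_left by (intro sum.cong HOL.refl) (simp only: mult_ac)
  finally have "of_nat (p ^ S) dvd (of_nat (p ^ (S - 1)) * (\<Sum>ij\<in>?I. of_int (e ij) * dickson_mon p ij))"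
   by (simp only: eqm_def mult_zero_right diff_zero)
  moreover have "p ^ S = p ^ (S - 1) * p" using S0 by (cases S) auto
  ultimately have "of_nat (p ^ (S - 1)) * of_nat p dvd (of_nat (p ^ (S - 1)) * (\<Sum>ij\<in>?I. of_int (e ij) * dickson_mon p ij))"
   by (simp only: of_nat_mult)
  moreover have "(of_nat (p ^ (S - 1)) :: int poly poly) \<noteq> 0" using p0 by simp
  ultimately have "eqm p (\<Sum>ij\<in>?I. of_int (e ij) * dickson_mon p ij) 0"
   unfolding eqm_def diff_zero using dvd_mult_cancel_left by blast
  then have "int p dvd e ij" if "ij \<in> ?I" for ij
   using dickson_mon_independent[OF p(1)] that by blast
  then have "int (p ^ Suc (vp_gcd p ij)) dvd c ij * int p ^ n" if "ij \<in> ?I" for ij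
   using that by (auto simp: e mult_ac intro: mult_dvd_mono)
  then show ?case using Suc.IH by blast
 qed simp
 moreover have "\<forall>ij\<in>?I. int (p ^ Suc (vp_gcd p ij)) dvd c ij * int p ^ S"
 proof
  fix ij assume "ij \<in> ?I"
  then have "p ^ Suc (vp_gcd p ij) dvd p ^ S" using S[OF \<open>ij \<in> ?I\<close>] by (intro le_imp_power_dvd) simp
  then have "int (p ^ Suc (vp_gcd p ij)) dvd int (p ^ S)" by (rule of_nat_dvd_iff[THEN iffD2])
  then show "int (p ^ Suc (vp_gcd p ij)) dvd c ij * int p ^ S" by simp
 qed
 ultimately show ?thesis using ij by blast
qed

section \<open>Cocycles in degrees 1 and 2\<close>

lemma (in comm_group) rcos_eq_iff:
 assumes "subgroup H G" "x \<in> carrier G" "y \<in> carrier G"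
 shows "H #> x = H #> y \<longleftrightarrow> x \<otimes> inv y \<in> H"
 using assms by (metis coset_join1 coset_join2 coset_mult_assoc coset_mult_inv2 inv_closed m_closed
   subgroup.subset coset_mult_inv1 l_inv r_inv coset_mult_one m_assoc r_one)

section \<open>Cocycles in degrees 1 and 2 as functions of one and two arguments\<close>

locale group_module = group G for G :: "('b, 'm) monoid_scheme" (structure) +
 fixes A :: "'a :: comm_ring_1 set" and act :: "'b \<Rightarrow> 'a \<Rightarrow> 'a"
 assumes A_zero: "0 \<in> A"
  and A_add: "a \<in> A \<Longrightarrow> b \<in> A \<Longrightarrow> a + b \<in> A"
  and A_uminus: "a \<in> A \<Longrightarrow> - a \<in> A"
  and act_closed: "g \<in> carrier G \<Longrightarrow> a \<in> A \<Longrightarrow> act g a \<in> A"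
  and act_add: "g \<in> carrier G \<Longrightarrow> act g (a + b) = act g a + act g b"
  and act_mult: "g \<in> carrier G \<Longrightarrow> h \<in> carrier G \<Longrightarrow> act (g \<otimes> h) a = act g (act h a)"
  and act_one: "act \<one> a = a"
begin

lemma A_diff: "a \<in> A \<Longrightarrow> b \<in> A \<Longrightarrow> a - b \<in> A"
 using A_add[of a "- b"] A_uminus by simp

lemma A_of_nat_mult: "a \<in> A \<Longrightarrow> of_nat n * a \<in> A"
 by (induction n) (auto simp: A_zero A_add distrib_right)

lemma A_of_int_mult: "a \<in> A \<Longrightarrow> of_int n * a \<in> A"
 by (cases n rule: int_cases2) (auto simp: A_of_nat_mult A_uminus)

lemmas A_closed = A_zero A_add A_uminus A_diff A_of_nat_mult A_of_int_mult act_closed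

lemma act_zero: "g \<in> carrier G \<Longrightarrow> act g 0 = 0"
 using act_add[of g 0 0] by simp

lemma act_uminus: "g \<in> carrier G \<Longrightarrow> act g (- a) = - act g a"
 using act_add[of g a "- a"] by (simp add: act_zero eq_neg_iff_add_eq_0 add.commute)

lemma act_diff: "g \<in> carrier G \<Longrightarrow> act g (a - b) = act g a - act g b"
 using act_add[of g a "- b"] by (simp add: act_uminus)

lemma act_of_nat_mult: "g \<in> carrier G \<Longrightarrow> act g (of_nat n * a) = of_nat n * act g a"
 by (induction n) (auto simp: act_zero act_add distrib_right)

lemma act_of_int_mult: "g \<in> carrier G \<Longrightarrow> act g (of_int n * a) = of_int n * act g a"
 by (cases n rule: int_cases2) (auto simp: act_of_nat_mult act_uminus)

lemma act_sum: "g \<in> carrier G \<Longrightarrow> act g (sum f I) = (\<Sum>i\<in>I. act g (f i))"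
 by (induction I rule: infinite_finite_induct) (auto simp: act_zero act_add)

lemmas act_simps = act_zero act_add act_uminus act_diff act_of_nat_mult act_of_int_mult act_sum

definition derivation :: "('b \<Rightarrow> 'a) \<Rightarrow> bool"
 where "derivation d \<longleftrightarrow> (\<forall>g\<in>carrier G. d g \<in> A) \<and>
  (\<forall>g\<in>carrier G. \<forall>h\<in>carrier G. d (g \<otimes> h) = d g + act g (d h))"

definition factor_set :: "('b \<Rightarrow> 'b \<Rightarrow> 'a) \<Rightarrow> bool"
 where "factor_set f \<longleftrightarrow> (\<forall>g\<in>carrier G. \<forall>h\<in>carrier G. f g h \<in> A) \<and>
  (\<forall>g\<in>carrier G. \<forall>h\<in>carrier G. \<forall>k\<in>carrier G.
    act g (f h k) + f g (h \<otimes> k) = f (g \<otimes> h) k + f g h)"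

text \<open>\<open>cochain1\<close> and \<open>cochain2\<close> return to the list encoding of
  \<open>cochains\<close>, where the value has to be 0 off the valid lists.\<close>

definition cochain1 :: "('b \<Rightarrow> 'a) \<Rightarrow> 'b list \<Rightarrow> 'a"
 where "cochain1 d gs = (if length gs = 1 \<and> set gs \<subseteq> carrier G then d (gs ! 0) else 0)"

definition cochain2 :: "('b \<Rightarrow> 'b \<Rightarrow> 'a) \<Rightarrow> 'b list \<Rightarrow> 'a"
 where "cochain2 f gs = (if length gs = 2 \<and> set gs \<subseteq> carrier G then f (gs ! 0) (gs ! 1) else 0)"

abbreviation Z :: "nat \<Rightarrow> ('b list \<Rightarrow> 'a) monoid"
 where "Z n \<equiv> cocycle_group G A act n"

abbreviation B :: "nat \<Rightarrow> ('b list \<Rightarrow> 'a) set"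
 where "B n \<equiv> coboundaries G A act n"

lemma mult_Z [simp]: "f \<otimes>\<^bsub>Z n\<^esub> f' = (\<lambda>gs. f gs + f' gs)"
 and one_Z [simp]: "\<one>\<^bsub>Z n\<^esub> = (\<lambda>_. 0)"
 and carrier_Z: "carrier (Z n) = {f \<in> cochains G A n. coboundary_map G act n f = (\<lambda>_. 0)}"
 by (simp_all add: cocycle_group_def)

lemma signed_add: "signed i (a + b) = signed i a + signed i (b :: 'a)"
 by (simp add: signed_def)

lemma signed_Suc: "signed 0 a = a" "signed (Suc i) a = - signed i (a :: 'a)"
 by (simp_all add: signed_def)

lemma coboundary_map_add:
 "coboundary_map G act n (\<lambda>gs. f gs + f' gs) gs = coboundary_map G act n f gs + coboundary_map G act n f' gs"
proof (cases "length gs = Suc n \<and> set gs \<subseteq> carrier G")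
 case True
 then have "hd gs \<in> carrier G" by (cases gs) auto
 then show ?thesis
  using True by (simp add: coboundary_map_def act_add signed_add sum.distrib add_ac)
qed (auto simp: coboundary_map_def)

lemma coboundary_map_zero: "coboundary_map G act n (\<lambda>_. 0) = (\<lambda>_. 0)"
proof
 fix gs show "coboundary_map G act n (\<lambda>_. 0) gs = 0"
  using coboundary_map_add[of n "\<lambda>_. 0" "\<lambda>_. 0" gs] by simp
qed

lemma coboundary_map_uminus:
 "coboundary_map G act n (\<lambda>gs. - f gs) gs = - coboundary_map G act n f gs"
 using coboundary_map_add[of n f "\<lambda>gs. - f gs" gs]
 by (simp add: coboundary_map_zero eq_neg_iff_add_eq_0 add.commute)

lemma cochains_add: "f \<in> cochains G A n \<Longrightarrow> f' \<in> cochains G A n \<Longrightarrow> (\<lambda>gs. f gs + f' gs) \<in> cochains G A n"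
 and cochains_zero: "(\<lambda>_. 0) \<in> cochains G A n"
 and cochains_uminus: "f \<in> cochains G A n \<Longrightarrow> (\<lambda>gs. - f gs) \<in> cochains G A n"
 by (auto simp: cochains_def A_zero intro: A_add A_uminus)

lemma comm_group_Z: "comm_group (Z n)"
proof (rule comm_groupI)
 fix f assume f: "f \<in> carrier (Z n)"
 show "\<exists>g\<in>carrier (Z n). g \<otimes>\<^bsub>Z n\<^esub> f = \<one>\<^bsub>Z n\<^esub>"
  using f by (intro bexI[of _ "\<lambda>gs. - f gs"])
   (auto simp: carrier_Z cochains_uminus coboundary_map_uminus fun_eq_iff)
qed (auto simp: carrier_Z cochains_add cochains_zero coboundary_map_add coboundary_map_zero fun_eq_iff add_ac)

lemma inv_Z:
 assumes "f \<in> carrier (Z n)"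
 shows "inv\<^bsub>Z n\<^esub> f = (\<lambda>gs. - f gs)"
proof -
 interpret Zn: comm_group "Z n" by (rule comm_group_Z)
 have "(\<lambda>gs. - f gs) \<in> carrier (Z n)"
  using assms by (auto simp: carrier_Z cochains_uminus coboundary_map_uminus fun_eq_iff)
 then show ?thesis using assms by (intro Zn.inv_equality) (auto simp: fun_eq_iff)
qed

lemma pow_Z: "f [^]\<^bsub>Z n\<^esub> (m :: nat) = (\<lambda>gs. of_nat m * f gs)"
 by (induction m) (auto simp: fun_eq_iff algebra_simps)

lemma length1: "length gs = Suc 0 \<longleftrightarrow> (\<exists>g. gs = [g])"
 and length2: "length gs = 2 \<longleftrightarrow> (\<exists>g h. gs = [g, h])"
 and length3: "length gs = 3 \<longleftrightarrow> (\<exists>g h k. gs = [g, h, k])"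
 by (auto simp: numeral_2_eq_2 numeral_3_eq_3 length_Suc_conv)

lemma cochains_1: "f \<in> cochains G A 1 \<longleftrightarrow> (\<exists>d. (\<forall>g\<in>carrier G. d g \<in> A) \<and> f = cochain1 d)"
proof
 assume f: "f \<in> cochains G A 1"
 then have "f = cochain1 (\<lambda>g. f [g])"
  by (auto simp: fun_eq_iff cochain1_def cochains_def length1)
 moreover have "\<forall>g\<in>carrier G. f [g] \<in> A" using f by (auto simp: cochains_def)
 ultimately show "\<exists>d. (\<forall>g\<in>carrier G. d g \<in> A) \<and> f = cochain1 d"
  by (intro exI[of _ "\<lambda>g. f [g]"]) simp
qed (auto simp: cochains_def cochain1_def length1 split: if_splits)

lemma cochains_2:
 "f \<in> cochains G A 2 \<longleftrightarrow> (\<exists>d. (\<forall>g\<in>carrier G. \<forall>h\<in>carrier G. d g h \<in> A) \<and> f = cochain2 d)"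
proof
 assume f: "f \<in> cochains G A 2"
 then have "f = cochain2 (\<lambda>g h. f [g, h])"
  by (auto simp: fun_eq_iff cochain2_def cochains_def length2)
 moreover have "\<forall>g\<in>carrier G. \<forall>h\<in>carrier G. f [g, h] \<in> A" using f by (auto simp: cochains_def)
 ultimately show "\<exists>d. (\<forall>g\<in>carrier G. \<forall>h\<in>carrier G. d g h \<in> A) \<and> f = cochain2 d"
  by (intro exI[of _ "\<lambda>g h. f [g, h]"]) simp
qed (auto simp: cochains_def cochain2_def length2 split: if_splits)

lemma coboundary_map_0: "f \<in> cochains G A 0 \<Longrightarrow> coboundary_map G act 0 f = cochain1 (\<lambda>g. act g (f []) - f [])"
 by (auto simp: fun_eq_iff coboundary_map_def cochain1_def signed_def length_Suc_conv)

lemma coboundary_map_1: "coboundary_map G act 1 (cochain1 d) = cochain2 (\<lambda>g h. act g (d h) - d (g \<otimes> h) + d g)"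
proof
 fix gs show "coboundary_map G act 1 (cochain1 d) gs = cochain2 (\<lambda>g h. act g (d h) - d (g \<otimes> h) + d g) gs"
 proof (cases "length gs = 2 \<and> set gs \<subseteq> carrier G")
  case True
  then obtain g h where "gs = [g, h]" "g \<in> carrier G" "h \<in> carrier G" by (auto simp: length2)
  then show ?thesis
   by (simp add: coboundary_map_def cochain1_def cochain2_def signed_def merge_at_def)
 next
  case False
  then show ?thesis unfolding coboundary_map_def cochain2_def Suc_1 by (simp only: if_False)
 qed
qed

lemma coboundary_map_2:
 assumes "g \<in> carrier G" "h \<in> carrier G" "k \<in> carrier G"
 shows "coboundary_map G act 2 (cochain2 f) [g, h, k]
  = act g (f h k) - f (g \<otimes> h) k + f g (h \<otimes> k) - f g h"
 using assms by (simp add: coboundary_map_def cochain2_def signed_Suc merge_at_def numeral_2_eq_2)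

lemma cochain1_eq_iff: "cochain1 d = cochain1 d' \<longleftrightarrow> (\<forall>g\<in>carrier G. d g = d' g)"
 by (auto simp: fun_eq_iff cochain1_def length1 dest: spec[of _ "[_]"])

lemma cochain2_eq_iff: "cochain2 d = cochain2 d' \<longleftrightarrow> (\<forall>g\<in>carrier G. \<forall>h\<in>carrier G. d g h = d' g h)"
 by (auto simp: fun_eq_iff cochain2_def length2 dest: spec[of _ "[_, _]"])

lemma cochain1_zero: "(\<lambda>_. 0) = cochain1 (\<lambda>_. 0)"
 and cochain2_zero: "(\<lambda>_. 0) = cochain2 (\<lambda>_ _. 0)"
 by (auto simp: fun_eq_iff cochain1_def cochain2_def)

lemma carrier_Z1: "carrier (Z 1) = cochain1 ` {d. derivation d}"
proof -
 have "coboundary_map G act 1 (cochain1 d) = (\<lambda>_. 0) \<longleftrightarrow>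
   (\<forall>g\<in>carrier G. \<forall>h\<in>carrier G. d (g \<otimes> h) = d g + act g (d h))" for d
  unfolding coboundary_map_1 cochain2_zero cochain2_eq_iff
  by (intro ball_cong HOL.refl) (auto simp: algebra_simps)
 note eq = this
 have "f \<in> carrier (Z 1) \<longleftrightarrow> f \<in> cochain1 ` {d. derivation d}" for f
  unfolding carrier_Z mem_Collect_eq cochains_1
  by (auto simp: eq derivation_def simp del: One_nat_def)
 then show ?thesis by blast
qed

lemma carrier_Z2: "carrier (Z 2) = cochain2 ` {f. factor_set f}"
proof -
 have "coboundary_map G act 2 (cochain2 d) = (\<lambda>_. 0) \<longleftrightarrow>
   (\<forall>g\<in>carrier G. \<forall>h\<in>carrier G. \<forall>k\<in>carrier G. act g (d h k) + d g (h \<otimes> k) = d (g \<otimes> h) k + d g h)"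
  (is "?L \<longleftrightarrow> ?R") for d
 proof
  assume L: ?L
  show ?R
  proof (intro ballI)
   fix g h k assume "g \<in> carrier G" "h \<in> carrier G" "k \<in> carrier G"
   from coboundary_map_2[OF this, of d] show "act g (d h k) + d g (h \<otimes> k) = d (g \<otimes> h) k + d g h"
    unfolding L by (simp add: algebra_simps)
  qed
 next
  assume R: ?R
  show ?L
  proof
   fix gs show "coboundary_map G act 2 (cochain2 d) gs = 0"
   proof (cases "length gs = 3 \<and> set gs \<subseteq> carrier G")
    case True
    then obtain g h k where gs: "gs = [g, h, k]" and c: "g \<in> carrier G" "h \<in> carrier G" "k \<in> carrier G"
     by (auto simp: length3)
    have "act g (d h k) + d g (h \<otimes> k) = d (g \<otimes> h) k + d g h" using R c by blast
    then show ?thesis unfolding gs coboundary_map_2[OF c] by (simp add: algebra_simps)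
   next
    case False
    then show ?thesis unfolding coboundary_map_def
     by (simp only: Suc_numeral Num.add_num_simps if_False)
   qed
  qed
 qed
 note eq = this
 have "f \<in> carrier (Z 2) \<longleftrightarrow> f \<in> cochain2 ` {d. factor_set d}" for f
  unfolding carrier_Z mem_Collect_eq cochains_2
  by (auto simp: eq factor_set_def)
 then show ?thesis by blast
qed

lemma B_1: "B 1 = {cochain1 (\<lambda>g. act g a - a) | a. a \<in> A}"
proof -
 have "(\<lambda>f. f []) ` cochains G A 0 = A"
 proof (intro equalityI subsetI)
  fix a assume "a \<in> A"
  then show "a \<in> (\<lambda>f. f []) ` cochains G A 0"
   by (intro image_eqI[of _ _ "\<lambda>gs. if gs = [] then a else 0"]) (auto simp: cochains_def)
 qed (auto simp: cochains_def)
 moreover have "B 1 = (\<lambda>a. cochain1 (\<lambda>g. act g a - a)) ` ((\<lambda>f. f []) ` cochains G A 0)"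
  unfolding image_image One_nat_def coboundaries.simps using coboundary_map_0 by (intro image_cong) auto
 ultimately show ?thesis by auto
qed

lemma B_2: "B 2 = {cochain2 (\<lambda>g h. act g (d h) - d (g \<otimes> h) + d g) | d. \<forall>g\<in>carrier G. d g \<in> A}"
proof -
 have "B 2 = coboundary_map G act 1 ` cochains G A 1" by (simp add: numeral_2_eq_2)
 also have "\<dots> = {coboundary_map G act 1 (cochain1 d) | d. \<forall>g\<in>carrier G. d g \<in> A}"
  using cochains_1 by (auto simp del: One_nat_def)
 finally show ?thesis unfolding coboundary_map_1 .
qed

lemma derivation_principal: "a \<in> A \<Longrightarrow> derivation (\<lambda>g. act g a - a)"
 by (auto simp: derivation_def A_closed act_mult act_diff)

lemma factor_set_coboundary:
 assumes "\<And>g. g \<in> carrier G \<Longrightarrow> d g \<in> A"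
 shows "factor_set (\<lambda>g h. act g (d h) - d (g \<otimes> h) + d g)"
 using assms by (auto simp: factor_set_def A_closed act_mult act_simps m_assoc)

lemma subgroup_B1: "subgroup (B 1) (Z 1)"
proof -
 interpret Zn: comm_group "Z 1" by (rule comm_group_Z)
 have sub: "B 1 \<subseteq> carrier (Z 1)"
  unfolding B_1 carrier_Z1 using derivation_principal by blast
 show ?thesis
 proof (rule Zn.subgroupI[OF sub])
  show "B 1 \<noteq> {}" unfolding B_1 using A_zero by blast
  fix f assume f: "f \<in> B 1"
  then obtain a where a: "f = cochain1 (\<lambda>g. act g a - a)" "a \<in> A" unfolding B_1 by blast
  have "inv\<^bsub>Z 1\<^esub> f = cochain1 (\<lambda>g. act g (- a) - - a)"
   by (subst inv_Z[OF subsetD[OF sub f]]) (auto simp: a(1) fun_eq_iff cochain1_def length1 act_uminus)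
  then show "inv\<^bsub>Z 1\<^esub> f \<in> B 1" unfolding B_1 using A_uminus a by blast
  fix f' assume "f' \<in> B 1"
  then obtain b where b: "f' = cochain1 (\<lambda>g. act g b - b)" "b \<in> A" unfolding B_1 by blast
  have "f \<otimes>\<^bsub>Z 1\<^esub> f' = cochain1 (\<lambda>g. act g (a + b) - (a + b))"
   unfolding a(1) b(1) by (auto simp: fun_eq_iff cochain1_def length1 act_add)
  then show "f \<otimes>\<^bsub>Z 1\<^esub> f' \<in> B 1" unfolding B_1 using A_add a b by blast
 qed
qed

lemma subgroup_B2: "subgroup (B 2) (Z 2)"
proof -
 interpret Zn: comm_group "Z 2" by (rule comm_group_Z)
 have sub: "B 2 \<subseteq> carrier (Z 2)"
  unfolding B_2 carrier_Z2 using factor_set_coboundary by blast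
 show ?thesis
 proof (rule Zn.subgroupI[OF sub])
  have "cochain2 (\<lambda>g h. act g ((\<lambda>_. 0) h) - (\<lambda>_. 0) (g \<otimes> h) + (\<lambda>_. 0) g) \<in> B 2"
   unfolding B_2 by (intro CollectI exI[of _ "\<lambda>_. 0"]) (simp add: A_zero)
  then show "B 2 \<noteq> {}" by auto
  fix f assume f: "f \<in> B 2"
  then obtain a where a: "f = cochain2 (\<lambda>g h. act g (a h) - a (g \<otimes> h) + a g)" "\<forall>g\<in>carrier G. a g \<in> A"
   unfolding B_2 by blast
  have "inv\<^bsub>Z 2\<^esub> f = cochain2 (\<lambda>g h. act g (- a h) - - a (g \<otimes> h) + - a g)"
   by (subst inv_Z[OF subsetD[OF sub f]]) (auto simp: a(1) fun_eq_iff cochain2_def length2 act_uminus)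
  then show "inv\<^bsub>Z 2\<^esub> f \<in> B 2" unfolding B_2 using A_uminus a
   by (intro CollectI exI[of _ "\<lambda>g. - a g"]) simp
  fix f' assume "f' \<in> B 2"
  then obtain b where b: "f' = cochain2 (\<lambda>g h. act g (b h) - b (g \<otimes> h) + b g)" "\<forall>g\<in>carrier G. b g \<in> A"
   unfolding B_2 by blast
  have "f \<otimes>\<^bsub>Z 2\<^esub> f' = cochain2 (\<lambda>g h. act g (a h + b h) - (a (g \<otimes> h) + b (g \<otimes> h)) + (a g + b g))"
   unfolding a(1) b(1) by (auto simp: fun_eq_iff cochain2_def length2 act_add)
  then show "f \<otimes>\<^bsub>Z 2\<^esub> f' \<in> B 2" unfolding B_2 using A_add a b
   by (intro CollectI exI[of _ "\<lambda>g. a g + b g"]) simp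
 qed
qed

abbreviation H :: "nat \<Rightarrow> ('b list \<Rightarrow> 'a) set monoid"
 where "H n \<equiv> group_cohomology G A act n"

lemma comm_group_H:
 assumes "n = 1 \<or> n = 2"
 shows "comm_group (H n)"
 unfolding group_cohomology_def
 using assms subgroup_B1 subgroup_B2 comm_group.abelian_FactGroup[OF comm_group_Z] by auto

definition contraction :: "'b \<Rightarrow> ('b \<Rightarrow> 'b \<Rightarrow> 'a) \<Rightarrow> 'b \<Rightarrow> 'a"
 where "contraction c f g = f c g - f g c"

text \<open>A central element acts trivially on cohomology; the contraction is the explicit homotopy.\<close>

lemma contraction_homotopy:
 assumes f: "factor_set f" and c: "c \<in> carrier G" "\<And>g. g \<in> carrier G \<Longrightarrow> c \<otimes> g = g \<otimes> c"
  and g: "g \<in> carrier G" and h: "h \<in> carrier G"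
 shows "act c (f g h) - f g h = act g (contraction c f h) - contraction c f (g \<otimes> h) + contraction c f g"
proof -
 \<comment> \<open>The cocycle identity for (c, g, h), (g, c, h) and (g, h, c), with c moved to the
   right of its neighbour.\<close>
 have 1: "act c (f g h) + f c (g \<otimes> h) = f (g \<otimes> c) h + f c g"
  using f c g h unfolding factor_set_def by metis
 have 2: "act g (f c h) + f g (h \<otimes> c) = f (g \<otimes> c) h + f g c"
  using f c g h unfolding factor_set_def by metis
 have 3: "act g (f h c) + f g (h \<otimes> c) = f (g \<otimes> h) c + f g h"
  using f c g h unfolding factor_set_def by metis
 have "act c (f g h) = f (g \<otimes> c) h + f c g - f c (g \<otimes> h)" using 1 by (simp add: eq_diff_eq)
 moreover have "act g (f c h) = f (g \<otimes> c) h + f g c - f g (h \<otimes> c)" using 2 by (simp add: eq_diff_eq)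
 moreover have "act g (f h c) = f (g \<otimes> h) c + f g h - f g (h \<otimes> c)" using 3 by (simp add: eq_diff_eq)
 ultimately show ?thesis unfolding contraction_def act_diff[OF g] by simp
qed

lemma contraction_closed:
 "factor_set f \<Longrightarrow> c \<in> carrier G \<Longrightarrow> g \<in> carrier G \<Longrightarrow> contraction c f g \<in> A"
 by (auto simp: contraction_def factor_set_def A_diff)

lemma derivation_central:
 assumes d: "derivation d" and c: "c \<in> carrier G" "\<And>g. g \<in> carrier G \<Longrightarrow> c \<otimes> g = g \<otimes> c"
  and g: "g \<in> carrier G"
 shows "act c (d g) - d g = act g (d c) - d c"
proof -
 have "d c + act c (d g) = d g + act g (d c)"
  using d c g unfolding derivation_def by metis
 then show ?thesis by (simp add: algebra_simps)
qed

end

section \<open>Homomorphisms out of the braid group and split extensions\<close>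

lemma (in group) word_value_braid3:
 assumes "\<And>x. \<phi> x \<in> carrier G"
 shows "word_value G \<phi> [(x, True), (y, True), (z, True)] = \<phi> x \<otimes> (\<phi> y \<otimes> \<phi> z)"
 using assms by simp

lemma braid_closed: "braid x \<in> carrier B3"
 by (simp add: B3_def braid_def carrier_presented_group)

lemma braid_relation:
 "braid Sigma1 \<cdot> (braid Sigma2 \<cdot> braid Sigma1)
  = braid Sigma2 \<cdot> (braid Sigma1 \<cdot> braid Sigma2)"
proof -
 have "word_cong braid_rel ([] @ [(Sigma1, True), (Sigma2, True), (Sigma1, True)] @ [])
   ([] @ [(Sigma2, True), (Sigma1, True), (Sigma2, True)] @ [])"
  by (rule word_cong.rel) (simp add: braid_rel_def)
 then show ?thesis by (simp add: B3_def braid_def word_class_eq_iff)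
qed

lemma word_value_B3: "word_value B3 braid w = word_class braid_rel w"
proof (induction w)
 case (Cons l w)
 interpret group B3 by (rule group_B3)
 obtain x s where l: "l = (x, s)" by fastforce
 have inv: "inv\<^bsub>B3\<^esub> (braid x) = word_class braid_rel [(x, False)]"
 proof (rule inv_equality)
  show "word_class braid_rel [(x, False)] \<cdot> braid x = \<one>\<^bsub>B3\<^esub>"
   using word_cong.cancel[of braid_rel "[]" x False "[]"]
   by (simp add: B3_def braid_def one_presented_group word_class_eq_iff)
 qed (auto simp: braid_closed, simp add: B3_def carrier_presented_group)
 have "(if s then braid x else inv\<^bsub>B3\<^esub> (braid x)) = word_class braid_rel [l]"
  by (simp add: inv l) (simp add: braid_def)
 then have "word_value B3 braid (l # w) = word_class braid_rel [l] \<cdot> word_class braid_rel w"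
  using Cons.IH by (simp only: word_value.simps l fst_conv snd_conv)
 also have "\<dots> = word_class braid_rel (l # w)" unfolding B3_def by simp
 finally show ?case .
qed (simp add: B3_def one_presented_group)

lemma carrier_B3: "carrier B3 = range (word_value B3 braid)"
 unfolding word_value_B3 by (simp add: B3_def carrier_presented_group)

lemma B3_induct [consumes 1, case_names one gen inv]:
 assumes "g \<in> carrier B3"
  and "P \<one>\<^bsub>B3\<^esub>"
  and "\<And>x g. g \<in> carrier B3 \<Longrightarrow> P g \<Longrightarrow> P (braid x \<cdot> g)"
  and "\<And>x g. g \<in> carrier B3 \<Longrightarrow> P g \<Longrightarrow> P (inv\<^bsub>B3\<^esub> (braid x) \<cdot> g)"
 shows "P g"
proof -
 interpret group B3 by (rule group_B3)
 have "P (word_value B3 braid w)" for w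
 proof (induction w)
  case (Cons l w)
  have "word_value B3 braid w \<in> carrier B3" unfolding carrier_B3 by simp
  then show ?case using assms(3,4) Cons.IH by simp
 qed (simp add: assms(2))
 then show ?thesis using assms(1) unfolding carrier_B3 by auto
qed

lemma presented_hom_B3:
 assumes "group E" "\<And>x. \<phi> x \<in> carrier E"
  and "\<phi> Sigma1 \<otimes>\<^bsub>E\<^esub> (\<phi> Sigma2 \<otimes>\<^bsub>E\<^esub> \<phi> Sigma1) = \<phi> Sigma2 \<otimes>\<^bsub>E\<^esub> (\<phi> Sigma1 \<otimes>\<^bsub>E\<^esub> \<phi> Sigma2)"
 obtains h where "h \<in> hom B3 E" "\<And>x. h (braid x) = \<phi> x"
proof
 interpret E: group E by (rule assms(1))
 have rel: "word_value E \<phi> u = word_value E \<phi> v" if "(u, v) \<in> braid_rel" for u v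
  using that assms(3) E.word_value_braid3[of \<phi>, OF assms(2)] by (auto simp: braid_rel_def simp del: word_value.simps)
 show "presented_hom E \<phi> \<in> hom B3 E"
  unfolding B3_def by (rule E.presented_hom_hom[OF assms(2) rel])
 show "presented_hom E \<phi> (braid x) = \<phi> x" for x
  unfolding braid_def by (subst E.presented_hom_class[OF assms(2) rel]) (simp_all add: assms(2))
qed

lemma B3_hom_eqI:
 assumes E: "group E" and h: "h \<in> hom B3 E" "h' \<in> hom B3 E" "\<And>x. h (braid x) = h' (braid x)"
  and g: "g \<in> carrier B3"
 shows "h g = h' g"
 using g
proof (induction rule: B3_induct)
 interpret E: group E by (rule E)
 interpret h: group_hom B3 E h by (simp add: group_hom_def group_hom_axioms_def group_B3 E h)
 interpret h': group_hom B3 E h' by (simp add: group_hom_def group_hom_axioms_def group_B3 E h)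
 {
  case one show ?case by simp
 next
  case (gen x g) then show ?case by (simp add: braid_closed h(3))
 next
  case (inv x g) then show ?case by (simp add: braid_closed h(3))
 }
qed

context group_module
begin

text \<open>The extension of the group by A that belongs to the factor set f. Factor sets are not
  assumed normalized, whence the neutral element.\<close>

definition extension :: "('b \<Rightarrow> 'b \<Rightarrow> 'a) \<Rightarrow> ('a \<times> 'b) monoid"
 where "extension f = \<lparr>carrier = A \<times> carrier G,
  monoid.mult = (\<lambda>(a, g) (b, h). (a + act g b + f g h, g \<otimes> h)), one = (- f \<one> \<one>, \<one>)\<rparr>"

lemma group_extension:
 assumes f: "factor_set f"
 shows "group (extension f)"
proof (rule groupI)
 have fA: "f g h \<in> A" if "g \<in> carrier G" "h \<in> carrier G" for g h
  using f that by (auto simp: factor_set_def)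
 have co: "act g (f h k) + f g (h \<otimes> k) = f (g \<otimes> h) k + f g h"
  if "g \<in> carrier G" "h \<in> carrier G" "k \<in> carrier G" for g h k
  using f that by (auto simp: factor_set_def)
 \<comment> \<open>The cocycle identity at (1, 1, g); it replaces normalization.\<close>
 have f1: "f \<one> g = f \<one> \<one>" if "g \<in> carrier G" for g
  using co[of \<one> \<one> g] that by (simp add: act_one)
 show "x \<otimes>\<^bsub>extension f\<^esub> y \<in> carrier (extension f)"
  if "x \<in> carrier (extension f)" "y \<in> carrier (extension f)" for x y
  using that by (auto simp: extension_def A_closed fA)
 show "\<one>\<^bsub>extension f\<^esub> \<in> carrier (extension f)"
  by (auto simp: extension_def A_closed fA)
 show "\<one>\<^bsub>extension f\<^esub> \<otimes>\<^bsub>extension f\<^esub> x = x" if "x \<in> carrier (extension f)" for x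
 proof -
  obtain a g where eq: "x = (a, g)" by (cases x)
  have "g \<in> carrier G" using that by (auto simp: eq extension_def)
  then show ?thesis using f1[of g] by (simp add: eq extension_def act_one)
 qed
 show "x \<otimes>\<^bsub>extension f\<^esub> y \<otimes>\<^bsub>extension f\<^esub> z = x \<otimes>\<^bsub>extension f\<^esub> (y \<otimes>\<^bsub>extension f\<^esub> z)"
  if xyz: "x \<in> carrier (extension f)" "y \<in> carrier (extension f)" "z \<in> carrier (extension f)" for x y z
 proof -
  obtain a g b h c k where eq: "x = (a, g)" "y = (b, h)" "z = (c, k)" by (cases x, cases y, cases z)
  have G: "g \<in> carrier G" "h \<in> carrier G" "k \<in> carrier G" using xyz by (auto simp: eq extension_def)
  show ?thesis using co[OF G] G
   by (simp add: eq extension_def act_mult act_add m_assoc algebra_simps)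
 qed
 show "\<exists>y\<in>carrier (extension f). y \<otimes>\<^bsub>extension f\<^esub> x = \<one>\<^bsub>extension f\<^esub>"
  if x: "x \<in> carrier (extension f)" for x
 proof -
  obtain a g where eq: "x = (a, g)" by (cases x)
  have G: "a \<in> A" "g \<in> carrier G" using x by (auto simp: eq extension_def)
  show ?thesis
   by (rule bexI[of _ "(- f \<one> \<one> - act (inv g) a - f (inv g) g, inv g)"])
     (use G in \<open>auto simp: eq extension_def A_closed fA\<close>)
 qed
qed

end

locale B3_module = group_module B3 A act for A :: "'a :: comm_ring_1 set" and act
begin

abbreviation s1 where "s1 \<equiv> braid Sigma1"
abbreviation s2 where "s2 \<equiv> braid Sigma2"

text \<open>A factor set is split by lifts of the two generators that satisfy the braid relation in the
 extension.\<close>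

lemma splitting:
 assumes f: "factor_set f" and a: "a1 \<in> A" "a2 \<in> A"
  and rel: "a1 + act s1 (a2 + act s2 a1 + f s2 s1) + f s1 (s2 \<cdot> s1)
      = a2 + act s2 (a1 + act s1 a2 + f s1 s2) + f s2 (s1 \<cdot> s2)"
 obtains e where "e s1 = a1" "e s2 = a2" "\<And>g. g \<in> carrier B3 \<Longrightarrow> e g \<in> A"
  "\<And>g h. g \<in> carrier B3 \<Longrightarrow> h \<in> carrier B3 \<Longrightarrow> e (g \<cdot> h) = e g + act g (e h) + f g h"
proof -
 interpret E: group "extension f" by (rule group_extension[OF f])
 define \<phi> where "\<phi> x = (case x of Sigma1 \<Rightarrow> (a1, s1) | Sigma2 \<Rightarrow> (a2, s2))" for x
 have phi: "\<phi> x \<in> carrier (extension f)" for x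
  using a by (cases x) (auto simp: \<phi>_def extension_def braid_closed)
 have "\<phi> Sigma1 \<otimes>\<^bsub>extension f\<^esub> (\<phi> Sigma2 \<otimes>\<^bsub>extension f\<^esub> \<phi> Sigma1)
   = \<phi> Sigma2 \<otimes>\<^bsub>extension f\<^esub> (\<phi> Sigma1 \<otimes>\<^bsub>extension f\<^esub> \<phi> Sigma2)"
  using rel braid_relation by (simp add: \<phi>_def extension_def)
 then obtain h where h: "h \<in> hom B3 (extension f)" "\<And>x. h (braid x) = \<phi> x"
  using presented_hom_B3[OF E.group_axioms, of \<phi>, OF phi] by blast
 have snd: "snd \<in> hom (extension f) B3"
  by (rule homI) (auto simp: extension_def)
 \<comment> \<open>The projection of h fixes the generators and is therefore the identity. So h is a
   section, and its first component splits f.\<close>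
 have "snd \<circ> h \<in> hom B3 B3" 
  by (rule homI) (simp_all add: hom_in_carrier[OF snd] hom_in_carrier[OF h(1)] hom_mult[OF h(1)] hom_mult[OF snd])
 moreover have "id \<in> hom B3 B3" by (rule homI) auto
 moreover have "(snd \<circ> h) (braid x) = id (braid x)" for x
  using h(2) by (cases x) (auto simp: \<phi>_def)
 ultimately have sh: "snd (h g) = g" if "g \<in> carrier B3" for g
  using B3_hom_eqI[OF group_B3, of "snd \<circ> h" id g] that by simp
 show thesis
 proof (rule that[of "fst \<circ> h"])
  show "(fst \<circ> h) s1 = a1" "(fst \<circ> h) s2 = a2" using h(2) by (auto simp: \<phi>_def)
  show "(fst \<circ> h) g \<in> A" if "g \<in> carrier B3" for g
   using hom_in_carrier[OF h(1) that] by (auto simp: extension_def)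
  show "(fst \<circ> h) (g \<cdot> k) = (fst \<circ> h) g + act g ((fst \<circ> h) k) + f g k"
   if "g \<in> carrier B3" "k \<in> carrier B3" for g k
  proof -
   have "h (g \<cdot> k) = h g \<otimes>\<^bsub>extension f\<^esub> h k" using h(1) that by (rule hom_mult)
   moreover have "h g = (fst (h g), g)" "h k = (fst (h k), k)"
    using sh that by (metis prod.collapse)+
   ultimately have "h (g \<cdot> k) = (fst (h g), g) \<otimes>\<^bsub>extension f\<^esub> (fst (h k), k)" by simp
   then show ?thesis by (simp add: extension_def)
  qed
 qed
qed

lemma derivation_exists:
 assumes "a1 \<in> A" "a2 \<in> A"
  and "a1 + act s1 (a2 + act s2 a1) = a2 + act s2 (a1 + act s1 a2)"
 obtains d where "derivation d" "d s1 = a1" "d s2 = a2"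
proof -
 have "factor_set (\<lambda>_ _. 0)" by (simp add: factor_set_def A_zero act_zero)
 moreover have "a1 + act s1 (a2 + act s2 a1 + 0) + 0 = a2 + act s2 (a1 + act s1 a2 + 0) + 0"
  using assms(3) by simp
 ultimately show thesis
 proof (rule splitting[OF _ assms(1,2)])
  fix e assume "e s1 = a1" "e s2 = a2" "\<And>g. g \<in> carrier B3 \<Longrightarrow> e g \<in> A"
   "\<And>g h. g \<in> carrier B3 \<Longrightarrow> h \<in> carrier B3 \<Longrightarrow> e (g \<cdot> h) = e g + act g (e h) + 0"
  then show thesis
   by (intro that[of e]) (simp_all add: derivation_def)
 qed
qed

lemma derivation_zeroI:
 assumes d: "derivation d" "d s1 = 0" "d s2 = 0" and g: "g \<in> carrier B3"
 shows "d g = 0"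
proof -
 have dm: "d (g \<cdot> h) = d g + act g (d h)" if "g \<in> carrier B3" "h \<in> carrier B3" for g h
  using d(1) that by (auto simp: derivation_def)
 have d1: "d \<one>\<^bsub>B3\<^esub> = 0" using dm[of "\<one>\<^bsub>B3\<^esub>" "\<one>\<^bsub>B3\<^esub>"] by (simp add: act_one)
 have db: "d (braid x) = 0" for x using d(2,3) by (cases x) auto
 have di: "d (inv\<^bsub>B3\<^esub> (braid x)) = 0" for x
  using dm[of "inv\<^bsub>B3\<^esub> (braid x)" "braid x"] by (simp add: braid_closed db d1 act_zero)
 show ?thesis
  using g
 proof (induction rule: B3_induct)
  case one show ?case by (rule d1)
 next
  case (gen x g) then show ?case using dm[of "braid x" g] by (simp add: braid_closed db act_zero)
 next
  case (inv x g) then show ?case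
   using dm[of "inv\<^bsub>B3\<^esub> (braid x)" g] by (simp add: braid_closed di act_zero)
 qed
qed

lemma derivation_diff: "derivation d \<Longrightarrow> derivation d' \<Longrightarrow> derivation (\<lambda>g. d g - d' g)"
 by (auto simp: derivation_def A_closed act_diff)

lemma derivation_of_nat_mult: "derivation d \<Longrightarrow> derivation (\<lambda>g. of_nat n * d g)"
 by (auto simp: derivation_def A_closed act_of_nat_mult distrib_left)

text \<open>The discrepancy between the two sides of the braid relation for the lifts (0, s1) and
  (0, s2). By \<open>factor_set_coboundaryI\<close> the cocycle is a coboundary if other lifts
  cancel it.\<close>

definition braid_obstruction :: "(braid_gen word set \<Rightarrow> braid_gen word set \<Rightarrow> 'a) \<Rightarrow> 'a"
 where "braid_obstruction f = act s1 (f s2 s1) + f s1 (s2 \<cdot> s1)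
  - (act s2 (f s1 s2) + f s2 (s1 \<cdot> s2))"

lemma factor_set_coboundaryI:
 assumes f: "factor_set f" and a: "a1 \<in> A" "a2 \<in> A"
  and ob: "braid_obstruction f = a2 + act s2 (a1 + act s1 a2) - (a1 + act s1 (a2 + act s2 a1))"
 shows "cochain2 f \<in> B 2"
proof -
 have "a1 + act s1 (a2 + act s2 a1 + f s2 s1) + f s1 (s2 \<cdot> s1)
   = a2 + act s2 (a1 + act s1 a2 + f s1 s2) + f s2 (s1 \<cdot> s2)"
  using ob by (simp add: braid_obstruction_def act_add braid_closed algebra_simps)
 from splitting[OF f a this] obtain e where
  e: "\<And>g. g \<in> carrier B3 \<Longrightarrow> e g \<in> A"
   "\<And>g h. g \<in> carrier B3 \<Longrightarrow> h \<in> carrier B3 \<Longrightarrow> e (g \<cdot> h) = e g + act g (e h) + f g h"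
  by blast
 have "cochain2 f = cochain2 (\<lambda>g h. act g (- e h) - - e (g \<cdot> h) + - e g)"
  unfolding cochain2_eq_iff using e(2) by (simp add: act_uminus)
 then show ?thesis
  unfolding B_2 using e(1) A_uminus by (intro CollectI exI[of _ "\<lambda>g. - e g"]) simp
qed

end

section \<open>The center and the cup product with the abelianization\<close>

lemma subst_xy_subst_xy:
 "subst_xy (subst_xy f u v) u' v' = subst_xy f (subst_xy u u' v') (subst_xy v u' v')"
 by (rule bivariate_hom_eqI[of "\<lambda>f. subst_xy (subst_xy f u v) u' v'"]) (simp_all add: subst_xy_hom)

lemma subst_xy_id: "subst_xy f var_x var_y = f"
 by (rule bivariate_hom_eqI[of "\<lambda>f. subst_xy f var_x var_y"]) (simp_all add: subst_xy_hom)

lemma SL2Z_action_mult: "SL2Z_action (A ** B) f = SL2Z_action A (SL2Z_action B f)"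
 unfolding SL2Z_action_def subst_xy_subst_xy
 by (simp add: subst_xy_hom matrix_matrix_mult_def sum_2 algebra_simps)

lemma SL2Z_action_one: "SL2Z_action (mat 1) f = f"
 by (simp add: SL2Z_action_def mat_def subst_xy_id)

lemma M_component_SL2Z_action: "f \<in> M_component n \<Longrightarrow> SL2Z_action A f \<in> M_component n"
 unfolding SL2Z_action_def
 by (intro M_component_subst_xy M_component_add M_component_of_int_mult M_component_var)

lemma B3_module_M: "B3_module (M_component n) B3_action"
proof -
 interpret B: group_hom B3 SL2Z braid_to_SL2Z
  by (simp add: group_hom_def group_hom_axioms_def group_B3 group_SL2Z braid_to_SL2Z_hom)
 have "B3_action \<one>\<^bsub>B3\<^esub> f = f" for f
  by (simp add: B3_action_def) (simp add: SL2Z_def SL2Z_action_one)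
 moreover have "B3_action (g \<cdot> h) f = B3_action g (B3_action h f)"
  if "g \<in> carrier B3" "h \<in> carrier B3" for g h f
  using that by (simp add: B3_action_def) (simp add: SL2Z_def SL2Z_action_mult)
 moreover have "B3_action g (a + b) = B3_action g a + B3_action g b" for g a b
  by (simp add: B3_action_def SL2Z_action_def subst_xy_add)
 moreover have "B3_action g a \<in> M_component n" if "a \<in> M_component n" for g a
  using that by (simp add: B3_action_def M_component_SL2Z_action)
 ultimately show ?thesis
  by (intro B3_module.intro group_module.intro group_module_axioms.intro group_B3)
    (auto simp: M_component_0 M_component_add M_component_uminus)
qed

lemma B3_action_gen: "B3_action (braid Sigma1) = act1" "B3_action (braid Sigma2) = act2"
 by (auto simp: fun_eq_iff B3_action_def SL2Z_action_def braid_to_SL2Z_braid act1_def act2_def)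

definition braid_v :: "braid_gen word set"
 where "braid_v = braid Sigma1 \<cdot> braid Sigma2"

definition braid_u :: "braid_gen word set"
 where "braid_u = braid_v \<cdot> braid Sigma1"

definition braid_c :: "braid_gen word set"
 where "braid_c = braid_v \<cdot> (braid_v \<cdot> braid_v)"

lemma braid_uvc_closed: "braid_v \<in> carrier B3" "braid_u \<in> carrier B3" "braid_c \<in> carrier B3"
proof -
 interpret group B3 by (rule group_B3)
 show "braid_v \<in> carrier B3" "braid_u \<in> carrier B3" "braid_c \<in> carrier B3"
  by (simp_all add: braid_v_def braid_u_def braid_c_def braid_closed)
qed

lemma braid_u_square: "braid_u \<cdot> braid_u = braid_c"
proof -
 interpret group B3 by (rule group_B3)
 note [simp] = braid_closed m_assoc
 have "braid_u = braid Sigma2 \<cdot> (braid Sigma1 \<cdot> braid Sigma2)"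
  using braid_relation by (simp add: braid_u_def braid_v_def)
 then have "braid_u \<cdot> braid_u
   = (braid_v \<cdot> braid Sigma1) \<cdot> (braid Sigma2 \<cdot> (braid Sigma1 \<cdot> braid Sigma2))"
  unfolding braid_u_def by (rule arg_cong)
 then show ?thesis by (simp add: braid_v_def braid_c_def)
qed

text \<open>Conjugation by u exchanges the generators, so u^2 = c commutes with both.\<close>

lemma braid_u_conj:
 "braid_u \<cdot> braid Sigma1 = braid Sigma2 \<cdot> braid_u"
 "braid_u \<cdot> braid Sigma2 = braid Sigma1 \<cdot> braid_u"
proof -
 interpret group B3 by (rule group_B3)
 note [simp] = braid_closed m_assoc
 have u: "braid_u = braid Sigma1 \<cdot> (braid Sigma2 \<cdot> braid Sigma1)"
  by (simp add: braid_u_def braid_v_def)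
 have u': "braid_u = braid Sigma2 \<cdot> (braid Sigma1 \<cdot> braid Sigma2)"
  using u braid_relation by simp
 have "braid_u \<cdot> braid Sigma1 = braid Sigma2 \<cdot> (braid Sigma1 \<cdot> (braid Sigma2 \<cdot> braid Sigma1))"
  by (simp add: u')
 then show "braid_u \<cdot> braid Sigma1 = braid Sigma2 \<cdot> braid_u"
  by (simp only: u[symmetric])
 have "braid_u \<cdot> braid Sigma2 = braid Sigma1 \<cdot> (braid Sigma2 \<cdot> (braid Sigma1 \<cdot> braid Sigma2))"
  by (simp add: u)
 then show "braid_u \<cdot> braid Sigma2 = braid Sigma1 \<cdot> braid_u"
  by (simp only: u'[symmetric])
qed

lemma braid_c_commute_gen: "braid_c \<cdot> braid x = braid x \<cdot> braid_c"
proof -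
 interpret group B3 by (rule group_B3)
 note [simp] = braid_closed braid_uvc_closed
 have "braid_u \<cdot> (braid_u \<cdot> braid x) = (braid x \<cdot> braid_u) \<cdot> braid_u"
 proof (cases x)
  case Sigma1
  have "braid_u \<cdot> (braid_u \<cdot> braid x) = (braid_u \<cdot> braid Sigma2) \<cdot> braid_u"
   unfolding Sigma1 braid_u_conj(1) by (rule m_assoc[symmetric]) simp_all
  then show ?thesis unfolding Sigma1 braid_u_conj(2) .
 next
  case Sigma2
  have "braid_u \<cdot> (braid_u \<cdot> braid x) = (braid_u \<cdot> braid Sigma1) \<cdot> braid_u"
   unfolding Sigma2 braid_u_conj(2) by (rule m_assoc[symmetric]) simp_all
  then show ?thesis unfolding Sigma2 braid_u_conj(1) .
 qed
 then show ?thesis by (simp add: braid_u_square[symmetric] m_assoc)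
qed

lemma braid_c_central: "g \<in> carrier B3 \<Longrightarrow> braid_c \<cdot> g = g \<cdot> braid_c"
proof (induction rule: B3_induct)
 interpret group B3 by (rule group_B3)
 note [simp] = braid_closed braid_uvc_closed
 {
  case one show ?case by simp
 next
  case (gen x g) then show ?case by (metis braid_c_commute_gen m_assoc braid_closed braid_uvc_closed(3))
 next
  case (inv x g)
  have "braid_c \<cdot> inv\<^bsub>B3\<^esub> (braid x) = inv\<^bsub>B3\<^esub> (braid x) \<cdot> braid_c"
   using braid_c_commute_gen[of x]
   by (metis braid_closed braid_uvc_closed(3) inv_closed inv_solve_left inv_solve_right m_closed m_assoc)
  then show ?case using inv by (metis m_assoc braid_closed braid_uvc_closed(3) inv_closed)
 }
qed

section \<open>The abelianization and the cup product with it\<close>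

lemma exists_exponent_sum:
 "\<exists>\<epsilon> :: braid_gen word set \<Rightarrow> int. \<epsilon> \<in> hom B3 integer_group \<and> (\<forall>x. \<epsilon> (braid x) = 1)"
proof -
 have "(\<lambda>_. 1) Sigma1 \<otimes>\<^bsub>integer_group\<^esub> ((\<lambda>_. 1) Sigma2 \<otimes>\<^bsub>integer_group\<^esub> (\<lambda>_. 1) Sigma1)
  = (\<lambda>_. 1) Sigma2 \<otimes>\<^bsub>integer_group\<^esub> ((\<lambda>_. 1) Sigma1 \<otimes>\<^bsub>integer_group\<^esub> (\<lambda>_. 1) Sigma2)" by simp
 then show ?thesis using presented_hom_B3[of integer_group "\<lambda>_. 1"] by auto
qed

definition exponent_sum :: "braid_gen word set \<Rightarrow> int"
 where "exponent_sum = (SOME \<epsilon>. \<epsilon> \<in> hom B3 integer_group \<and> (\<forall>x. \<epsilon> (braid x) = 1))"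

lemma exponent_sum_hom: "exponent_sum \<in> hom B3 integer_group"
 and exponent_sum_braid: "exponent_sum (braid x) = 1"
 using someI_ex[OF exists_exponent_sum] unfolding exponent_sum_def by auto

lemma exponent_sum_mult:
 "g \<in> carrier B3 \<Longrightarrow> h \<in> carrier B3 \<Longrightarrow> exponent_sum (g \<cdot> h) = exponent_sum g + exponent_sum h"
 using hom_mult[OF exponent_sum_hom] by simp

text \<open>c is a product of six generators; this number becomes the factor between the cup product
  and the contraction.\<close>

lemma exponent_sum_c: "exponent_sum braid_c = 6"
proof -
 interpret group B3 by (rule group_B3)
 show ?thesis
  by (simp add: braid_c_def braid_v_def exponent_sum_mult exponent_sum_braid braid_closed)
qed

context B3_module
begin

text \<open>The cup product of the homomorphism \<open>exponent_sum\<close>, as a class with integer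
  coefficients, with d, on the level of cochains.\<close>

definition chi_cup :: "(braid_gen word set \<Rightarrow> 'a) \<Rightarrow> braid_gen word set \<Rightarrow> braid_gen word set \<Rightarrow> 'a"
 where "chi_cup d g h = of_int (exponent_sum g) * act g (d h)"

lemma factor_set_chi_cup:
 assumes d: "derivation d"
 shows "factor_set (chi_cup d)"
 unfolding factor_set_def
proof (intro conjI ballI)
 fix g h assume gh: "g \<in> carrier B3" "h \<in> carrier B3"
 then have "d h \<in> A" using d by (simp add: derivation_def)
 then show "chi_cup d g h \<in> A" unfolding chi_cup_def using gh by (intro A_closed)
 fix k assume k: "k \<in> carrier B3"
 have "d (h \<cdot> k) = d h + act h (d k)" using d gh k by (simp add: derivation_def)
 then show "act g (chi_cup d h k) + chi_cup d g (h \<cdot> k) = chi_cup d (g \<cdot> h) k + chi_cup d g h"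
  using gh k by (simp add: chi_cup_def act_simps act_mult exponent_sum_mult algebra_simps)
qed

lemma chi_cup_principal:
 assumes a: "a \<in> A"
 shows "cochain2 (chi_cup (\<lambda>g. act g a - a)) \<in> B 2"
proof -
 \<comment> \<open>Up to sign, e is the cup product of \<open>exponent_sum\<close> with the
   0-cochain a.\<close>
 define e where "e g = - (of_int (exponent_sum g) * act g a)" for g
 have "cochain2 (chi_cup (\<lambda>g. act g a - a)) = cochain2 (\<lambda>g h. act g (e h) - e (g \<cdot> h) + e g)"
  unfolding cochain2_eq_iff
  by (auto simp: chi_cup_def e_def act_simps act_mult exponent_sum_mult algebra_simps)
 moreover have "\<forall>g\<in>carrier B3. e g \<in> A" using a by (auto simp: e_def A_closed)
 ultimately show ?thesis unfolding B_2 by blast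
qed

end

text \<open>Satisfied by the forms of even degree k > 0 in x and y, see
  \<open>B3_module_trivial_center_M\<close>.\<close>

locale B3_module_trivial_center = B3_module +
 assumes act_c: "a \<in> A \<Longrightarrow> act braid_c a = a"
  and no_invariants: "a \<in> A \<Longrightarrow> act s1 a = a \<Longrightarrow> act s2 a = a \<Longrightarrow> a = 0"
begin

text \<open>Since c acts trivially, \<open>derivation_central\<close> makes d c invariant.\<close>

lemma derivation_c:
 assumes d: "derivation d"
 shows "d braid_c = 0"
proof (rule no_invariants)
 have dA: "d g \<in> A" if "g \<in> carrier B3" for g using d that by (simp add: derivation_def)
 show "d braid_c \<in> A" by (simp add: dA braid_uvc_closed)
 have "act g (d braid_c) = d braid_c" if g: "g \<in> carrier B3" for g
  using derivation_central[OF d braid_uvc_closed(3) braid_c_central g] act_c[OF dA[OF g]] by simp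
 then show "act s1 (d braid_c) = d braid_c" "act s2 (d braid_c) = d braid_c"
  by (simp_all add: braid_closed)
qed

text \<open>At g the contraction is 6 c d(g) minus a multiple of g d(c); here d(c) = 0 and c acts
  trivially.\<close>

lemma contraction_chi_cup:
 assumes d: "derivation d" and g: "g \<in> carrier B3"
 shows "contraction braid_c (chi_cup d) g = 6 * d g"
proof -
 have "d g \<in> A" using d g by (simp add: derivation_def)
 then show ?thesis
  using act_c by (simp add: contraction_def chi_cup_def derivation_c[OF d] exponent_sum_c act_zero g)
qed

lemma derivation_contraction:
 assumes f: "factor_set f"
 shows "derivation (contraction braid_c f)"
 unfolding derivation_def
proof (intro conjI ballI)
 fix g h assume gh: "g \<in> carrier B3" "h \<in> carrier B3"
 show "contraction braid_c f g \<in> A" by (rule contraction_closed[OF f braid_uvc_closed(3) gh(1)])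
 have "f g h \<in> A" using f gh by (simp add: factor_set_def)
 then show "contraction braid_c f (g \<cdot> h) = contraction braid_c f g + act g (contraction braid_c f h)"
  using contraction_homotopy[OF f braid_uvc_closed(3) braid_c_central gh] act_c
  by (simp add: algebra_simps)
qed

lemma contraction_coboundary:
 assumes d: "\<And>g. g \<in> carrier B3 \<Longrightarrow> d g \<in> A" and g: "g \<in> carrier B3"
 shows "contraction braid_c (\<lambda>g h. act g (d h) - d (g \<cdot> h) + d g) g = act g (- d braid_c) - - d braid_c"
 using act_c[OF d[OF g]] by (simp add: contraction_def braid_c_central[OF g] act_uminus g)

lemma act_u_u: "a \<in> A \<Longrightarrow> act braid_u (act braid_u a) = a"
 using act_mult[OF braid_uvc_closed(2) braid_uvc_closed(2), of a] by (simp add: braid_u_square act_c)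

lemma act_v_v_v: "a \<in> A \<Longrightarrow> act braid_v (act braid_v (act braid_v a)) = a"
proof -
 interpret group B3 by (rule group_B3)
 assume "a \<in> A"
 then show ?thesis
  using act_mult[of braid_v "braid_v \<cdot> braid_v" a] act_mult[of braid_v braid_v a] act_c
  by (simp add: braid_c_def[symmetric] braid_uvc_closed)
qed

lemma act_inv: "g \<in> carrier B3 \<Longrightarrow> act g (act (inv\<^bsub>B3\<^esub> g) a) = a" "g \<in> carrier B3 \<Longrightarrow> act (inv\<^bsub>B3\<^esub> g) (act g a) = a"
 by (simp_all add: act_mult[symmetric] act_one)

lemma act_v: "act braid_v a = act s1 (act s2 a)"
 and act_u: "act braid_u a = act s1 (act s2 (act s1 a))"
 by (simp_all add: braid_u_def braid_v_def act_mult braid_closed)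

text \<open>The derivations with \<open>d v = 0\<close>: these correspond to \<open>d u = \<beta>\<close> with \<open>(1 + u) \<beta> = 0\<close>.\<close>

lemma derivation_vanishing_on_v:
 assumes b: "b \<in> A" "act braid_u b = - b"
 obtains d where "derivation d" "d braid_v = 0" "d braid_u = b"
  "d s1 = - act s1 b" "d s2 = b"
proof -
 have u: "act s1 (act s2 (act s1 b)) = - b" using b(2) by (simp add: act_u)
 have a: "- act s1 b \<in> A" "b \<in> A" using b by (auto simp: A_closed braid_closed)
 have "- act s1 b + act s1 (b + act s2 (- act s1 b)) = b + act s2 (- act s1 b + act s1 b)"
  by (simp add: act_simps braid_closed u)
 then obtain d where d: "derivation d" "d s1 = - act s1 b" "d s2 = b"
  by (rule derivation_exists[OF a])
 have dm: "d (g \<cdot> h) = d g + act g (d h)" if "g \<in> carrier B3" "h \<in> carrier B3" for g h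
  using d(1) that by (auto simp: derivation_def)
 have "d braid_v = 0" by (simp add: braid_v_def dm braid_closed d)
 moreover have "d braid_u = b"
  using calculation by (simp add: braid_u_def dm braid_closed braid_uvc_closed d act_v act_uminus u)
 ultimately show thesis using that[of d] d by simp
qed

text \<open>The lifts (- s1 t, t) show that t + u t is the obstruction of a coboundary, so up to
  coboundaries u acts as -1 on obstructions and b = a - u a stands for 2 a. The derivation with
  value b on u is the preimage to try for 6 f.\<close>

lemma six_factor_set:
 assumes f: "factor_set f"
 obtains d where "derivation d" "cochain2 (\<lambda>g h. of_nat 6 * f g h - chi_cup d g h) \<in> B 2"
proof -
 define a where "a = braid_obstruction f"
 have fA: "f g h \<in> A" if "g \<in> carrier B3" "h \<in> carrier B3" for g h
  using f that by (simp add: factor_set_def)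
 have a: "a \<in> A" unfolding a_def braid_obstruction_def
  by (intro A_closed fA braid_closed m_closed)
 define b where "b = a - act braid_u a"
 have b: "b \<in> A" "act braid_u b = - b"
  using a by (auto simp: b_def A_closed braid_uvc_closed act_diff act_u_u)
 obtain d where d: "derivation d" "d braid_v = 0" "d braid_u = b" "d s1 = - act s1 b" "d s2 = b"
  by (rule derivation_vanishing_on_v[OF b])
 have dm: "d (g \<cdot> h) = d g + act g (d h)" if "g \<in> carrier B3" "h \<in> carrier B3" for g h
  using d(1) that by (auto simp: derivation_def)
 define F where "F = (\<lambda>g h. of_nat 6 * f g h - chi_cup d g h)"
 have F: "factor_set F"
  unfolding factor_set_def
 proof (intro conjI ballI)
  fix g h assume gh: "g \<in> carrier B3" "h \<in> carrier B3"
  have "chi_cup d g h \<in> A" using factor_set_chi_cup[OF d(1)] gh by (simp add: factor_set_def)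
  then show "F g h \<in> A" unfolding F_def using fA[OF gh] by (intro A_closed)
  fix k assume k: "k \<in> carrier B3"
  have "act g (f h k) + f g (h \<cdot> k) = f (g \<cdot> h) k + f g h"
   using f gh k by (simp add: factor_set_def)
  then have "of_nat 6 * (act g (f h k) + f g (h \<cdot> k)) = of_nat 6 * (f (g \<cdot> h) k + f g h)"
   by (rule arg_cong)
  moreover have "act g (chi_cup d h k) + chi_cup d g (h \<cdot> k) = chi_cup d (g \<cdot> h) k + chi_cup d g h"
   using factor_set_chi_cup[OF d(1)] gh k by (simp add: factor_set_def)
  ultimately show "act g (F h k) + F g (h \<cdot> k) = F (g \<cdot> h) k + F g h"
   unfolding F_def act_diff[OF gh(1)] act_of_nat_mult[OF gh(1)] distrib_left
   by (simp add: algebra_simps)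
 qed
 have u: "act s1 (act s2 (act s1 b)) = - b" using b(2) by (simp add: act_u)
 have obF: "braid_obstruction F = of_nat 6 * a - braid_obstruction (chi_cup d)"
  unfolding a_def F_def braid_obstruction_def
  by (simp only: act_diff act_of_nat_mult braid_closed) (simp add: algebra_simps)
 have obc: "braid_obstruction (chi_cup d) = 2 * b + act s1 b - act s2 (act s1 b)"
  by (simp add: braid_obstruction_def chi_cup_def exponent_sum_braid exponent_sum_mult braid_closed
    act_simps dm d(4,5) u algebra_simps)
 \<comment> \<open>The lifts (- s1 t, t) contribute t + u t = 2 t - 3 b, and the extra b in the
   second lift contributes b - s1 b + s2 s1 b. Together this is 6 a minus the obstruction of
   \<open>chi_cup d\<close>.\<close>
 define t where "t = of_nat 3 * a"
 define c1 where "c1 = - act s1 t"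
 define c2 where "c2 = t + b"
 have c: "c1 \<in> A" "c2 \<in> A"
  unfolding c1_def c2_def t_def by (intro A_closed a b braid_closed)+
 have "act braid_u t = of_nat 3 * act braid_u a"
  unfolding t_def by (rule act_of_nat_mult[OF braid_uvc_closed(2)])
 also have "\<dots> = t - (b + b + b)" by (simp add: b_def t_def algebra_simps)
 finally have ut: "act s1 (act s2 (act s1 t)) = t - (b + b + b)" by (simp add: act_u)
 have "braid_obstruction F = t + t - braid_obstruction (chi_cup d)"
  unfolding obF t_def by simp
 also have "\<dots> = c2 + act s2 (c1 + act s1 c2) - (c1 + act s1 (c2 + act s2 c1))"
  unfolding obc by (simp add: c1_def c2_def act_simps braid_closed ut algebra_simps)
 finally have "braid_obstruction F = c2 + act s2 (c1 + act s1 c2) - (c1 + act s1 (c2 + act s2 c1))" .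
 then have "cochain2 F \<in> B 2" by (rule factor_set_coboundaryI[OF F c])
 then show thesis using that[OF d(1)] by (simp add: F_def)
qed

end

section \<open>Passage to cohomology classes\<close>

lemma quotient_hom:
 assumes G: "comm_group G" "subgroup N G" and G': "comm_group G'" "subgroup N' G'"
  and f: "f \<in> hom G G'" "f ` N \<subseteq> N'"
 obtains F where "F \<in> hom (G Mod N) (G' Mod N')" "\<And>x. x \<in> carrier G \<Longrightarrow> F (N #>\<^bsub>G\<^esub> x) = N' #>\<^bsub>G'\<^esub> f x"
proof -
 interpret G: comm_group G by (rule G)
 interpret G': comm_group G' by (rule G')
 interpret f: group_hom G G' f by (simp add: group_hom_def group_hom_axioms_def G.group_axioms G'.group_axioms f)
 have N: "N \<lhd> G" "N' \<lhd> G'" using G G' by (simp_all add: comm_group.normal_iff_subgroup)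
 have "(\<lambda>y. N' #>\<^bsub>G'\<^esub> y) \<in> hom G' (G' Mod N')" using N(2) by (rule normal.r_coset_hom_Mod)
 then have q: "(\<lambda>y. N' #>\<^bsub>G'\<^esub> y) \<circ> f \<in> hom G (G' Mod N')"
  using f(1) by (auto simp: hom_def Pi_def)
 show thesis
 proof (rule FactGroup_universal[OF q N(1)])
  fix x y assume xy: "x \<in> carrier G" "y \<in> carrier G" "N #>\<^bsub>G\<^esub> x = N #>\<^bsub>G\<^esub> y"
  then have "x \<otimes>\<^bsub>G\<^esub> inv\<^bsub>G\<^esub> y \<in> N" using G.rcos_eq_iff[OF G(2)] by simp
  then have "f (x \<otimes>\<^bsub>G\<^esub> inv\<^bsub>G\<^esub> y) \<in> N'" using f(2) by auto
  then have "f x \<otimes>\<^bsub>G'\<^esub> inv\<^bsub>G'\<^esub> f y \<in> N'" using xy by simp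
  then show "((\<lambda>y. N' #>\<^bsub>G'\<^esub> y) \<circ> f) x = ((\<lambda>y. N' #>\<^bsub>G'\<^esub> y) \<circ> f) y"
   using xy G'.rcos_eq_iff[OF G'(2)] by simp
 qed (use that in auto)
qed

lemma (in comm_group) rcos_pow:
 assumes "subgroup N G" "x \<in> carrier G"
 shows "(N #> x) [^]\<^bsub>G Mod N\<^esub> (k :: nat) = N #> (x [^] k)"
proof -
 interpret normal N G using assms by (simp add: normal_iff_subgroup)
 show ?thesis using assms by (rule_tac FactGroup_pow)
qed

lemma (in comm_group) rcos_eq_one_iff:
 assumes "subgroup N G" "x \<in> carrier G"
 shows "N #> x = N \<longleftrightarrow> x \<in> N"
 using assms rcos_eq_iff[of N x \<one>] coset_mult_one[OF subgroup.subset[OF assms(1)]] by simp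

context group_module
begin

lemma cochain1_app: "g \<in> carrier G \<Longrightarrow> cochain1 d [g] = d g"
 and cochain2_app: "g \<in> carrier G \<Longrightarrow> h \<in> carrier G \<Longrightarrow> cochain2 f [g, h] = f g h"
 by (simp_all add: cochain1_def cochain2_def)

lemma cochain1_cong: "(\<And>g. g \<in> carrier G \<Longrightarrow> d g = d' g) \<Longrightarrow> cochain1 d = cochain1 d'"
 and cochain2_cong: "(\<And>g h. g \<in> carrier G \<Longrightarrow> h \<in> carrier G \<Longrightarrow> f g h = f' g h) \<Longrightarrow> cochain2 f = cochain2 f'"
 by (simp_all add: cochain1_eq_iff cochain2_eq_iff)

lemma cochain1_add: "cochain1 (\<lambda>g. d g + d' g) = (\<lambda>gs. cochain1 d gs + cochain1 d' gs)"
 and cochain2_add: "cochain2 (\<lambda>g h. f g h + f' g h) = (\<lambda>gs. cochain2 f gs + cochain2 f' gs)"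
 and cochain1_minus: "cochain1 (\<lambda>g. d g - d' g) = (\<lambda>gs. cochain1 d gs - cochain1 d' gs)"
 and cochain2_minus: "cochain2 (\<lambda>g h. f g h - f' g h) = (\<lambda>gs. cochain2 f gs - cochain2 f' gs)"
 and cochain1_mult: "cochain1 (\<lambda>g. k * d g) = (\<lambda>gs. k * cochain1 d gs)"
 and cochain2_mult: "cochain2 (\<lambda>g h. k * f g h) = (\<lambda>gs. k * cochain2 f gs)"
 by (auto simp: cochain1_def cochain2_def fun_eq_iff)

lemma Z1_cases:
 assumes "x \<in> carrier (Z 1)"
 obtains d where "x = cochain1 d" "derivation d"
 using assms unfolding carrier_Z1 by blast

lemma Z2_cases:
 assumes "x \<in> carrier (Z 2)"
 obtains f where "x = cochain2 f" "factor_set f"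
 using assms unfolding carrier_Z2 by blast

lemma carrier_H: "carrier (H n) = (\<lambda>x. B n #>\<^bsub>Z n\<^esub> x) ` carrier (Z n)"
 by (simp add: group_cohomology_def carrier_FactGroup)

lemma one_H: "\<one>\<^bsub>H n\<^esub> = B n"
 by (simp add: group_cohomology_def)

lemma subgroup_B: "n = 1 \<or> n = 2 \<Longrightarrow> subgroup (B n) (Z n)"
 using subgroup_B1 subgroup_B2 by auto

lemma class_eq_iff:
 assumes n: "n = 1 \<or> n = 2" and x: "x \<in> carrier (Z n)" and y: "y \<in> carrier (Z n)"
 shows "B n #>\<^bsub>Z n\<^esub> x = B n #>\<^bsub>Z n\<^esub> y \<longleftrightarrow> (\<lambda>gs. x gs - y gs) \<in> B n"
 using comm_group.rcos_eq_iff[OF comm_group_Z subgroup_B[OF n] x y] inv_Z[OF y] by simp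

lemma class_eq_one_iff:
 assumes "n = 1 \<or> n = 2" "x \<in> carrier (Z n)"
 shows "B n #>\<^bsub>Z n\<^esub> x = \<one>\<^bsub>H n\<^esub> \<longleftrightarrow> x \<in> B n"
 using comm_group.rcos_eq_one_iff[OF comm_group_Z subgroup_B] assms by (simp add: one_H)

lemma class_pow:
 assumes "n = 1 \<or> n = 2" "x \<in> carrier (Z n)"
 shows "(B n #>\<^bsub>Z n\<^esub> x) [^]\<^bsub>H n\<^esub> (k :: nat) = B n #>\<^bsub>Z n\<^esub> (\<lambda>gs. of_nat k * x gs)"
 unfolding group_cohomology_def
 using comm_group.rcos_pow[OF comm_group_Z subgroup_B] assms by (simp add: pow_Z)

lemma class_mult:
 assumes "n = 1 \<or> n = 2" "x \<in> carrier (Z n)" "y \<in> carrier (Z n)"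
 shows "(B n #>\<^bsub>Z n\<^esub> x) \<otimes>\<^bsub>H n\<^esub> (B n #>\<^bsub>Z n\<^esub> y) = B n #>\<^bsub>Z n\<^esub> (\<lambda>gs. x gs + y gs)"
proof -
 have "B n \<lhd> Z n" using subgroup_B[OF assms(1)] by (simp add: comm_group.normal_iff_subgroup comm_group_Z)
 from normal.rcos_sum[OF this assms(2,3)] show ?thesis by (simp add: group_cohomology_def)
qed

lemma principal_in_B1: "a \<in> A \<Longrightarrow> cochain1 (\<lambda>g. act g a - a) \<in> B 1"
 unfolding B_1 by blast

lemma coboundary_in_B2:
 "(\<And>g. g \<in> carrier G \<Longrightarrow> d g \<in> A) \<Longrightarrow> cochain2 (\<lambda>g h. act g (d h) - d (g \<otimes> h) + d g) \<in> B 2"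
 unfolding B_2 by blast

end

context B3_module
begin

text \<open>The homotopies make c z - z a coboundary for every cocycle z, and here c z - z = -2
  z.\<close>

lemma negative_center_torsion:
 assumes c: "\<And>a. a \<in> A \<Longrightarrow> act braid_c a = - a" and n: "n = 1 \<or> n = 2" and x: "x \<in> carrier (H n)"
 shows "x [^]\<^bsub>H n\<^esub> (2 :: nat) = \<one>\<^bsub>H n\<^esub>"
proof -
 obtain z where z: "z \<in> carrier (Z n)" "x = B n #>\<^bsub>Z n\<^esub> z" using x by (auto simp: carrier_H)
 have sZ: "(\<lambda>gs. of_nat 2 * z gs) \<in> carrier (Z n)"
  using monoid.nat_pow_closed[of "Z n" z 2] z(1) comm_group_Z[of n]
  by (simp only: pow_Z comm_group_def comm_monoid_def)
 have "(\<lambda>gs. of_nat 2 * z gs) \<in> B n"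
 proof (cases "n = 1")
  case True
  obtain d where d: "z = cochain1 d" "derivation d" using z(1) unfolding True by (rule Z1_cases)
  have dA: "d g \<in> A" if "g \<in> carrier B3" for g using d(2) that by (simp add: derivation_def)
  have "(\<lambda>gs. of_nat 2 * z gs) = cochain1 (\<lambda>g. act g (- d braid_c) - - d braid_c)"
   unfolding d(1) cochain1_mult[symmetric]
  proof (rule cochain1_cong)
   fix g assume g: "g \<in> carrier B3"
   have "act g (d braid_c) - d braid_c = - d g - d g"
    using derivation_central[OF d(2) braid_uvc_closed(3) braid_c_central g] c[OF dA[OF g]] by simp
   then have "d braid_c - act g (d braid_c) = d g + d g" by (metis minus_diff_eq minus_add_distrib minus_minus diff_conv_add_uminus)
   then show "of_nat 2 * d g = act g (- d braid_c) - - d braid_c"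
    by (simp add: act_uminus g)
  qed
  then show ?thesis unfolding True using principal_in_B1[of "- d braid_c"] dA[OF braid_uvc_closed(3)] A_uminus
   by simp
 next
  case False
  then have n: "n = 2" using n by simp
  obtain f where f: "z = cochain2 f" "factor_set f" using z(1) unfolding n by (rule Z2_cases)
  define e where "e g = - contraction braid_c f g" for g
  have eA: "e g \<in> A" if "g \<in> carrier B3" for g
   unfolding e_def by (intro A_uminus contraction_closed f(2) braid_uvc_closed that)
  have "(\<lambda>gs. of_nat 2 * z gs) = cochain2 (\<lambda>g h. act g (e h) - e (g \<cdot> h) + e g)"
   unfolding f(1) cochain2_mult[symmetric]
  proof (rule cochain2_cong)
   fix g h assume gh: "g \<in> carrier B3" "h \<in> carrier B3"
   have "f g h \<in> A" using f(2) gh by (simp add: factor_set_def)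
   then have e2: "- f g h - f g h = act g (contraction braid_c f h) - contraction braid_c f (g \<cdot> h) + contraction braid_c f g"
    using contraction_homotopy[OF f(2) braid_uvc_closed(3) braid_c_central gh] c by simp
   have "of_nat 2 * f g h = - (- f g h - f g h)" by simp
   then show "of_nat 2 * f g h = act g (e h) - e (g \<cdot> h) + e g"
    unfolding e2 by (simp add: e_def act_uminus gh)
  qed
  then show ?thesis unfolding n using coboundary_in_B2[of e] eA by simp
 qed
 then show ?thesis
  unfolding z(2) class_pow[OF n z(1)] by (rule class_eq_one_iff[OF n sZ, THEN iffD2])
qed

end

context B3_module_trivial_center
begin

text \<open>The last property only says that sixth powers lie in the image of the cup product; this
  is the form in which \<open>six_factor_set\<close> provides it and in which transfer of torsion
  and rank can use it.\<close>

lemma cup_and_contraction: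
 obtains \<Phi> \<Psi> where "\<Phi> \<in> hom (H 1) (H 2)" "\<Psi> \<in> hom (H 2) (H 1)"
  "\<And>x. x \<in> carrier (H 1) \<Longrightarrow> \<Psi> (\<Phi> x) = x [^]\<^bsub>H 1\<^esub> (6 :: nat)"
  "\<And>y. y \<in> carrier (H 2) \<Longrightarrow> \<exists>x\<in>carrier (H 1). y [^]\<^bsub>H 2\<^esub> (6 :: nat) = \<Phi> x"
proof -
 define \<Phi>0 where "\<Phi>0 x = cochain2 (chi_cup (\<lambda>g. x [g]))" for x :: "braid_gen word set list \<Rightarrow> 'a"
 define \<Psi>0 where "\<Psi>0 y = cochain1 (contraction braid_c (\<lambda>g h. y [g, h]))" for y :: "braid_gen word set list \<Rightarrow> 'a"
 have Phi0: "\<Phi>0 (cochain1 d) = cochain2 (chi_cup d)" for d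
  unfolding \<Phi>0_def by (rule cochain2_cong) (simp add: chi_cup_def cochain1_app)
 have Psi0: "\<Psi>0 (cochain2 f) = cochain1 (contraction braid_c f)" for f
  unfolding \<Psi>0_def by (rule cochain1_cong) (simp add: contraction_def cochain2_app braid_uvc_closed)
 have hPhi: "\<Phi>0 \<in> hom (Z 1) (Z 2)"
 proof (rule homI)
  fix x assume "x \<in> carrier (Z 1)"
  then obtain d where d: "x = cochain1 d" "derivation d" by (rule Z1_cases)
  then show "\<Phi>0 x \<in> carrier (Z 2)" using factor_set_chi_cup by (simp add: Phi0 carrier_Z2)
  fix y assume "y \<in> carrier (Z 1)"
  then obtain d' where d': "y = cochain1 d'" "derivation d'" by (rule Z1_cases)
  have "\<Phi>0 (x \<otimes>\<^bsub>Z 1\<^esub> y) = cochain2 (chi_cup (\<lambda>g. d g + d' g))"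
   by (simp add: d d' cochain1_add[symmetric] Phi0 del: One_nat_def)
  also have "\<dots> = cochain2 (\<lambda>g h. chi_cup d g h + chi_cup d' g h)"
   by (rule cochain2_cong) (simp add: chi_cup_def act_add distrib_left)
  finally show "\<Phi>0 (x \<otimes>\<^bsub>Z 1\<^esub> y) = \<Phi>0 x \<otimes>\<^bsub>Z 2\<^esub> \<Phi>0 y" by (simp add: d d' Phi0 cochain2_add)
 qed
 have hPsi: "\<Psi>0 \<in> hom (Z 2) (Z 1)"
 proof (rule homI)
  fix x assume "x \<in> carrier (Z 2)"
  then obtain d where d: "x = cochain2 d" "factor_set d" by (rule Z2_cases)
  then show "\<Psi>0 x \<in> carrier (Z 1)" using derivation_contraction by (simp only: Psi0 carrier_Z1) blast
  fix y assume "y \<in> carrier (Z 2)"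
  then obtain d' where d': "y = cochain2 d'" "factor_set d'" by (rule Z2_cases)
  have "\<Psi>0 (x \<otimes>\<^bsub>Z 2\<^esub> y) = cochain1 (contraction braid_c (\<lambda>g h. d g h + d' g h))"
   by (simp add: d d' cochain2_add[symmetric] Psi0)
  also have "\<dots> = cochain1 (\<lambda>g. contraction braid_c d g + contraction braid_c d' g)"
   by (rule cochain1_cong) (simp add: contraction_def)
  finally show "\<Psi>0 (x \<otimes>\<^bsub>Z 2\<^esub> y) = \<Psi>0 x \<otimes>\<^bsub>Z 1\<^esub> \<Psi>0 y" by (simp add: d d' Psi0 cochain1_add)
 qed
 have bPhi: "\<Phi>0 ` B 1 \<subseteq> B 2"
  unfolding B_1 using chi_cup_principal by (auto simp: Phi0)
 have bPsi: "\<Psi>0 ` B 2 \<subseteq> B 1"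
 proof
  fix y assume "y \<in> \<Psi>0 ` B 2"
  then obtain d where d: "y = \<Psi>0 (cochain2 (\<lambda>g h. act g (d h) - d (g \<cdot> h) + d g))" "\<forall>g\<in>carrier B3. d g \<in> A"
   unfolding B_2 by blast
  have "y = cochain1 (\<lambda>g. act g (- d braid_c) - - d braid_c)"
   unfolding d(1) Psi0 using d(2) by (intro cochain1_cong contraction_coboundary) auto
  then show "y \<in> B 1" using principal_in_B1[of "- d braid_c"] d(2) A_uminus braid_uvc_closed(3) by simp
 qed
 obtain \<Phi> where Phi: "\<Phi> \<in> hom (H 1) (H 2)" "\<And>x. x \<in> carrier (Z 1) \<Longrightarrow> \<Phi> (B 1 #>\<^bsub>Z 1\<^esub> x) = B 2 #>\<^bsub>Z 2\<^esub> \<Phi>0 x"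
  using quotient_hom[OF comm_group_Z subgroup_B1 comm_group_Z subgroup_B2 hPhi bPhi]
  unfolding group_cohomology_def by blast
 obtain \<Psi> where Psi: "\<Psi> \<in> hom (H 2) (H 1)" "\<And>x. x \<in> carrier (Z 2) \<Longrightarrow> \<Psi> (B 2 #>\<^bsub>Z 2\<^esub> x) = B 1 #>\<^bsub>Z 1\<^esub> \<Psi>0 x"
  using quotient_hom[OF comm_group_Z subgroup_B2 comm_group_Z subgroup_B1 hPsi bPsi]
  unfolding group_cohomology_def by blast
 show thesis
 proof (rule that[OF Phi(1) Psi(1)])
  fix x assume "x \<in> carrier (H 1)"
  then obtain z where z: "z \<in> carrier (Z 1)" "x = B 1 #>\<^bsub>Z 1\<^esub> z" by (auto simp: carrier_H)
  obtain d where d: "z = cochain1 d" "derivation d" using z(1) by (rule Z1_cases)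
  have "\<Psi>0 (\<Phi>0 z) = (\<lambda>gs. of_nat 6 * z gs)"
   unfolding d(1) Phi0 Psi0 cochain1_mult[symmetric]
   by (rule cochain1_cong) (simp add: contraction_chi_cup[OF d(2)])
  then show "\<Psi> (\<Phi> x) = x [^]\<^bsub>H 1\<^esub> (6 :: nat)"
   unfolding z(2) Phi(2)[OF z(1)] Psi(2)[OF hom_in_carrier[OF hPhi z(1)]] by (subst class_pow) (use z in auto)
 next
  fix y assume "y \<in> carrier (H 2)"
  then obtain z where z: "z \<in> carrier (Z 2)" "y = B 2 #>\<^bsub>Z 2\<^esub> z" by (auto simp: carrier_H)
  obtain f where f: "z = cochain2 f" "factor_set f" using z(1) by (rule Z2_cases)
  obtain d where d: "derivation d" "cochain2 (\<lambda>g h. of_nat 6 * f g h - chi_cup d g h) \<in> B 2"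
   by (rule six_factor_set[OF f(2)])
  have dZ: "cochain1 d \<in> carrier (Z 1)" using d(1) by (simp only: carrier_Z1) blast
  have sZ: "(\<lambda>gs. of_nat 6 * z gs) \<in> carrier (Z 2)"
   using monoid.nat_pow_closed[of "Z 2" z 6] z(1) comm_group_Z[of 2]
   by (simp only: pow_Z comm_group_def comm_monoid_def)
  have "(\<lambda>gs. of_nat 6 * z gs - \<Phi>0 (cochain1 d) gs) \<in> B 2"
   using d(2) unfolding f(1) Phi0 cochain2_minus cochain2_mult .
  then have "y [^]\<^bsub>H 2\<^esub> (6 :: nat) = \<Phi> (B 1 #>\<^bsub>Z 1\<^esub> cochain1 d)"
   unfolding z(2) Phi(2)[OF dZ] using class_pow[OF _ z(1), of 6] class_eq_iff[OF _ sZ hom_in_carrier[OF hPhi dZ]] by simp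
  then show "\<exists>x\<in>carrier (H 1). y [^]\<^bsub>H 2\<^esub> (6 :: nat) = \<Phi> x"
   unfolding carrier_H using dZ by blast
 qed
qed

end

text \<open>v acts by x -> x - y and y -> x, and the cube of this substitution is -1.\<close>

lemma act_c_M:
 assumes "f \<in> M_component (2 * k)"
 shows "B3_action braid_c f = (- 1) ^ k * f"
proof -
 interpret B3_module "M_component (2 * k)" B3_action by (rule B3_module_M)
 have v: "B3_action braid_v f = subst_xy f (var_x - var_y) var_x" for f
  by (simp add: braid_v_def act_mult braid_closed B3_action_gen act1_def act2_def subst_xy_subst_xy subst_xy_hom)
 have "B3_action braid_c f = B3_action braid_v (B3_action braid_v (B3_action braid_v f))"
  by (simp add: braid_c_def act_mult braid_uvc_closed)
 also have "\<dots> = subst_xy f (- var_x) (- var_y)"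
  by (simp add: v subst_xy_subst_xy subst_xy_hom)
 also have "\<dots> = (\<Sum>i\<le>degree f. (\<Sum>j\<le>degree (coeff f i). of_int (coeff (coeff f i) j) * (- var_y) ^ j) * (- var_x) ^ i)"
  by (simp add: subst_xy_def poly_map_poly_altdef)
 also have "\<dots> = (\<Sum>i\<le>degree f. (\<Sum>j\<le>degree (coeff f i). (- 1) ^ k * (of_int (coeff (coeff f i) j) * var_y ^ j)) * var_x ^ i)"
  unfolding sum_distrib_right
 proof (intro sum.cong HOL.refl)
  fix i j
  show "of_int (coeff (coeff f i) j) * (- var_y) ^ j * (- var_x) ^ i
    = (- 1) ^ k * (of_int (coeff (coeff f i) j) * var_y ^ j) * var_x ^ i"
  proof (cases "coeff (coeff f i) j = 0")
   case False
   then have "k = j + i" using M_componentD[OF assms False] by simp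
   then show ?thesis by (simp add: power_minus[of var_x] power_minus[of var_y] power_add mult_ac)
  qed simp
 qed
 also have "\<dots> = (- 1) ^ k * subst_xy f var_x var_y"
  by (simp add: subst_xy_def poly_map_poly_altdef sum_distrib_left sum_distrib_right mult.assoc)
 finally show ?thesis by (simp add: subst_xy_id)
qed

lemma periodic_poly_const:
 fixes g :: "int poly"
 assumes "pcompose g [:1, 1:] = g"
 shows "g = [:poly g 0:]"
proof -
 have "poly g (int n) = poly g 0" for n
 proof (induction n)
  case (Suc n)
  have "poly g (int (Suc n)) = poly (pcompose g [:1, 1:]) (int n)" by (simp add: poly_pcompose)
  then show ?case using Suc.IH assms by simp
 qed simp
 then have "range int \<subseteq> {x. poly (g - [:poly g 0:]) x = 0}" by auto
 then have "infinite {x. poly (g - [:poly g 0:]) x = 0}"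
  using infinite_super range_inj_infinite[of int] by (metis inj_of_nat)
 then have "g - [:poly g 0:] = 0" using poly_roots_finite by blast
 then show ?thesis by simp
qed

text \<open>At x = 1 an invariant form is periodic, hence a constant, namely its value at (1, 0).
  For k > 0 a constant has no term y^k, so the value at (0, 1) is 0, and invariance equates the
  two.\<close>

lemma no_invariants_M:
 assumes k: "k > 0" and f: "f \<in> M_component (2 * k)" "act1 f = f" "act2 f = f"
 shows "f = 0"
proof -
 define g where "g = poly f 1"
 have "g = [:poly g 0:]"
  using dehomogenize_act2[of f] by (intro periodic_poly_const) (simp add: g_def f)
 then obtain c where c: "g = [:c:]" by blast
 \<comment> \<open>Congruence modulo 0 is equality, so the lemma on congruences applies.\<close>
 have "eqm 0 (eval_int f 0 1) (eval_int f 1 0)"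
  by (rule invariant_corner_values) (simp add: invariant_mod_def f)
 then have "eval_int f 0 1 = eval_int f 1 0" by (simp add: eqm_def)
 moreover have "eval_int f 0 1 = 0"
  using k eval_int_0_left[OF f(1), of 1] by (cases k) (auto simp: g_def[symmetric] c)
 moreover have "eval_int f 1 0 = c" by (simp add: eval_int_1_left g_def[symmetric] c)
 ultimately have "poly f 1 = poly 0 1" by (simp add: g_def[symmetric] c)
 then show ?thesis using dehomogenize_inject[OF f(1) M_component_0] by simp
qed

lemma B3_module_trivial_center_M:
 assumes "k > 0" "even k"
 shows "B3_module_trivial_center (M_component (2 * k)) B3_action"
proof -
 interpret B3_module "M_component (2 * k)" B3_action by (rule B3_module_M)
 show ?thesis
  by unfold_locales (use assms in \<open>auto simp: act_c_M B3_action_gen intro: no_invariants_M\<close>)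
qed

lemma M_component_odd:
 assumes "odd n"
 shows "M_component n = {0}"
proof -
 have "f = 0" if f: "f \<in> M_component n" for f
 proof (intro poly_eqI)
  fix i j
  show "coeff (coeff f i) j = coeff (coeff 0 i) j"
  proof (cases "coeff (coeff f i) j = 0")
   case False
   from M_componentD[OF f False] assms show ?thesis by auto
  qed simp
 qed
 then show ?thesis using M_component_0 by blast
qed

section \<open>Primary parts\<close>

lemma (in group) coprime_pow_eq_one:
 assumes "x \<in> carrier G" "x [^] (a :: nat) = \<one>" "x [^] (b :: nat) = \<one>" "coprime a b"
 shows "x = \<one>"
proof -
 have "ord x dvd a" "ord x dvd b" using assms pow_eq_id by auto
 then have "ord x = 1" using assms(4) by (meson coprime_common_divisor_nat is_unit_gcd coprime_def nat_dvd_1_iff_1)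
 then show ?thesis using assms(1) ord_eq_1 by blast
qed

lemma (in group) pow_mod:
 assumes "x \<in> carrier G" "x [^] (n :: nat) = \<one>"
 shows "x [^] (a mod n) = x [^] a"
proof -
 have "x [^] a = x [^] (n * (a div n) + a mod n)" by simp
 also have "\<dots> = (x [^] n) [^] (a div n) \<otimes> x [^] (a mod n)"
  using assms(1) by (simp only: nat_pow_mult[symmetric] nat_pow_pow)
 finally show ?thesis using assms by simp
qed

lemma (in group) mult_inv_eq_one_iff:
 assumes "x \<in> carrier G" "y \<in> carrier G"
 shows "x \<otimes> inv y = \<one> \<longleftrightarrow> x = y"
proof
 assume "x \<otimes> inv y = \<one>"
 then have "x \<otimes> inv y \<otimes> y = \<one> \<otimes> y" by simp
 then show "x = y" using assms by (simp add: m_assoc)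
qed (use assms in simp)

lemma (in comm_group) subgroup_primary_part: "subgroup (primary_part p G) G"
proof (rule subgroupI)
 show "primary_part p G \<subseteq> carrier G" by (auto simp: primary_part_def)
 have "\<one> \<in> primary_part p G" by (auto simp: primary_part_def)
 then show "primary_part p G \<noteq> {}" by blast
 fix a assume "a \<in> primary_part p G"
 then obtain k where k: "a \<in> carrier G" "a [^] (p ^ k) = \<one>" by (auto simp: primary_part_def)
 then show "inv a \<in> primary_part p G" by (auto simp: primary_part_def nat_pow_inv intro: exI[of _ k])
 fix b assume "b \<in> primary_part p G"
 then obtain l where l: "b \<in> carrier G" "b [^] (p ^ l) = \<one>" by (auto simp: primary_part_def)
 have "(a \<otimes> b) [^] (p ^ k * p ^ l) = (a [^] (p ^ k)) [^] (p ^ l) \<otimes> (b [^] (p ^ l)) [^] (p ^ k)"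
  using k(1) l(1) by (simp add: nat_pow_distrib nat_pow_pow mult.commute)
 then have "(a \<otimes> b) [^] (p ^ (k + l)) = \<one>" by (simp add: k l power_add)
 then show "a \<otimes> b \<in> primary_part p G" using k(1) l(1) unfolding primary_part_def by blast
qed

text \<open>On p-primary elements the N-th power map is invertible. Injectivity follows from the
  composite Psi Phi, surjectivity from an inverse of N^2.\<close>

lemma primary_transfer:
 fixes N :: nat
 assumes L: "comm_group L" and L': "comm_group L'"
  and \<Phi>: "\<Phi> \<in> hom L L'" and \<Psi>: "\<Psi> \<in> hom L' L"
  and \<Psi>\<Phi>: "\<And>x. x \<in> carrier L \<Longrightarrow> \<Psi> (\<Phi> x) = x [^]\<^bsub>L\<^esub> N"
  and im: "\<And>y. y \<in> carrier L' \<Longrightarrow> \<exists>x\<in>carrier L. y [^]\<^bsub>L'\<^esub> N = \<Phi> x"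
  and p: "coprime N p"
 shows "bij_betw \<Phi> (primary_part p L) (primary_part p L')"
proof -
 interpret L: comm_group L by (rule L)
 interpret L': comm_group L' by (rule L')
 interpret \<Phi>: group_hom L L' \<Phi> by (simp add: group_hom_def group_hom_axioms_def L.group_axioms L'.group_axioms \<Phi>)
 interpret \<Psi>: group_hom L' L \<Psi> by (simp add: group_hom_def group_hom_axioms_def L.group_axioms L'.group_axioms \<Psi>)
 show ?thesis
  unfolding bij_betw_def
 proof (intro conjI equalityI subsetI)
  show "inj_on \<Phi> (primary_part p L)"
  proof (rule inj_onI)
   fix x y assume xy: "x \<in> primary_part p L" "y \<in> primary_part p L" "\<Phi> x = \<Phi> y"
   then have c: "x \<in> carrier L" "y \<in> carrier L" by (auto simp: primary_part_def)
   define z where "z = x \<otimes>\<^bsub>L\<^esub> inv\<^bsub>L\<^esub> y"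
   have "z \<in> primary_part p L"
    unfolding z_def using xy L.subgroup_primary_part by (simp add: subgroup.m_closed subgroup.m_inv_closed)
   then obtain k where k: "z \<in> carrier L" "z [^]\<^bsub>L\<^esub> (p ^ k) = \<one>\<^bsub>L\<^esub>" by (auto simp: primary_part_def)
   have "\<Phi> z = \<one>\<^bsub>L'\<^esub>" using xy(3) c by (simp add: z_def)
   then have "z [^]\<^bsub>L\<^esub> N = \<one>\<^bsub>L\<^esub>" using \<Psi>\<Phi>[OF k(1)] by simp
   then have "z = \<one>\<^bsub>L\<^esub>" using L.coprime_pow_eq_one[OF k(1) _ k(2)] p by simp
   then show "x = y" using c unfolding z_def by (simp add: L.mult_inv_eq_one_iff)
  qed
 next
  fix y assume "y \<in> \<Phi> ` primary_part p L"
  then obtain x k where x: "y = \<Phi> x" "x \<in> carrier L" "x [^]\<^bsub>L\<^esub> (p ^ k) = \<one>\<^bsub>L\<^esub>"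
   by (auto simp: primary_part_def)
  then have "y [^]\<^bsub>L'\<^esub> (p ^ k) = \<one>\<^bsub>L'\<^esub>" by (metis \<Phi>.hom_nat_pow \<Phi>.hom_one)
  then show "y \<in> primary_part p L'" using x by (auto simp: primary_part_def)
 next
  fix y assume "y \<in> primary_part p L'"
  then obtain k where k: "y \<in> carrier L'" "y [^]\<^bsub>L'\<^esub> (p ^ k) = \<one>\<^bsub>L'\<^esub>" by (auto simp: primary_part_def)
  obtain x where x: "x \<in> carrier L" "y [^]\<^bsub>L'\<^esub> N = \<Phi> x" using im[OF k(1)] by blast
  \<comment> \<open>The preimage x of y^N need not be p-primary, only x^N is. One factor N repairs
    this and the other undoes the power of y, so N^2 has to be inverted modulo p^k.\<close>
  have "coprime (N * N) (p ^ k)" using p by simp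
  from cong_solve_coprime_nat[OF this] obtain m where m: "[N * N * m = 1] (mod p ^ k)" by auto
  have "\<Phi> x [^]\<^bsub>L'\<^esub> (p ^ k) = (y [^]\<^bsub>L'\<^esub> (p ^ k)) [^]\<^bsub>L'\<^esub> N"
   using k(1) by (simp add: x(2)[symmetric] L'.nat_pow_pow mult.commute)
  then have "\<Phi> (x [^]\<^bsub>L\<^esub> (p ^ k)) = \<one>\<^bsub>L'\<^esub>" using x(1) by (simp add: \<Phi>.hom_nat_pow k(2))
  then have "(x [^]\<^bsub>L\<^esub> (p ^ k)) [^]\<^bsub>L\<^esub> N = \<one>\<^bsub>L\<^esub>" using \<Psi>\<Phi>[of "x [^]\<^bsub>L\<^esub> (p ^ k)"] x(1) by simp
  then have "(x [^]\<^bsub>L\<^esub> (N * m)) [^]\<^bsub>L\<^esub> (p ^ k) = \<one>\<^bsub>L\<^esub>"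
   using x(1) by (metis L.nat_pow_pow L.nat_pow_one mult.commute mult.assoc)
  then have "x [^]\<^bsub>L\<^esub> (N * m) \<in> primary_part p L" using x(1) by (auto simp: primary_part_def)
  moreover have "\<Phi> (x [^]\<^bsub>L\<^esub> (N * m)) = y"
  proof -
   have "\<Phi> (x [^]\<^bsub>L\<^esub> (N * m)) = y [^]\<^bsub>L'\<^esub> (N * N * m)"
    using x k(1) by (simp add: \<Phi>.hom_nat_pow x(2)[symmetric] L'.nat_pow_pow mult.assoc)
   also have "\<dots> = y [^]\<^bsub>L'\<^esub> (1 :: nat)"
   proof -
    have "y [^]\<^bsub>L'\<^esub> (N * N * m mod p ^ k) = y [^]\<^bsub>L'\<^esub> ((1 :: nat) mod p ^ k)"
     using m by (simp add: cong_def)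
    then show ?thesis by (simp only: L'.pow_mod[OF k])
   qed
   finally show ?thesis using k(1) by simp
  qed
  ultimately show "y \<in> \<Phi> ` primary_part p L" by force
 qed
qed

section \<open>Primary parts of graded direct sums\<close>

context
 fixes L :: "nat \<Rightarrow> 'a monoid"
 assumes L: "\<And>n. comm_group (L n)"
begin

lemma group_L: "group (L n)"
 using L by (rule comm_group.axioms(2))

lemma comm_group_sum_group: "comm_group (sum_group UNIV L)"
proof -
 interpret group "sum_group UNIV L" using group_L by simp
 show ?thesis
 proof (rule group_comm_groupI)
  fix x y assume xy: "x \<in> carrier (sum_group UNIV L)" "y \<in> carrier (sum_group UNIV L)"
  then have "x n \<in> carrier (L n)" "y n \<in> carrier (L n)" for n
   using group_L by (auto simp: carrier_sum_group)
  then show "x \<otimes>\<^bsub>sum_group UNIV L\<^esub> y = y \<otimes>\<^bsub>sum_group UNIV L\<^esub> x"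
   using L by (auto simp: fun_eq_iff comm_groupE(4))
 qed
qed

lemma carrier_sum_group_UNIV:
 "a \<in> carrier (sum_group UNIV L) \<longleftrightarrow> (\<forall>n. a n \<in> carrier (L n)) \<and> finite {n. a n \<noteq> \<one>\<^bsub>L n\<^esub>}"
 using group_L by (auto simp: carrier_sum_group PiE_def Pi_def extensional_def)

lemma pow_sum_group: "a [^]\<^bsub>sum_group UNIV L\<^esub> (m :: nat) = (\<lambda>n. a n [^]\<^bsub>L n\<^esub> m)"
 by (induction m) (auto simp: fun_eq_iff)

lemma graded_primary_part_simps:
 "a \<in> carrier (graded_primary_part p (graded_direct_sum L)) \<longleftrightarrow>
   (\<forall>n. a n \<in> carrier (L n)) \<and> finite {n. a n \<noteq> \<one>\<^bsub>L n\<^esub>} \<and> (\<exists>k. \<forall>n. a n [^]\<^bsub>L n\<^esub> (p ^ k) = \<one>\<^bsub>L n\<^esub>)"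
 "a \<otimes>\<^bsub>graded_primary_part p (graded_direct_sum L)\<^esub> b = (\<lambda>n. a n \<otimes>\<^bsub>L n\<^esub> b n)"
 "\<one>\<^bsub>graded_primary_part p (graded_direct_sum L)\<^esub> = (\<lambda>n. \<one>\<^bsub>L n\<^esub>)"
 "homog (graded_primary_part p (graded_direct_sum L)) m =
   {a \<in> carrier (graded_primary_part p (graded_direct_sum L)). \<forall>n. n \<noteq> m \<longrightarrow> a n = \<one>\<^bsub>L n\<^esub>}"
proof -
 have pow: "a [^]\<^bsub>graded_direct_sum L\<^esub> (m :: nat) = (\<lambda>n. a n [^]\<^bsub>L n\<^esub> m)" for a m
  unfolding pow_sum_group[symmetric] by (induction m) (auto simp: nat_pow_def graded_direct_sum_def)
 have c: "a \<in> carrier (graded_direct_sum L) \<longleftrightarrow> (\<forall>n. a n \<in> carrier (L n)) \<and> finite {n. a n \<noteq> \<one>\<^bsub>L n\<^esub>}" for a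
  by (simp add: graded_direct_sum_def carrier_sum_group_UNIV)
 have o: "\<one>\<^bsub>graded_direct_sum L\<^esub> = (\<lambda>n. \<one>\<^bsub>L n\<^esub>)" by (simp add: graded_direct_sum_def fun_eq_iff)
 show 1: "a \<in> carrier (graded_primary_part p (graded_direct_sum L)) \<longleftrightarrow>
   (\<forall>n. a n \<in> carrier (L n)) \<and> finite {n. a n \<noteq> \<one>\<^bsub>L n\<^esub>} \<and> (\<exists>k. \<forall>n. a n [^]\<^bsub>L n\<^esub> (p ^ k) = \<one>\<^bsub>L n\<^esub>)" for a
  by (auto simp: graded_primary_part_def primary_part_def c pow o fun_eq_iff)
 show "a \<otimes>\<^bsub>graded_primary_part p (graded_direct_sum L)\<^esub> b = (\<lambda>n. a n \<otimes>\<^bsub>L n\<^esub> b n)"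
  by (simp add: graded_primary_part_def graded_direct_sum_def fun_eq_iff)
 show "\<one>\<^bsub>graded_primary_part p (graded_direct_sum L)\<^esub> = (\<lambda>n. \<one>\<^bsub>L n\<^esub>)"
  by (simp add: graded_primary_part_def o)
 have h: "homog (graded_direct_sum L) m = {a \<in> carrier (graded_direct_sum L). \<forall>n. n \<noteq> m \<longrightarrow> a n = \<one>\<^bsub>L n\<^esub>}"
  by (simp add: graded_direct_sum_def)
 show "homog (graded_primary_part p (graded_direct_sum L)) m =
   {a \<in> carrier (graded_primary_part p (graded_direct_sum L)). \<forall>n. n \<noteq> m \<longrightarrow> a n = \<one>\<^bsub>L n\<^esub>}"
  by (auto simp: graded_primary_part_def h primary_part_def)
qed

lemma group_graded_primary_part: "group (graded_primary_part p (graded_direct_sum L))"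
proof -
 let ?S = "sum_group UNIV L"
 interpret S: comm_group ?S by (rule comm_group_sum_group)
 let ?X = "graded_primary_part p (graded_direct_sum L)"
 have "a [^]\<^bsub>graded_direct_sum L\<^esub> (m :: nat) = a [^]\<^bsub>?S\<^esub> m" for a m
  by (induction m) (auto simp: nat_pow_def graded_direct_sum_def)
 then have c: "carrier ?X = primary_part p ?S"
  by (simp add: primary_part_def graded_primary_part_def graded_direct_sum_def)
 have m: "a \<otimes>\<^bsub>?X\<^esub> b = a \<otimes>\<^bsub>?S\<^esub> b" and o: "\<one>\<^bsub>?X\<^esub> = \<one>\<^bsub>?S\<^esub>" for a b
  by (simp_all add: graded_primary_part_def graded_direct_sum_def)
 note sub = S.subgroup_primary_part[of p]
 have sc: "a \<in> carrier ?S" if "a \<in> primary_part p ?S" for a using that by (simp add: primary_part_def)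
 show ?thesis
 proof (rule groupI, unfold c m o)
  fix x assume x: "x \<in> primary_part p ?S"
  show "\<exists>y\<in>primary_part p ?S. y \<otimes>\<^bsub>?S\<^esub> x = \<one>\<^bsub>?S\<^esub>"
   using subgroup.m_inv_closed[OF sub x] S.l_inv[OF sc[OF x]] by blast
  show "\<one>\<^bsub>?S\<^esub> \<otimes>\<^bsub>?S\<^esub> x = x" by (rule S.l_one[OF sc[OF x]])
  fix y assume y: "y \<in> primary_part p ?S"
  show "x \<otimes>\<^bsub>?S\<^esub> y \<in> primary_part p ?S" by (rule subgroup.m_closed[OF sub x y])
  fix z assume z: "z \<in> primary_part p ?S"
  show "x \<otimes>\<^bsub>?S\<^esub> y \<otimes>\<^bsub>?S\<^esub> z = x \<otimes>\<^bsub>?S\<^esub> (y \<otimes>\<^bsub>?S\<^esub> z)"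
   by (rule S.m_assoc[OF sc[OF x] sc[OF y] sc[OF z]])
 qed (rule subgroup.one_closed[OF sub])
qed

end

text \<open>The maps in the single degrees are homomorphisms on the whole groups, but bijective only
  between the primary parts; they are put together degree by degree.\<close>

lemma graded_iso_primary:
 assumes L: "\<And>n. comm_group (L n)" and L': "\<And>n. comm_group (L' n)"
  and h: "\<And>n. \<exists>h\<in>hom (L n) (L' n). bij_betw h (primary_part p (L n)) (primary_part p (L' n))"
 shows "graded_iso (graded_primary_part p (graded_direct_sum L)) (graded_primary_part p (graded_direct_sum L'))"
proof -
 let ?X = "graded_primary_part p (graded_direct_sum L)" and ?Y = "graded_primary_part p (graded_direct_sum L')"
 obtain h where h: "\<And>n. h n \<in> hom (L n) (L' n)" "\<And>n. bij_betw (h n) (primary_part p (L n)) (primary_part p (L' n))"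
  using h by metis
 have gh: "group_hom (L n) (L' n) (h n)" for n
  using h(1) L L' by (simp add: group_hom_def group_hom_axioms_def comm_group.axioms(2))
 define H where "H a = (\<lambda>n. h n (a n))" for a
 have one: "h n \<one>\<^bsub>L n\<^esub> = \<one>\<^bsub>L' n\<^esub>" for n using group_hom.hom_one[OF gh] .
 have pow: "h n (x [^]\<^bsub>L n\<^esub> (m :: nat)) = h n x [^]\<^bsub>L' n\<^esub> m" if "x \<in> carrier (L n)" for n x m
  using group_hom.hom_nat_pow[OF gh that] .
 have X: "a n \<in> primary_part p (L n)" if "a \<in> carrier ?X" for a n
  using that unfolding graded_primary_part_simps(1)[of L, OF L] primary_part_def by auto
 have Y: "a n \<in> primary_part p (L' n)" if "a \<in> carrier ?Y" for a n
  using that unfolding graded_primary_part_simps(1)[of L', OF L'] primary_part_def by auto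
 have HX: "H a \<in> carrier ?Y" if a: "a \<in> carrier ?X" for a
 proof -
  obtain k where k: "\<And>n. a n [^]\<^bsub>L n\<^esub> (p ^ k) = \<one>\<^bsub>L n\<^esub>" and c: "\<And>n. a n \<in> carrier (L n)" "finite {n. a n \<noteq> \<one>\<^bsub>L n\<^esub>}"
   using a unfolding graded_primary_part_simps(1)[of L, OF L] by auto
  have "finite {n. H a n \<noteq> \<one>\<^bsub>L' n\<^esub>}"
   by (rule finite_subset[OF _ c(2)]) (auto simp: H_def one)
  moreover have "H a n \<in> carrier (L' n)" for n unfolding H_def by (rule hom_in_carrier[OF h(1) c(1)])
  moreover have "H a n [^]\<^bsub>L' n\<^esub> (p ^ k) = \<one>\<^bsub>L' n\<^esub>" for n
   unfolding H_def pow[OF c(1), symmetric] by (simp add: k one)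
  ultimately show ?thesis unfolding graded_primary_part_simps(1)[of L', OF L'] by blast
 qed
 have one_mem: "\<one>\<^bsub>L n\<^esub> \<in> primary_part p (L n)" for n
  using comm_group.subgroup_primary_part[OF L] by (rule subgroup.one_closed)
 have inj: "h n x = h n y \<longleftrightarrow> x = y" if "x \<in> primary_part p (L n)" "y \<in> primary_part p (L n)" for n x y
  using h(2)[of n] that unfolding bij_betw_def inj_on_def by blast
 have surj: "\<exists>a\<in>carrier ?X. H a = b" if b: "b \<in> carrier ?Y" for b
 proof -
  obtain k where k: "\<And>n. b n [^]\<^bsub>L' n\<^esub> (p ^ k) = \<one>\<^bsub>L' n\<^esub>" and c: "finite {n. b n \<noteq> \<one>\<^bsub>L' n\<^esub>}"
   using b unfolding graded_primary_part_simps(1)[of L', OF L'] by auto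
  have "\<exists>x\<in>primary_part p (L n). h n x = b n" for n
   using h(2)[of n] Y[OF b, of n] unfolding bij_betw_def by (metis imageE)
  then obtain a where a: "\<And>n. a n \<in> primary_part p (L n)" "\<And>n. h n (a n) = b n" by metis
  have ac: "a n \<in> carrier (L n)" for n using a(1)[of n] by (simp add: primary_part_def)
  have "finite {n. a n \<noteq> \<one>\<^bsub>L n\<^esub>}"
   by (rule finite_subset[OF _ c]) (use inj[OF a(1) one_mem] one a(2) in auto)
  \<comment> \<open>One exponent k has to serve all degrees at once; injectivity on the primary
    parts carries it back from b to a.\<close>
  moreover have "a n [^]\<^bsub>L n\<^esub> (p ^ k) = \<one>\<^bsub>L n\<^esub>" for n
  proof -
   have "a n [^]\<^bsub>L n\<^esub> (p ^ k) \<in> primary_part p (L n)"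
   proof -
    interpret comm_group "L n" by (rule L)
    interpret S: group "(L n)\<lparr>carrier := primary_part p (L n)\<rparr>"
     by (rule subgroup.subgroup_is_group[OF subgroup_primary_part group_axioms])
    have "a n [^]\<^bsub>L n\<^esub> (m :: nat) \<in> primary_part p (L n)" for m
     using a(1)[of n] subgroup_primary_part
     by (induction m) (auto intro: subgroup.m_closed subgroup.one_closed)
    then show ?thesis .
   qed
   moreover have "h n (a n [^]\<^bsub>L n\<^esub> (p ^ k)) = h n \<one>\<^bsub>L n\<^esub>"
    by (simp add: pow[OF ac] a(2) k one)
   ultimately show ?thesis using inj[OF _ one_mem] by blast
  qed
  ultimately have "a \<in> carrier ?X" using ac unfolding graded_primary_part_simps(1)[of L, OF L] by blast
  then show ?thesis using a(2) by (intro bexI[of _ a]) (auto simp: H_def)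
 qed
 have "H \<in> iso ?X ?Y"
  unfolding iso_def
 proof (intro CollectI conjI)
  show "H \<in> hom ?X ?Y"
  proof (rule homI[OF HX])
   fix a b assume "a \<in> carrier ?X" "b \<in> carrier ?X"
   then have "a n \<in> carrier (L n)" "b n \<in> carrier (L n)" for n
    using X by (auto simp: primary_part_def)
   then show "H (a \<otimes>\<^bsub>?X\<^esub> b) = H a \<otimes>\<^bsub>?Y\<^esub> H b"
    unfolding graded_primary_part_simps(2)[of L, OF L] graded_primary_part_simps(2)[of L', OF L']
    by (simp add: H_def hom_mult[OF h(1)])
  qed
  show "bij_betw H (carrier ?X) (carrier ?Y)"
   unfolding bij_betw_def
  proof (intro conjI)
   show "inj_on H (carrier ?X)"
   proof (rule inj_onI)
    fix a b assume ab: "a \<in> carrier ?X" "b \<in> carrier ?X" "H a = H b"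
    show "a = b"
    proof
     fix n have "h n (a n) = h n (b n)" using ab(3) by (metis H_def)
     then show "a n = b n" using inj[OF X[OF ab(1)] X[OF ab(2)]] by blast
    qed
   qed
   show "H ` carrier ?X = carrier ?Y" using HX surj by blast
  qed
 qed
 moreover have "H ` homog ?X n = homog ?Y n" for n
 proof -
  have "H a \<in> homog ?Y n \<longleftrightarrow> a \<in> homog ?X n" if "a \<in> carrier ?X" for a
   unfolding graded_primary_part_simps(4)[of L, OF L] graded_primary_part_simps(4)[of L', OF L']
   using HX[OF that] that inj[OF X[OF that] one_mem] one by (auto simp: H_def)
  moreover have "homog ?X n \<subseteq> carrier ?X" "homog ?Y n \<subseteq> carrier ?Y"
   unfolding graded_primary_part_simps(4)[of L, OF L] graded_primary_part_simps(4)[of L', OF L'] by auto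
  ultimately show ?thesis using surj by blast
 qed
 ultimately show ?thesis unfolding graded_iso_def by blast
qed

text \<open>Two surjections from F with the same kernel have isomorphic targets, and matching the
  images of the sets \<open>Fn\<close> gives the grading.\<close>

lemma graded_iso_common_cover:
 assumes F: "group F" and X: "group X" and Y: "group Y"
  and \<theta>: "\<theta> \<in> hom F X" "\<theta> ` carrier F = carrier X"
  and \<theta>': "\<theta>' \<in> hom F Y" "\<theta>' ` carrier F = carrier Y"
  and ker: "\<And>x. x \<in> carrier F \<Longrightarrow> \<theta> x = \<one>\<^bsub>X\<^esub> \<longleftrightarrow> \<theta>' x = \<one>\<^bsub>Y\<^esub>"
  and hom: "\<And>n. Fn n \<subseteq> carrier F" "\<And>n. \<theta> ` Fn n = homog X n" "\<And>n. \<theta>' ` Fn n = homog Y n"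
 shows "graded_iso X Y"
proof -
 interpret F: group F by (rule F)
 interpret \<theta>: group_hom F X \<theta> by (simp add: group_hom_def group_hom_axioms_def F X \<theta>)
 interpret \<theta>': group_hom F Y \<theta>' by (simp add: group_hom_def group_hom_axioms_def F Y \<theta>')
 have eq: "\<theta> x = \<theta> y \<longleftrightarrow> \<theta>' x = \<theta>' y" if "x \<in> carrier F" "y \<in> carrier F" for x y
 proof -
  have d: "x \<otimes>\<^bsub>F\<^esub> inv\<^bsub>F\<^esub> y \<in> carrier F" using that by simp
  have 1: "\<theta> (x \<otimes>\<^bsub>F\<^esub> inv\<^bsub>F\<^esub> y) = \<theta> x \<otimes>\<^bsub>X\<^esub> inv\<^bsub>X\<^esub> \<theta> y" using that by simp
  have 2: "\<theta>' (x \<otimes>\<^bsub>F\<^esub> inv\<^bsub>F\<^esub> y) = \<theta>' x \<otimes>\<^bsub>Y\<^esub> inv\<^bsub>Y\<^esub> \<theta>' y" using that by simp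
  have c: "\<theta> x \<in> carrier X" "\<theta> y \<in> carrier X" "\<theta>' x \<in> carrier Y" "\<theta>' y \<in> carrier Y"
   using that by simp_all
  show ?thesis
   using ker[OF d] unfolding 1 2 group.mult_inv_eq_one_iff[OF X c(1,2)] group.mult_inv_eq_one_iff[OF Y c(3,4)] .
 qed
 define s where "s x = (SOME a. a \<in> carrier F \<and> \<theta> a = x)" for x
 have s: "s x \<in> carrier F" "\<theta> (s x) = x" if "x \<in> carrier X" for x
 proof -
  have "\<exists>a. a \<in> carrier F \<and> \<theta> a = x" using that unfolding \<theta>(2)[symmetric] by auto
  from someI_ex[OF this] show "s x \<in> carrier F" "\<theta> (s x) = x" unfolding s_def by blast+
 qed
 define h where "h x = \<theta>' (s x)" for x
 have h\<theta>: "h (\<theta> a) = \<theta>' a" if "a \<in> carrier F" for a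
  unfolding h_def using that s[of "\<theta> a"] eq[of "s (\<theta> a)" a] by simp
 have "h \<in> iso X Y"
  unfolding iso_def
 proof (intro CollectI conjI homI)
  fix x assume x: "x \<in> carrier X"
  then show "h x \<in> carrier Y" using s[OF x] by (simp add: h_def)
  fix y assume y: "y \<in> carrier X"
  obtain a b where "x = \<theta> a" "y = \<theta> b" "a \<in> carrier F" "b \<in> carrier F" using x y \<theta>(2) by blast
  then show "h (x \<otimes>\<^bsub>X\<^esub> y) = h x \<otimes>\<^bsub>Y\<^esub> h y"
   by (simp add: h\<theta> flip: \<theta>.hom_mult)
 next
  have "inj_on h (carrier X)"
  proof (rule inj_onI)
   fix x y assume xy: "x \<in> carrier X" "y \<in> carrier X" "h x = h y"
   then obtain a b where "x = \<theta> a" "y = \<theta> b" "a \<in> carrier F" "b \<in> carrier F" using \<theta>(2) by blast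
   then show "x = y" using xy(3) eq by (simp add: h\<theta>)
  qed
  moreover have "h ` carrier X = carrier Y"
   unfolding \<theta>(2)[symmetric] \<theta>'(2)[symmetric] image_image using h\<theta> by (rule image_cong[OF HOL.refl])
  ultimately show "bij_betw h (carrier X) (carrier Y)" by (simp add: bij_betw_def)
 qed
 moreover have "h ` homog X n = homog Y n" for n
  unfolding hom(2,3)[symmetric] image_image using hom(1) h\<theta> by (intro image_cong HOL.refl) auto
 ultimately show ?thesis unfolding graded_iso_def by blast
qed

section \<open>The torsion of first cohomology\<close>

lemma invariant_mod_derivation:
 assumes f: "f \<in> M_component n" "invariant_mod m f" and m: "m > 0"
 obtains d where "group_module.derivation B3 (M_component n) B3_action d"
  "\<And>g. g \<in> carrier B3 \<Longrightarrow> of_nat m * d g = B3_action g f - f"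
proof -
 interpret B3_module "M_component n" B3_action by (rule B3_module_M)
 have "of_nat m dvd B3_action g f - f" if "g \<in> carrier B3" for g
  using that
 proof (induction rule: B3_induct)
  case one show ?case by (simp add: act_one)
 next
  case (gen x g)
  have x: "of_nat m dvd B3_action (braid x) f - f"
   using f(2) by (cases x) (auto simp: invariant_mod_def eqm_def B3_action_gen)
  obtain h where h: "B3_action g f - f = of_nat m * h" using gen.IH by (auto simp: dvd_def)
  have "B3_action (braid x \<cdot> g) f - f = B3_action (braid x) (B3_action g f - f) + (B3_action (braid x) f - f)"
   using gen.hyps by (simp add: act_mult braid_closed act_diff)
  also have "B3_action (braid x) (B3_action g f - f) = of_nat m * B3_action (braid x) h"
   by (simp add: h act_of_nat_mult braid_closed)
  finally have eq: "B3_action (braid x \<cdot> g) f - f = of_nat m * B3_action (braid x) h + (B3_action (braid x) f - f)" .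
  show ?case unfolding eq by (rule dvd_add[OF dvd_triv_left x])
 next
  case (inv x g)
  let ?y = "inv\<^bsub>B3\<^esub> (braid x)"
  have y: "?y \<in> carrier B3" by (simp add: braid_closed)
  have x: "of_nat m dvd B3_action (braid x) f - f"
   using f(2) by (cases x) (auto simp: invariant_mod_def eqm_def B3_action_gen)
  obtain h where h: "B3_action g f - f = of_nat m * h" using inv.IH by (auto simp: dvd_def)
  obtain h' where h': "B3_action (braid x) f - f = of_nat m * h'" using x by (auto simp: dvd_def)
  have "B3_action ?y (B3_action (braid x) f) = f"
   by (simp add: act_mult[symmetric] braid_closed act_one)
  then have "B3_action (?y \<cdot> g) f - f = B3_action ?y (B3_action g f - f) - B3_action ?y (B3_action (braid x) f - f)"
   using inv.hyps by (simp add: act_mult act_diff y)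
  also have "\<dots> = of_nat m * (B3_action ?y h - B3_action ?y h')"
   by (simp add: h h' act_of_nat_mult y right_diff_distrib)
  finally show ?case by simp
 qed
 then have "\<forall>g\<in>carrier B3. \<exists>d. B3_action g f - f = of_nat m * d" by (simp add: dvd_def)
 then obtain d where d: "\<And>g. g \<in> carrier B3 \<Longrightarrow> of_nat m * d g = B3_action g f - f" by metis
 have "derivation d"
  unfolding derivation_def
 proof (intro conjI ballI)
  fix g assume g: "g \<in> carrier B3"
  have "of_nat m * d g \<in> M_component n" unfolding d[OF g] by (intro A_closed g f)
  then show "d g \<in> M_component n" using m by (rule M_component_of_nat_cancel[rotated])
  fix h assume h: "h \<in> carrier B3"
  have "of_nat m * d (g \<cdot> h) = of_nat m * (d g + B3_action g (d h))"
   using g h by (simp add: d distrib_left act_of_nat_mult[symmetric] act_mult act_diff)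
  then show "d (g \<cdot> h) = d g + B3_action g (d h)" using m by simp
 qed
 then show thesis using that d by blast
qed

section \<open>The torsion classes given by the monomials in P and Q\<close>

definition weight_index :: "nat \<Rightarrow> nat \<Rightarrow> (nat \<times> nat) set"
 where "weight_index p n = {ij. ij \<noteq> (0, 0) \<and> 2 * (p + 1) * fst ij + 2 * p * (p - 1) * snd ij = n}"

lemma weight_index_odd: "odd n \<Longrightarrow> weight_index p n = {}"
 by (auto simp: weight_index_def)

lemma weight_index_0: "p \<ge> 2 \<Longrightarrow> weight_index p 0 = {}"
 by (auto simp: weight_index_def)

lemma weight_index_even: "k > 0 \<Longrightarrow> weight_index p (2 * k) = dickson_index p k"
proof -
 assume k: "k > 0"
 have "2 * (p + 1) * i + 2 * p * (p - 1) * j = 2 * k \<longleftrightarrow> (p + 1) * i + p * (p - 1) * j = k" for i j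
 proof -
  have "2 * a * i + 2 * p * b * j = 2 * (a * i + p * b * j)" for a b
   by (simp add: algebra_simps)
  from this[of "p + 1" "p - 1"] show ?thesis by (simp only: mult_cancel1) simp
 qed
 then show ?thesis using k by (auto simp: weight_index_def dickson_index_def)
qed

text \<open>The derivation g -> (g f - f) / p^(a+1) for f = P^i Q^j. Its degree is computed from the
  pair, so that the choice does not involve n.\<close>

definition torsion_derivation :: "nat \<Rightarrow> nat \<times> nat \<Rightarrow> braid_gen word set \<Rightarrow> int poly poly"
 where "torsion_derivation p ij = (SOME d.
  group_module.derivation B3 (M_component (2 * (p + 1) * fst ij + 2 * p * (p - 1) * snd ij)) B3_action d \<and>
  (\<forall>g\<in>carrier B3. of_nat (p ^ Suc (vp_gcd p ij)) * d g
    = B3_action g (dickson_mon p ij) - dickson_mon p ij))"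

lemma torsion_derivation:
 assumes p: "prime p" "odd p" and ij: "ij \<in> weight_index p n"
 shows "group_module.derivation B3 (M_component n) B3_action (torsion_derivation p ij)"
  and "g \<in> carrier B3 \<Longrightarrow> of_nat (p ^ Suc (vp_gcd p ij)) * torsion_derivation p ij g
    = B3_action g (dickson_mon p ij) - dickson_mon p ij"
proof -
 have n: "2 * (p + 1) * fst ij + 2 * p * (p - 1) * snd ij = n" using ij by (simp add: weight_index_def)
 have "even n" "n \<noteq> 0"
  using ij weight_index_odd[of n p] weight_index_0[OF prime_ge_2_nat[OF p(1)]] by (metis empty_iff)+
 then obtain k where k: "n = 2 * k" "k > 0" by (auto elim!: evenE)
 have "dickson_mon p ij \<in> M_component n"
  unfolding k(1) using ij k prime_gt_0_nat[OF p(1)]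
  by (intro dickson_mon_homogeneous) (simp_all add: weight_index_even)
 from invariant_mod_derivation[OF this invariant_dickson_mon[OF p]] prime_gt_0_nat[OF p(1)]
 have "\<exists>d. group_module.derivation B3 (M_component (2 * (p + 1) * fst ij + 2 * p * (p - 1) * snd ij)) B3_action d \<and>
  (\<forall>g\<in>carrier B3. of_nat (p ^ Suc (vp_gcd p ij)) * d g
    = B3_action g (dickson_mon p ij) - dickson_mon p ij)"
  unfolding n by (metis zero_less_power)
 from someI_ex[OF this]
 show "group_module.derivation B3 (M_component n) B3_action (torsion_derivation p ij)"
  and "g \<in> carrier B3 \<Longrightarrow> of_nat (p ^ Suc (vp_gcd p ij)) * torsion_derivation p ij g
    = B3_action g (dickson_mon p ij) - dickson_mon p ij"
  unfolding torsion_derivation_def n by blast+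
qed

definition torsion_comb :: "nat \<Rightarrow> nat \<Rightarrow> (nat \<times> nat \<Rightarrow>\<^sub>0 int) \<Rightarrow> braid_gen word set \<Rightarrow> int poly poly"
 where "torsion_comb p n c g =
  (\<Sum>ij\<in>weight_index p n. of_int (lookup c ij) * torsion_derivation p ij g)"

lemma torsion_comb_add:
 "torsion_comb p n (c + c') g = torsion_comb p n c g + torsion_comb p n c' g"
 by (simp add: torsion_comb_def lookup_add distrib_right sum.distrib)

lemma derivation_torsion_comb:
 assumes p: "prime p" "odd p"
 shows "group_module.derivation B3 (M_component n) B3_action (torsion_comb p n c)"
proof -
 interpret B3_module "M_component n" B3_action by (rule B3_module_M)
 have dv: "torsion_derivation p ij g \<in> M_component n"
  "torsion_derivation p ij (g \<cdot> h) = torsion_derivation p ij g + B3_action g (torsion_derivation p ij h)"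
  if "ij \<in> weight_index p n" "g \<in> carrier B3" "h \<in> carrier B3" for ij g h
  using torsion_derivation(1)[OF p that(1)] that(2,3) by (auto simp: derivation_def)
 show ?thesis
  unfolding derivation_def torsion_comb_def
 proof (intro conjI ballI M_component_sum M_component_of_int_mult)
  fix g h assume gh: "g \<in> carrier B3" "h \<in> carrier B3"
  show "(\<Sum>ij\<in>weight_index p n. of_int (lookup c ij) * torsion_derivation p ij (g \<cdot> h)) =
   (\<Sum>ij\<in>weight_index p n. of_int (lookup c ij) * torsion_derivation p ij g) +
   B3_action g (\<Sum>ij\<in>weight_index p n. of_int (lookup c ij) * torsion_derivation p ij h)"
   using gh by (simp add: act_sum act_of_int_mult sum.distrib[symmetric] dv distrib_left cong: sum.cong)
 qed (use dv in blast)
qed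

text \<open>The denominators p^(a+1) are brought to the common denominator p^S, which turns each
  monomial into \<open>dickson_scaled\<close>.\<close>

lemma torsion_comb_scaled:
 assumes p: "prime p" "odd p" and k: "k > 0"
  and S: "\<And>ij. ij \<in> dickson_index p k \<Longrightarrow> vp_gcd p ij < S" and g: "g \<in> carrier B3"
  and W: "W = (\<Sum>ij\<in>dickson_index p k. of_int (lookup c ij) * dickson_scaled p S ij)"
 shows "of_nat (p ^ S) * torsion_comb p (2 * k) c g = B3_action g W - W"
proof -
 interpret B3_module "M_component (2 * k)" B3_action by (rule B3_module_M)
 have "of_nat (p ^ S) * (of_int l * torsion_derivation p ij g)
   = of_int l * (B3_action g (dickson_scaled p S ij) - dickson_scaled p S ij)"
  if ij: "ij \<in> dickson_index p k" for ij l
 proof -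
  have "p ^ S = p ^ (S - 1 - vp_gcd p ij) * p ^ Suc (vp_gcd p ij)"
   using S[OF ij] by (simp flip: power_add power_Suc)
  then have "of_nat (p ^ S) * torsion_derivation p ij g
    = of_nat (p ^ (S - 1 - vp_gcd p ij)) * (of_nat (p ^ Suc (vp_gcd p ij)) * torsion_derivation p ij g)"
   by (simp only: of_nat_mult mult.assoc)
  also have "\<dots> = B3_action g (dickson_scaled p S ij) - dickson_scaled p S ij"
   using ij torsion_derivation(2)[OF p, of ij "2 * k" g] g k
   by (simp only: weight_index_even dickson_scaled_def act_of_nat_mult right_diff_distrib)
  finally show ?thesis by (simp only: mult.left_commute)
 qed
 then show ?thesis
  unfolding torsion_comb_def W weight_index_even[OF k] sum_distrib_left
  using g by (simp add: act_sum act_of_int_mult sum_subtractf[symmetric] right_diff_distrib cong: sum.cong)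
qed

lemma exponent_bound_exists:
 assumes "p \<ge> 2"
 obtains S where "S > t" "\<And>ij. ij \<in> dickson_index p k \<Longrightarrow> vp_gcd p ij < S"
proof -
 have "finite (vp_gcd p ` dickson_index p k)" using finite_dickson_index[OF assms] by simp
 then obtain b where "\<And>x. x \<in> vp_gcd p ` dickson_index p k \<Longrightarrow> x < b"
  unfolding finite_nat_set_iff_bounded by blast
 then show thesis using that[of "t + 1 + b"] by force
qed

text \<open>If the combination is principal with element a, then W - p^S a is invariant, hence 0. So
  W is 0 modulo p^S, and \<open>scaled_relations\<close> reads off its coefficients.\<close>

lemma torsion_comb_principal_iff:
 assumes p: "prime p" "odd p" and k: "k > 0"
 shows "(\<exists>a\<in>M_component (2 * k). \<forall>g\<in>carrier B3. torsion_comb p (2 * k) c g = B3_action g a - a)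
  \<longleftrightarrow> (\<forall>ij\<in>dickson_index p k. int (p ^ Suc (vp_gcd p ij)) dvd lookup c ij)"
  (is "?L \<longleftrightarrow> ?R")
proof
 interpret B3_module "M_component (2 * k)" B3_action by (rule B3_module_M)
 assume ?L
 then obtain a where a: "a \<in> M_component (2 * k)"
  "\<And>g. g \<in> carrier B3 \<Longrightarrow> torsion_comb p (2 * k) c g = B3_action g a - a" by blast
 obtain S where S: "S > 0" "\<And>ij. ij \<in> dickson_index p k \<Longrightarrow> vp_gcd p ij < S"
  using exponent_bound_exists[OF prime_ge_2_nat[OF p(1)]] by blast
 define W where "W = (\<Sum>ij\<in>dickson_index p k. of_int (lookup c ij) * dickson_scaled p S ij)"
 have WM: "W \<in> M_component (2 * k)" unfolding W_def
  by (intro M_component_sum M_component_of_int_mult dickson_scaled_homogeneous prime_gt_0_nat p)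
 have e: "of_nat (p ^ S) * (B3_action g a - a) = B3_action g W - W" if "g \<in> carrier B3" for g
  using torsion_comb_scaled[OF p k S(2) that W_def] a(2)[OF that] by simp
 have "B3_action g (W - of_nat (p ^ S) * a) = W - of_nat (p ^ S) * a" if "g \<in> carrier B3" for g
  using e[OF that] by (simp only: act_diff[OF that] act_of_nat_mult[OF that] right_diff_distrib) algebra
 then have "W - of_nat (p ^ S) * a = 0"
  using a(1) WM
  by (intro no_invariants_M[OF k]) (auto simp: B3_action_gen[symmetric] braid_closed M_component_diff M_component_of_nat_mult simp del: of_nat_power)
 then have "eqm (p ^ S) W 0" by (simp add: eqm_def)
 then show ?R using scaled_relations[OF p S, where c = "lookup c"] unfolding W_def by blast
next
 interpret B3_module "M_component (2 * k)" B3_action by (rule B3_module_M)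
 assume R: ?R
 then obtain e where e: "\<And>ij. ij \<in> dickson_index p k \<Longrightarrow> lookup c ij = int (p ^ Suc (vp_gcd p ij)) * e ij"
  unfolding dvd_def by metis
 define a where "a = (\<Sum>ij\<in>dickson_index p k. of_int (e ij) * dickson_mon p ij)"
 have aM: "a \<in> M_component (2 * k)" unfolding a_def
  by (intro M_component_sum M_component_of_int_mult dickson_mon_homogeneous prime_gt_0_nat p)
 have "torsion_comb p (2 * k) c g = B3_action g a - a" if g: "g \<in> carrier B3" for g
 proof -
  have "torsion_comb p (2 * k) c g = (\<Sum>ij\<in>dickson_index p k. of_int (e ij) * (B3_action g (dickson_mon p ij) - dickson_mon p ij))"
   unfolding torsion_comb_def weight_index_even[OF k]
  proof (rule sum.cong[OF HOL.refl])
   fix ij assume ij: "ij \<in> dickson_index p k"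
   have "of_nat (p ^ Suc (vp_gcd p ij)) * torsion_derivation p ij g
     = B3_action g (dickson_mon p ij) - dickson_mon p ij"
    using torsion_derivation(2)[OF p _ g, of ij "2 * k"] ij k by (simp only: weight_index_even)
   then show "of_int (lookup c ij) * torsion_derivation p ij g
     = of_int (e ij) * (B3_action g (dickson_mon p ij) - dickson_mon p ij)"
    unfolding e[OF ij] of_int_mult of_int_of_nat_eq by (simp only: mult.left_commute mult.assoc)
  qed
  also have "\<dots> = B3_action g a - a"
   using g by (simp add: a_def act_sum act_of_int_mult sum_subtractf[symmetric] right_diff_distrib)
  finally show ?thesis .
 qed
 then show ?L using aM by blast
qed

text \<open>After rescaling to the denominator p^S, the form h is invariant modulo p^S, so h = W +
  p^S b with W a combination of scaled monomials. Division by p^S turns b into a coboundary.\<close>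

lemma torsion_class_combination:
 assumes p: "prime p" "odd p" and k: "k > 0"
  and d: "group_module.derivation B3 (M_component (2 * k)) B3_action d"
  and a: "a \<in> M_component (2 * k)" "\<And>g. g \<in> carrier B3 \<Longrightarrow> of_nat (p ^ t) * d g = B3_action g a - a"
 shows "\<exists>c b. keys c \<subseteq> weight_index p (2 * k) \<and> b \<in> M_component (2 * k) \<and>
  (\<forall>g\<in>carrier B3. d g = torsion_comb p (2 * k) c g + (B3_action g b - b))"
proof -
 interpret B3_module "M_component (2 * k)" B3_action by (rule B3_module_M)
 note p2 = prime_ge_2_nat[OF p(1)] and p0 = prime_gt_0_nat[OF p(1)]
 obtain S where S: "S > t" "\<And>ij. ij \<in> dickson_index p k \<Longrightarrow> vp_gcd p ij < S"
  using exponent_bound_exists[OF p2] by blast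
 have S0: "S > 0" using S(1) by simp
 define h where "h = of_nat (p ^ (S - t)) * a"
 have hM: "h \<in> M_component (2 * k)" unfolding h_def by (intro M_component_of_nat_mult a)
 have e: "p ^ S = p ^ (S - t) * p ^ t" using S(1) by (simp flip: power_add)
 have hd: "of_nat (p ^ S) * d g = B3_action g h - h" if "g \<in> carrier B3" for g
 proof -
  have "of_nat (p ^ S) * d g = of_nat (p ^ (S - t)) * (of_nat (p ^ t) * d g)"
   unfolding e by (simp only: of_nat_mult mult.assoc)
  also have "\<dots> = B3_action g h - h"
   unfolding a(2)[OF that] h_def act_of_nat_mult[OF that] right_diff_distrib ..
  finally show ?thesis .
 qed
 have "invariant_mod (p ^ S) h"
  using hd[OF braid_closed, of Sigma1] hd[OF braid_closed, of Sigma2]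
  unfolding invariant_mod_def eqm_def B3_action_gen by (metis dvd_triv_left)
 from invariants_scaled_span[OF p k S0 S(2) hM this]
 obtain l where l: "eqm (p ^ S) h (\<Sum>ij\<in>dickson_index p k. of_int (l ij) * dickson_scaled p S ij)"
  by (auto simp: scaled_span_def)
 define c :: "nat \<times> nat \<Rightarrow>\<^sub>0 int" where "c = Abs_poly_mapping (\<lambda>ij. if ij \<in> dickson_index p k then l ij else 0)"
 have lc: "lookup c ij = (if ij \<in> dickson_index p k then l ij else 0)" for ij
  unfolding c_def by (subst Abs_poly_mapping_inverse) (auto intro: finite_subset[OF _ finite_dickson_index[OF p2, of k]])
 have keys: "keys c \<subseteq> weight_index p (2 * k)"
  unfolding weight_index_even[OF k] by (auto simp: in_keys_iff lc split: if_splits)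
 define W where "W = (\<Sum>ij\<in>dickson_index p k. of_int (lookup c ij) * dickson_scaled p S ij)"
 have Wl: "W = (\<Sum>ij\<in>dickson_index p k. of_int (l ij) * dickson_scaled p S ij)"
  unfolding W_def by (intro sum.cong HOL.refl) (simp add: lc)
 obtain b where b: "h - W = of_nat (p ^ S) * b" using l unfolding eqm_def Wl by (auto simp: dvd_def)
 have WM: "W \<in> M_component (2 * k)" unfolding W_def
  by (intro M_component_sum M_component_of_int_mult dickson_scaled_homogeneous p0)
 have "of_nat (p ^ S) * b \<in> M_component (2 * k)" unfolding b[symmetric] by (intro M_component_diff hM WM)
 then have bM: "b \<in> M_component (2 * k)"
  using p0 by (metis M_component_of_nat_cancel zero_less_power)
 have "d g = torsion_comb p (2 * k) c g + (B3_action g b - b)" if g: "g \<in> carrier B3" for g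
 proof -
  have hW: "h = W + of_nat (p ^ S) * b" using b by (simp add: algebra_simps)
  have "of_nat (p ^ S) * d g = (B3_action g W - W) + of_nat (p ^ S) * (B3_action g b - b)"
   unfolding hd[OF g] hW act_add[OF g] act_of_nat_mult[OF g] right_diff_distrib by simp
  also have "\<dots> = of_nat (p ^ S) * (torsion_comb p (2 * k) c g + (B3_action g b - b))"
   using torsion_comb_scaled[OF p k S(2) g W_def] by (simp only: distrib_left)
  finally have "of_nat (p ^ S) * d g = of_nat (p ^ S) * (torsion_comb p (2 * k) c g + (B3_action g b - b))" .
  moreover have "(of_nat (p ^ S) :: int poly poly) \<noteq> 0" using p0 by simp
  ultimately show ?thesis using mult_left_cancel by blast
 qed
 then show ?thesis using keys bM by blast
qed

abbreviation positive_pairs :: "(nat \<times> nat) set"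
 where "positive_pairs \<equiv> {ij. ij \<noteq> (0, 0)}"

text \<open>The map from the free abelian group on exponent pairs to the classes in all degrees; the
  component in degree n sees the coefficients of weight n.\<close>

definition H1_cover :: "nat \<Rightarrow> (nat \<times> nat \<Rightarrow>\<^sub>0 int) \<Rightarrow> nat \<Rightarrow> (braid_gen word set list \<Rightarrow> int poly poly) set"
 where "H1_cover p c n = coboundaries B3 (M_component n) B3_action 1 #>\<^bsub>cocycle_group B3 (M_component n) B3_action 1\<^esub>
  group_module.cochain1 B3 (torsion_comb p n c)"

lemma H_B3_comm_group: "k = 1 \<or> k = 2 \<Longrightarrow> comm_group (H_B3 k n)"
proof -
 assume k: "k = 1 \<or> k = 2"
 interpret B3_module "M_component n" B3_action by (rule B3_module_M)
 show ?thesis unfolding H_B3_def by (rule comm_group_H[OF k])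
qed

lemma H1_cover_mult:
 assumes p: "prime p" "odd p"
 shows "H1_cover p (c + c') n = H1_cover p c n \<otimes>\<^bsub>H_B3 1 n\<^esub> H1_cover p c' n"
proof -
 interpret B3_module "M_component n" B3_action by (rule B3_module_M)
 have Z: "cochain1 (torsion_comb p n c) \<in> carrier (Z 1)" for c
  unfolding carrier_Z1 using derivation_torsion_comb[OF p] by blast
 have "cochain1 (torsion_comb p n (c + c')) = (\<lambda>gs. cochain1 (torsion_comb p n c) gs + cochain1 (torsion_comb p n c') gs)"
  unfolding cochain1_add[symmetric] by (rule cochain1_cong) (rule torsion_comb_add)
 then show ?thesis
  unfolding H1_cover_def H_B3_def using class_mult[OF _ Z Z, of c c'] by simp
qed

lemma H1_cover_closed:
 assumes p: "prime p" "odd p"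
 shows "H1_cover p c n \<in> carrier (H_B3 1 n)"
proof -
 interpret B3_module "M_component n" B3_action by (rule B3_module_M)
 have Z: "cochain1 (torsion_comb p n c) \<in> carrier (Z 1)"
  unfolding carrier_Z1 using derivation_torsion_comb[OF p] by blast
 then show ?thesis unfolding H1_cover_def H_B3_def carrier_H by blast
qed

lemma H1_cover_trivial:
 assumes p: "prime p" "odd p" and w: "\<And>ij. ij \<in> weight_index p n \<Longrightarrow> lookup c ij = 0"
 shows "H1_cover p c n = \<one>\<^bsub>H_B3 1 n\<^esub>"
proof -
 interpret B3_module "M_component n" B3_action by (rule B3_module_M)
 have "torsion_comb p n c = (\<lambda>_. 0)"
  using w by (auto simp: torsion_comb_def fun_eq_iff intro!: sum.neutral)
 then have "cochain1 (torsion_comb p n c) = \<one>\<^bsub>Z 1\<^esub>"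
  by (simp add: cochain1_zero[symmetric])
 then show ?thesis
  unfolding H1_cover_def H_B3_def one_H
  using subgroup_B1 comm_group_Z[of 1] by (metis comm_group.axioms(2) group.coset_mult_one subgroup.subset)
qed

lemma H1_cover_eq_one_iff:
 assumes p: "prime p" "odd p"
 shows "H1_cover p c n = \<one>\<^bsub>H_B3 1 n\<^esub> \<longleftrightarrow>
  (\<forall>ij\<in>weight_index p n. int (p ^ Suc (vp_gcd p ij)) dvd lookup c ij)"
proof (cases "weight_index p n = {}")
 case True
 then show ?thesis using H1_cover_trivial[OF p, of n c] by simp
next
 case False
 interpret B3_module "M_component n" B3_action by (rule B3_module_M)
 have "even n" "n \<noteq> 0"
  using False weight_index_odd[of n p] weight_index_0[OF prime_ge_2_nat[OF p(1)]] by metis+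
 then obtain k where k: "n = 2 * k" "k > 0" by (auto elim!: evenE)
 have Z: "cochain1 (torsion_comb p n c) \<in> carrier (Z 1)"
  unfolding carrier_Z1 using derivation_torsion_comb[OF p] by blast
 have "H1_cover p c n = \<one>\<^bsub>H_B3 1 n\<^esub> \<longleftrightarrow> cochain1 (torsion_comb p n c) \<in> B 1"
  unfolding H1_cover_def H_B3_def using class_eq_one_iff[OF _ Z] by simp
 also have "\<dots> \<longleftrightarrow> (\<exists>a\<in>M_component n. \<forall>g\<in>carrier B3. torsion_comb p n c g = B3_action g a - a)"
  unfolding B_1 mem_Collect_eq cochain1_eq_iff by blast
 also have "\<dots> \<longleftrightarrow> (\<forall>ij\<in>weight_index p n. int (p ^ Suc (vp_gcd p ij)) dvd lookup c ij)"
  unfolding k(1) weight_index_even[OF k(2)] by (rule torsion_comb_principal_iff[OF p k(2)])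
 finally show ?thesis .
qed

lemma B3_action_M_0:
 assumes "f \<in> M_component 0"
 shows "B3_action g f = f"
proof -
 have "f = of_int (coeff (coeff f 0) 0)"
 proof (intro poly_eqI)
  fix i j
  show "coeff (coeff f i) j = coeff (coeff (of_int (coeff (coeff f 0) 0)) i) j"
   using M_componentD[OF assms, of i j]
   by (cases "coeff (coeff f i) j = 0"; cases i; cases j) (auto simp: of_int_poly)
 qed
 then show ?thesis by (metis B3_action_def SL2Z_action_def subst_xy_of_int)
qed

lemma primary_class_cover:
 assumes p: "prime p" "odd p" and x: "x \<in> primary_part p (H_B3 1 n)"
 shows "\<exists>c. keys c \<subseteq> weight_index p n \<and> H1_cover p c n = x"
proof -
 interpret B3_module "M_component n" B3_action by (rule B3_module_M)
 note p0 = prime_gt_0_nat[OF p(1)]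
 obtain t where x: "x \<in> carrier (H 1)" "x [^]\<^bsub>H 1\<^esub> (p ^ t) = \<one>\<^bsub>H 1\<^esub>"
  using x by (auto simp: primary_part_def H_B3_def)
 then obtain z where z: "z \<in> carrier (Z 1)" "x = B 1 #>\<^bsub>Z 1\<^esub> z" by (auto simp: carrier_H)
 obtain d where d: "z = cochain1 d" "derivation d" using z(1) by (rule Z1_cases)
 have tZ: "(\<lambda>gs. of_nat (p ^ t) * z gs) \<in> carrier (Z 1)"
  using monoid.nat_pow_closed[of "Z 1" z "p ^ t"] z(1) comm_group_Z[of 1]
  by (simp only: pow_Z comm_group_def comm_monoid_def)
 have "(\<lambda>gs. of_nat (p ^ t) * z gs) \<in> B 1"
  using x(2) class_pow[OF _ z(1), of "p ^ t"] class_eq_one_iff[OF _ tZ] unfolding z(2) by simp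
 then obtain a where a: "a \<in> M_component n" "cochain1 (\<lambda>g. of_nat (p ^ t) * d g) = cochain1 (\<lambda>g. B3_action g a - a)"
  unfolding B_1 d(1) cochain1_mult[symmetric] by blast
 then have ad: "of_nat (p ^ t) * d g = B3_action g a - a" if "g \<in> carrier B3" for g
  using that unfolding cochain1_eq_iff by blast
 have "\<exists>c b. keys c \<subseteq> weight_index p n \<and> b \<in> M_component n \<and>
  (\<forall>g\<in>carrier B3. d g = torsion_comb p n c g + (B3_action g b - b))"
 proof (cases "even n \<and> n \<noteq> 0")
  case True
  then obtain k where k: "n = 2 * k" "k > 0" by (auto elim!: evenE)
  show ?thesis
   using torsion_class_combination[OF p k(2) d(2)[unfolded k(1)] a(1)[unfolded k(1)] ad] unfolding k(1) by blast
 next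
  \<comment> \<open>In degree 0 and in odd degrees all principal derivations vanish, so p^t d = 0
    and there is no torsion.\<close>
  case False
  have "B3_action g a = a" if "g \<in> carrier B3" for g
  proof (cases "n = 0")
   case True then show ?thesis using B3_action_M_0 a(1) by simp
  next
   case n: False
   then have "a = 0" using a(1) False M_component_odd by auto
   then show ?thesis using act_zero[OF that] by simp
  qed
  then have "d g = 0" if "g \<in> carrier B3" for g
   using ad[OF that] that p0 by simp
  moreover have "torsion_comb p n 0 g = 0" for g by (simp add: torsion_comb_def)
  moreover have "B3_action g 0 - 0 = 0" if "g \<in> carrier B3" for g using act_zero[OF that] by simp
  ultimately show ?thesis
   by (intro exI[of _ 0] conjI) (simp_all add: M_component_0)
 qed
 then obtain c b where c: "keys c \<subseteq> weight_index p n" "b \<in> M_component n"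
  "\<And>g. g \<in> carrier B3 \<Longrightarrow> d g = torsion_comb p n c g + (B3_action g b - b)" by blast
 have Z: "cochain1 (torsion_comb p n c) \<in> carrier (Z 1)"
  unfolding carrier_Z1 using derivation_torsion_comb[OF p] by blast
 have "(\<lambda>gs. cochain1 (torsion_comb p n c) gs - z gs) = cochain1 (\<lambda>g. torsion_comb p n c g - d g)"
  by (simp add: d(1) cochain1_minus)
 also have "\<dots> = cochain1 (\<lambda>g. B3_action g (- b) - - b)"
  by (rule cochain1_cong) (simp add: c(3) act_uminus)
 also have "\<dots> \<in> B 1" by (intro principal_in_B1 M_component_uminus c)
 finally have "H1_cover p c n = x"
  unfolding H1_cover_def z(2) using class_eq_iff[OF _ Z z(1)] by simp
 then show ?thesis using c(1) by blast
qed

text \<open>c has finite support, so one power of p annihilates the classes in all degrees.\<close>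

lemma H1_cover_primary:
 assumes p: "prime p" "odd p"
 shows "\<exists>t. \<forall>n. H1_cover p c n [^]\<^bsub>H_B3 1 n\<^esub> (p ^ t) = \<one>\<^bsub>H_B3 1 n\<^esub>"
proof -
 have "finite (vp_gcd p ` keys c)" by simp
 then obtain b where b: "\<And>ij. ij \<in> keys c \<Longrightarrow> vp_gcd p ij < b"
  unfolding finite_nat_set_iff_bounded by blast
 have pow: "H1_cover p c n [^]\<^bsub>H_B3 1 n\<^esub> (m :: nat) = H1_cover p (frag_cmul (int m) c) n" for n m
 proof (induction m)
  case 0
  show ?case using H1_cover_trivial[OF p, of n "0"] by simp
 next
  case (Suc m)
  have "frag_cmul (int (Suc m)) c = frag_cmul (int m) c + c"
   by (simp add: frag_cmul_distrib add.commute)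
  then show ?case using Suc.IH by (simp add: H1_cover_mult[OF p])
 qed
 have "H1_cover p c n [^]\<^bsub>H_B3 1 n\<^esub> (p ^ b) = \<one>\<^bsub>H_B3 1 n\<^esub>" for n
  unfolding pow H1_cover_eq_one_iff[OF p]
 proof
  fix ij assume "ij \<in> weight_index p n"
  show "int (p ^ Suc (vp_gcd p ij)) dvd lookup (frag_cmul (int (p ^ b)) c) ij"
  proof (cases "ij \<in> keys c")
   case True
   then have "p ^ Suc (vp_gcd p ij) dvd p ^ b" using b[OF True] by (intro le_imp_power_dvd) simp
   then have "int (p ^ Suc (vp_gcd p ij)) dvd int (p ^ b)" by (rule of_nat_dvd_iff[THEN iffD2])
   then show ?thesis by simp
  qed (simp add: in_keys_iff)
 qed
 then show ?thesis by blast
qed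

lemma weight_index_disjoint: "ij \<in> weight_index p n \<Longrightarrow> ij \<in> weight_index p m \<Longrightarrow> n = m"
 by (simp add: weight_index_def)

definition weight :: "nat \<Rightarrow> nat \<times> nat \<Rightarrow> nat"
 where "weight p ij = 2 * (p + 1) * fst ij + 2 * p * (p - 1) * snd ij"

lemma weight_index_iff: "ij \<in> weight_index p n \<longleftrightarrow> ij \<noteq> (0, 0) \<and> weight p ij = n"
 by (simp add: weight_index_def weight_def)

lemma H1_cover_graded:
 assumes p: "prime p" "odd p"
 defines "F \<equiv> free_Abelian_group positive_pairs"
  and "X \<equiv> graded_primary_part p (H_B3_M 1)"
 shows "H1_cover p \<in> hom F X" "H1_cover p ` carrier F = carrier X"
  "\<And>n. H1_cover p ` {c. keys c \<subseteq> weight_index p n} = homog X n"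
  "\<And>c. c \<in> carrier F \<Longrightarrow> H1_cover p c = \<one>\<^bsub>X\<^esub> \<longleftrightarrow>
    (\<forall>ij\<in>positive_pairs. int (p ^ Suc (vp_gcd p ij)) dvd lookup c ij)"
proof -
 have L: "comm_group (H_B3 1 n)" for n using H_B3_comm_group by simp
 note simps = graded_primary_part_simps[of "H_B3 1", OF L, folded H_B3_M_def]
 have fin: "finite {n. H1_cover p c n \<noteq> \<one>\<^bsub>H_B3 1 n\<^esub>}" for c
 proof (rule finite_subset)
  show "{n. H1_cover p c n \<noteq> \<one>\<^bsub>H_B3 1 n\<^esub>} \<subseteq> weight p ` keys c"
  proof
   fix n assume "n \<in> {n. H1_cover p c n \<noteq> \<one>\<^bsub>H_B3 1 n\<^esub>}"
   then obtain ij where "ij \<in> weight_index p n" "lookup c ij \<noteq> 0"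
    using H1_cover_trivial[OF p, of n c] by blast
   then show "n \<in> weight p ` keys c"
    by (auto simp: weight_index_iff in_keys_iff)
  qed
 qed simp
 have mem: "H1_cover p c \<in> carrier X" for c
  unfolding X_def simps using H1_cover_closed[OF p] fin H1_cover_primary[OF p] by blast
 show hom: "H1_cover p \<in> hom F X"
 proof (rule homI[OF mem])
  fix c c'
  show "H1_cover p (c \<otimes>\<^bsub>F\<^esub> c') = H1_cover p c \<otimes>\<^bsub>X\<^esub> H1_cover p c'"
   unfolding X_def simps F_def mult_free_Abelian_group by (rule ext) (rule H1_cover_mult[OF p])
 qed
 have part: "\<exists>c. keys c \<subseteq> weight_index p n \<and> H1_cover p c n = x n" if "x \<in> carrier X" for x n
  using that primary_class_cover[OF p, of "x n" n] unfolding X_def simps primary_part_def by blast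
 have off: "H1_cover p c m = \<one>\<^bsub>H_B3 1 m\<^esub>" if "keys c \<subseteq> weight_index p n" "m \<noteq> n" for c m n
  using that by (intro H1_cover_trivial[OF p]) (metis in_keys_iff subsetD weight_index_disjoint)
 show "H1_cover p ` carrier F = carrier X"
 proof (intro equalityI subsetI)
  fix x assume x: "x \<in> carrier X"
  obtain c where c: "\<And>n. keys (c n) \<subseteq> weight_index p n" "\<And>n. H1_cover p (c n) n = x n"
   using part[OF x] by metis
  define N where "N = {n. x n \<noteq> \<one>\<^bsub>H_B3 1 n\<^esub>}"
  have N: "finite N" using x unfolding X_def simps N_def by blast
  \<comment> \<open>The supports of the \<open>c n\<close> lie in disjoint weight sets, so in degree
    m the sum acts like \<open>c m\<close> alone.\<close>
  define C where "C = (\<Sum>n\<in>N. c n)"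
  have C: "C \<in> carrier F"
   unfolding F_def C_def using c(1) by (intro sum_closed_free_Abelian_group) (force simp: weight_index_iff)
  have "H1_cover p C m = x m" for m
  proof -
   have lookup: "lookup C ij = (if m \<in> N then lookup (c m) ij else 0)"
    if ij: "ij \<in> weight_index p m" for ij
   proof -
    have "lookup C ij = (\<Sum>n\<in>N. lookup (c n) ij)"
     by (simp add: C_def lookup_sum)
    also have "\<dots> = (\<Sum>n\<in>N. if n = m then lookup (c m) ij else 0)"
    proof (rule sum.cong[OF HOL.refl])
     fix n
     have "ij \<notin> keys (c n)" if "n \<noteq> m"
      using c(1)[of n] ij weight_index_disjoint[of ij p n m] that by blast
     then show "lookup (c n) ij = (if n = m then lookup (c m) ij else 0)"
      by (auto simp: in_keys_iff)
    qed
    finally show ?thesis using N by simp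
   qed
   show ?thesis
   proof (cases "m \<in> N")
    case True
    have "torsion_comb p m C = torsion_comb p m (c m)"
     unfolding torsion_comb_def using lookup True by (simp add: fun_eq_iff)
    then show ?thesis using c(2)[of m] by (simp add: H1_cover_def)
   next
    case False
    then show ?thesis using H1_cover_trivial[OF p, of m C] lookup by (simp add: N_def)
   qed
  qed
  then show "x \<in> H1_cover p ` carrier F" using C by (intro image_eqI[of _ _ C]) auto
 qed (use mem in auto)
 show "H1_cover p ` {c. keys c \<subseteq> weight_index p n} = homog X n" for n
 proof (intro equalityI subsetI)
  fix x assume "x \<in> homog X n"
  then have x: "x \<in> carrier X" "\<And>m. m \<noteq> n \<Longrightarrow> x m = \<one>\<^bsub>H_B3 1 m\<^esub>" unfolding X_def simps by auto
  obtain c where c: "keys c \<subseteq> weight_index p n" "H1_cover p c n = x n" using part[OF x(1)] by blast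
  have "H1_cover p c m = x m" for m using c x(2) off by (cases "m = n") auto
  then show "x \<in> H1_cover p ` {c. keys c \<subseteq> weight_index p n}"
   using c(1) by (intro image_eqI[of _ _ c]) auto
 next
  fix x assume "x \<in> H1_cover p ` {c. keys c \<subseteq> weight_index p n}"
  then show "x \<in> homog X n"
   using mem off unfolding X_def simps(4) by auto
 qed
 show "H1_cover p c = \<one>\<^bsub>X\<^esub> \<longleftrightarrow>
    (\<forall>ij\<in>positive_pairs. int (p ^ Suc (vp_gcd p ij)) dvd lookup c ij)" if "c \<in> carrier F" for c
  unfolding X_def simps fun_eq_iff H1_cover_eq_one_iff[OF p] by (auto simp: weight_index_iff)
qed

section \<open>The divided polynomial side\<close>

text \<open>The coordinate of a polynomial at \<open>z\<^sub>i = z\<^sup>i / i!\<close>.\<close>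

definition divided_coeff :: "rat poly \<Rightarrow> nat \<Rightarrow> rat"
 where "divided_coeff f i = coeff f i * fact i"

lemma divided_coeff_simps:
 "divided_coeff (f + g) i = divided_coeff f i + divided_coeff g i"
 "divided_coeff (f - g) i = divided_coeff f i - divided_coeff g i"
 "divided_coeff (- f) i = - divided_coeff f i"
 "divided_coeff 0 i = 0"
 "divided_coeff (divided_power k) i = (if i = k then 1 else 0)"
 by (simp_all add: divided_coeff_def divided_power_def algebra_simps)

lemma divided_coeff_of_int_mult: "divided_coeff (of_int c * f) i = of_int c * divided_coeff f i"
 by (simp add: divided_coeff_def of_int_poly)

lemma divided_coeff_sum: "divided_coeff (sum f I) i = (\<Sum>x\<in>I. divided_coeff (f x) i)"
 by (induction I rule: infinite_finite_induct) (auto simp: divided_coeff_simps)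

lemma divided_coeff_mult:
 "divided_coeff (f * g) i = (\<Sum>j\<le>i. of_nat (i choose j) * divided_coeff f j * divided_coeff g (i - j))"
 unfolding divided_coeff_def coeff_mult sum_distrib_right
proof (rule sum.cong[OF HOL.refl])
 fix j assume "j \<in> {..i}"
 then have "(of_nat (fact i) :: rat) = of_nat (fact j * fact (i - j) * (i choose j))"
  by (simp add: binomial_fact_lemma)
 then show "coeff f j * coeff g (i - j) * fact i = of_nat (i choose j) * (coeff f j * fact j) * (coeff g (i - j) * fact (i - j))"
  by (simp add: algebra_simps)
qed

lemma divided_coeff_eqI: "(\<And>i. divided_coeff f i = divided_coeff g i) \<Longrightarrow> f = g"
 by (intro poly_eqI) (simp add: divided_coeff_def)

lemma divided_expansion:
 assumes "\<And>i. divided_coeff f i = of_int (c i)"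
 shows "f = (\<Sum>i\<le>degree f. of_int (c i) * divided_power i)"
proof (rule divided_coeff_eqI)
 fix k
 have "divided_coeff (\<Sum>i\<le>degree f. of_int (c i) * divided_power i) k
   = (\<Sum>i\<le>degree f. if i = k then of_int (c i) else 0)"
  unfolding divided_coeff_sum by (intro sum.cong HOL.refl) (simp add: divided_coeff_of_int_mult divided_coeff_simps)
 also have "\<dots> = (if k \<le> degree f then of_int (c k) else 0)" by simp
 also have "\<dots> = divided_coeff f k"
  using assms[of k] by (auto simp: divided_coeff_def coeff_eq_0)
 finally show "divided_coeff f k = divided_coeff (\<Sum>i\<le>degree f. of_int (c i) * divided_power i) k" ..
qed

lemma carrier_Gamma_ring: "f \<in> carrier Gamma_ring \<longleftrightarrow> (\<forall>i. divided_coeff f i \<in> \<int>)"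
proof
 assume "f \<in> carrier Gamma_ring"
 then obtain c N where f: "f = (\<Sum>i\<le>N. of_int (c i) * divided_power i)" by (auto simp: Gamma_ring_def)
 show "\<forall>i. divided_coeff f i \<in> \<int>"
  unfolding f divided_coeff_sum by (auto simp: divided_coeff_of_int_mult divided_coeff_simps)
next
 assume "\<forall>i. divided_coeff f i \<in> \<int>"
 then have "\<forall>i. \<exists>c. divided_coeff f i = of_int c" by (auto elim: Ints_cases)
 then obtain c where "\<And>i. divided_coeff f i = of_int (c i)" by metis
 from divided_expansion[OF this] show "f \<in> carrier Gamma_ring" by (auto simp: Gamma_ring_def)
qed

lemma Gamma_ring_simps [simp]:
 "f \<oplus>\<^bsub>Gamma_ring\<^esub> g = f + g" "f \<otimes>\<^bsub>Gamma_ring\<^esub> g = f * g" "\<zero>\<^bsub>Gamma_ring\<^esub> = 0" "\<one>\<^bsub>Gamma_ring\<^esub> = 1"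
 by (simp_all add: Gamma_ring_def)

lemma Gamma_ring_mult: "f \<in> carrier Gamma_ring \<Longrightarrow> g \<in> carrier Gamma_ring \<Longrightarrow> f * g \<in> carrier Gamma_ring"
 unfolding carrier_Gamma_ring divided_coeff_mult by (auto intro!: Ints_sum)

lemma Gamma_ring_add: "f \<in> carrier Gamma_ring \<Longrightarrow> g \<in> carrier Gamma_ring \<Longrightarrow> f + g \<in> carrier Gamma_ring"
 and Gamma_ring_diff: "f \<in> carrier Gamma_ring \<Longrightarrow> g \<in> carrier Gamma_ring \<Longrightarrow> f - g \<in> carrier Gamma_ring"
 and Gamma_ring_uminus: "f \<in> carrier Gamma_ring \<Longrightarrow> - f \<in> carrier Gamma_ring"
 and Gamma_ring_zero: "0 \<in> carrier Gamma_ring"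
 and Gamma_ring_divided_power: "divided_power i \<in> carrier Gamma_ring"
 and Gamma_ring_of_int_mult: "f \<in> carrier Gamma_ring \<Longrightarrow> of_int c * f \<in> carrier Gamma_ring"
 by (auto simp: carrier_Gamma_ring divided_coeff_simps divided_coeff_of_int_mult)

lemma Gamma_ring_one: "1 \<in> carrier Gamma_ring"
proof -
 have "1 = divided_power 0" by (simp add: divided_power_def)
 then show ?thesis using Gamma_ring_divided_power by metis
qed

lemma ring_Gamma_ring: "ring Gamma_ring"
proof (rule ringI)
 show "abelian_group Gamma_ring"
 proof (rule abelian_groupI)
  fix x assume "x \<in> carrier Gamma_ring"
  then show "\<exists>y\<in>carrier Gamma_ring. y \<oplus>\<^bsub>Gamma_ring\<^esub> x = \<zero>\<^bsub>Gamma_ring\<^esub>"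
   by (intro bexI[of _ "- x"]) (auto intro: Gamma_ring_uminus)
 qed (auto intro: Gamma_ring_add Gamma_ring_zero)
 show "Group.monoid Gamma_ring"
  by (rule monoidI) (auto intro: Gamma_ring_mult Gamma_ring_one)
qed (simp_all add: algebra_simps)

text \<open>The order of z_i in the quotient; the value 0 at i = 0 stands for the infinite order of
  z_0 = 1.\<close>

definition gamma_modulus :: "nat \<Rightarrow> nat \<Rightarrow> nat"
 where "gamma_modulus p i = (if i = 0 then 0 else p ^ (multiplicity p i + 1))"

text \<open>From j (i choose j) = i (i - 1 choose j - 1), after cancelling the part of j prime to p.
  The product of z_j and z_(i-j) is (i choose j) z_i, so this is what makes the additive span of the
  generators an ideal.\<close>

lemma gamma_modulus_binomial:
 assumes p: "prime p" and j: "j \<le> i"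
 shows "gamma_modulus p i dvd (i choose j) * gamma_modulus p j"
proof (cases "j = 0")
 case False
 define v where "v = multiplicity p i"
 define w where "w = multiplicity p j"
 have ij: "i \<noteq> 0" "j \<noteq> 0" using False j by auto
 obtain j' where j': "j = p ^ w * j'" "\<not> p dvd j'"
  using multiplicity_decompose'[of j p] ij p unfolding w_def by (metis not_prime_unit)
 have "p ^ v dvd i" unfolding v_def by (rule multiplicity_dvd)
 then have "p ^ v dvd i * ((i - 1) choose (j - 1))" by simp
 also have "i * ((i - 1) choose (j - 1)) = j * (i choose j)"
  using ij times_binomial_minus1_eq[of j i] by simp
 finally have "p ^ v dvd (p ^ w * (i choose j)) * j'" by (simp add: j'(1) mult_ac)
 moreover have "coprime (p ^ v) j'" using p j'(2) by (simp add: prime_imp_coprime)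
 ultimately have "p ^ v dvd p ^ w * (i choose j)" by (simp add: coprime_dvd_mult_left_iff)
 then have "p * p ^ v dvd p * (p ^ w * (i choose j))" by (rule mult_dvd_mono[OF dvd_refl])
 then show ?thesis using ij by (simp add: gamma_modulus_def v_def w_def mult_ac)
qed (simp add: gamma_modulus_def)

text \<open>The additive span of the generators of \<open>Gamma_ideal p\<close>, in coordinates; by
  \<open>Gamma_ideal_eq\<close> it is the whole ideal.\<close>

definition gamma_rels :: "nat \<Rightarrow> rat poly set"
 where "gamma_rels p = {f. \<forall>i. \<exists>c. divided_coeff f i = of_int (int (gamma_modulus p i) * c)}"

lemma gamma_rels_carrier: "gamma_rels p \<subseteq> carrier Gamma_ring"
proof
 fix f assume "f \<in> gamma_rels p"
 then obtain c where "\<And>j. divided_coeff f j = of_int (int (gamma_modulus p j) * c j)"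
  unfolding gamma_rels_def mem_Collect_eq by metis
 then show "f \<in> carrier Gamma_ring" by (metis carrier_Gamma_ring Ints_of_int)
qed

lemma gamma_rels_add:
 assumes "f \<in> gamma_rels p" "g \<in> gamma_rels p"
 shows "f + g \<in> gamma_rels p"
 unfolding gamma_rels_def
proof (intro CollectI allI)
 fix i
 obtain c d where "divided_coeff f i = of_int (int (gamma_modulus p i) * c)"
  "divided_coeff g i = of_int (int (gamma_modulus p i) * d)" using assms unfolding gamma_rels_def by blast
 then show "\<exists>c. divided_coeff (f + g) i = of_int (int (gamma_modulus p i) * c)"
  by (intro exI[of _ "c + d"]) (simp add: divided_coeff_simps algebra_simps)
qed

lemma gamma_rels_mult:
 assumes p: "prime p" and f: "f \<in> gamma_rels p" and g: "g \<in> carrier Gamma_ring"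
 shows "f * g \<in> gamma_rels p"
 unfolding gamma_rels_def
proof (intro CollectI allI)
 fix i
 obtain c where c: "\<And>j. divided_coeff f j = of_int (int (gamma_modulus p j) * c j)"
  using f unfolding gamma_rels_def mem_Collect_eq by metis
 have "\<forall>i. \<exists>d. divided_coeff g i = of_int d" using g by (auto simp: carrier_Gamma_ring elim: Ints_cases)
 then obtain d where d: "\<And>j. divided_coeff g j = of_int (d j)" by metis
 have "divided_coeff (f * g) i = of_int (\<Sum>j\<le>i. int ((i choose j) * gamma_modulus p j) * c j * d (i - j))"
  unfolding divided_coeff_mult c d by (simp add: mult_ac)
 moreover have "int (gamma_modulus p i) dvd (\<Sum>j\<le>i. int ((i choose j) * gamma_modulus p j) * c j * d (i - j))"
 proof (rule dvd_sum)
  fix j assume "j \<in> {..i}"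
  then have "gamma_modulus p i dvd (i choose j) * gamma_modulus p j" using gamma_modulus_binomial[OF p] by simp
  then have "int (gamma_modulus p i) dvd int ((i choose j) * gamma_modulus p j)" by (rule of_nat_dvd_iff[THEN iffD2])
  then show "int (gamma_modulus p i) dvd int ((i choose j) * gamma_modulus p j) * c j * d (i - j)"
   by (intro dvd_mult2)
 qed
 ultimately show "\<exists>c. divided_coeff (f * g) i = of_int (int (gamma_modulus p i) * c)" by (metis dvdE)
qed

lemma gamma_rels_of_int_mult:
 "f \<in> gamma_rels p \<Longrightarrow> of_int c * f \<in> gamma_rels p"
 unfolding gamma_rels_def mem_Collect_eq divided_coeff_of_int_mult
 by (metis (no_types, opaque_lifting) mult.left_commute of_int_mult)

lemma subgroup_gamma_rels: "subgroup (gamma_rels p) (add_monoid Gamma_ring)"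
proof -
 interpret ring Gamma_ring by (rule ring_Gamma_ring)
 show ?thesis
 proof (rule add.subgroupI)
  have "0 \<in> gamma_rels p" by (auto simp: gamma_rels_def divided_coeff_simps intro!: exI[of _ 0])
  then show "gamma_rels p \<noteq> {}" by auto
  fix a assume a: "a \<in> gamma_rels p"
  have "\<ominus>\<^bsub>Gamma_ring\<^esub> a = - a"
   using a gamma_rels_carrier[of p] by (intro minus_equality) (auto intro: Gamma_ring_uminus)
  then show "\<ominus>\<^bsub>Gamma_ring\<^esub> a \<in> gamma_rels p" using gamma_rels_of_int_mult[OF a, of "-1"] by simp
  fix b assume "b \<in> gamma_rels p"
  then show "a \<oplus>\<^bsub>Gamma_ring\<^esub> b \<in> gamma_rels p" using a by (simp add: gamma_rels_add)
 qed (rule gamma_rels_carrier)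
qed

lemma Gamma_ideal_eq:
 assumes p: "prime p"
 shows "Gamma_ideal p = gamma_rels p"
proof -
 interpret ring Gamma_ring by (rule ring_Gamma_ring)
 let ?S = "{of_nat (p ^ (multiplicity p i + 1)) * divided_power i | i. i \<ge> 1}"
 have ideal: "ideal (gamma_rels p) Gamma_ring"
 proof (rule idealI[OF ring_Gamma_ring subgroup_gamma_rels])
  fix a x assume "a \<in> gamma_rels p" "x \<in> carrier Gamma_ring"
  from gamma_rels_mult[OF p this]
  show "x \<otimes>\<^bsub>Gamma_ring\<^esub> a \<in> gamma_rels p" "a \<otimes>\<^bsub>Gamma_ring\<^esub> x \<in> gamma_rels p"
   by (simp_all add: mult.commute)
 qed
 have Sm: "of_nat (gamma_modulus p i) * divided_power i \<in> gamma_rels p" for i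
  using divided_coeff_of_int_mult[of "int (gamma_modulus p i)" "divided_power i"]
  unfolding gamma_rels_def
  by (intro CollectI allI) (simp add: divided_coeff_simps)
 have "?S \<subseteq> gamma_rels p"
 proof
  fix f assume "f \<in> ?S"
  then obtain i where "f = of_nat (p ^ (multiplicity p i + 1)) * divided_power i" "i \<ge> 1" by blast
  then show "f \<in> gamma_rels p" using Sm[of i] by (simp add: gamma_modulus_def)
 qed
 then have 1: "Gamma_ideal p \<subseteq> gamma_rels p"
  unfolding Gamma_ideal_def by (rule genideal_minimal[OF ideal])
 have Sc: "?S \<subseteq> carrier Gamma_ring" using \<open>?S \<subseteq> gamma_rels p\<close> gamma_rels_carrier by blast
 interpret I: ideal "Gamma_ideal p" Gamma_ring
  unfolding Gamma_ideal_def by (rule genideal_ideal[OF Sc])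
 have sum: "sum f I \<in> Gamma_ideal p" if "\<And>i. i \<in> I \<Longrightarrow> f i \<in> Gamma_ideal p" for f and I :: "nat set"
  using that
 proof (induction I rule: infinite_finite_induct)
  case (insert x I) then show ?case using I.a_closed[of "f x" "sum f I"] by simp
 qed (use I.zero_closed in simp_all)
 have "gamma_rels p \<subseteq> Gamma_ideal p"
 proof
  fix f assume "f \<in> gamma_rels p"
  then obtain c where c: "\<And>j. divided_coeff f j = of_int (int (gamma_modulus p j) * c j)"
   unfolding gamma_rels_def mem_Collect_eq by metis
  have "of_int (int (gamma_modulus p i) * c i) * divided_power i \<in> Gamma_ideal p" for i
  proof (cases "i = 0")
   case True
   then show ?thesis using I.zero_closed by (simp add: gamma_modulus_def)
  next
   case False
   then have "of_nat (gamma_modulus p i) * divided_power i \<in> ?S"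
    by (auto simp: gamma_modulus_def)
   then have "of_nat (gamma_modulus p i) * divided_power i \<in> Gamma_ideal p"
    unfolding Gamma_ideal_def using genideal_self[OF Sc] by blast
   moreover have "of_int (c i) \<in> carrier Gamma_ring" using Gamma_ring_of_int_mult[OF Gamma_ring_one, of "c i"] by simp
   ultimately have "of_int (c i) * (of_nat (gamma_modulus p i) * divided_power i) \<in> Gamma_ideal p"
    using I.I_l_closed by simp
   then show ?thesis by (simp add: mult_ac)
  qed
  then show "f \<in> Gamma_ideal p" by (subst divided_expansion[OF c]) (rule sum)
 qed
 with 1 show ?thesis by blast
qed

section \<open>The additive group of the quotient and its coordinates\<close>

definition gamma_group :: "nat \<Rightarrow> rat poly set monoid"
 where "gamma_group p = add_monoid Gamma_ring Mod gamma_rels p"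

abbreviation gamma_class :: "nat \<Rightarrow> rat poly \<Rightarrow> rat poly set"
 where "gamma_class p f \<equiv> gamma_rels p #>\<^bsub>add_monoid Gamma_ring\<^esub> f"

lemma comm_group_add_Gamma: "comm_group (add_monoid Gamma_ring)"
 using ring.is_abelian_group[OF ring_Gamma_ring] by (rule abelian_group.a_comm_group)

lemma comm_group_gamma_group: "comm_group (gamma_group p)"
 unfolding gamma_group_def
 by (rule comm_group.abelian_FactGroup[OF comm_group_add_Gamma subgroup_gamma_rels])

lemma carrier_gamma_group: "carrier (gamma_group p) = gamma_class p ` carrier Gamma_ring"
 by (simp add: gamma_group_def carrier_FactGroup)

lemma gamma_class_add:
 assumes "f \<in> carrier Gamma_ring" "g \<in> carrier Gamma_ring"
 shows "gamma_class p f \<otimes>\<^bsub>gamma_group p\<^esub> gamma_class p g = gamma_class p (f + g)"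
proof -
 have "gamma_rels p \<lhd> add_monoid Gamma_ring"
  by (rule comm_group.normal_iff_subgroup[OF comm_group_add_Gamma, THEN iffD2, OF subgroup_gamma_rels])
 from normal.rcos_sum[OF this, of f g] assms show ?thesis by (simp add: gamma_group_def)
qed

lemma gamma_class_eq_iff:
 assumes "f \<in> carrier Gamma_ring" "g \<in> carrier Gamma_ring"
 shows "gamma_class p f = gamma_class p g \<longleftrightarrow> f - g \<in> gamma_rels p"
proof -
 interpret ring Gamma_ring by (rule ring_Gamma_ring)
 have "\<ominus>\<^bsub>Gamma_ring\<^esub> g = - g" using assms by (intro minus_equality) (auto intro: Gamma_ring_uminus)
 then have "inv\<^bsub>add_monoid Gamma_ring\<^esub> g = - g" by (simp add: a_inv_def)
 then show ?thesis
  using comm_group.rcos_eq_iff[OF comm_group_add_Gamma subgroup_gamma_rels, of f g p] assms by simp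
qed

lemma Gamma_p_simps:
 assumes p: "prime p"
 shows "carrier (Gamma_p p d) = carrier (gamma_group p)" "monoid.mult (Gamma_p p d) = monoid.mult (gamma_group p)"
  "\<one>\<^bsub>Gamma_p p d\<^esub> = \<one>\<^bsub>gamma_group p\<^esub>"
  "homog (Gamma_p p d) n = generate (gamma_group p) {gamma_class p (divided_power i) | i. d * i = n}"
proof -
 have 1: "carrier (Gamma_p_ring p) = carrier (gamma_group p)"
  "ring.add (Gamma_p_ring p) = monoid.mult (gamma_group p)" "ring.zero (Gamma_p_ring p) = \<one>\<^bsub>gamma_group p\<^esub>"
  by (simp_all add: Gamma_p_ring_def FactRing_def A_RCOSETS_def gamma_group_def FactGroup_def
    Gamma_ideal_eq[OF p] set_add_def)
 then show "carrier (Gamma_p p d) = carrier (gamma_group p)" "monoid.mult (Gamma_p p d) = monoid.mult (gamma_group p)"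
  "\<one>\<^bsub>Gamma_p p d\<^esub> = \<one>\<^bsub>gamma_group p\<^esub>" by (simp_all add: Gamma_p_def)
 show "homog (Gamma_p p d) n = generate (gamma_group p) {gamma_class p (divided_power i) | i. d * i = n}"
 proof -
  have "add_monoid (Gamma_p_ring p) = gamma_group p"
   unfolding 1 by (simp add: gamma_group_def FactGroup_def)
  then show ?thesis
   unfolding Gamma_p_def a_r_coset_def Gamma_ideal_eq[OF p] by simp
 qed
qed

text \<open>Allows a change of record type, from graded groups to plain monoids, which equality of
  the structures would not.\<close>

lemma generate_cong:
 assumes "carrier G = carrier H" "monoid.mult G = monoid.mult H" "\<one>\<^bsub>G\<^esub> = \<one>\<^bsub>H\<^esub>"
 shows "generate G S = generate H S"
proof -
 have inv: "inv\<^bsub>G\<^esub> x = inv\<^bsub>H\<^esub> x" for x by (simp add: m_inv_def assms)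
 have 1: "x \<in> generate H S" if "x \<in> generate G S" for x
  using that by induction (auto simp: assms inv intro: generate.intros)
 have 2: "x \<in> generate G S" if "x \<in> generate H S" for x
  using that by induction (auto simp: assms[symmetric] inv[symmetric] intro: generate.intros)
 from 1 2 show ?thesis by blast
qed

lemma (in group) pow_gcd_eq_one:
 assumes "x \<in> carrier G" "x [^] (a :: nat) = \<one>" "x [^] (b :: nat) = \<one>"
 shows "x [^] (gcd a b) = \<one>"
 using assms by (simp add: pow_eq_id)

text \<open>Integral lifts of the coordinates of a class; they are well defined modulo \<open>gamma_modulus\<close>.\<close>

definition class_coord :: "rat poly set \<Rightarrow> nat \<Rightarrow> int"
 where "class_coord A i = \<lfloor>divided_coeff (SOME f. f \<in> A) i\<rfloor>"

lemma class_coord: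
 assumes f: "f \<in> carrier Gamma_ring"
 obtains c where "of_int (class_coord (gamma_class p f) i) = divided_coeff f i + of_int (int (gamma_modulus p i) * c)"
proof -
 interpret comm_group "add_monoid Gamma_ring" by (rule comm_group_add_Gamma)
 define g where "g = (SOME h. h \<in> gamma_class p f)"
 have "f \<in> gamma_class p f"
  using rcos_self[of f "gamma_rels p"] subgroup_gamma_rels f by simp
 then have g: "g \<in> gamma_class p f" unfolding g_def by (rule someI)
 have sub: "gamma_class p f \<subseteq> carrier Gamma_ring"
  using r_coset_subset_G[of "gamma_rels p" f] gamma_rels_carrier[of p] f by simp
 have gc: "g \<in> carrier Gamma_ring" using g sub by blast
 have "gamma_class p f = gamma_class p g"
  using repr_independence[OF g _ subgroup_gamma_rels] f by simp
 then have "f - g \<in> gamma_rels p" using gamma_class_eq_iff[OF f gc] by simp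
 then obtain c where c: "divided_coeff f i - divided_coeff g i = of_int (int (gamma_modulus p i) * c)"
  unfolding gamma_rels_def by (auto simp: divided_coeff_simps)
 have "divided_coeff g i \<in> \<int>" using gc by (simp add: carrier_Gamma_ring)
 then have "of_int (class_coord (gamma_class p f) i) = divided_coeff g i"
  unfolding class_coord_def g_def[symmetric] by (auto elim: Ints_cases)
 then show thesis using c by (intro that[of "- c"]) (simp add: algebra_simps)
qed

lemma class_coord_add:
 assumes "A \<in> carrier (gamma_group p)" "B \<in> carrier (gamma_group p)"
 shows "int (gamma_modulus p i) dvd class_coord (A \<otimes>\<^bsub>gamma_group p\<^esub> B) i - class_coord A i - class_coord B i"
proof -
 obtain f g where fg: "A = gamma_class p f" "f \<in> carrier Gamma_ring" "B = gamma_class p g" "g \<in> carrier Gamma_ring"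
  using assms by (auto simp: carrier_gamma_group)
 obtain a where a: "of_int (class_coord A i) = divided_coeff f i + of_int (int (gamma_modulus p i) * a)"
  unfolding fg using fg by (metis class_coord)
 obtain b where b: "of_int (class_coord B i) = divided_coeff g i + of_int (int (gamma_modulus p i) * b)"
  unfolding fg using fg by (metis class_coord)
 obtain c where c: "of_int (class_coord (A \<otimes>\<^bsub>gamma_group p\<^esub> B) i) = divided_coeff (f + g) i + of_int (int (gamma_modulus p i) * c)"
  unfolding fg gamma_class_add[OF fg(2,4)] using fg by (metis class_coord Gamma_ring_add)
 have "of_int (class_coord (A \<otimes>\<^bsub>gamma_group p\<^esub> B) i - class_coord A i - class_coord B i)
   = (of_int (int (gamma_modulus p i) * (c - a - b)) :: rat)"
  by (simp only: of_int_diff a b c divided_coeff_simps) (simp add: algebra_simps)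
 then have "class_coord (A \<otimes>\<^bsub>gamma_group p\<^esub> B) i - class_coord A i - class_coord B i
   = int (gamma_modulus p i) * (c - a - b)" by (simp only: of_int_eq_iff)
 then show ?thesis by simp
qed

definition gamma_z :: "nat \<Rightarrow> nat \<Rightarrow> rat poly set"
 where "gamma_z p i = gamma_class p (divided_power i)"

lemma gamma_z_closed: "gamma_z p i \<in> carrier (gamma_group p)"
 unfolding gamma_z_def carrier_gamma_group using Gamma_ring_divided_power by blast

lemma class_coord_z: "int (gamma_modulus p i) dvd class_coord (gamma_z p k) i - (if i = k then 1 else 0)"
proof -
 obtain c where "of_int (class_coord (gamma_z p k) i) = divided_coeff (divided_power k) i + of_int (int (gamma_modulus p i) * c)"
  unfolding gamma_z_def using class_coord[OF Gamma_ring_divided_power] by metis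
 then have "of_int (class_coord (gamma_z p k) i) = (of_int ((if i = k then 1 else 0) + int (gamma_modulus p i) * c) :: rat)"
  by (simp add: divided_coeff_simps)
 then have "class_coord (gamma_z p k) i = (if i = k then 1 else 0) + int (gamma_modulus p i) * c"
  by (simp only: of_int_eq_iff)
 then show ?thesis by simp
qed

lemma gamma_z_pow: "gamma_z p i [^]\<^bsub>gamma_group p\<^esub> (gamma_modulus p i) = \<one>\<^bsub>gamma_group p\<^esub>"
proof -
 have pow: "gamma_z p i [^]\<^bsub>gamma_group p\<^esub> (m :: nat) = gamma_class p (of_nat m * divided_power i)" for m
 proof (induction m)
  case 0
  have "\<one>\<^bsub>gamma_group p\<^esub> = gamma_class p 0"
   using comm_group.rcos_eq_one_iff[OF comm_group_add_Gamma subgroup_gamma_rels, of 0 p]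
    subgroup.one_closed[OF subgroup_gamma_rels, of p] Gamma_ring_zero
   by (simp add: gamma_group_def)
  then show ?case by (simp only: nat_pow_0 of_nat_0 mult_zero_left)
 next
  case (Suc m)
  have "of_nat m * divided_power i \<in> carrier Gamma_ring"
   using Gamma_ring_of_int_mult[OF Gamma_ring_divided_power, of "int m"] by simp
  note add = gamma_class_add[OF this Gamma_ring_divided_power]
  have "gamma_z p i [^]\<^bsub>gamma_group p\<^esub> Suc m = gamma_class p (of_nat m * divided_power i) \<otimes>\<^bsub>gamma_group p\<^esub> gamma_z p i"
   unfolding nat_pow_Suc Suc.IH ..
  also have "\<dots> = gamma_class p (of_nat m * divided_power i + divided_power i)"
   unfolding gamma_z_def by (rule add)
  also have "of_nat m * divided_power i + divided_power i = of_nat (Suc m) * divided_power i"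
   by (simp add: algebra_simps)
  finally show ?case .
 qed
 have m: "of_nat (gamma_modulus p i) * divided_power i \<in> gamma_rels p"
  using divided_coeff_of_int_mult[of "int (gamma_modulus p i)" "divided_power i"]
  unfolding gamma_rels_def
  by (intro CollectI allI) (simp add: divided_coeff_simps)
 then show ?thesis
  unfolding pow
  using comm_group.rcos_eq_one_iff[OF comm_group_add_Gamma subgroup_gamma_rels, of _ p] gamma_rels_carrier[of p]
  by (simp add: gamma_group_def subset_eq)
qed

text \<open>The gcd of two powers of p has the smaller exponent, and gcd with 0 is the other
  argument, which covers pairs with one entry 0. For the pair (0, 0) it would be 0, an element of
  infinite order.\<close>

lemma gcd_gamma_modulus:
 assumes p: "prime p" and ij: "ij \<noteq> (0, 0)"
 shows "gcd (gamma_modulus p (fst ij)) (gamma_modulus p (snd ij)) = p ^ Suc (vp_gcd p ij)"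
proof -
 have pow: "gcd (p ^ a) (p ^ b) = p ^ min a b" for a b
  by (cases "a \<le> b") (simp_all add: le_imp_power_dvd gcd_proj1_if_dvd gcd_proj2_if_dvd min_def)
 consider "fst ij = 0" "snd ij \<noteq> 0" | "fst ij \<noteq> 0" "snd ij = 0" | "fst ij \<noteq> 0" "snd ij \<noteq> 0"
  using ij by (cases ij) auto
 then show ?thesis
 proof cases
  case 3
  then have "vp_gcd p ij = min (multiplicity p (fst ij)) (multiplicity p (snd ij))"
   unfolding vp_gcd_def using p by (intro multiplicity_gcd) auto
  then show ?thesis using 3 pow[of "Suc (multiplicity p (fst ij))" "Suc (multiplicity p (snd ij))"]
   by (simp add: gamma_modulus_def min_Suc_Suc)
 qed (simp_all add: gamma_modulus_def vp_gcd_def)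
qed

section \<open>The tensor product of the two additive groups\<close>

context
 fixes p :: nat
 assumes p: "prime p"
begin

abbreviation (input) "QQ \<equiv> gamma_group p"
abbreviation (input) "FF \<equiv> free_Abelian_group (carrier (gamma_group p) \<times> carrier (gamma_group p))"
abbreviation (input) "KK \<equiv> tensor_kernel (gamma_group p) (gamma_group p)"
abbreviation (input) "TT \<equiv> tensor_group (gamma_group p) (gamma_group p)"

lemma gamma_mult_closed: "a \<in> carrier QQ \<Longrightarrow> b \<in> carrier QQ \<Longrightarrow> a \<otimes>\<^bsub>QQ\<^esub> b \<in> carrier QQ"
 using comm_group_gamma_group[of p] by (meson comm_group.axioms(2) group.is_monoid monoid.m_closed)

lemma tensor_relations_carrier: "tensor_relations QQ QQ \<subseteq> carrier FF"
proof
 fix X assume "X \<in> tensor_relations QQ QQ"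
 then obtain u v w where "X = frag_of u - frag_of v - frag_of w"
  "u \<in> carrier QQ \<times> carrier QQ" "v \<in> carrier QQ \<times> carrier QQ" "w \<in> carrier QQ \<times> carrier QQ"
  unfolding tensor_relations_def using gamma_mult_closed by blast
 moreover have "keys (frag_of u - frag_of v - frag_of w) \<subseteq> {u, v, w}"
  using keys_diff[of "frag_of u - frag_of v" "frag_of w"] keys_diff[of "frag_of u" "frag_of v"] by fastforce
 ultimately show "X \<in> carrier FF" by auto
qed

lemma subgroup_tensor_kernel: "subgroup KK FF"
 unfolding tensor_kernel_def
 by (rule group.generate_is_subgroup[OF group_free_Abelian_group tensor_relations_carrier])

lemma comm_group_tensor: "comm_group TT"
 unfolding tensor_group_def
 by (rule comm_group.abelian_FactGroup[OF abelian_free_Abelian_group subgroup_tensor_kernel])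

definition tensor_class :: "(rat poly set \<times> rat poly set \<Rightarrow>\<^sub>0 int) \<Rightarrow> (rat poly set \<times> rat poly set \<Rightarrow>\<^sub>0 int) set"
 where "tensor_class X = KK #>\<^bsub>FF\<^esub> X"

lemma tensor_class_hom: "tensor_class \<in> hom FF TT"
proof -
 have "KK \<lhd> FF"
  by (rule comm_group.normal_iff_subgroup[OF abelian_free_Abelian_group, THEN iffD2, OF subgroup_tensor_kernel])
 from normal.r_coset_hom_Mod[OF this] show ?thesis
  unfolding tensor_group_def tensor_class_def[abs_def] .
qed

lemma tensor_class_eq_one_iff: "X \<in> carrier FF \<Longrightarrow> tensor_class X = \<one>\<^bsub>TT\<^esub> \<longleftrightarrow> X \<in> KK"
 using comm_group.rcos_eq_one_iff[OF abelian_free_Abelian_group subgroup_tensor_kernel, of X]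
 by (simp add: tensor_class_def tensor_group_def)

lemma group_hom_tensor_class: "group_hom FF TT tensor_class"
 using tensor_class_hom comm_group_tensor
 by (simp add: group_hom_def group_hom_axioms_def comm_group.axioms(2))

lemma pure_tensor_class: "pure_tensor QQ QQ a b = tensor_class (frag_of (a, b))"
 by (simp add: pure_tensor_def tensor_class_def)

lemma frag_carrier: "a \<in> carrier QQ \<Longrightarrow> b \<in> carrier QQ \<Longrightarrow> frag_of (a, b) \<in> carrier FF"
 by simp

lemma pure_tensor_hom_left:
 assumes b: "b \<in> carrier QQ"
 shows "(\<lambda>a. tensor_class (frag_of (a, b))) \<in> hom QQ TT"
proof (rule homI)
 interpret q: group_hom FF TT tensor_class by (rule group_hom_tensor_class)
 fix a assume a: "a \<in> carrier QQ"
 show "tensor_class (frag_of (a, b)) \<in> carrier TT" by (rule q.hom_closed[OF frag_carrier[OF a b]])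
 fix a' assume a': "a' \<in> carrier QQ"
 let ?R = "frag_of (a \<otimes>\<^bsub>QQ\<^esub> a', b) - frag_of (a, b) - frag_of (a', b)"
 have "?R \<in> tensor_relations QQ QQ" unfolding tensor_relations_def using a a' b by blast
 then have R: "?R \<in> KK" unfolding tensor_kernel_def by (rule generate.incl)
 have Rc: "?R \<in> carrier FF" using R subgroup.subset[OF subgroup_tensor_kernel] by blast
 have "frag_of (a \<otimes>\<^bsub>QQ\<^esub> a', b) = ?R \<otimes>\<^bsub>FF\<^esub> (frag_of (a, b) \<otimes>\<^bsub>FF\<^esub> frag_of (a', b))" by simp
 then have "tensor_class (frag_of (a \<otimes>\<^bsub>QQ\<^esub> a', b))
   = tensor_class ?R \<otimes>\<^bsub>TT\<^esub> (tensor_class (frag_of (a, b)) \<otimes>\<^bsub>TT\<^esub> tensor_class (frag_of (a', b)))"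
  using q.hom_mult[OF Rc, of "frag_of (a, b) \<otimes>\<^bsub>FF\<^esub> frag_of (a', b)"]
   q.hom_mult[OF frag_carrier[OF a b] frag_carrier[OF a' b]]
   q.G.m_closed[OF frag_carrier[OF a b] frag_carrier[OF a' b]] by simp
 also have "tensor_class ?R = \<one>\<^bsub>TT\<^esub>" using tensor_class_eq_one_iff[OF Rc] R by simp
 finally show "tensor_class (frag_of (a \<otimes>\<^bsub>QQ\<^esub> a', b)) = tensor_class (frag_of (a, b)) \<otimes>\<^bsub>TT\<^esub> tensor_class (frag_of (a', b))"
  using q.hom_closed[OF frag_carrier[OF a b]] q.hom_closed[OF frag_carrier[OF a' b]] by simp
qed

lemma pure_tensor_hom_right:
 assumes b: "b \<in> carrier QQ"
 shows "(\<lambda>a. tensor_class (frag_of (b, a))) \<in> hom QQ TT"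
proof (rule homI)
 interpret q: group_hom FF TT tensor_class by (rule group_hom_tensor_class)
 fix a assume a: "a \<in> carrier QQ"
 show "tensor_class (frag_of (b, a)) \<in> carrier TT" by (rule q.hom_closed[OF frag_carrier[OF b a]])
 fix a' assume a': "a' \<in> carrier QQ"
 let ?R = "frag_of (b, a \<otimes>\<^bsub>QQ\<^esub> a') - frag_of (b, a) - frag_of (b, a')"
 have "?R \<in> tensor_relations QQ QQ" unfolding tensor_relations_def using a a' b by blast
 then have R: "?R \<in> KK" unfolding tensor_kernel_def by (rule generate.incl)
 have Rc: "?R \<in> carrier FF" using R subgroup.subset[OF subgroup_tensor_kernel] by blast
 have "frag_of (b, a \<otimes>\<^bsub>QQ\<^esub> a') = ?R \<otimes>\<^bsub>FF\<^esub> (frag_of (b, a) \<otimes>\<^bsub>FF\<^esub> frag_of (b, a'))" by simp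
 then have "tensor_class (frag_of (b, a \<otimes>\<^bsub>QQ\<^esub> a'))
   = tensor_class ?R \<otimes>\<^bsub>TT\<^esub> (tensor_class (frag_of (b, a)) \<otimes>\<^bsub>TT\<^esub> tensor_class (frag_of (b, a')))"
  using q.hom_mult[OF Rc, of "frag_of (b, a) \<otimes>\<^bsub>FF\<^esub> frag_of (b, a')"]
   q.hom_mult[OF frag_carrier[OF b a] frag_carrier[OF b a']]
   q.G.m_closed[OF frag_carrier[OF b a] frag_carrier[OF b a']] by simp
 also have "tensor_class ?R = \<one>\<^bsub>TT\<^esub>" using tensor_class_eq_one_iff[OF Rc] R by simp
 finally show "tensor_class (frag_of (b, a \<otimes>\<^bsub>QQ\<^esub> a')) = tensor_class (frag_of (b, a)) \<otimes>\<^bsub>TT\<^esub> tensor_class (frag_of (b, a'))"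
  using q.hom_closed[OF frag_carrier[OF b a]] q.hom_closed[OF frag_carrier[OF b a']] by simp
qed

definition pair_frag :: "(nat \<times> nat \<Rightarrow>\<^sub>0 int) \<Rightarrow> (rat poly set \<times> rat poly set \<Rightarrow>\<^sub>0 int)"
 where "pair_frag c = frag_extend (\<lambda>ij. frag_of (gamma_z p (fst ij), gamma_z p (snd ij))) c"

definition gamma_cover :: "(nat \<times> nat \<Rightarrow>\<^sub>0 int) \<Rightarrow> (rat poly set \<times> rat poly set \<Rightarrow>\<^sub>0 int) set"
 where "gamma_cover c = tensor_class (pair_frag c)"

lemma pair_frag_carrier: "pair_frag c \<in> carrier FF"
 using keys_frag_extend[of "\<lambda>ij. frag_of (gamma_z p (fst ij), gamma_z p (snd ij))" c] gamma_z_closed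
 by (auto simp: pair_frag_def)

lemma gamma_cover_hom: "gamma_cover \<in> hom (free_Abelian_group S) TT"
proof (rule homI)
 show "gamma_cover c \<in> carrier TT" for c
  unfolding gamma_cover_def by (rule hom_in_carrier[OF tensor_class_hom pair_frag_carrier])
 show "gamma_cover (c \<otimes>\<^bsub>free_Abelian_group S\<^esub> c') = gamma_cover c \<otimes>\<^bsub>TT\<^esub> gamma_cover c'" for c c'
  using hom_mult[OF tensor_class_hom pair_frag_carrier pair_frag_carrier, of c c']
  by (simp add: gamma_cover_def pair_frag_def frag_extend_add)
qed

lemma gamma_cover_gen: "gamma_cover (frag_of (i, j)) = pure_tensor QQ QQ (gamma_z p i) (gamma_z p j)"
 by (simp add: gamma_cover_def pair_frag_def pure_tensor_class)

text \<open>The bilinear extension of the products of two coordinates. It descends to the tensor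
  product modulo p^(a+1). The free group on \<open>()\<close> plays the role of the integers, since
  \<open>frag_extend\<close> takes values in a free group.\<close>

definition pair_coord :: "nat \<times> nat \<Rightarrow> (rat poly set \<times> rat poly set \<Rightarrow>\<^sub>0 int) \<Rightarrow> int"
 where "pair_coord ij X = lookup
  (frag_extend (\<lambda>ab. frag_cmul (class_coord (fst ab) (fst ij) * class_coord (snd ab) (snd ij)) (frag_of ())) X) ()"

lemma pair_coord_simps:
 "pair_coord ij (X + Y) = pair_coord ij X + pair_coord ij Y"
 "pair_coord ij (X - Y) = pair_coord ij X - pair_coord ij Y"
 "pair_coord ij (- X) = - pair_coord ij X"
 "pair_coord ij 0 = 0"
 "pair_coord ij (frag_cmul m X) = m * pair_coord ij X"
 "pair_coord ij (frag_of (a, b)) = class_coord a (fst ij) * class_coord b (snd ij)"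
 by (simp_all add: pair_coord_def frag_extend_add frag_extend_diff frag_extend_minus frag_extend_cmul lookup_add lookup_minus)

lemma pair_modulus_dvd:
 assumes "ij \<noteq> (0, 0)"
 shows "int (p ^ Suc (vp_gcd p ij)) dvd int (gamma_modulus p (fst ij))" "int (p ^ Suc (vp_gcd p ij)) dvd int (gamma_modulus p (snd ij))"
 using gcd_gamma_modulus[OF p assms] by (metis gcd_dvd1 of_nat_dvd_iff, metis gcd_dvd2 of_nat_dvd_iff)

text \<open>\<open>class_coord\<close> is additive modulo the order of z_i or z_j, and p^(a+1)
  divides both orders, so it divides the value on each bilinearity relation.\<close>

lemma pair_coord_kernel:
 assumes ij: "ij \<noteq> (0, 0)" and X: "X \<in> KK"
 shows "int (p ^ Suc (vp_gcd p ij)) dvd pair_coord ij X"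
 using X unfolding tensor_kernel_def
proof (induction rule: generate.induct)
 have rel: "int (p ^ Suc (vp_gcd p ij)) dvd pair_coord ij h" if "h \<in> tensor_relations QQ QQ" for h
  using that unfolding tensor_relations_def
 proof (elim UnE CollectE exE conjE)
  fix a a' b assume h: "h = frag_of (a \<otimes>\<^bsub>QQ\<^esub> a', b) - frag_of (a, b) - frag_of (a', b)"
   and c: "a \<in> carrier QQ" "a' \<in> carrier QQ"
  have "pair_coord ij h = (class_coord (a \<otimes>\<^bsub>QQ\<^esub> a') (fst ij) - class_coord a (fst ij) - class_coord a' (fst ij)) * class_coord b (snd ij)"
   by (simp add: h pair_coord_simps algebra_simps)
  then show ?thesis using dvd_trans[OF pair_modulus_dvd(1)[OF ij] class_coord_add[OF c]] by (simp only: dvd_mult2)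
 next
  fix a b b' assume h: "h = frag_of (a, b \<otimes>\<^bsub>QQ\<^esub> b') - frag_of (a, b) - frag_of (a, b')"
   and c: "b \<in> carrier QQ" "b' \<in> carrier QQ"
  have "pair_coord ij h = class_coord a (fst ij) * (class_coord (b \<otimes>\<^bsub>QQ\<^esub> b') (snd ij) - class_coord b (snd ij) - class_coord b' (snd ij))"
   by (simp add: h pair_coord_simps algebra_simps)
  then show ?thesis using dvd_trans[OF pair_modulus_dvd(2)[OF ij] class_coord_add[OF c]] by (simp only: dvd_mult)
 qed
 {
  case one show ?case by (simp add: pair_coord_simps)
 next
  case (incl h) then show ?case by (rule rel)
 next
  case (inv h)
  have "h \<in> carrier FF" using inv tensor_relations_carrier by blast
  then have "inv\<^bsub>FF\<^esub> h = - h" by simp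
  then show ?case using rel[OF inv] by (simp only: pair_coord_simps dvd_minus_iff)
 next
  case (eng h1 h2) then show ?case by (simp add: pair_coord_simps)
 }
qed

lemma pair_coord_pair_frag:
 assumes ij: "ij \<noteq> (0, 0)"
 shows "int (p ^ Suc (vp_gcd p ij)) dvd pair_coord ij (pair_frag c) - lookup c ij"
proof -
 let ?m = "int (p ^ Suc (vp_gcd p ij))"
 have "?m dvd pair_coord ij (pair_frag (frag_cmul l (frag_of kl))) - lookup (frag_cmul l (frag_of kl)) ij" for l kl
 proof -
  let ?a = "class_coord (gamma_z p (fst kl)) (fst ij)" and ?b = "class_coord (gamma_z p (snd kl)) (snd ij)"
  let ?e = "if fst ij = fst kl then 1 else 0 :: int" and ?f = "if snd ij = snd kl then 1 else 0 :: int"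
  have "?m dvd ?a - ?e" "?m dvd ?b - ?f"
   using dvd_trans[OF pair_modulus_dvd(1)[OF ij] class_coord_z] dvd_trans[OF pair_modulus_dvd(2)[OF ij] class_coord_z] by blast+
  \<comment> \<open>Telescoping: a b - e f = (a - e) b + e (b - f).\<close>
  then have "?m dvd (?a - ?e) * ?b + ?e * (?b - ?f)" by (intro dvd_add dvd_mult dvd_mult2)
  then have "?m dvd l * ((?a - ?e) * ?b + ?e * (?b - ?f))" by (rule dvd_mult)
  moreover have "pair_coord ij (pair_frag (frag_cmul l (frag_of kl))) = l * (?a * ?b)"
   by (simp add: pair_frag_def frag_extend_cmul pair_coord_simps)
  moreover have "lookup (frag_cmul l (frag_of kl)) ij = l * (?e * ?f)"
   by (auto simp: lookup_frag_of prod_eq_iff)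
  moreover have alg: "k * ((a - e) * b + e * (b - f)) = k * (a * b) - k * (e * f)" for k a b e f :: int
   by (simp add: algebra_simps)
  ultimately show ?thesis by (simp only: alg)
 qed
 note single = this
 have add: "?m dvd pair_coord ij (pair_frag (x + y)) - lookup (x + y) ij"
  if "?m dvd pair_coord ij (pair_frag x) - lookup x ij" "?m dvd pair_coord ij (pair_frag y) - lookup y ij" for x y
 proof -
  have "pair_coord ij (pair_frag (x + y)) - lookup (x + y) ij
   = (pair_coord ij (pair_frag x) - lookup x ij) + (pair_coord ij (pair_frag y) - lookup y ij)"
   by (simp add: pair_frag_def frag_extend_add pair_coord_simps lookup_add)
  then show ?thesis using dvd_add[OF that] by simp
 qed
 have "c = frag_extend frag_of c" by (rule frag_expansion)
 then have c: "c = (\<Sum>kl\<in>keys c. frag_cmul (lookup c kl) (frag_of kl))"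
  by (simp add: frag_extend_def)
 have "?m dvd pair_coord ij (pair_frag (\<Sum>kl\<in>K. frag_cmul (l kl) (frag_of kl))) - lookup (\<Sum>kl\<in>K. frag_cmul (l kl) (frag_of kl)) ij" for K l
 proof (induction K rule: infinite_finite_induct)
  case (insert x K)
  then show ?case using add[OF single insert.IH] by simp
 qed (simp_all add: pair_frag_def pair_coord_simps)
 from this[of "lookup c" "keys c"] show ?thesis unfolding c[symmetric] .
qed

text \<open>By bilinearity the tensor is annihilated by the orders of both factors, hence by their
  gcd.\<close>

lemma gamma_cover_gen_torsion:
 assumes ij: "ij \<noteq> (0, 0)"
 shows "gamma_cover (frag_of ij) [^]\<^bsub>TT\<^esub> (p ^ Suc (vp_gcd p ij)) = \<one>\<^bsub>TT\<^esub>"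
proof -
 let ?x = "tensor_class (frag_of (gamma_z p (fst ij), gamma_z p (snd ij)))"
 interpret T: comm_group TT by (rule comm_group_tensor)
 have Q: "group QQ" using comm_group_gamma_group by (rule comm_group.axioms(2))
 interpret l: group_hom QQ TT "\<lambda>a. tensor_class (frag_of (a, gamma_z p (snd ij)))"
  using pure_tensor_hom_left[OF gamma_z_closed] Q T.group_axioms by (simp add: group_hom_def group_hom_axioms_def)
 interpret r: group_hom QQ TT "\<lambda>a. tensor_class (frag_of (gamma_z p (fst ij), a))"
  using pure_tensor_hom_right[OF gamma_z_closed] Q T.group_axioms by (simp add: group_hom_def group_hom_axioms_def)
 have "?x [^]\<^bsub>TT\<^esub> gamma_modulus p (fst ij) = \<one>\<^bsub>TT\<^esub>"
  using l.hom_nat_pow[OF gamma_z_closed, of "fst ij" "gamma_modulus p (fst ij)"] by (simp add: gamma_z_pow)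
 moreover have "?x [^]\<^bsub>TT\<^esub> gamma_modulus p (snd ij) = \<one>\<^bsub>TT\<^esub>"
  using r.hom_nat_pow[OF gamma_z_closed, of "snd ij" "gamma_modulus p (snd ij)"] by (simp add: gamma_z_pow)
 moreover have "?x \<in> carrier TT" by (rule l.hom_closed[OF gamma_z_closed])
 ultimately have "?x [^]\<^bsub>TT\<^esub> (gcd (gamma_modulus p (fst ij)) (gamma_modulus p (snd ij))) = \<one>\<^bsub>TT\<^esub>"
  by (intro T.pow_gcd_eq_one)
 then show ?thesis unfolding gcd_gamma_modulus[OF p ij] by (simp add: gamma_cover_def pair_frag_def)
qed

lemma frag_expansion_sum: "c = (\<Sum>kl\<in>keys c. frag_cmul (lookup c kl) (frag_of kl))"
 using frag_expansion[of c] by (simp add: frag_extend_def)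

lemma gamma_cover_subgroup:
 assumes S: "subgroup S TT" and c: "\<And>ij. ij \<in> keys c \<Longrightarrow> gamma_cover (frag_cmul (lookup c ij) (frag_of ij)) \<in> S"
 shows "gamma_cover c \<in> S"
proof -
 interpret g: group_hom "free_Abelian_group UNIV" TT gamma_cover
  using gamma_cover_hom comm_group_tensor by (simp add: group_hom_def group_hom_axioms_def comm_group.axioms(2))
 have "gamma_cover (\<Sum>kl\<in>K. frag_cmul (lookup c kl) (frag_of kl)) \<in> S" if "K \<subseteq> keys c" for K
  using finite_subset[OF that finite_keys] that
 proof (induction K rule: finite_induct)
  case empty
  show ?case using g.hom_one subgroup.one_closed[OF S] by simp
 next
  case (insert x K)
  then show ?case
   using g.hom_mult[of "frag_cmul (lookup c x) (frag_of x)" "\<Sum>kl\<in>K. frag_cmul (lookup c kl) (frag_of kl)"]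
    subgroup.m_closed[OF S] c by simp
 qed
 from this[OF order_refl] show ?thesis unfolding frag_expansion_sum[symmetric] .
qed

lemma gamma_cover_cmul: "gamma_cover (frag_cmul m x) = gamma_cover x [^]\<^bsub>TT\<^esub> (m :: int)"
proof -
 interpret g: group_hom "free_Abelian_group UNIV" TT gamma_cover
  using gamma_cover_hom comm_group_tensor by (simp add: group_hom_def group_hom_axioms_def comm_group.axioms(2))
 show ?thesis using g.hom_int_pow[of x m] by simp
qed

text \<open>\<open>pair_coord\<close> recovers each coefficient modulo p^(a+1), and the torsion of
  the generators gives the converse. The condition is the one that \<open>H1_cover\<close>
  has.\<close>

lemma gamma_cover_eq_one_iff:
 assumes c: "keys c \<subseteq> positive_pairs"
 shows "gamma_cover c = \<one>\<^bsub>TT\<^esub> \<longleftrightarrow> (\<forall>ij\<in>positive_pairs. int (p ^ Suc (vp_gcd p ij)) dvd lookup c ij)"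
proof
 assume "gamma_cover c = \<one>\<^bsub>TT\<^esub>"
 then have K: "pair_frag c \<in> KK" using tensor_class_eq_one_iff[OF pair_frag_carrier] by (simp add: gamma_cover_def)
 show "\<forall>ij\<in>positive_pairs. int (p ^ Suc (vp_gcd p ij)) dvd lookup c ij"
 proof
  fix ij assume "ij \<in> positive_pairs"
  then have ij: "ij \<noteq> (0, 0)" by simp
  from dvd_diff[OF pair_coord_kernel[OF ij K] pair_coord_pair_frag[OF ij, of c]]
  show "int (p ^ Suc (vp_gcd p ij)) dvd lookup c ij" by simp
 qed
next
 interpret T: comm_group TT by (rule comm_group_tensor)
 assume d: "\<forall>ij\<in>positive_pairs. int (p ^ Suc (vp_gcd p ij)) dvd lookup c ij"
 have "gamma_cover c \<in> {\<one>\<^bsub>TT\<^esub>}"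
 proof (rule gamma_cover_subgroup[OF T.triv_subgroup])
  fix ij assume "ij \<in> keys c"
  then have ij: "ij \<noteq> (0, 0)" using c by blast
  then have "int (p ^ Suc (vp_gcd p ij)) dvd lookup c ij" using d by blast
  then obtain e where e: "lookup c ij = int (p ^ Suc (vp_gcd p ij)) * e" by (rule dvdE)
  have x: "gamma_cover (frag_of ij) \<in> carrier TT" using hom_in_carrier[OF gamma_cover_hom, of "frag_of ij" UNIV] by simp
  have "gamma_cover (frag_of ij) [^]\<^bsub>TT\<^esub> (int (p ^ Suc (vp_gcd p ij)) * e)
    = (gamma_cover (frag_of ij) [^]\<^bsub>TT\<^esub> int (p ^ Suc (vp_gcd p ij))) [^]\<^bsub>TT\<^esub> e"
   by (rule T.int_pow_pow[OF x, symmetric])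
  also have "gamma_cover (frag_of ij) [^]\<^bsub>TT\<^esub> int (p ^ Suc (vp_gcd p ij)) = \<one>\<^bsub>TT\<^esub>"
   using gamma_cover_gen_torsion[OF ij] by (simp only: int_pow_int)
  finally show "gamma_cover (frag_cmul (lookup c ij) (frag_of ij)) \<in> {\<one>\<^bsub>TT\<^esub>}"
   unfolding gamma_cover_cmul e by simp
 qed
 then show "gamma_cover c = \<one>\<^bsub>TT\<^esub>" by simp
qed

lemma tensor_Gamma_p:
 "tensor_kernel (Gamma_p p d) (Gamma_p p d') = KK" "tensor_group (Gamma_p p d) (Gamma_p p d') = TT"
 "pure_tensor (Gamma_p p d) (Gamma_p p d') a b = pure_tensor QQ QQ a b"
proof -
 show K: "tensor_kernel (Gamma_p p d) (Gamma_p p d') = KK"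
  by (simp add: tensor_kernel_def tensor_relations_def Gamma_p_simps[OF p])
 show "tensor_group (Gamma_p p d) (Gamma_p p d') = TT"
  "pure_tensor (Gamma_p p d) (Gamma_p p d') a b = pure_tensor QQ QQ a b"
  by (simp_all add: tensor_group_def pure_tensor_def K Gamma_p_simps[OF p])
qed

lemma subgroup_preimage_left:
 assumes S: "subgroup S TT" and b: "b \<in> carrier QQ"
 shows "subgroup {a \<in> carrier QQ. pure_tensor QQ QQ a b \<in> S} QQ"
  and "subgroup {a \<in> carrier QQ. pure_tensor QQ QQ b a \<in> S} QQ"
proof -
 have Q: "group QQ" using comm_group_gamma_group by (rule comm_group.axioms(2))
 have sub: "subgroup {a \<in> carrier QQ. h a \<in> S} QQ" if "h \<in> hom QQ TT" for h
 proof -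
  interpret h: group_hom QQ TT h
   using that Q comm_group_tensor by (simp add: group_hom_def group_hom_axioms_def comm_group.axioms(2))
  show ?thesis
  proof (rule h.G.subgroupI)
   show "{a \<in> carrier QQ. h a \<in> S} \<noteq> {}" using subgroup.one_closed[OF S] by (auto intro!: exI[of _ "\<one>\<^bsub>QQ\<^esub>"])
  qed (auto intro: subgroup.m_closed[OF S] subgroup.m_inv_closed[OF S])
 qed
 show "subgroup {a \<in> carrier QQ. pure_tensor QQ QQ a b \<in> S} QQ"
  unfolding pure_tensor_class by (rule sub[OF pure_tensor_hom_left[OF b]])
 show "subgroup {a \<in> carrier QQ. pure_tensor QQ QQ b a \<in> S} QQ"
  unfolding pure_tensor_class by (rule sub[OF pure_tensor_hom_right[OF b]])
qed

lemma gamma_cover_closed: "gamma_cover c \<in> carrier TT"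
 using hom_in_carrier[OF gamma_cover_hom, of c UNIV] by simp

lemma subgroup_gamma_cover_image: "subgroup (gamma_cover ` {c. keys c \<subseteq> W}) TT"
proof -
 interpret g: group_hom "free_Abelian_group W" TT gamma_cover
  using gamma_cover_hom comm_group_tensor by (simp add: group_hom_def group_hom_axioms_def comm_group.axioms(2))
 have "carrier (free_Abelian_group W) = {c. keys c \<subseteq> W}" by auto
 then show ?thesis using g.img_is_subgroup by simp
qed

lemma gamma_class_z: "gamma_class p (divided_power i) = gamma_z p i"
 by (simp add: gamma_z_def)

lemma homog_graded_tensor:
 assumes n: "n > 0"
 shows "homog (graded_tensor (Gamma_p p (2 * (p + 1))) (Gamma_p p (2 * p * (p - 1)))) n
  = gamma_cover ` {c. keys c \<subseteq> weight_index p n}"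
proof -
 let ?A = "Gamma_p p (2 * (p + 1))" and ?B = "Gamma_p p (2 * p * (p - 1))"
 let ?P = "{pure_tensor QQ QQ a b | a b i j. a \<in> homog ?A i \<and> b \<in> homog ?B j \<and> i + j = n}"
 let ?S = "gamma_cover ` {c. keys c \<subseteq> weight_index p n}"
 have Q: "group QQ" using comm_group_gamma_group by (rule comm_group.axioms(2))
 interpret T: comm_group TT by (rule comm_group_tensor)
 have h: "homog (graded_tensor ?A ?B) n = generate TT ?P"
  by (simp add: graded_tensor_def tensor_Gamma_p)
 note S = subgroup_gamma_cover_image[of "weight_index p n"]
 have zz: "{gamma_z p i | i. d * i = m} \<subseteq> carrier QQ" for d m using gamma_z_closed by blast
 have PS: "?P \<subseteq> ?S"
 proof
  fix t assume "t \<in> ?P"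
  then obtain a b i j where t: "t = pure_tensor QQ QQ a b" "a \<in> homog ?A i" "b \<in> homog ?B j" "i + j = n" by blast
  have kl: "pure_tensor QQ QQ (gamma_z p k) (gamma_z p l) \<in> ?S"
   if "2 * (p + 1) * k = i" "2 * p * (p - 1) * l = j" for k l
  proof -
   have "(k, l) \<in> weight_index p n" using that t(4) n by (auto simp: weight_index_iff weight_def)
   then show ?thesis unfolding gamma_cover_gen[symmetric] by (intro imageI) auto
  qed
  \<comment> \<open>The homogeneous parts are only generated by the z_k, so bilinearity is used one
    factor at a time, by pulling the target subgroup back along each partial map.\<close>
  have al: "pure_tensor QQ QQ a (gamma_z p l) \<in> ?S" if l: "2 * p * (p - 1) * l = j" for l
  proof -
   have "homog ?A i \<subseteq> {a \<in> carrier QQ. pure_tensor QQ QQ a (gamma_z p l) \<in> ?S}"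
    unfolding Gamma_p_simps[OF p] gamma_class_z
    by (rule group.generate_subgroup_incl[OF Q _ subgroup_preimage_left(1)[OF S gamma_z_closed]])
      (use kl l gamma_z_closed in auto)
   then show ?thesis using t(2) by blast
  qed
  have ac: "a \<in> carrier QQ"
   using t(2) group.generate_incl[OF Q zz] unfolding Gamma_p_simps[OF p] gamma_class_z by blast
  have "homog ?B j \<subseteq> {b \<in> carrier QQ. pure_tensor QQ QQ a b \<in> ?S}"
   unfolding Gamma_p_simps[OF p] gamma_class_z
   by (rule group.generate_subgroup_incl[OF Q _ subgroup_preimage_left(2)[OF S ac]])
     (use al gamma_z_closed in auto)
  then show "t \<in> ?S" using t by blast
 qed
 have 1: "generate TT ?P \<subseteq> ?S" by (rule T.generate_subgroup_incl[OF PS S])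
 have Pc: "?P \<subseteq> carrier TT" by (rule order_trans[OF PS subgroup.subset[OF S]])
 have 2: "?S \<subseteq> generate TT ?P"
 proof
  fix t assume "t \<in> ?S"
  then obtain c where c: "t = gamma_cover c" "keys c \<subseteq> weight_index p n" by blast
  have sub: "subgroup (generate TT ?P) TT" by (rule T.generate_is_subgroup[OF Pc])
  show "t \<in> generate TT ?P"
   unfolding c(1)
  proof (rule gamma_cover_subgroup[OF sub])
   fix ij assume "ij \<in> keys c"
   then have ij: "2 * (p + 1) * fst ij + 2 * p * (p - 1) * snd ij = n" using c(2) by (auto simp: weight_index_def)
   have "gamma_z p (fst ij) \<in> homog ?A (2 * (p + 1) * fst ij)" "gamma_z p (snd ij) \<in> homog ?B (2 * p * (p - 1) * snd ij)"
    unfolding Gamma_p_simps[OF p] gamma_class_z by (rule generate.incl, blast)+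
   then have "pure_tensor QQ QQ (gamma_z p (fst ij)) (gamma_z p (snd ij)) \<in> ?P" using ij by blast
   moreover have "gamma_cover (frag_of ij) = pure_tensor QQ QQ (gamma_z p (fst ij)) (gamma_z p (snd ij))"
    using gamma_cover_gen[of "fst ij" "snd ij"] by simp
   ultimately have "gamma_cover (frag_of ij) \<in> generate TT ?P"
    by (simp only: generate.incl)
   then show "gamma_cover (frag_cmul (lookup c ij) (frag_of ij)) \<in> generate TT ?P"
    unfolding gamma_cover_cmul by (rule T.subgroup_int_pow_closed[OF sub])
  qed
 qed
 from h 1 2 show ?thesis by blast
qed

lemma gamma_cover_graded:
 defines "Y \<equiv> Gamma_p_plus p (2 * (p + 1)) (2 * p * (p - 1))"
 shows "group Y" "gamma_cover \<in> hom (free_Abelian_group positive_pairs) Y"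
  "gamma_cover ` carrier (free_Abelian_group positive_pairs) = carrier Y"
  "\<And>n. gamma_cover ` {c. keys c \<subseteq> weight_index p n} = homog Y n"
  "\<one>\<^bsub>Y\<^esub> = \<one>\<^bsub>TT\<^esub>"
proof -
 let ?L = "graded_tensor (Gamma_p p (2 * (p + 1))) (Gamma_p p (2 * p * (p - 1)))"
 let ?S = "gamma_cover ` {c. keys c \<subseteq> positive_pairs}"
 interpret T: comm_group TT by (rule comm_group_tensor)
 have L: "carrier ?L = carrier TT" "monoid.mult ?L = monoid.mult TT" "\<one>\<^bsub>?L\<^esub> = \<one>\<^bsub>TT\<^esub>"
  by (simp_all add: graded_tensor_def tensor_Gamma_p)
 note S = subgroup_gamma_cover_image[of positive_pairs]
 have cY: "carrier Y = generate TT (\<Union>n\<in>{0<..}. homog ?L n)"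
  unfolding Y_def Gamma_p_plus_def positive_part_def using generate_cong[OF L] by simp
 have hs: "homog ?L n \<subseteq> ?S" if "n > 0" for n
  unfolding homog_graded_tensor[OF that] by (rule image_mono) (auto simp: weight_index_iff)
 have 1: "generate TT (\<Union>n\<in>{0<..}. homog ?L n) \<subseteq> ?S"
  by (rule T.generate_subgroup_incl[OF _ S]) (use hs in auto)
 have Uc: "(\<Union>n\<in>{0<..}. homog ?L n) \<subseteq> carrier TT" using hs gamma_cover_closed by blast
 have 2: "?S \<subseteq> generate TT (\<Union>n\<in>{0<..}. homog ?L n)"
 proof
  fix t assume "t \<in> ?S"
  then obtain c where c: "t = gamma_cover c" "keys c \<subseteq> positive_pairs" by blast
  show "t \<in> generate TT (\<Union>n\<in>{0<..}. homog ?L n)"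
   unfolding c(1)
  proof (rule gamma_cover_subgroup[OF T.generate_is_subgroup[OF Uc]])
   fix ij assume "ij \<in> keys c"
   then have ij: "ij \<noteq> (0, 0)" using c(2) by blast
   have w: "weight p ij > 0"
    using ij prime_ge_2_nat[OF p] by (cases ij) (auto simp: weight_def)
   have "gamma_cover (frag_cmul (lookup c ij) (frag_of ij)) \<in> homog ?L (weight p ij)"
    unfolding homog_graded_tensor[OF w]
   proof (intro imageI CollectI)
    have "keys (frag_cmul (lookup c ij) (frag_of ij)) \<subseteq> {ij}"
     using keys_cmul[of "lookup c ij" "frag_of ij"] by simp
    then show "keys (frag_cmul (lookup c ij) (frag_of ij)) \<subseteq> weight_index p (weight p ij)"
     using ij by (auto simp: weight_index_iff)
   qed
   then show "gamma_cover (frag_cmul (lookup c ij) (frag_of ij)) \<in> generate TT (\<Union>n\<in>{0<..}. homog ?L n)"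
    using w by (intro generate.incl) blast
  qed
 qed
 have c: "carrier Y = ?S" using cY 1 2 by blast
 have m: "x \<otimes>\<^bsub>Y\<^esub> y = x \<otimes>\<^bsub>TT\<^esub> y" for x y
  unfolding Y_def Gamma_p_plus_def positive_part_def using L by simp
 show o: "\<one>\<^bsub>Y\<^esub> = \<one>\<^bsub>TT\<^esub>"
  unfolding Y_def Gamma_p_plus_def positive_part_def using L by simp
 have sc: "x \<in> carrier TT" if "x \<in> ?S" for x using that gamma_cover_closed by blast
 show "group Y"
 proof (rule groupI, unfold c m o)
  fix x assume x: "x \<in> ?S"
  show "\<exists>y\<in>?S. y \<otimes>\<^bsub>TT\<^esub> x = \<one>\<^bsub>TT\<^esub>"
   using subgroup.m_inv_closed[OF S x] T.l_inv[OF sc[OF x]] by blast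
  show "\<one>\<^bsub>TT\<^esub> \<otimes>\<^bsub>TT\<^esub> x = x" by (rule T.l_one[OF sc[OF x]])
  fix y assume y: "y \<in> ?S"
  show "x \<otimes>\<^bsub>TT\<^esub> y \<in> ?S" by (rule subgroup.m_closed[OF S x y])
  fix z assume z: "z \<in> ?S"
  show "x \<otimes>\<^bsub>TT\<^esub> y \<otimes>\<^bsub>TT\<^esub> z = x \<otimes>\<^bsub>TT\<^esub> (y \<otimes>\<^bsub>TT\<^esub> z)"
   by (rule T.m_assoc[OF sc[OF x] sc[OF y] sc[OF z]])
 qed (rule subgroup.one_closed[OF S])
 show "gamma_cover \<in> hom (free_Abelian_group positive_pairs) Y"
  using hom_mult[OF gamma_cover_hom] by (intro homI) (auto simp: c m)
 show "gamma_cover ` carrier (free_Abelian_group positive_pairs) = carrier Y"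
  unfolding c by (rule arg_cong[where f = "image gamma_cover"]) auto
 show "gamma_cover ` {c. keys c \<subseteq> weight_index p n} = homog Y n" for n
 proof (cases "n = 0")
  case True
  have "gamma_cover 0 = \<one>\<^bsub>TT\<^esub>" using gamma_cover_eq_one_iff[of 0] by simp
  then show ?thesis
   unfolding Y_def Gamma_p_plus_def positive_part_def using L True
   by (simp add: weight_index_0[OF prime_ge_2_nat[OF p]])
 next
  case False
  then show ?thesis
   unfolding Y_def Gamma_p_plus_def positive_part_def using homog_graded_tensor[of n] by simp
 qed
qed

end

lemma graded_iso_H1_Gamma:
 assumes p: "prime p" "odd p"
 shows "graded_iso (graded_primary_part p (H_B3_M 1)) (Gamma_p_plus p (2 * (p + 1)) (2 * p * (p - 1)))"
proof (rule graded_iso_common_cover[of "free_Abelian_group positive_pairs" _ _ "H1_cover p" "gamma_cover p" "\<lambda>n. {c. keys c \<subseteq> weight_index p n}"])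
 have L: "comm_group (H_B3 1 n)" for n using H_B3_comm_group by simp
 show "group (graded_primary_part p (H_B3_M 1))"
  unfolding H_B3_M_def by (rule group_graded_primary_part[OF L])
 show "H1_cover p x = \<one>\<^bsub>graded_primary_part p (H_B3_M 1)\<^esub> \<longleftrightarrow> gamma_cover p x = \<one>\<^bsub>Gamma_p_plus p (2 * (p + 1)) (2 * p * (p - 1))\<^esub>"
  if "x \<in> carrier (free_Abelian_group positive_pairs)" for x
  using H1_cover_graded(4)[OF p that] gamma_cover_eq_one_iff[OF p(1), of x] that
  unfolding gamma_cover_graded(5)[OF p(1)] by simp
 show "{c. keys c \<subseteq> weight_index p n} \<subseteq> carrier (free_Abelian_group positive_pairs)" for n
  by (auto simp: weight_index_iff)
qed (use H1_cover_graded[OF p] gamma_cover_graded[OF p(1)] in simp_all)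

section \<open>Free parts\<close>

context comm_group
begin

lemma hom_integer_mult:
 "c \<in> hom G integer_group \<Longrightarrow> x \<in> carrier G \<Longrightarrow> y \<in> carrier G \<Longrightarrow> c (x \<otimes> y) = c x + (c y :: int)"
 by (simp add: hom_def)

lemma hom_integer_pow:
 assumes c: "c \<in> hom G integer_group" and x: "x \<in> carrier G"
 shows "c (x [^] (k :: int)) = k * c x" "c (x [^] (n :: nat)) = int n * c x" "c (inv x) = - c x"
proof -
 interpret h: group_hom G integer_group c
  by (simp add: group_hom_def group_hom_axioms_def c)
 show "c (x [^] k) = k * c x" using h.hom_int_pow[OF x, of k] by simp
 show "c (x [^] n) = int n * c x" using h.hom_nat_pow[OF x, of n] by simp
 show "c (inv x) = - c x" using h.hom_inv[OF x] by simp
qed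

lemma hom_integer_one: "c \<in> hom G integer_group \<Longrightarrow> c \<one> = (0 :: int)"
 using hom_one[OF _ is_group group_integer_group] by simp

lemma subgroup_kernel_inter:
 assumes c: "c \<in> hom G integer_group" and K: "subgroup K G"
 shows "subgroup {x \<in> K. c x = 0} G"
 using K by (intro subgroupI)
  (auto simp: subgroup.mem_carrier subgroup.one_closed subgroup.m_inv_closed subgroup.m_closed
   hom_integer_mult[OF c] hom_integer_pow[OF c] hom_integer_one[OF c] intro!: exI[of _ "\<one>"])

text \<open>The image of a subgroup under a homomorphism to \<open>\<int>\<close> is generated by its least positive
 element.\<close>

lemma subgroup_split_by_hom:
 assumes c: "c \<in> hom G integer_group" and K: "subgroup K G"
  and x0: "x0 \<in> K" "c x0 \<noteq> 0"
 obtains z where "z \<in> K" "c z \<noteq> 0"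
  "\<And>x. x \<in> K \<Longrightarrow> \<exists>k :: int. \<exists>y\<in>K. c y = 0 \<and> x = y \<otimes> z [^] k"
proof -
 note KG = subgroup.mem_carrier[OF K]
 define P where "P = (\<lambda>n :: nat. n > 0 \<and> (\<exists>x\<in>K. c x = int n))"
 have "P (nat \<bar>c x0\<bar>)"
 proof (cases "c x0 > 0")
  case True
  then show ?thesis unfolding P_def using x0 by force
 next
  case False
  then show ?thesis unfolding P_def
   using x0 hom_integer_pow(3)[OF c KG[OF x0(1)]] subgroup.m_inv_closed[OF K x0(1)] by force
 qed
 then have L: "P (LEAST n. P n)" by (rule LeastI)
 then obtain z where z: "z \<in> K" "c z = int (LEAST n. P n)" "c z > 0" unfolding P_def by auto
 have "\<exists>k :: int. \<exists>y\<in>K. c y = 0 \<and> x = y \<otimes> z [^] k" if x: "x \<in> K" for x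
 proof -
  define k where "k = c x div c z"
  define y where "y = x \<otimes> z [^] (- k)"
  have pow: "z [^] j \<in> K" "z [^] j \<in> carrier G" for j :: int
   using subgroup_int_pow_closed[OF K z(1)] KG by auto
  have y: "y \<in> K" unfolding y_def by (rule subgroup.m_closed[OF K x pow(1)])
  have cy: "c y = c x mod c z"
   unfolding y_def
   by (simp add: hom_integer_mult[OF c] hom_integer_pow(1)[OF c] KG x z(1) pow k_def minus_div_mult_eq_mod)
  have "c y = 0"
  proof (rule ccontr)
   assume "c y \<noteq> 0"
   then have cy': "0 < c y" "c y < c z" using cy z(3) pos_mod_bound[of "c z" "c x"] pos_mod_sign[of "c z" "c x"] by linarith+
   then have "P (nat (c y))" unfolding P_def using y by auto
   then have "(LEAST n. P n) \<le> nat (c y)" by (rule Least_le)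
   then show False using cy' z(2) by linarith
  qed
  moreover have "x = y \<otimes> z [^] k"
   unfolding y_def using KG x z(1) pow by (simp add: m_assoc flip: int_pow_mult)
  ultimately show ?thesis using y by blast
 qed
 then show ?thesis using that z by force
qed

text \<open>The image of K under finitely many integer functionals is finitely generated: split off
  an element with least positive value of one functional, and treat the others on its kernel.
  Therefore K varies in the induction.\<close>

lemma generated_modulo_joint_kernel:
 fixes c :: "'i \<Rightarrow> 'a \<Rightarrow> int"
 assumes "finite I" "\<And>i. i \<in> I \<Longrightarrow> c i \<in> hom G integer_group" "subgroup K G"
 shows "\<exists>S\<subseteq>K. finite S \<and> (\<forall>x\<in>K. \<exists>y\<in>generate G S. \<forall>i\<in>I. c i x = c i y)"
 using assms
proof (induction I arbitrary: K rule: finite_induct)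
 case empty
 then show ?case by (intro exI[of _ "{}"]) (auto intro: generate.one)
next
 case (insert j I)
 note c = insert.prems(1)[OF insertI1] and K = insert.prems(2)
 note KG = subgroup.mem_carrier[OF K]
 show ?case
 proof (cases "\<exists>x0\<in>K. c j x0 \<noteq> 0")
  case False
  obtain S where S: "S \<subseteq> K" "finite S" "\<And>x. x \<in> K \<Longrightarrow> \<exists>y\<in>generate G S. \<forall>i\<in>I. c i x = c i y"
   using insert.IH[OF _ K] insert.prems(1) by (metis insertI2)
  have "generate G S \<subseteq> K" using generate_subgroup_incl[OF S(1) K] .
  then have "\<forall>x\<in>K. \<exists>y\<in>generate G S. \<forall>i\<in>insert j I. c i x = c i y"
   using S(3) False by (metis insert_iff subsetD)
  then show ?thesis using S by blast
 next
  case True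
  then obtain z where z: "z \<in> K"
   "\<And>x. x \<in> K \<Longrightarrow> \<exists>k :: int. \<exists>y\<in>K. c j y = 0 \<and> x = y \<otimes> z [^] k"
   using subgroup_split_by_hom[OF c K] by metis
  let ?K' = "{x \<in> K. c j x = 0}"
  have K': "subgroup ?K' G" by (rule subgroup_kernel_inter[OF c K])
  obtain S where S: "S \<subseteq> ?K'" "finite S" "\<And>x. x \<in> ?K' \<Longrightarrow> \<exists>y\<in>generate G S. \<forall>i\<in>I. c i x = c i y"
   using insert.IH[OF _ K'] insert.prems(1) by (metis (no_types, lifting) insertI2)
  have genK': "generate G S \<subseteq> ?K'" by (rule generate_subgroup_incl[OF S(1) K'])
  have SG: "insert z S \<subseteq> carrier G" using S(1) z(1) KG by auto
  have "\<exists>y\<in>generate G (insert z S). \<forall>i\<in>insert j I. c i x = c i y" if x: "x \<in> K" for x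
  proof -
   obtain k :: int and y where y: "y \<in> K" "c j y = 0" "x = y \<otimes> z [^] k" using z(2)[OF x] by blast
   obtain y' where y': "y' \<in> generate G S" "\<forall>i\<in>I. c i y = c i y'" using S(3) y by blast
   have y'': "y' \<in> carrier G" "c j y' = 0" using genK' y'(1) KG by auto
   have "z [^] k \<in> generate G (insert z S)"
    by (intro subgroup_int_pow_closed generate_is_subgroup SG generate.incl) simp
   moreover have "y' \<in> generate G (insert z S)"
    using mono_generate[of S "insert z S"] y'(1) by blast
   ultimately have "y' \<otimes> z [^] k \<in> generate G (insert z S)" by (simp add: generate.eng)
   moreover have "c i x = c i (y' \<otimes> z [^] k)" if "i \<in> insert j I" for i
    using that y y' y'' insert.prems(1)[OF that] KG z(1) by (auto simp: hom_integer_mult)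
   ultimately show ?thesis by blast
  qed
  moreover have "insert z S \<subseteq> K" using S(1) z(1) by auto
  ultimately show ?thesis using S(2) by (intro exI[of _ "insert z S"]) auto
 qed
qed

text \<open>G is not assumed finitely generated; it is enough that finitely many functionals have
  their joint kernel inside N. This is what lets the obstruction handle the group of
  2-cocycles.\<close>

lemma finitely_generated_quotient:
 fixes c :: "'i \<Rightarrow> 'a \<Rightarrow> int"
 assumes "finite I" "\<And>i. i \<in> I \<Longrightarrow> c i \<in> hom G integer_group" and N: "subgroup N G"
  and ker: "\<And>x. x \<in> carrier G \<Longrightarrow> (\<And>i. i \<in> I \<Longrightarrow> c i x = 0) \<Longrightarrow> x \<in> N"
 shows "finitely_generated_group (G Mod N)"
proof -
 obtain S where S0: "S \<subseteq> carrier G"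
   "finite S \<and> (\<forall>x\<in>carrier G. \<exists>y\<in>generate G S. \<forall>i\<in>I. c i x = c i y)"
  using generated_modulo_joint_kernel[where I = I and c = c and K = "carrier G"] assms(1,2) subgroup_self
  by meson
 then have S: "S \<subseteq> carrier G" "finite S"
  "\<And>x. x \<in> carrier G \<Longrightarrow> \<exists>y\<in>generate G S. \<forall>i\<in>I. c i x = c i y" by simp_all
 interpret Q: comm_group "G Mod N" by (rule abelian_FactGroup[OF N])
 interpret q: group_hom G "G Mod N" "\<lambda>x. N #> x"
  by (simp add: group_hom_def group_hom_axioms_def Q.is_group normal.r_coset_hom_Mod subgroup_imp_normal[OF N])
 have genG: "generate G S \<subseteq> carrier G" by (rule generate_incl[OF S(1)])
 have "X \<in> generate (G Mod N) ((\<lambda>x. N #> x) ` S)" if X: "X \<in> carrier (G Mod N)" for X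
 proof -
  obtain x where x: "x \<in> carrier G" "X = N #> x" using X by (auto simp: carrier_FactGroup)
  obtain y where y: "y \<in> generate G S" "\<forall>i\<in>I. c i x = c i y" using S(3)[OF x(1)] by blast
  have yG: "y \<in> carrier G" using y(1) genG by blast
  have "x \<otimes> inv y \<in> N"
   by (rule ker) (use assms(2) x yG y(2) in \<open>auto simp: hom_integer_mult hom_integer_pow\<close>)
  then have "X = N #> y" using rcos_eq_iff[OF N x(1) yG] x(2) by simp
  then show ?thesis using q.generate_img[OF S(1)] y(1) by auto
 qed
 moreover have "(\<lambda>x. N #> x) ` S \<subseteq> carrier (G Mod N)" using S(1) q.hom_closed by blast
 moreover have "generate (G Mod N) ((\<lambda>x. N #> x) ` S) \<subseteq> carrier (G Mod N)"
  by (rule Q.generate_incl) fact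
 ultimately show ?thesis
  unfolding finitely_generated_group_def using S(2) by (intro exI[of _ "(\<lambda>x. N #> x) ` S"]) auto
qed

lemma subgroup_adjoin:
 assumes F: "subgroup F G" and z: "z \<in> carrier G"
 shows "subgroup {x \<otimes> z [^] (k :: int) | x k. x \<in> F} G"
proof (rule subgroupI)
 note FG = subgroup.mem_carrier[OF F]
 show "{x \<otimes> z [^] (k :: int) | x k. x \<in> F} \<subseteq> carrier G" using FG z by auto
 show "{x \<otimes> z [^] (k :: int) | x k. x \<in> F} \<noteq> {}" using subgroup.one_closed[OF F] by blast
 fix a assume "a \<in> {x \<otimes> z [^] (k :: int) | x k. x \<in> F}"
 then obtain x and k :: int where a: "a = x \<otimes> z [^] k" "x \<in> F" by blast
 have "inv a = inv x \<otimes> z [^] (- k)" using a FG z by (simp add: inv_mult int_pow_neg)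
 then show "inv a \<in> {x \<otimes> z [^] (k :: int) | x k. x \<in> F}" using subgroup.m_inv_closed[OF F a(2)] by blast
 fix b assume "b \<in> {x \<otimes> z [^] (k :: int) | x k. x \<in> F}"
 then obtain y and l :: int where b: "b = y \<otimes> z [^] l" "y \<in> F" by blast
 have "a \<otimes> b = (x \<otimes> y) \<otimes> z [^] (k + l)" using a b FG z by (simp add: int_pow_mult m_ac)
 then show "a \<otimes> b \<in> {x \<otimes> z [^] (k :: int) | x k. x \<in> F}" using subgroup.m_closed[OF F a(2) b(2)] by blast
qed

text \<open>The basis in \<open>free_abelian\<close> is a set of labels inside the carrier, not
  necessarily the images of the generators. The independent element z serves as the new label; it is
  not in B because it is not in F.\<close>

lemma adjoin_free_Abelian_group:
 assumes F: "subgroup F G" and B: "B \<subseteq> F" and iso: "G\<lparr>carrier := F\<rparr> \<cong> free_Abelian_group B"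
  and z: "z \<in> carrier G" and ind: "\<And>k :: int. z [^] k \<in> F \<Longrightarrow> k = 0"
 shows "G\<lparr>carrier := {x \<otimes> z [^] (k :: int) | x k. x \<in> F}\<rparr> \<cong> free_Abelian_group (insert z B)"
  (is "?G' \<cong> _")
proof -
 note FG = subgroup.mem_carrier[OF F]
 interpret FF: group "G\<lparr>carrier := F\<rparr>" by (rule subgroup_imp_group[OF F])
 obtain \<phi> where \<phi>: "\<phi> \<in> iso (free_Abelian_group B) (G\<lparr>carrier := F\<rparr>)"
  using FF.iso_sym[OF iso] unfolding is_iso_def by blast
 have \<phi>F: "\<phi> c \<in> F" if "keys c \<subseteq> B" for c
  using \<phi> that by (auto simp: iso_def hom_def)
 have \<phi>add: "\<phi> (c + c') = \<phi> c \<otimes> \<phi> c'" if "keys c \<subseteq> B" "keys c' \<subseteq> B" for c c'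
  using \<phi> that by (auto simp: iso_def hom_def)
 have \<phi>bij: "bij_betw \<phi> {c. keys c \<subseteq> B} F"
  using \<phi> by (simp add: iso_def free_Abelian_group_def)
 have zF: "z \<notin> F" using ind[of 1] z by auto
 then have zB: "z \<notin> B" using B by blast
 define p where "p c = c - frag_cmul (lookup c z) (frag_of z)" for c :: "'a \<Rightarrow>\<^sub>0 int"
 have p_keys: "keys (p c) \<subseteq> B" if "keys c \<subseteq> insert z B" for c
 proof
  fix i assume "i \<in> keys (p c)"
  then have "lookup (p c) i \<noteq> 0" by (simp add: in_keys_iff)
  then have "i \<noteq> z" "lookup c i \<noteq> 0"
   by (auto simp: p_def lookup_minus split: if_splits)
  then show "i \<in> B" using that by (auto simp: in_keys_iff subset_iff)
 qed
 have p_add: "p (c + c') = p c + p c'" for c c'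
  by (simp add: p_def lookup_add frag_cmul_distrib)
 define h where "h c = \<phi> (p c) \<otimes> z [^] lookup c z" for c
 have h_hom: "h \<in> hom (free_Abelian_group (insert z B)) ?G'"
 proof (rule homI)
  fix c assume c: "c \<in> carrier (free_Abelian_group (insert z B))"
  then show "h c \<in> carrier ?G'" using \<phi>F p_keys by (auto simp: h_def)
  fix c' assume c': "c' \<in> carrier (free_Abelian_group (insert z B))"
  have "\<phi> (p c) \<in> carrier G" "\<phi> (p c') \<in> carrier G" using c c' \<phi>F p_keys FG by auto
  then show "h (c \<otimes>\<^bsub>free_Abelian_group (insert z B)\<^esub> c') = h c \<otimes>\<^bsub>?G'\<^esub> h c'"
   using c c' z \<phi>add[OF p_keys p_keys] by (simp add: h_def p_add lookup_add int_pow_mult m_ac)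
 qed
 have "inj_on h (carrier (free_Abelian_group (insert z B)))"
 proof (rule inj_onI)
  fix c c' assume cc: "c \<in> carrier (free_Abelian_group (insert z B))" "c' \<in> carrier (free_Abelian_group (insert z B))"
   and eq: "h c = h c'"
  let ?k = "lookup c z" and ?l = "lookup c' z"
  have F': "\<phi> (p c) \<in> F" "\<phi> (p c') \<in> F" using cc \<phi>F p_keys by auto
  then have FG': "\<phi> (p c) \<in> carrier G" "\<phi> (p c') \<in> carrier G" using FG by auto
  have "z [^] (?k - ?l) = inv \<phi> (p c) \<otimes> (\<phi> (p c) \<otimes> z [^] ?k) \<otimes> inv (z [^] ?l)"
   using FG' z by (simp add: m_assoc[symmetric] int_pow_diff)
  also have "\<dots> = inv \<phi> (p c) \<otimes> \<phi> (p c')"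
   using eq FG' z by (simp add: h_def m_assoc)
  finally have k: "?k = ?l"
   using ind[of "?k - ?l"] subgroup.m_closed[OF F subgroup.m_inv_closed[OF F F'(1)] F'(2)] by simp
  then have "\<phi> (p c) = \<phi> (p c')" using eq FG' z by (simp add: h_def)
  then have "p c = p c'" using \<phi>bij p_keys cc by (auto simp: bij_betw_def dest!: inj_onD)
  then show "c = c'" using k by (simp add: p_def)
 qed
 moreover have "h ` carrier (free_Abelian_group (insert z B)) = carrier ?G'"
 proof (rule equalityI)
  show "h ` carrier (free_Abelian_group (insert z B)) \<subseteq> carrier ?G'" using h_hom by (auto simp: hom_def)
  show "carrier ?G' \<subseteq> h ` carrier (free_Abelian_group (insert z B))"
  proof
   fix a assume "a \<in> carrier ?G'"
   then obtain x and k :: int where a: "a = x \<otimes> z [^] k" "x \<in> F" by auto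
   then obtain c where c: "keys c \<subseteq> B" "\<phi> c = x" using \<phi>bij by (auto simp: bij_betw_def)
   have cz: "lookup c z = 0" using c(1) zB by (auto simp: in_keys_iff subset_iff)
   let ?c = "c + frag_cmul k (frag_of z)"
   have l: "lookup ?c z = k" using cz by (simp add: lookup_add)
   have "h ?c = a" unfolding h_def l p_def using a c by simp
   moreover have "keys ?c \<subseteq> insert z B"
    using c(1) keys_add[of c "frag_cmul k (frag_of z)"] keys_cmul[of k "frag_of z"] by auto
   ultimately show "a \<in> h ` carrier (free_Abelian_group (insert z B))" by force
  qed
 qed
 ultimately have "h \<in> iso (free_Abelian_group (insert z B)) ?G'"
  using h_hom by (simp add: iso_def bij_betw_def)
 then show ?thesis
  using group.iso_sym[OF group_free_Abelian_group] unfolding is_iso_def by blast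
qed

end

lemma torsion_free_free_Abelian_group:
 assumes "group G" "G \<cong> free_Abelian_group B" "x \<in> carrier G" "x [^]\<^bsub>G\<^esub> (n :: nat) = \<one>\<^bsub>G\<^esub>" "n > 0"
 shows "x = \<one>\<^bsub>G\<^esub>"
proof -
 obtain \<phi> where \<phi>: "\<phi> \<in> iso G (free_Abelian_group B)" using assms(2) unfolding is_iso_def by blast
 interpret h: group_hom G "free_Abelian_group B" \<phi>
  using \<phi> assms(1) by (simp add: group_hom_def group_hom_axioms_def iso_def)
 have "frag_cmul (int n) (\<phi> x) = 0"
  using h.hom_nat_pow[OF assms(3), of n] assms(4) h.hom_one by simp
 then have "\<phi> x = \<phi> \<one>\<^bsub>G\<^esub>" using assms(5) h.hom_one by simp
 moreover have "inj_on \<phi> (carrier G)" using \<phi> by (simp add: iso_def bij_betw_def)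
 ultimately show ?thesis using assms(3) h.G.one_closed by (metis inj_onD)
qed

lemma free_Abelian_group_iso_product_group:
 assumes "finite B" "card B = r"
 shows "free_Abelian_group B \<cong> product_group {..<r} (\<lambda>_. integer_group)"
proof -
 have "B \<approx> {..<r}" using assms by (simp add: eqpoll_iff_card)
 then have "free_Abelian_group B \<cong> free_Abelian_group {..<r}"
  by (simp add: isomorphic_free_Abelian_groups)
 also have "\<dots> \<cong> sum_group {..<r} (\<lambda>_. integer_group)"
  using group.iso_sym[OF _ isomorphic_sum_integer_group] by simp
 also have "sum_group {..<r} (\<lambda>_. integer_group) = product_group {..<r} (\<lambda>_. integer_group)"
 proof -
  have "{x \<in> \<Pi>\<^sub>E i\<in>{..<r}. carrier integer_group. finite {i \<in> {..<r}. x i \<noteq> \<one>\<^bsub>integer_group\<^esub>}}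
    = carrier (product_group {..<r} (\<lambda>_. integer_group))"
   by auto
  then show ?thesis
   unfolding sum_group_def
   using group.subgroup_generated_group_carrier[OF product_group[of "{..<r}" "\<lambda>_. integer_group"]]
   by simp
 qed
 finally show ?thesis .
qed

context comm_group
begin

lemma complement_iso_quotient:
 assumes F: "subgroup F G" and T: "subgroup T G" and int: "F \<inter> T = {\<one>}"
  and cover: "\<And>x. x \<in> carrier G \<Longrightarrow> \<exists>f\<in>F. \<exists>t\<in>T. x = f \<otimes> t"
 shows "G\<lparr>carrier := F\<rparr> \<cong> G Mod T"
proof -
 note FG = subgroup.mem_carrier[OF F] and TG = subgroup.mem_carrier[OF T]
 have "(\<lambda>x. T #> x) \<in> hom (G\<lparr>carrier := F\<rparr>) (G Mod T)"
  using normal.r_coset_hom_Mod[OF subgroup_imp_normal[OF T]] FG by (auto simp: hom_def)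
 moreover have "inj_on (\<lambda>x. T #> x) F"
 proof (rule inj_onI)
  fix x y assume xy: "x \<in> F" "y \<in> F" "T #> x = T #> y"
  then have "x \<otimes> inv y \<in> T" using rcos_eq_iff[OF T] FG by simp
  moreover have "x \<otimes> inv y \<in> F" using xy subgroup.m_closed[OF F] subgroup.m_inv_closed[OF F] by simp
  ultimately have "x \<otimes> inv y = \<one>" using int by blast
  then show "x = y" using xy FG mult_inv_eq_one_iff by simp
 qed
 moreover have "X \<in> (\<lambda>x. T #> x) ` F" if X: "X \<in> carrier (G Mod T)" for X
 proof -
  obtain x where x: "x \<in> carrier G" "X = T #> x" using X by (auto simp: carrier_FactGroup)
  obtain f t where ft: "f \<in> F" "t \<in> T" "x = f \<otimes> t" using cover[OF x(1)] by blast
  have "x \<otimes> inv f = t" using ft FG TG by (simp add: m_comm m_assoc[symmetric])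
  then have "T #> x = T #> f" using rcos_eq_iff[OF T x(1)] ft FG by simp
  then show ?thesis using x ft by blast
 qed
 ultimately have "(\<lambda>x. T #> x) \<in> iso (G\<lparr>carrier := F\<rparr>) (G Mod T)"
  by (auto simp: iso_def bij_betw_def hom_def)
 then show ?thesis unfolding is_iso_def by blast
qed

lemma subset_adjoin:
 assumes F: "subgroup F G" and z: "z \<in> carrier G"
 shows "F \<subseteq> {x \<otimes> z [^] (k :: int) | x k. x \<in> F}" "z \<in> {x \<otimes> z [^] (k :: int) | x k. x \<in> F}"
proof -
 have "x = x \<otimes> z [^] (0 :: int)" if "x \<in> F" for x using subgroup.mem_carrier[OF F that] by simp
 then show "F \<subseteq> {x \<otimes> z [^] (k :: int) | x k. x \<in> F}" by blast
 have "z = \<one> \<otimes> z [^] (1 :: int)" using z by (simp add: int_pow_1 del: One_nat_def)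
 then show "z \<in> {x \<otimes> z [^] (k :: int) | x k. x \<in> F}" using subgroup.one_closed[OF F] by blast
qed

text \<open>The first functional splits K into its kernel and the powers of one element z; the
  remaining functionals are treated on the kernel. In echelon position each functional contributes
  one generator, which fixes the rank.\<close>

lemma free_complement_of_joint_kernel:
 assumes "set cs \<subseteq> hom G integer_group" "subgroup K G"
 shows "\<exists>F B. subgroup F G \<and> F \<subseteq> K \<and> B \<subseteq> F \<and> finite B \<and> G\<lparr>carrier := F\<rparr> \<cong> free_Abelian_group B \<and>
  (\<forall>x\<in>F. (\<forall>c\<in>set cs. c x = 0) \<longrightarrow> x = \<one>) \<and>
  (\<forall>x\<in>K. \<exists>f\<in>F. \<exists>t\<in>K. (\<forall>c\<in>set cs. c t = 0) \<and> x = f \<otimes> t) \<and>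
  ((\<forall>i<length cs. \<exists>x\<in>K. (cs ! i) x \<noteq> 0 \<and> (\<forall>j<i. (cs ! j) x = 0)) \<longrightarrow> card B = length cs)"
 using assms
proof (induction cs arbitrary: K)
 case Nil
 note K = Nil(2)
 have iso: "G\<lparr>carrier := {\<one>}\<rparr> \<cong> free_Abelian_group ({} :: 'a set)"
  unfolding is_iso_def by (auto simp: iso_def hom_def bij_betw_def free_Abelian_group_def intro!: exI[of _ "\<lambda>_. 0"])
 show ?case
  by (rule exI[of _ "{\<one>}"], rule exI[of _ "{}"])
   (use iso subgroup.one_closed[OF K] subgroup.mem_carrier[OF K] triv_subgroup in auto)
next
 case (Cons c cs)
 have c: "c \<in> hom G integer_group" and cs: "set cs \<subseteq> hom G integer_group" using Cons.prems(1) by simp_all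
 note K = Cons.prems(2)
 note KG = subgroup.mem_carrier[OF K]
 show ?case
 proof (cases "\<exists>x0\<in>K. c x0 \<noteq> 0")
  case False
  obtain F B where FB: "subgroup F G" "F \<subseteq> K" "B \<subseteq> F" "finite B" "G\<lparr>carrier := F\<rparr> \<cong> free_Abelian_group B"
   "\<forall>x\<in>F. (\<forall>c\<in>set cs. c x = 0) \<longrightarrow> x = \<one>"
   "\<forall>x\<in>K. \<exists>f\<in>F. \<exists>t\<in>K. (\<forall>c\<in>set cs. c t = 0) \<and> x = f \<otimes> t"
   using Cons.IH[OF cs K] by (elim exE conjE) (rule that; assumption)
  \<comment> \<open>If c vanishes on K, the echelon condition fails already at index 0, and the
    claim about the cardinality is vacuous.\<close>
  have "\<not> (\<forall>i<length (c # cs). \<exists>x\<in>K. ((c # cs) ! i) x \<noteq> 0 \<and> (\<forall>j<i. ((c # cs) ! j) x = 0))"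
   using False by (auto intro!: exI[of _ 0])
  moreover have "\<forall>x\<in>F. (\<forall>c'\<in>set (c # cs). c' x = 0) \<longrightarrow> x = \<one>" using FB(6) by simp
  moreover have "\<exists>f\<in>F. \<exists>t\<in>K. (\<forall>c'\<in>set (c # cs). c' t = 0) \<and> x = f \<otimes> t" if "x \<in> K" for x
  proof -
   obtain f t where "f \<in> F" "t \<in> K" "\<forall>c\<in>set cs. c t = 0" "x = f \<otimes> t" using FB(7) \<open>x \<in> K\<close> by blast
   moreover have "c t = 0" using False \<open>t \<in> K\<close> by blast
   ultimately show ?thesis by auto
  qed
  ultimately show ?thesis
   by (intro exI[of _ F] exI[of _ B] conjI FB(1-5)) blast+
 next
  case True
  then obtain z where z: "z \<in> K" "c z \<noteq> 0"
   "\<And>x. x \<in> K \<Longrightarrow> \<exists>k :: int. \<exists>y\<in>K. c y = 0 \<and> x = y \<otimes> z [^] k"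
   using subgroup_split_by_hom[OF c K] by metis
  let ?K' = "{x \<in> K. c x = 0}"
  have K': "subgroup ?K' G" by (rule subgroup_kernel_inter[OF c K])
  obtain F B where FB: "subgroup F G" "F \<subseteq> ?K'" "B \<subseteq> F" "finite B" "G\<lparr>carrier := F\<rparr> \<cong> free_Abelian_group B"
   and F_ker: "\<forall>x\<in>F. (\<forall>c\<in>set cs. c x = 0) \<longrightarrow> x = \<one>"
   and F_cover: "\<forall>x\<in>?K'. \<exists>f\<in>F. \<exists>t\<in>?K'. (\<forall>c\<in>set cs. c t = 0) \<and> x = f \<otimes> t"
   and F_card: "(\<forall>i<length cs. \<exists>x\<in>?K'. (cs ! i) x \<noteq> 0 \<and> (\<forall>j<i. (cs ! j) x = 0)) \<longrightarrow> card B = length cs"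
   using Cons.IH[OF cs K'] by (elim exE conjE) (rule that; assumption)
  note zG = KG[OF z(1)] and FG = subgroup.mem_carrier[OF FB(1)]
  have ind: "k = 0" if "z [^] k \<in> F" for k :: int
   using that FB(2) z(2) hom_integer_pow(1)[OF c zG, of k] by auto
  define F1 where "F1 = {x \<otimes> z [^] (k :: int) | x k. x \<in> F}"
  have F1: "subgroup F1 G" unfolding F1_def by (rule subgroup_adjoin[OF FB(1) zG])
  have "F1 \<subseteq> K" unfolding F1_def
   using FB(2) subgroup.m_closed[OF K] subgroup_int_pow_closed[OF K z(1)] by auto
  have zF1: "z \<in> F1" and FF1: "F \<subseteq> F1"
   unfolding F1_def using subset_adjoin[OF FB(1) zG] by simp_all
  have "G\<lparr>carrier := F1\<rparr> \<cong> free_Abelian_group (insert z B)"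
   unfolding F1_def by (rule adjoin_free_Abelian_group[OF FB(1,3,5) zG ind])
  moreover have "x = \<one>" if x: "x \<in> F1" "\<forall>c'\<in>set (c # cs). c' x = 0" for x
  proof -
   obtain f and k :: int where f: "f \<in> F" "x = f \<otimes> z [^] k" using x(1) unfolding F1_def by blast
   have "c x = k * c z" using f FB(2) FG zG by (auto simp: hom_integer_mult[OF c] hom_integer_pow(1)[OF c])
   then have "k = 0" using x(2) z(2) by simp
   then show ?thesis using f F_ker x(2) FG by simp
  qed
  moreover have "\<exists>f\<in>F1. \<exists>t\<in>K. (\<forall>c'\<in>set (c # cs). c' t = 0) \<and> x = f \<otimes> t" if x: "x \<in> K" for x
  proof -
   obtain k :: int and y where y: "y \<in> K" "c y = 0" "x = y \<otimes> z [^] k" using z(3)[OF x] by blast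
   obtain f t where ft: "f \<in> F" "t \<in> ?K'" "\<forall>c\<in>set cs. c t = 0" "y = f \<otimes> t" using F_cover y by blast
   have tK: "t \<in> K" "c t = 0" using ft(2) by auto
   have "x = (f \<otimes> z [^] k) \<otimes> t" unfolding y(3) ft(4) using ft(1) FG KG[OF tK(1)] zG by (simp add: m_ac)
   moreover have "f \<otimes> z [^] k \<in> F1" unfolding F1_def using ft(1) by blast
   ultimately show ?thesis using tK ft(3) by auto
  qed
  moreover have "card (insert z B) = length (c # cs)"
   if ech: "\<forall>i<length (c # cs). \<exists>x\<in>K. ((c # cs) ! i) x \<noteq> 0 \<and> (\<forall>j<i. ((c # cs) ! j) x = 0)"
  proof -
   have "\<exists>x\<in>?K'. (cs ! i) x \<noteq> 0 \<and> (\<forall>j<i. (cs ! j) x = 0)" if i: "i < length cs" for i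
   proof -
    obtain x where x: "x \<in> K" "(cs ! i) x \<noteq> 0" "\<And>j. j < Suc i \<Longrightarrow> ((c # cs) ! j) x = 0"
     using ech[rule_format, of "Suc i"] i by auto
    have "c x = 0" "\<forall>j<i. (cs ! j) x = 0" using x(3)[of 0] x(3)[of "Suc j" for j] by simp_all
    then show ?thesis using x(1,2) by blast
   qed
   moreover have "z \<notin> B" using FB(2,3) z(2) by auto
   ultimately show ?thesis using F_card FB(4) by simp
  qed
  moreover have "insert z B \<subseteq> F1" using FB(3) FF1 zF1 by auto
  ultimately show ?thesis
   using F1 \<open>F1 \<subseteq> K\<close> FB(4)
   by (intro exI[of _ F1] exI[of _ "insert z B"] conjI ballI impI) simp_all
 qed
qed

text \<open>The list \<open>cs\<close> is a system of coordinates modulo torsion; its length is the rank because of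
 the echelon condition.\<close>

lemma free_parts_of_coordinates:
 assumes cs: "\<And>c. c \<in> set cs \<Longrightarrow> c \<in> hom G integer_group"
  and tors: "\<And>x. x \<in> carrier G \<Longrightarrow> (\<And>c. c \<in> set cs \<Longrightarrow> c x = 0) \<Longrightarrow> \<exists>n :: nat > 0. x [^] n = \<one>"
  and ech: "\<And>i. i < length cs \<Longrightarrow> \<exists>x\<in>carrier G. (cs ! i) x \<noteq> 0 \<and> (\<forall>j<i. (cs ! j) x = 0)"
 shows "free_parts G \<noteq> {}"
  and "F \<in> free_parts G \<Longrightarrow> F \<cong> product_group {..<length cs} (\<lambda>_. integer_group)"
proof -
 have csG: "set cs \<subseteq> hom G integer_group" using cs by blast
 define T where "T = {x \<in> carrier G. \<forall>c\<in>set cs. c x = 0}"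
 have T: "subgroup T G"
  unfolding T_def
  by (intro subgroupI)
   (use cs in \<open>auto simp: hom_integer_mult hom_integer_pow hom_integer_one intro!: exI[of _ "\<one>"]\<close>)
 have T_tors: "\<exists>n :: nat > 0. x [^] n = \<one>" if "x \<in> T" for x
  using tors[of x] that by (auto simp: T_def)
 have tors_T: "x \<in> T" if "x \<in> carrier G" "x [^] n = \<one>" "n > 0" for x and n :: nat
 proof -
  have "int n * c x = 0" if "c \<in> set cs" for c
   using hom_integer_pow(2)[OF cs[OF that] \<open>x \<in> carrier G\<close>, of n] hom_integer_one[OF cs[OF that]]
   by (simp add: \<open>x [^] n = \<one>\<close>)
  then show ?thesis using that by (simp add: T_def)
 qed
 obtain F0 B where F0: "subgroup F0 G" "B \<subseteq> F0" "finite B" "G\<lparr>carrier := F0\<rparr> \<cong> free_Abelian_group B"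
  and F0_ker: "\<forall>x\<in>F0. (\<forall>c\<in>set cs. c x = 0) \<longrightarrow> x = \<one>"
  and F0_cover: "\<forall>x\<in>carrier G. \<exists>f\<in>F0. \<exists>t\<in>carrier G. (\<forall>c\<in>set cs. c t = 0) \<and> x = f \<otimes> t"
  and F0_card: "(\<forall>i<length cs. \<exists>x\<in>carrier G. (cs ! i) x \<noteq> 0 \<and> (\<forall>j<i. (cs ! j) x = 0)) \<longrightarrow> card B = length cs"
  using free_complement_of_joint_kernel[OF csG subgroup_self] by (elim exE conjE) (rule that; assumption)
 note F0G = subgroup.mem_carrier[OF F0(1)]
 have F0T: "F0 \<inter> T = {\<one>}"
 proof
  show "F0 \<inter> T \<subseteq> {\<one>}" using F0_ker unfolding T_def by blast
  show "{\<one>} \<subseteq> F0 \<inter> T" using subgroup.one_closed[OF F0(1)] subgroup.one_closed[OF T] by blast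
 qed
 have cover0: "\<exists>f\<in>F0. \<exists>t\<in>T. x = f \<otimes> t" if "x \<in> carrier G" for x
 proof -
  obtain f t where "f \<in> F0" "t \<in> carrier G" "\<forall>c\<in>set cs. c t = 0" "x = f \<otimes> t"
   using F0_cover \<open>x \<in> carrier G\<close> by blast
  then show ?thesis unfolding T_def by blast
 qed
 have free_T: "F \<inter> T = {\<one>}" if "free_summand G F" for F
 proof -
  have F: "subgroup F G" using \<open>free_summand G F\<close> by (simp add: free_summand_def direct_summand_def)
  obtain B' :: "'a set" where B': "G\<lparr>carrier := F\<rparr> \<cong> free_Abelian_group B'"
   using \<open>free_summand G F\<close> by (auto simp: free_summand_def free_abelian_def)
  have "x = \<one>" if x: "x \<in> F" "x \<in> T" for x
  proof -
   obtain n :: nat where n: "n > 0" "x [^] n = \<one>" using T_tors[OF x(2)] by blast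
   have "x [^]\<^bsub>G\<lparr>carrier := F\<rparr>\<^esub> n = \<one>\<^bsub>G\<lparr>carrier := F\<rparr>\<^esub>" using n(2) by (simp add: nat_pow_def)
   then show ?thesis
    using torsion_free_free_Abelian_group[OF subgroup_imp_group[OF F] B'] x(1) n(1) by simp
  qed
  then have "F \<inter> T \<subseteq> {\<one>}" by blast
  moreover have "{\<one>} \<subseteq> F \<inter> T" using subgroup.one_closed[OF F] subgroup.one_closed[OF T] by blast
  ultimately show ?thesis by (rule equalityI)
 qed
 have "F0 <#> T = carrier G"
 proof
  show "F0 <#> T \<subseteq> carrier G"
   using F0G subgroup.mem_carrier[OF T] by (auto simp: set_mult_def)
  show "carrier G \<subseteq> F0 <#> T" using cover0 unfolding set_mult_def by blast
 qed
 then have "direct_summand G F0" unfolding direct_summand_def using F0(1) T F0T by blast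
 moreover have "free_abelian (G\<lparr>carrier := F0\<rparr>)"
  unfolding free_abelian_def using F0(2,4) by (intro exI[of _ B]) simp
 ultimately have "free_summand G F0" by (simp add: free_summand_def)
 \<comment> \<open>Modulo F0 every element is torsion, and a free summand contains no torsion that
   could enlarge F0.\<close>
 moreover have "F' = F0" if F': "free_summand G F'" "F0 \<subseteq> F'" for F'
 proof (rule equalityI[OF _ F'(2)], rule subsetI)
  fix x assume x: "x \<in> F'"
  have sF': "subgroup F' G" using F'(1) by (simp add: free_summand_def direct_summand_def)
  obtain f t where ft: "f \<in> F0" "t \<in> T" "x = f \<otimes> t"
   using cover0[OF subgroup.mem_carrier[OF sF' x]] by blast
  have G: "f \<in> carrier G" "t \<in> carrier G" using ft F0G subgroup.mem_carrier[OF T] by auto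
  have "inv f \<otimes> x = t" using ft(3) G by (simp add: m_assoc[symmetric])
  moreover have "inv f \<otimes> x \<in> F'"
   using subgroup.m_closed[OF sF' subgroup.m_inv_closed[OF sF'] x] ft(1) F'(2) by blast
  ultimately have "t = \<one>" using free_T[OF F'(1)] ft(2) by blast
  then show "x \<in> F0" using ft G by simp
 qed
 ultimately have "G\<lparr>carrier := F0\<rparr> \<in> free_parts G" unfolding free_parts_def by blast
 then show "free_parts G \<noteq> {}" by blast
 assume "F \<in> free_parts G"
 then obtain H where FH: "F = G\<lparr>carrier := H\<rparr>" and H: "free_summand G H"
  and max: "\<And>F'. free_summand G F' \<Longrightarrow> H \<subseteq> F' \<Longrightarrow> F' = H"
  unfolding free_parts_def by blast
 have sH: "subgroup H G" using H by (simp add: free_summand_def direct_summand_def)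
 note HG = subgroup.mem_carrier[OF sH]
 obtain C where C: "subgroup C G" "H \<inter> C = {\<one>}" "H <#> C = carrier G"
  using H by (auto simp: free_summand_def direct_summand_def)
 note CG = subgroup.mem_carrier[OF C(1)]
 obtain B' where B': "B' \<subseteq> H" "G\<lparr>carrier := H\<rparr> \<cong> free_Abelian_group B'"
  using H by (auto simp: free_summand_def free_abelian_def)
 \<comment> \<open>The complement of a maximal free summand is torsion: otherwise an element z of
   infinite order splits off from C and can be moved to H.\<close>
 have "C \<subseteq> T"
 proof (rule ccontr)
  assume "\<not> C \<subseteq> T"
  then obtain c x0 where c: "c \<in> set cs" and x0: "x0 \<in> C" "c x0 \<noteq> 0" using CG by (auto simp: T_def)
  note c' = cs[OF c]
  obtain z where z: "z \<in> C" "c z \<noteq> 0"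
   "\<And>x. x \<in> C \<Longrightarrow> \<exists>k :: int. \<exists>y\<in>C. c y = 0 \<and> x = y \<otimes> z [^] k"
   using subgroup_split_by_hom[OF c' C(1) x0] by metis
  note zG = CG[OF z(1)]
  have zk: "z [^] k \<in> C" for k :: int by (rule subgroup_int_pow_closed[OF C(1) z(1)])
  have ck: "c (z [^] k) = k * c z" for k :: int by (rule hom_integer_pow(1)[OF c' zG])
  have ind: "k = 0" if "z [^] k \<in> H" for k :: int
  proof -
   have "z [^] k = \<one>" using that zk C(2) by blast
   then show ?thesis using ck[of k] z(2) hom_integer_one[OF c'] by simp
  qed
  define H1 where "H1 = {x \<otimes> z [^] (k :: int) | x k. x \<in> H}"
  define C1 where "C1 = {x \<in> C. c x = 0}"
  have sH1: "subgroup H1 G" unfolding H1_def by (rule subgroup_adjoin[OF sH zG])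
  have sC1: "subgroup C1 G" unfolding C1_def by (rule subgroup_kernel_inter[OF c' C(1)])
  have zH1: "z \<in> H1" and HH1: "H \<subseteq> H1"
   unfolding H1_def using subset_adjoin[OF sH zG] by simp_all
  have "H1 \<inter> C1 \<subseteq> {\<one>}"
  proof
   fix x assume x: "x \<in> H1 \<inter> C1"
   then obtain h and k :: int where h: "h \<in> H" "x = h \<otimes> z [^] k" unfolding H1_def by blast
   have xC: "x \<in> C" "c x = 0" using x by (auto simp: C1_def)
   have "x \<otimes> inv (z [^] k) = h" using h HG zG by (simp add: m_assoc)
   then have "h \<in> C" using subgroup.m_closed[OF C(1) xC(1) subgroup.m_inv_closed[OF C(1) zk]] by metis
   then have "h = \<one>" using h(1) C(2) by blast
   then have "k * c z = 0" using xC(2) h(2) ck[of k] zG by simp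
   then show "x \<in> {\<one>}" using \<open>h = \<one>\<close> h(2) z(2) by simp
  qed
  moreover have "{\<one>} \<subseteq> H1 \<inter> C1"
   using subgroup.one_closed[OF sH1] subgroup.one_closed[OF sC1] by blast
  ultimately have H1C1: "H1 \<inter> C1 = {\<one>}" by (rule equalityI)
  have H1C1_mult: "H1 <#> C1 = carrier G"
  proof
   show "H1 <#> C1 \<subseteq> carrier G"
    using subgroup.mem_carrier[OF sH1] subgroup.mem_carrier[OF sC1] by (auto simp: set_mult_def)
   show "carrier G \<subseteq> H1 <#> C1"
   proof
    fix x assume "x \<in> carrier G"
    then obtain h y where hy: "h \<in> H" "y \<in> C" "x = h \<otimes> y"
     unfolding C(3)[symmetric] set_mult_def by blast
    obtain k :: int and w where w: "w \<in> C" "c w = 0" "y = w \<otimes> z [^] k" using z(3)[OF hy(2)] by blast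
    have "x = (h \<otimes> z [^] k) \<otimes> w" using hy w HG CG zG by (simp add: m_ac)
    moreover have "h \<otimes> z [^] k \<in> H1" unfolding H1_def using hy(1) by blast
    moreover have "w \<in> C1" using w by (simp add: C1_def)
    ultimately show "x \<in> H1 <#> C1" by (auto simp: set_mult_def)
   qed
  qed
  have "G\<lparr>carrier := H1\<rparr> \<cong> free_Abelian_group (insert z B')"
   unfolding H1_def by (rule adjoin_free_Abelian_group[OF sH B' zG ind])
  moreover have "insert z B' \<subseteq> H1" using B'(1) HH1 zH1 by auto
  ultimately have "free_abelian (G\<lparr>carrier := H1\<rparr>)"
   unfolding free_abelian_def by (intro exI[of _ "insert z B'"]) simp
  moreover have "direct_summand G H1"
   unfolding direct_summand_def using sH1 sC1 H1C1 H1C1_mult by blast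
  ultimately have "free_summand G H1" by (simp add: free_summand_def)
  then have "H1 = H" using max HH1 by blast
  then have "z = \<one>" using zH1 z(1) C(2) by blast
  then show False using z(2) hom_integer_one[OF c'] by simp
 qed
 then have "\<exists>f\<in>H. \<exists>t\<in>T. x = f \<otimes> t" if "x \<in> carrier G" for x
  using that unfolding C(3)[symmetric] set_mult_def by blast
 \<comment> \<open>H and F0 are both complements of T, so both are isomorphic to the quotient by
   T.\<close>
 then have "F \<cong> G Mod T"
  unfolding FH by (rule complement_iso_quotient[OF sH T free_T[OF H]])
 also have "G Mod T \<cong> G\<lparr>carrier := F0\<rparr>"
  using group.iso_sym[OF subgroup_imp_group[OF F0(1)] complement_iso_quotient[OF F0(1) T F0T cover0]] .
 also have "\<dots> \<cong> free_Abelian_group B" by (rule F0(4))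
 also have "\<dots> \<cong> product_group {..<length cs} (\<lambda>_. integer_group)"
  using F0_card ech by (intro free_Abelian_group_iso_product_group[OF F0(3)]) auto
 finally show "F \<cong> product_group {..<length cs} (\<lambda>_. integer_group)" .
qed

end

section \<open>Rational forms and the ranks\<close>

interpretation qp: vector_space "smult :: rat \<Rightarrow> rat poly \<Rightarrow> rat poly"
 by unfold_locales (simp_all add: smult_add_right smult_add_left)

lemma rat_poly_linear:
 fixes f :: "rat poly \<Rightarrow> rat poly"
 assumes "\<And>p q. f (p + q) = f p + f q" "\<And>c p. f (smult c p) = smult c (f p)"
 shows "Vector_Spaces.linear smult smult f"
 using assms by unfold_locales

text \<open>Coordinates on U modulo the span of BX: BX is extended to a basis of U and then of all
  polynomials, so that the functionals are linear everywhere and not only on U.\<close>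

lemma quotient_coordinates:
 assumes X: "qp.independent BX" "finite BX" and U: "qp.subspace U" "BX \<subseteq> U"
  and BU: "qp.independent BU" "finite BU" "qp.span BU = U"
 obtains \<phi> :: "nat \<Rightarrow> rat poly \<Rightarrow> rat" and e :: "nat \<Rightarrow> rat poly" where
  "\<And>i p q. \<phi> i (p + q) = \<phi> i p + \<phi> i q" "\<And>i c p. \<phi> i (smult c p) = c * \<phi> i p"
  "\<And>i p. p \<in> qp.span BX \<Longrightarrow> i < card BU - card BX \<Longrightarrow> \<phi> i p = 0"
  "\<And>p. p \<in> U \<Longrightarrow> (\<And>i. i < card BU - card BX \<Longrightarrow> \<phi> i p = 0) \<Longrightarrow> p \<in> qp.span BX"
  "\<And>i. i < card BU - card BX \<Longrightarrow> e i \<in> U"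
  "\<And>i j. i < card BU - card BX \<Longrightarrow> j < card BU - card BX \<Longrightarrow> \<phi> i (e j) = (if i = j then 1 else 0)"
proof -
 obtain C where C: "BX \<subseteq> C" "C \<subseteq> U" "qp.independent C" "U \<subseteq> qp.span C"
  using qp.maximal_independent_subset_extend[OF U(2) X(1)] by blast
 have finC: "finite C"
  using qp.independent_span_bound[OF BU(2) C(3)] C(2) BU(3) by simp
 have BUU: "BU \<subseteq> U" using BU(3) qp.span_superset by blast
 have "card C = card BU"
  using qp.basis_card_eq_dim[OF C(2,4,3)] qp.basis_card_eq_dim[OF BUU _ BU(1)] BU(3) by simp
 then have "card (C - BX) = card BU - card BX" using card_Diff_subset[OF X(2) C(1)] by simp
 then obtain e where e: "bij_betw e {..<card BU - card BX} (C - BX)"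
  using ex_bij_betw_nat_finite[of "C - BX"] finC by (auto simp: atLeast0LessThan)
 define E where "E = qp.extend_basis C"
 have E: "qp.independent E" "C \<subseteq> E" "qp.span E = UNIV"
  unfolding E_def using qp.independent_extend_basis[OF C(3)] qp.extend_basis_superset[OF C(3)]
   qp.span_extend_basis[OF C(3)] by simp_all
 define \<phi> where "\<phi> i p = qp.representation E p (e i)" for i p
 have ran: "e i \<in> C" "e i \<notin> BX" if "i < card BU - card BX" for i
  using bij_betwE[OF e] that by auto
 show ?thesis
 proof (rule that[of \<phi> e])
  show "\<phi> i (p + q) = \<phi> i p + \<phi> i q" for i p q
   unfolding \<phi>_def using qp.representation_add[OF E(1), of q p] E(3) by simp
  show "\<phi> i (smult c p) = c * \<phi> i p" for i c p
   unfolding \<phi>_def using qp.representation_scale[OF E(1), of p c] E(3) by simp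
  show "\<phi> i p = 0" if "p \<in> qp.span BX" "i < card BU - card BX" for i p
  proof -
   have "qp.representation E p = qp.representation BX p"
    using qp.representation_extend[OF E(1) that(1)] C(1) E(2) by simp
   then show ?thesis unfolding \<phi>_def using qp.representation_ne_zero[of BX p "e i"] ran(2)[OF that(2)] by auto
  qed
  show "p \<in> qp.span BX" if p: "p \<in> U" and z: "\<And>i. i < card BU - card BX \<Longrightarrow> \<phi> i p = 0" for p
  proof -
   have rep: "qp.representation E p = qp.representation C p"
    using qp.representation_extend[OF E(1) _ E(2)] p C(4) by blast
   have "b \<in> BX" if "qp.representation C p b \<noteq> 0" for b
   proof (rule ccontr)
    assume "b \<notin> BX"
    then have "b \<in> C - BX" using qp.representation_ne_zero[OF that] by simp
    then obtain i where "i < card BU - card BX" "b = e i" using e by (auto simp: bij_betw_def)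
    then show False using z[of i] that rep unfolding \<phi>_def by simp
   qed
   then have "(\<Sum>b | qp.representation C p b \<noteq> 0. smult (qp.representation C p b) b) \<in> qp.span BX"
    by (intro qp.span_sum qp.span_scale qp.span_base) simp
   then show ?thesis using qp.sum_nonzero_representation_eq[OF C(3), of p] p C(4) by auto
  qed
  show "e i \<in> U" if "i < card BU - card BX" for i using ran(1)[OF that] C(2) by blast
  show "\<phi> i (e j) = (if i = j then 1 else 0)"
   if "i < card BU - card BX" "j < card BU - card BX" for i j
  proof -
   have "e j \<in> E" using ran(1)[OF that(2)] E(2) by blast
   moreover have "e i = e j \<longleftrightarrow> i = j" using bij_betw_imp_inj_on[OF e] that by (auto dest: inj_onD)
   ultimately show ?thesis unfolding \<phi>_def using qp.representation_basis[OF E(1)] by auto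
  qed
 qed
qed

text \<open>\<open>hsubst k a g\<close> is \<open>f(a, 1)\<close> for the form \<open>f\<close> of degree \<open>k\<close> with \<open>f(1, y) = g\<close>.\<close>

definition hsubst :: "nat \<Rightarrow> rat poly \<Rightarrow> rat poly \<Rightarrow> rat poly"
 where "hsubst k a g = (\<Sum>j\<le>k. smult (coeff g j) (a ^ (k - j)))"

lemma hsubst_add: "hsubst k a (p + q) = hsubst k a p + hsubst k a q"
 by (simp add: hsubst_def smult_add_left sum.distrib)

lemma hsubst_smult: "hsubst k a (smult c p) = smult c (hsubst k a p)"
 by (simp add: hsubst_def qp.scale_sum_right)

lemma hsubst_diff: "hsubst k a (p - q) = hsubst k a p - hsubst k a q"
 by (simp add: hsubst_def smult_diff_left sum_subtractf)

lemma hsubst_0 [simp]: "hsubst k a 0 = 0"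
 by (simp add: hsubst_def)

lemma degree_hsubst: "degree a \<le> 1 \<Longrightarrow> degree (hsubst k a g) \<le> k"
 unfolding hsubst_def
 by (intro degree_sum_le finite_atMost)
  (use degree_power_le[of a] in \<open>auto intro!: order_trans[OF degree_smult_le] order_trans[OF degree_power_le]
   intro: order_trans[OF mult_le_mono1]\<close>)

text \<open>Multiplying a form by x keeps g and raises k, which multiplies the value by a.
  Multiplying it by y is \<open>pCons 0\<close>, which leaves the value unchanged because y is
  replaced by 1.\<close>

lemma hsubst_Suc: "degree g \<le> k \<Longrightarrow> hsubst (Suc k) a g = a * hsubst k a g"
 by (simp add: hsubst_def coeff_eq_0 sum_distrib_left Suc_diff_le)

lemma hsubst_pCons: "hsubst (Suc k) a (pCons 0 g) = hsubst k a g"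
 unfolding hsubst_def by (subst sum.atMost_Suc_shift) simp

lemma hsubst_monom: "j \<le> k \<Longrightarrow> hsubst k a (monom 1 j) = a ^ (k - j)"
 by (simp add: hsubst_def if_distrib[of "\<lambda>c. smult c _"] cong: if_cong)

section \<open>Forms fixed by v\<close>

abbreviation v_coord :: "rat poly" where "v_coord \<equiv> [:1, - 1:]"
text \<open>v sends x to x - y and y to x, so at x = 1 it is the substitution of
  \<open>v_coord\<close> for x and 1 for y. The norm form x^2 - x y + y^2 is fixed by v.\<close>

definition norm_form :: "rat poly" where "norm_form = [:1, - 1, 1:]"

lemma degree_norm_form: "degree norm_form = 2" and norm_form_nonzero [simp]: "norm_form \<noteq> 0"
 by (simp_all add: norm_form_def)

lemma norm_form_mult: "norm_form * g = g - pCons 0 g + pCons 0 (pCons 0 g)"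
 by (simp add: norm_form_def)

lemma hsubst_norm_form:
 assumes "degree g \<le> k"
 shows "hsubst (Suc (Suc k)) v_coord (norm_form * g) = norm_form * hsubst k v_coord g"
proof -
 have d: "degree (pCons 0 g) \<le> Suc k" using assms by (simp add: degree_pCons_eq_if)
 have "hsubst (Suc (Suc k)) v_coord (norm_form * g)
   = v_coord * (v_coord * hsubst k v_coord g) - v_coord * hsubst k v_coord g + hsubst k v_coord g"
  unfolding norm_form_mult hsubst_add hsubst_diff
  using assms d by (simp add: hsubst_Suc hsubst_pCons del: mult_pCons_left)
 also have "\<dots> = (v_coord * v_coord - v_coord + 1) * hsubst k v_coord g" by (simp only: algebra_simps)
 also have "v_coord * v_coord - v_coord + 1 = norm_form" by (simp add: norm_form_def one_pCons)
 finally show ?thesis .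
qed

text \<open>Modulo the norm form y is a primitive sixth root of unity with inverse 1 - y, so the
  substituted form is y^(-k) times the original one.\<close>

lemma norm_form_dvd_hsubst: "norm_form dvd [:0, 1:] ^ k * hsubst k v_coord g - (\<Sum>j\<le>k. smult (coeff g j) ([:0, 1:] ^ j))"
proof -
 have "norm_form dvd [:0, 1:] ^ k * smult c (v_coord ^ (k - j)) - smult c ([:0, 1:] ^ j)"
  if "j \<le> k" for j and c :: rat
 proof -
  have 1: "[:0, 1:] * v_coord = 1 - norm_form" by (simp add: norm_form_def one_pCons)
  have "norm_form dvd ([:0, 1:] * v_coord) ^ (k - j) - 1"
   unfolding 1 power_diff_1_eq by simp
  then have "norm_form dvd smult c ([:0, 1:] ^ j) * (([:0, 1:] * v_coord) ^ (k - j) - 1)"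
   by (rule dvd_mult)
  also have "smult c ([:0, 1:] ^ j) * (([:0, 1:] * v_coord) ^ (k - j) - 1)
    = smult c (([:0, 1:] ^ j * [:0, 1:] ^ (k - j)) * v_coord ^ (k - j)) - smult c ([:0, 1:] ^ j)"
   by (simp only: power_mult_distrib right_diff_distrib mult_smult_left mult_1_right mult.assoc)
  also have "[:0, 1 :: rat:] ^ j * [:0, 1:] ^ (k - j) = [:0, 1:] ^ k"
   using that by (simp only: power_add[symmetric] le_add_diff_inverse)
  finally show ?thesis by (simp only: mult_smult_right)
 qed
 then have "norm_form dvd (\<Sum>j\<le>k. [:0, 1:] ^ k * smult (coeff g j) (v_coord ^ (k - j)) - smult (coeff g j) ([:0, 1:] ^ j))"
  by (intro dvd_sum) simp
 then show ?thesis by (simp add: hsubst_def sum_distrib_left sum_subtractf)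
qed

text \<open>Here forms have the even degree 2 m in x and y, corresponding to degree 4 m in
  M.\<close>

definition v_forms :: "nat \<Rightarrow> rat poly set"
 where "v_forms m = {g. degree g \<le> 2 * m \<and> hsubst (2 * m) v_coord g = g}"

lemma subspace_v_forms: "qp.subspace (v_forms m)"
 unfolding qp.subspace_def v_forms_def
 by (auto simp: hsubst_add hsubst_smult degree_add_le intro: order_trans[OF degree_smult_le])

lemma norm_form_v_forms: "norm_form * g \<in> v_forms (Suc m) \<longleftrightarrow> g \<in> v_forms m"
proof (cases "g = 0")
 case False
 then have d: "degree (norm_form * g) = 2 + degree g" by (simp add: degree_mult_eq degree_norm_form)
 have "norm_form * g \<in> v_forms (Suc m) \<longleftrightarrow>
   degree g \<le> 2 * m \<and> hsubst (Suc (Suc (2 * m))) v_coord (norm_form * g) = norm_form * g"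
  unfolding v_forms_def mem_Collect_eq d by simp
 also have "\<dots> \<longleftrightarrow> degree g \<le> 2 * m \<and> norm_form * hsubst (2 * m) v_coord g = norm_form * g"
  by (auto simp: hsubst_norm_form simp del: mult_pCons_left)
 also have "\<dots> \<longleftrightarrow> g \<in> v_forms m"
  unfolding v_forms_def by (simp del: mult_pCons_left)
 finally show ?thesis .
qed (simp add: v_forms_def)

lemma poly_as_power_sum: "degree g \<le> k \<Longrightarrow> (\<Sum>j\<le>k. smult (coeff g j) ([:0, 1:] ^ j)) = (g :: rat poly)"
 using poly_as_sum_of_monoms'[of g k] by (simp add: monom_altdef)

text \<open>A fixed form equals y^(-2 m) times itself modulo the norm form.\<close>

lemma norm_form_dvd_v_form:
 assumes g: "g \<in> v_forms m"
 shows "norm_form dvd ([:0, 1:] ^ (2 * m) - 1) * g"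
proof -
 have "norm_form dvd [:0, 1:] ^ (2 * m) * hsubst (2 * m) v_coord g - g"
  using norm_form_dvd_hsubst[of "2 * m" g] g poly_as_power_sum[of g "2 * m"] by (simp add: v_forms_def)
 then show ?thesis using g by (simp add: v_forms_def algebra_simps)
qed

text \<open>The hypothesis holds for a = y and for a = 1 - y, the two sixth roots of unity that
  occur.\<close>

lemma norm_form_dvd_power:
 assumes a: "a * a - a + 1 = norm_form"
 shows "norm_form dvd a ^ (6 * t) - 1"
proof -
 have "a ^ 6 - 1 = norm_form * ((a + 1) * (a ^ 3 - 1))"
  unfolding a[symmetric] by (simp add: algebra_simps power_numeral_reduce)
 then have "norm_form dvd a ^ 6 - 1" by simp
 moreover have "a ^ 6 - 1 dvd (a ^ 6) ^ t - 1" using power_diff_1_eq[of "a ^ 6" t] by simp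
 ultimately show ?thesis by (metis dvd_trans power_mult)
qed

lemma hsubst_v_coord_power:
 "i \<le> k \<Longrightarrow> hsubst k v_coord (v_coord ^ i) = v_coord ^ (k - i) * [:0, - 1:] ^ i"
proof (induction i arbitrary: k)
 case 0
 show ?case using hsubst_monom[of 0 k v_coord] by (simp add: monom_altdef one_pCons)
next
 case (Suc i)
 then obtain l where l: "k = Suc l" "i \<le> l" by (cases k) auto
 have d: "degree (v_coord ^ i) \<le> l" using degree_power_le[of v_coord i] l(2) by simp
 have "v_coord * v_coord ^ i = v_coord ^ i - pCons 0 (v_coord ^ i)" by simp
 then have "hsubst k v_coord (v_coord ^ Suc i) = v_coord * hsubst l v_coord (v_coord ^ i) - hsubst l v_coord (v_coord ^ i)"
  using d by (simp add: l hsubst_diff hsubst_Suc hsubst_pCons del: mult_pCons_left)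
 also have "\<dots> = (v_coord - 1) * hsubst l v_coord (v_coord ^ i)" by (simp only: algebra_simps)
 also have "v_coord - 1 = [:0, - 1:]" by (simp add: one_pCons)
 finally show ?case unfolding Suc.IH[OF l(2)] by (simp only: l diff_Suc_Suc power_Suc ac_simps)
qed

text \<open>These are \<open>(1 + v + v\<^sup>2) x\<^sup>2\<^sup>m\<close> and \<open>(1 + v + v\<^sup>2) x\<^sup>2\<^sup>m\<^sup>-\<^sup>1 y\<close>.\<close>

lemma v_forms_trace:
 assumes m: "m > 0"
 shows "1 + v_coord ^ (2 * m) + [:0, 1:] ^ (2 * m) \<in> v_forms m"
  and "[:0, 1:] + v_coord ^ (2 * m - 1) + ([:0, 1:] ^ (2 * m) - [:0, 1:] ^ (2 * m - 1)) \<in> v_forms m"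
proof -
 let ?k = "2 * m"
 have d: "degree (a ^ i) \<le> ?k" if "degree a \<le> 1" "i \<le> ?k" for a :: "rat poly" and i
  using degree_power_le[of a i] that by (metis le_trans mult_le_mono1 mult_1)
 obtain l where l: "?k = Suc l" using m by (cases ?k) auto
 have odd: "odd l" using l by (metis even_Suc even_mult_iff even_numeral)
 have y: "[:0, - 1:] ^ i = (if even i then [:0, 1:] ^ i else - ([:0, 1 :: rat:] ^ i))" for i
  using power_minus[of "[:0, 1 :: rat:]" i] by auto
 have h1: "hsubst ?k v_coord 1 = v_coord ^ ?k" using hsubst_v_coord_power[of 0 ?k] by simp
 have hy: "hsubst ?k v_coord ([:0, 1:] ^ i) = v_coord ^ (?k - i)" if "i \<le> ?k" for i
  using hsubst_monom[OF that, of v_coord] by (simp add: monom_altdef)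
 have hv: "hsubst ?k v_coord (v_coord ^ ?k) = [:0, 1:] ^ ?k"
  using hsubst_v_coord_power[of ?k ?k] y[of ?k] by simp
 have hv': "hsubst ?k v_coord (v_coord ^ l) = [:0, 1:] ^ ?k - [:0, 1:] ^ l"
  using hsubst_v_coord_power[of l ?k] y[of l] odd l by (simp add: algebra_simps)
 have "hsubst ?k v_coord (1 + v_coord ^ ?k + [:0, 1:] ^ ?k) = v_coord ^ ?k + [:0, 1:] ^ ?k + 1"
  unfolding hsubst_add h1 hv hy[OF order_refl] by simp
 then show "1 + v_coord ^ ?k + [:0, 1:] ^ ?k \<in> v_forms m"
  unfolding v_forms_def mem_Collect_eq by (intro conjI degree_add_le d) (simp_all add: algebra_simps)
 have "hsubst ?k v_coord ([:0, 1:] ^ 1 + v_coord ^ l + ([:0, 1:] ^ ?k - [:0, 1:] ^ l))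
   = v_coord ^ l + ([:0, 1:] ^ ?k - [:0, 1:] ^ l) + (1 - v_coord ^ 1)"
  unfolding hsubst_add hsubst_diff hv' using hy[of 1] hy[of l] hy[of ?k] l by simp
 also have "1 - v_coord ^ 1 = [:0, 1:]" by (simp add: one_pCons)
 finally have "hsubst ?k v_coord ([:0, 1:] + v_coord ^ l + ([:0, 1:] ^ ?k - [:0, 1:] ^ l))
   = [:0, 1:] + v_coord ^ l + ([:0, 1:] ^ ?k - [:0, 1:] ^ l)" by (simp only: power_one_right ac_simps)
 moreover have "2 * m - 1 = l" using l by simp
 ultimately show "[:0, 1:] + v_coord ^ (?k - 1) + ([:0, 1:] ^ ?k - [:0, 1:] ^ (?k - 1)) \<in> v_forms m"
  unfolding v_forms_def mem_Collect_eq
  by (intro conjI degree_add_le degree_diff_le d) (use m in simp_all)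
qed

text \<open>In degree 6 (t + 1) the traces have the residues 3 and 3 y, because y and 1 - y are
  mutually inverse sixth roots of unity. So every residue modulo the norm form is attained.\<close>

lemma v_forms_trace_residues:
 obtains w1 w2 where "w1 \<in> v_forms (3 * Suc t)" "w2 \<in> v_forms (3 * Suc t)"
  "norm_form dvd w1 - [:3:]" "norm_form dvd w2 - [:0, 3:]"
proof -
 let ?m = "3 * Suc t" and ?y = "[:0, 1 :: rat:]"
 have k: "2 * ?m = 6 * Suc t" by simp
 obtain l where l: "6 * Suc t = Suc l" by (cases "6 * Suc t") auto
 have m: "?m > 0" by simp
 have vy: "v_coord * ?y = 1 - norm_form" by (simp add: norm_form_def one_pCons)
 have pv: "norm_form dvd v_coord ^ (6 * Suc t) - 1"
  by (rule norm_form_dvd_power) (simp add: norm_form_def one_pCons)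
 have py: "norm_form dvd ?y ^ (6 * Suc t) - 1"
  by (rule norm_form_dvd_power) (simp add: norm_form_def one_pCons)
 have *: "(a - 1) + (b - 1) = (1 + a + b) - (1 + 1 + 1)" for a b :: "rat poly"
  by (simp add: diff_eq_eq eq_diff_eq)
 have "norm_form dvd (v_coord ^ (6 * Suc t) - 1) + (?y ^ (6 * Suc t) - 1)" by (rule dvd_add[OF pv py])
 also have "\<dots> = (1 + v_coord ^ (6 * Suc t) + ?y ^ (6 * Suc t)) - (1 + 1 + 1)"
  by (rule *)
 also have "1 + 1 + 1 = [:3 :: rat:]" by (simp add: one_pCons)
 finally have 1: "norm_form dvd (1 + v_coord ^ (6 * Suc t) + ?y ^ (6 * Suc t)) - [:3:]" .
 have v': "norm_form dvd v_coord ^ l - ?y"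
 proof -
  have "norm_form dvd ?y * (v_coord ^ Suc l - 1) + v_coord ^ l * norm_form"
   using pv unfolding l by (intro dvd_add dvd_mult) simp_all
  also have "\<dots> = (v_coord * ?y) * v_coord ^ l - ?y + v_coord ^ l * norm_form"
   by (simp only: power_Suc algebra_simps)
  also have "\<dots> = v_coord ^ l - ?y" unfolding vy by (simp only: algebra_simps)
  finally show ?thesis .
 qed
 have y': "norm_form dvd ?y ^ l - v_coord"
 proof -
  have "norm_form dvd v_coord * (?y ^ Suc l - 1) + ?y ^ l * norm_form"
   using py unfolding l by (intro dvd_add dvd_mult) simp_all
  also have "\<dots> = (v_coord * ?y) * ?y ^ l - v_coord + ?y ^ l * norm_form"
   by (simp only: power_Suc algebra_simps)
  also have "\<dots> = ?y ^ l - v_coord" unfolding vy by (simp only: algebra_simps)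
  finally show ?thesis .
 qed
 have "norm_form dvd (v_coord ^ l - ?y) + ((?y ^ (6 * Suc t) - 1) - (?y ^ l - v_coord))"
  by (intro dvd_add dvd_diff v' py y')
 also have "\<dots> = (?y + v_coord ^ l + (?y ^ (6 * Suc t) - ?y ^ l)) - (?y + ?y + (1 - v_coord))"
  by (simp only: algebra_simps)
 also have "?y + ?y + (1 - v_coord) = [:0, 3:]" by (simp add: one_pCons)
 finally have 2: "norm_form dvd (?y + v_coord ^ l + (?y ^ (6 * Suc t) - ?y ^ l)) - [:0, 3:]" .
 have "6 * Suc t - 1 = l" using l by simp
 then show ?thesis using that v_forms_trace[OF m] 1 2 unfolding k by simp
qed

text \<open>b is an inverse of a modulo the norm form, up to the nonzero scalar c.\<close>

lemma norm_form_cancel: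
 assumes "norm_form dvd a * g" "a * b = norm_form * q + [:c:]" "c \<noteq> 0"
 shows "norm_form dvd g"
proof -
 have "norm_form dvd (a * g) * b - norm_form * (q * g)"
  by (rule dvd_diff[OF dvd_mult2[OF assms(1)] dvd_triv_left])
 also have "(a * g) * b - norm_form * (q * g) = (a * b - norm_form * q) * g" by (simp only: algebra_simps)
 also have "\<dots> = smult c g" using assms(2) by simp
 finally show ?thesis using assms(3) by (simp add: dvd_smult_iff)
qed

lemma norm_form_dvd_v_form':
 assumes g: "g \<in> v_forms m" and m: "\<not> 3 dvd m"
 shows "norm_form dvd g"
proof -
 let ?y = "[:0, 1 :: rat:]"
 define t r where "t = m div 3" and "r = m mod 3"
 have r: "r = 1 \<or> r = 2" using m unfolding r_def by (auto simp: dvd_eq_mod_eq_0)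
 have k: "2 * m = 6 * t + 2 * r" using div_mult_mod_eq[of m 3] unfolding t_def r_def by linarith
 have py: "norm_form dvd ?y ^ (6 * t) - 1"
  by (rule norm_form_dvd_power) (simp add: norm_form_def one_pCons)
 have "norm_form dvd (?y ^ (2 * m) - 1) * g - (?y ^ (6 * t) - 1) * (?y ^ (2 * r) * g)"
  by (rule dvd_diff[OF norm_form_dvd_v_form[OF g] dvd_mult2[OF py]])
 also have "\<dots> = (?y ^ (2 * r) - 1) * g"
  unfolding k power_add by (simp only: algebra_simps)
 finally have *: "norm_form dvd (?y ^ (2 * r) - 1) * g" .
 show ?thesis
  using r
 proof
  assume r: "r = 1"
  \<comment> \<open>Modulo the norm form (y^2 - 1) (y + 1) = -3; in the second case (y^4 - 1) (y -
    2) = 3. The other witness is the quotient.\<close>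
  show ?thesis
   by (rule norm_form_cancel[OF *, of "[:1, 1:]" "[:2, 1:]" "- 3"])
    (simp_all add: r norm_form_def power2_eq_square one_pCons)
 next
  assume r: "r = 2"
  show ?thesis
   by (rule norm_form_cancel[OF *, of "[:- 2, 1:]" "[:- 1, - 2, - 1, 1:]" 3])
    (simp_all add: r norm_form_def power_numeral_reduce one_pCons)
 qed
qed

text \<open>Multiplication by the norm form embeds the space for m into that for m + 1, with the
  divisible forms as image. This is everything unless 3 divides m + 1, when the two traces supply
  the missing residues.\<close>

lemma v_forms_basis:
 "\<exists>B. finite B \<and> qp.independent B \<and> qp.span B = v_forms m \<and> card B = 2 * (m div 3) + 1"
proof (induction m)
 case 0
 have "g \<in> v_forms 0 \<longleftrightarrow> (\<exists>c. g = smult c 1)" for g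
 proof
  assume "g \<in> v_forms 0"
  then show "\<exists>c. g = smult c 1" by (auto simp: v_forms_def elim: degree_eq_zeroE)
 qed (auto simp: v_forms_def hsubst_def)
 then have "qp.span {1} = v_forms 0" by (auto simp: qp.span_singleton)
 moreover have "qp.independent {1}" by simp
 ultimately show ?case by (intro exI[of _ "{1}"]) simp
next
 case (Suc m)
 then obtain B where B: "finite B" "qp.independent B" "qp.span B = v_forms m"
  "card B = 2 * (m div 3) + 1" by blast
 interpret q: Vector_Spaces.linear smult smult "\<lambda>g. norm_form * g"
  by (rule rat_poly_linear) (simp_all add: algebra_simps)
 have inj: "inj_on (\<lambda>g. norm_form * g) S" for S by (rule inj_onI) simp
 let ?qB = "(\<lambda>g. norm_form * g) ` B"
 have qB: "finite ?qB" "qp.independent ?qB" "card ?qB = 2 * (m div 3) + 1"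
  "qp.span ?qB = (\<lambda>g. norm_form * g) ` v_forms m"
  using B q.independent_injective_image[OF B(2) inj] card_image[OF inj, of B] q.span_image[of B] by simp_all
 have qW: "(\<lambda>g. norm_form * g) ` v_forms m \<subseteq> v_forms (Suc m)" by (auto simp: norm_form_v_forms)
 have divisible: "g \<in> (\<lambda>g. norm_form * g) ` v_forms m" if "g \<in> v_forms (Suc m)" "norm_form dvd g" for g
  using that norm_form_v_forms by (auto elim!: dvdE)
 show ?case
 proof (cases "3 dvd Suc m")
  case False
  then have "v_forms (Suc m) = (\<lambda>g. norm_form * g) ` v_forms m"
   using qW divisible norm_form_dvd_v_form' by blast
  moreover have "Suc m div 3 = m div 3" using False by (simp add: div_Suc dvd_eq_mod_eq_0)
  ultimately show ?thesis using qB by (intro exI[of _ ?qB]) simp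
 next
  case True
  then obtain t where t: "Suc m = 3 * Suc t" by (metis dvdE mult_0_right not0_implies_Suc old.nat.distinct(2))
  then have div: "Suc m div 3 = Suc (m div 3)" by (simp add: div_Suc)
  obtain w1 w2 where w: "w1 \<in> v_forms (Suc m)" "w2 \<in> v_forms (Suc m)"
   and w1: "norm_form dvd w1 - [:3:]" and w2: "norm_form dvd w2 - [:0, 3:]"
   using v_forms_trace_residues[of t] unfolding t .
  have small: "r = 0" if "norm_form dvd r" "degree r < 2" for r
   using dvd_imp_degree_le[OF that(1)] that(2) degree_norm_form by fastforce
  have qB_dvd: "norm_form dvd g" if "g \<in> qp.span ?qB" for g using that unfolding qB(4) by auto
  have "w1 \<notin> qp.span ?qB"
  proof
   assume "w1 \<in> qp.span ?qB"
   from dvd_diff[OF qB_dvd[OF this] w1] show False using small[of "[:3:]"] by simp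
  qed
  note n1 = this
  have i1: "qp.independent (insert w1 ?qB)" by (rule qp.independent_insertI[OF n1 qB(2)])
  have "w2 \<notin> qp.span (insert w1 ?qB)"
  proof
   assume "w2 \<in> qp.span (insert w1 ?qB)"
   then obtain c where "w2 - smult c w1 \<in> qp.span ?qB" by (auto simp: qp.span_insert)
   then have "norm_form dvd (w2 - smult c w1) - (w2 - [:0, 3:]) + smult c (w1 - [:3:])"
    using dvd_add[OF dvd_diff[OF qB_dvd w2] dvd_smult[OF w1, of c]] by blast
   also have "\<dots> = [:0, 3:] - smult c [:3:]" by (simp only: smult_diff_right algebra_simps)
   also have "\<dots> = [:- 3 * c, 3:]" by simp
   finally show False using small[of "[:- 3 * c, 3:]"] by simp
  qed
  note n2 = this
  let ?C = "insert w2 (insert w1 ?qB)"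
  have i2: "qp.independent ?C" by (rule qp.independent_insertI[OF n2 i1])
  have new: "w1 \<notin> ?qB" "w2 \<notin> insert w1 ?qB"
   using n1 n2 qp.span_base[of w1 ?qB] qp.span_base[of w2 "insert w1 ?qB"] by auto
  have "?qB \<subseteq> v_forms (Suc m)" using qp.span_superset[of ?qB] qW unfolding qB(4) by (rule order_trans)
  then have "?C \<subseteq> v_forms (Suc m)" using w by simp
  then have "qp.span ?C \<subseteq> v_forms (Suc m)" by (rule qp.span_minimal[OF _ subspace_v_forms])
  moreover have "g \<in> qp.span ?C" if g: "g \<in> v_forms (Suc m)" for g
  proof -
   \<comment> \<open>If g has residue a + b y, subtracting a/3 of the first trace and b/3 of the
     second leaves a fixed form divisible by the norm form.\<close>
   define r where "r = g mod norm_form"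
   have "degree r < 2" unfolding r_def using degree_mod_less'[of norm_form g] degree_norm_form
    by (cases "g mod norm_form = 0") auto
   then have "r = [:coeff r 0, coeff r 1:]"
    by (intro poly_eqI) (auto simp: coeff_pCons coeff_eq_0 split: nat.split)
   then obtain a b where r: "r = [:a, b:]" by blast
   have "norm_form dvd g - r" unfolding r_def by (simp add: minus_mod_eq_mult_div)
   then have "norm_form dvd (g - r) - smult (a / 3) (w1 - [:3:]) - smult (b / 3) (w2 - [:0, 3:])"
    using dvd_diff[OF dvd_diff[OF _ dvd_smult[OF w1]] dvd_smult[OF w2]] by blast
   also have "\<dots> = (g - smult (a / 3) w1 - smult (b / 3) w2) - (r - smult (a / 3) [:3:] - smult (b / 3) [:0, 3:])"
    by (simp only: smult_diff_right algebra_simps)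
   also have "r - smult (a / 3) [:3:] - smult (b / 3) [:0, 3:] = 0" by (simp add: r)
   finally have "norm_form dvd g - smult (a / 3) w1 - smult (b / 3) w2" by simp
   moreover have "g - smult (a / 3) w1 - smult (b / 3) w2 \<in> v_forms (Suc m)"
    using g w subspace_v_forms by (intro qp.subspace_diff qp.subspace_scale) auto
   ultimately have gC: "g - smult (a / 3) w1 - smult (b / 3) w2 \<in> qp.span ?C"
    using divisible qp.span_mono[of ?qB ?C] unfolding qB(4) by blast
   have "w1 \<in> qp.span ?C" "w2 \<in> qp.span ?C" by (simp_all add: qp.span_base)
   from qp.span_add[OF qp.span_add[OF gC qp.span_scale[OF this(2)]] qp.span_scale[OF this(1)],
     of "b / 3" "a / 3"]
   show ?thesis by simp
  qed
  ultimately have "qp.span ?C = v_forms (Suc m)" by blast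
  moreover have "card ?C = 2 * (Suc m div 3) + 1" using new qB(1,3) div by simp
  ultimately show ?thesis using i2 qB(1) by (intro exI[of _ ?C]) simp
 qed
qed

section \<open>Forms negated by u, which acts by x -> - y and y -> x\<close>

definition u_anti_forms :: "nat \<Rightarrow> rat poly set"
 where "u_anti_forms m = {g. degree g \<le> 2 * m \<and> hsubst (2 * m) [:0, - 1:] g = - g}"

lemma coeff_hsubst_flip:
 assumes "i \<le> k"
 shows "coeff (hsubst k [:0, - 1:] g) i = (- 1) ^ i * coeff g (k - i)"
proof -
 have "coeff ([:0, - 1 :: rat:] ^ n) i = (if i = n then (- 1) ^ n else 0)" for n
 proof -
  have "[:0, - 1 :: rat:] = smult (- 1) [:0, 1:]" by simp
  then have "[:0, - 1 :: rat:] ^ n = monom ((- 1) ^ n) n" by (simp only: smult_power monom_altdef)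
  then show ?thesis by simp
 qed
 then have "coeff (hsubst k [:0, - 1:] g) i = (\<Sum>j\<le>k. if j = k - i then coeff g j * (- 1) ^ i else 0)"
  unfolding hsubst_def coeff_sum coeff_smult using assms by (intro sum.cong) auto
 then show ?thesis by (simp add: mult.commute)
qed

lemma u_anti_forms_iff:
 "g \<in> u_anti_forms m \<longleftrightarrow> degree g \<le> 2 * m \<and> (\<forall>i\<le>2 * m. (- 1) ^ i * coeff g (2 * m - i) = - coeff g i)"
proof -
 have "hsubst (2 * m) [:0, - 1:] g = - g \<longleftrightarrow>
   (\<forall>i\<le>2 * m. (- 1) ^ i * coeff g (2 * m - i) = - coeff g i)" if "degree g \<le> 2 * m"
 proof -
  have "degree (hsubst (2 * m) [:0, - 1:] g) \<le> 2 * m" by (rule degree_hsubst) simp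
  then have "coeff (hsubst (2 * m) [:0, - 1:] g) i = coeff (- g) i" if "\<not> i \<le> 2 * m" for i
   using that \<open>degree g \<le> 2 * m\<close> by (simp add: coeff_eq_0)
  then have "hsubst (2 * m) [:0, - 1:] g = - g \<longleftrightarrow>
    (\<forall>i\<le>2 * m. coeff (hsubst (2 * m) [:0, - 1:] g) i = coeff (- g) i)"
   unfolding poly_eq_iff by blast
  then show ?thesis by (simp add: coeff_hsubst_flip)
 qed
 then show ?thesis by (auto simp: u_anti_forms_def)
qed

lemma subspace_u_anti_forms: "qp.subspace (u_anti_forms m)"
 unfolding qp.subspace_def u_anti_forms_def
 by (auto simp: hsubst_add hsubst_smult degree_add_le intro: order_trans[OF degree_smult_le])

text \<open>u exchanges the coefficients of y^j and y^(2 m - j) up to sign, which leaves one free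
  parameter for each j < m. The middle coefficient is free exactly for odd m.\<close>

lemma u_anti_forms_basis:
 "\<exists>B. finite B \<and> qp.independent B \<and> qp.span B = u_anti_forms m \<and>
  card B = m + (if odd m then 1 else 0)"
proof -
 let ?k = "2 * m"
 define r where "r = m + (if odd m then 1 else 0)"
 \<comment> \<open>Chosen dual to the first r coefficients; a form negated by u is determined by
   these.\<close>
 define e where "e j = (if j < m then monom 1 j - monom ((- 1) ^ j) (?k - j) else monom (1 :: rat) m)" for j
 have ce: "coeff (e j) i = (if i = j then 1 else 0)" if "i < r" "j < r" for i j
  using that by (auto simp: e_def r_def coeff_diff split: if_splits)
 have sgn: "(- 1 :: rat) ^ (?k - i) = (- 1) ^ i" if "i \<le> ?k" for i
  using that by (simp add: minus_one_power_iff)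
 have eU: "e j \<in> u_anti_forms m" if "j < r" for j
 proof (cases "j < m")
  case True
  then show ?thesis
   unfolding u_anti_forms_iff e_def
   by (auto intro!: degree_diff_le order_trans[OF degree_monom_le] simp: sgn power_add[symmetric])
 next
  case False
  then have "j = m" "odd m" using that by (auto simp: r_def split: if_splits)
  then show ?thesis
   unfolding u_anti_forms_iff e_def by (auto intro!: order_trans[OF degree_monom_le])
 qed
 have sep: "g = 0" if g: "g \<in> u_anti_forms m" and z: "\<And>i. i < r \<Longrightarrow> coeff g i = 0" for g
 proof (rule poly_eqI)
  fix i
  consider "i < r" | "i = m" "even m" | "i > m" "i \<le> ?k" | "i > ?k"
   unfolding r_def by (cases "i < m"; cases "i = m"; cases "i \<le> ?k"; cases "even m") auto
  then show "coeff g i = coeff 0 i"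
  proof cases
   case 1 then show ?thesis using z by simp
  next
   case 2
   then show ?thesis using g[unfolded u_anti_forms_iff] by (auto dest!: spec[of _ m])
  next
   case 3
   then have "coeff g (?k - i) = 0" using z unfolding r_def by simp
   then show ?thesis using g[unfolded u_anti_forms_iff] 3 by (auto dest!: spec[of _ i])
  next
   case 4 then show ?thesis using g[unfolded u_anti_forms_iff] by (simp add: coeff_eq_0)
  qed
 qed
 have inj: "inj_on e {..<r}"
  by (rule inj_onI) (metis ce lessThan_iff zero_neq_one)
 have coeff_comb: "coeff (\<Sum>j<r. smult (c j) (e j)) i = c i" if "i < r" for c i
  using that by (simp add: coeff_sum ce if_distrib cong: if_cong)
 have "qp.independent (e ` {..<r})"
  unfolding qp.independent_explicit_finite_subsets
 proof (intro allI impI ballI)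
  fix S c b assume S: "S \<subseteq> e ` {..<r}" "finite S" and z: "(\<Sum>x\<in>S. smult (c x) x) = 0" and b: "b \<in> S"
  define d where "d j = (if e j \<in> S then c (e j) else 0)" for j
  have "(\<Sum>x\<in>S. smult (c x) x) = (\<Sum>x\<in>e ` {..<r}. smult (if x \<in> S then c x else 0) x)"
   using S by (intro sum.mono_neutral_cong_left) auto
  also have "\<dots> = (\<Sum>j<r. smult (d j) (e j))" unfolding d_def by (subst sum.reindex[OF inj]) simp
  finally have "d j = 0" if "j < r" for j using coeff_comb[OF that, of d] z by simp
  then show "c b = 0" using b S unfolding d_def by fastforce
 qed
 moreover have "qp.span (e ` {..<r}) = u_anti_forms m"
 proof
  show "qp.span (e ` {..<r}) \<subseteq> u_anti_forms m"
   by (rule qp.span_minimal[OF _ subspace_u_anti_forms]) (use eU in blast)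
  show "u_anti_forms m \<subseteq> qp.span (e ` {..<r})"
  proof
   fix g assume g: "g \<in> u_anti_forms m"
   let ?s = "\<Sum>j<r. smult (coeff g j) (e j)"
   have s: "?s \<in> qp.span (e ` {..<r})"
    by (intro qp.span_sum qp.span_scale qp.span_base) simp
   have "?s \<in> u_anti_forms m"
    using eU by (intro qp.subspace_sum qp.subspace_scale subspace_u_anti_forms) auto
   then have "g - ?s = 0"
    using g coeff_comb by (intro sep qp.subspace_diff subspace_u_anti_forms) simp_all
   then show "g \<in> qp.span (e ` {..<r})" using s by simp
  qed
 qed
 moreover have "card (e ` {..<r}) = r" using card_image[OF inj] by simp
 ultimately show ?thesis unfolding r_def by blast
qed

section \<open>Finite generation of the cohomology groups\<close>

context group_module
begin

lemma finitely_generated_H: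
 assumes "n = 1 \<or> n = 2" "finite I" "\<And>i. i \<in> I \<Longrightarrow> c i \<in> hom (Z n) integer_group"
  and "\<And>x. x \<in> carrier (Z n) \<Longrightarrow> (\<And>i. i \<in> I \<Longrightarrow> c i x = 0) \<Longrightarrow> x \<in> B n"
 shows "finitely_generated_group (H n)"
 unfolding group_cohomology_def
 by (rule comm_group.finitely_generated_quotient[OF comm_group_Z assms(2,3) subgroup_B[OF assms(1)] assms(4)])

end

text \<open>A derivation is determined by its values on the two generators, and these are forms with
  finitely many coefficients.\<close>

lemma finitely_generated_H_B3_1: "finitely_generated_group (H_B3 1 n)"
proof -
 interpret B3_module "M_component n" B3_action by (rule B3_module_M)
 let ?I = "(UNIV :: braid_gen set) \<times> ({..n} \<times> {..n})"
 define c where "c t x = (case t of (s, i, j) \<Rightarrow> coeff (coeff (x [braid s]) i) j)"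
  for t :: "braid_gen \<times> nat \<times> nat" and x :: "braid_gen word set list \<Rightarrow> int poly poly"
 have fin: "finite ?I"
 proof -
  have "(UNIV :: braid_gen set) \<subseteq> {Sigma1, Sigma2}" using braid_gen.exhaust by blast
  then have "finite (UNIV :: braid_gen set)" by (rule finite_subset) simp
  then show ?thesis by (intro finite_cartesian_product) auto
 qed
 show ?thesis
  unfolding H_B3_def
 proof (rule finitely_generated_H[of 1 ?I c, OF _ fin])
  show "c t \<in> hom (Z 1) integer_group" for t
   by (rule homI) (auto simp: c_def split: prod.splits)
  fix x assume x: "x \<in> carrier (Z 1)" and z: "\<And>t. t \<in> ?I \<Longrightarrow> c t x = 0"
  obtain d where d: "x = cochain1 d" "derivation d" using x by (rule Z1_cases)
  have "d (braid s) = 0" for s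
  proof (rule poly_eqI, rule poly_eqI)
   fix i j
   have dM: "d (braid s) \<in> M_component n" using d(2) braid_closed by (simp add: derivation_def)
   show "coeff (coeff (d (braid s)) i) j = coeff (coeff 0 i) j"
   proof (rule ccontr)
    assume *: "coeff (coeff (d (braid s)) i) j \<noteq> coeff (coeff 0 i) j"
    then have "2 * (i + j) = n" using M_componentD[OF dM] by simp
    then have "(s, i, j) \<in> ?I" by simp
    then show False using z[of "(s, i, j)"] * by (simp add: c_def d(1) cochain1_app braid_closed)
   qed
  qed
  then have "d g = 0" if "g \<in> carrier B3" for g using derivation_zeroI[OF d(2)] that by blast
  then have "x = (\<lambda>_. 0)" unfolding d(1) cochain1_zero by (intro cochain1_cong)
  then show "x \<in> B 1" using subgroup.one_closed[OF subgroup_B1] by simp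
 qed simp
qed

text \<open>A 2-cocycle with zero obstruction splits, so the finitely many coefficients of the
  obstruction detect coboundaries.\<close>

lemma finitely_generated_H_B3_2: "finitely_generated_group (H_B3 2 n)"
proof -
 interpret B3_module "M_component n" B3_action by (rule B3_module_M)
 let ?I = "{..n} \<times> {..n}"
 define ob where "ob x = braid_obstruction (\<lambda>g h. x [g, h])"
  for x :: "braid_gen word set list \<Rightarrow> int poly poly"
 define c where "c t x = coeff (coeff (ob x) (fst t)) (snd t)"
  for t :: "nat \<times> nat" and x :: "braid_gen word set list \<Rightarrow> int poly poly"
 show ?thesis
  unfolding H_B3_def
 proof (rule finitely_generated_H[of 2 ?I c])
  show "c t \<in> hom (Z 2) integer_group" for t
   by (rule homI) (auto simp: c_def ob_def braid_obstruction_def act_add braid_closed)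
  fix x assume x: "x \<in> carrier (Z 2)" and z: "\<And>t. t \<in> ?I \<Longrightarrow> c t x = 0"
  obtain f where f: "x = cochain2 f" "factor_set f" using x by (rule Z2_cases)
  have fob: "ob x = braid_obstruction f"
   by (simp add: f(1) ob_def braid_obstruction_def cochain2_app braid_closed)
  have obM: "braid_obstruction f \<in> M_component n"
  proof -
   have fA: "f g h \<in> M_component n" if "g \<in> carrier B3" "h \<in> carrier B3" for g h
    using f(2) that by (simp add: factor_set_def)
   show ?thesis unfolding braid_obstruction_def
    by (intro A_diff A_add act_closed fA braid_closed m_closed)
  qed
  have "braid_obstruction f = 0"
  proof (rule poly_eqI, rule poly_eqI)
   fix i j
   show "coeff (coeff (braid_obstruction f) i) j = coeff (coeff 0 i) j"
   proof (rule ccontr)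
    assume *: "coeff (coeff (braid_obstruction f) i) j \<noteq> coeff (coeff 0 i) j"
    then have "2 * (i + j) = n" using M_componentD[OF obM] by simp
    then have "(i, j) \<in> ?I" by simp
    then show False using z[of "(i, j)"] * by (simp add: c_def fob)
   qed
  qed
  then show "x \<in> B 2"
   unfolding f(1)
   by (intro factor_set_coboundaryI[OF f(2) A_zero A_zero]) (simp add: act_zero braid_closed)
 qed simp_all
qed

section \<open>Derivations up to torsion and their values on u\<close>

context B3_module_trivial_center
begin

lemma derivationD:
 assumes "derivation d"
 shows "g \<in> carrier B3 \<Longrightarrow> d g \<in> A"
  and "g \<in> carrier B3 \<Longrightarrow> h \<in> carrier B3 \<Longrightarrow> d (g \<cdot> h) = d g + act g (d h)"
 using assms by (auto simp: derivation_def)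

text \<open>Up to the factor 3, every derivation is cohomologous to one that vanishes on \<open>v\<close>;
 \<open>v_defect d\<close> is the element whose coboundary has to be added, and \<open>u_value d\<close> the value on \<open>u\<close>
 of the resulting derivation.\<close>

definition v_defect :: "(braid_gen word set \<Rightarrow> 'a) \<Rightarrow> 'a"
 where "v_defect d = d braid_v + d braid_v + act braid_v (d braid_v)"

definition u_value :: "(braid_gen word set \<Rightarrow> 'a) \<Rightarrow> 'a"
 where "u_value d = of_nat 3 * d braid_u + (act braid_u (v_defect d) - v_defect d)"

lemma v_defect_closed: "derivation d \<Longrightarrow> v_defect d \<in> A"
 unfolding v_defect_def by (intro A_add act_closed derivationD(1) braid_uvc_closed)

lemma u_value_add: "u_value (\<lambda>g. d g + d' g) = u_value d + u_value d'"
 by (simp add: u_value_def v_defect_def act_add braid_uvc_closed algebra_simps)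

text \<open>From d c = 0 the value of d on v is annihilated by 1 + v + v^2, and there (v - 1) (v +
  2) = -3. So the principal derivation of (v + 2) d(v) cancels 3 d at v.\<close>

lemma normalized_derivation:
 assumes d: "derivation d"
 defines "d' \<equiv> \<lambda>g. of_nat 3 * d g - (act g (- v_defect d) - (- v_defect d))"
 shows "derivation d'" "d' braid_v = 0" "d' braid_u = u_value d"
proof -
 note cl = braid_uvc_closed
 show "derivation d'"
  unfolding d'_def
  by (intro derivation_diff derivation_of_nat_mult derivation_principal A_uminus v_defect_closed d)
 have "d braid_c = d braid_v + act braid_v (d braid_v + act braid_v (d braid_v))"
  by (simp add: braid_c_def derivationD[OF d] cl)
 then have "d braid_v + act braid_v (d braid_v) + act braid_v (act braid_v (d braid_v)) = 0"
  using derivation_c[OF d] by (simp add: act_add cl add.assoc)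
 then have vv: "act braid_v (act braid_v (d braid_v)) = - d braid_v - act braid_v (d braid_v)"
  by (simp add: add_eq_0_iff algebra_simps)
 have "act braid_v (v_defect d) = act braid_v (d braid_v) + act braid_v (d braid_v) + (- d braid_v - act braid_v (d braid_v))"
  unfolding v_defect_def act_add[OF cl(1)] vv ..
 moreover have "d' braid_v = of_nat 3 * d braid_v + (act braid_v (v_defect d) - v_defect d)"
  by (simp add: d'_def act_uminus cl)
 ultimately show "d' braid_v = 0" by (simp add: v_defect_def algebra_simps)
 show "d' braid_u = u_value d"
  by (simp add: d'_def u_value_def act_simps cl)
qed

lemma u_value_closed: "derivation d \<Longrightarrow> u_value d \<in> A"
 by (simp add: u_value_def v_defect_closed derivationD A_closed braid_uvc_closed del: of_nat_numeral)

text \<open>As c = u^2, a derivation vanishing on c has a value on u annihilated by 1 + u.\<close>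

lemma act_u_u_value:
 assumes d: "derivation d"
 shows "act braid_u (u_value d) = - u_value d"
proof -
 note n = normalized_derivation[OF d]
 have "u_value d + act braid_u (u_value d) = 0"
  using derivation_c[OF n(1)] derivationD(2)[OF n(1) braid_uvc_closed(2,2)]
  unfolding braid_u_square n(3) by simp
 then show ?thesis by (simp add: add_eq_0_iff algebra_simps)
qed

lemma derivation_vanishing_on_uv:
 assumes d: "derivation d" "d braid_v = 0" "d braid_u = 0" and g: "g \<in> carrier B3"
 shows "d g = 0"
proof -
 note cl = braid_uvc_closed braid_closed
 have "act braid_v (d s1) = 0"
  using derivationD(2)[OF d(1) cl(1) cl(4), of Sigma1] d by (simp add: braid_u_def)
 then have 1: "d s1 = 0"
  using act_inv(2)[OF cl(1), of "d s1"] act_zero[OF group.inv_closed[OF group_B3 cl(1)]] by simp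
 have "act s1 (d s2) = 0"
  using derivationD(2)[OF d(1) cl(4) cl(4), of Sigma1 Sigma2] d 1 by (simp add: braid_v_def)
 then have "d s2 = 0"
  using act_inv(2)[OF cl(4), of Sigma1 "d s2"] act_zero[OF group.inv_closed[OF group_B3 cl(4)]] by simp
 with 1 show ?thesis using derivation_zeroI[OF d(1) _ _ g] by blast
qed

text \<open>N times the normalized derivation minus the principal derivation of w vanishes on v and
  on u, and these generate the group.\<close>

lemma torsion_of_u_value:
 assumes d: "derivation d" and w: "w \<in> A" "act braid_v w = w"
  and N: "of_nat N * u_value d = act braid_u w - w"
 shows "\<exists>a\<in>A. \<forall>g\<in>carrier B3. of_nat (N * 3) * d g = act g a - a"
proof -
 note n = normalized_derivation[OF d]
 let ?d' = "\<lambda>g. of_nat 3 * d g - (act g (- v_defect d) - (- v_defect d))"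
 let ?a = "w - of_nat N * v_defect d"
 let ?\<delta> = "\<lambda>g. of_nat N * ?d' g - (act g w - w)"
 have \<delta>: "derivation ?\<delta>"
  by (intro derivation_diff derivation_of_nat_mult n(1) derivation_principal w(1))
 have "?\<delta> g = 0" if "g \<in> carrier B3" for g
  by (rule derivation_vanishing_on_uv[OF \<delta> _ _ that])
   (use n(2,3) w(2) N in \<open>simp_all only: mult_zero_right diff_self\<close>)
 then have "of_nat (N * 3) * d g = act g ?a - ?a" if "g \<in> carrier B3" for g
  using that by (simp add: act_simps algebra_simps del: of_nat_numeral)
 moreover have "?a \<in> A" using w(1) v_defect_closed[OF d] by (simp add: A_closed)
 ultimately show ?thesis by blast
qed

text \<open>The element w is the trace (1 + v + v^2) a: normalizing multiplies a by 3 + (v + 2) (v -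
  1), which is 1 + v + v^2.\<close>

lemma u_value_principal:
 assumes a: "a \<in> A"
 shows "\<exists>w\<in>A. act braid_v w = w \<and> u_value (\<lambda>g. act g a - a) = act braid_u w - w"
proof (intro bexI conjI)
 note cl = braid_uvc_closed
 let ?w = "a + act braid_v a + act braid_v (act braid_v a)"
 show "?w \<in> A" using a by (simp add: A_closed cl)
 show "act braid_v ?w = ?w" using a by (simp add: act_add cl act_v_v_v algebra_simps)
 show "u_value (\<lambda>g. act g a - a) = act braid_u ?w - ?w"
 proof -
  have "v_defect (\<lambda>g. act g a - a) = (act braid_v a - a) + (act braid_v a - a)
    + (act braid_v (act braid_v a) - act braid_v a)"
   by (simp add: v_defect_def act_diff cl)
  moreover from this have "act braid_u (v_defect (\<lambda>g. act g a - a))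
    = (act braid_u (act braid_v a) - act braid_u a) + (act braid_u (act braid_v a) - act braid_u a)
    + (act braid_u (act braid_v (act braid_v a)) - act braid_u (act braid_v a))"
   by (simp only: act_add[OF cl(2)] act_diff[OF cl(2)])
  ultimately show ?thesis by (simp add: u_value_def act_add cl algebra_simps)
 qed
qed

lemma derivation_with_u_value:
 assumes "b \<in> A" "act braid_u b = - b"
 shows "\<exists>d. derivation d \<and> u_value d = of_nat 3 * b"
proof -
 obtain d where "derivation d" "d braid_v = 0" "d braid_u = b"
  using derivation_vanishing_on_v[OF assms] by metis
 then show ?thesis
  by (intro exI[of _ d]) (simp add: u_value_def v_defect_def act_simps braid_uvc_closed)
qed

end

section \<open>Comparison of integral forms with rational polynomials\<close>

definition rat_form :: "int poly poly \<Rightarrow> rat poly"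
 where "rat_form f = map_poly of_int (poly f 1)"

lemma rat_form_hom:
 "rat_form 1 = 1" "rat_form (f + g) = rat_form f + rat_form g" "rat_form (f * g) = rat_form f * rat_form g"
 "rat_form 0 = 0" "rat_form (f - g) = rat_form f - rat_form g" "rat_form (- f) = - rat_form f"
 by (auto simp: rat_form_def intro!: poly_eqI simp: coeff_map_poly coeff_mult)

lemma rat_form_of_nat_mult: "rat_form (of_nat n * f) = smult (of_nat n) (rat_form f)"
 by (auto simp: rat_form_def intro!: poly_eqI simp: coeff_map_poly of_nat_poly)

lemma rat_form_inject:
 assumes "f \<in> M_component (2 * k)" "g \<in> M_component (2 * k)" "rat_form f = rat_form g"
 shows "f = g"
proof (rule dehomogenize_inject[OF assms(1,2)])
 show "poly f 1 = poly g 1"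
  using assms(3) by (simp add: rat_form_def poly_eq_iff coeff_map_poly)
qed

lemma degree_rat_form: "f \<in> M_component (2 * k) \<Longrightarrow> degree (rat_form f) \<le> k"
 unfolding rat_form_def using degree_dehomogenize[of f k]
 by (intro degree_le) (simp add: coeff_map_poly coeff_eq_0)

lemma homogenize_dehomogenize: "f \<in> M_component (2 * k) \<Longrightarrow> homogenize k (poly f 1) = f"
 by (rule dehomogenize_inject[OF homogenize_M_component])
  (simp_all add: dehomogenize_homogenize degree_dehomogenize)

lemma monom_as_vars: "monom (monom c j) i = of_int c * var_x ^ i * var_y ^ j"
proof -
 have "var_y ^ j = [:monom 1 j:]"
  by (induction j) (simp_all add: var_y_def monom_Suc one_pCons)
 moreover have "var_x ^ i = monom 1 i" by (simp add: var_x_def monom_altdef)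
 ultimately show ?thesis
  by (auto intro!: poly_eqI simp: of_int_poly mult.commute[of "monom 1 i"] smult_monom)
qed

text \<open>Both u and v send y to x, which becomes 1 at x = 1; hence the hypothesis on the second
  argument and the single substituted polynomial in \<open>hsubst\<close>.\<close>

lemma rat_form_subst_xy:
 assumes f: "f \<in> M_component (2 * k)" and v: "rat_form v = 1"
 shows "rat_form (subst_xy f u v) = hsubst k (rat_form u) (rat_form f)"
proof -
 define E where "E g = rat_form (subst_xy g u v)" for g
 have E1: "E 1 = 1" and E_add: "E (g + g') = E g + E g'" and E_mult: "E (g * g') = E g * E g'" for g g'
  by (simp_all add: E_def subst_xy_hom rat_form_hom)
 have E_power: "E (g ^ i) = E g ^ i" for g i by (induction i) (simp_all add: E1 E_mult)
 have E_0: "E 0 = 0" using E_add[of 0 0] by simp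
 have E_sum: "E (sum h I) = (\<Sum>i\<in>I. E (h i))" for h and I :: "nat set"
  by (induction I rule: infinite_finite_induct) (simp_all add: E_0 E_add)
 have E_nat: "E (of_nat n) = of_nat n" for n by (induction n) (simp_all add: E_0 E1 E_add)
 have E_minus: "E (- g) = - E g" for g using E_add[of g "- g"] E_0 by (simp add: add_eq_0_iff)
 have E_int: "E (of_int c) = of_int c" for c
  by (cases c rule: int_cases2) (simp_all add: E_nat E_minus)
 have E_var: "E var_x = rat_form u" "E var_y = 1"
  using v by (simp_all add: E_def subst_xy_hom)
 have "E (homogenize k (poly f 1)) = hsubst k (rat_form u) (rat_form f)"
  unfolding homogenize_def E_sum monom_as_vars E_mult E_power E_int E_var hsubst_def
  by (intro sum.cong) (simp_all add: rat_form_def coeff_map_poly of_int_poly)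
 then show ?thesis unfolding homogenize_dehomogenize[OF f] E_def .
qed

lemma rat_form_vars: "rat_form var_x = 1" "rat_form var_y = [:0, 1:]"
 by (simp_all add: rat_form_def var_x_def var_y_def one_pCons map_poly_pCons)

lemma rat_form_act_v:
 assumes "f \<in> M_component (2 * k)"
 shows "rat_form (B3_action braid_v f) = hsubst k v_coord (rat_form f)"
proof -
 interpret B3_module "M_component (2 * k)" B3_action by (rule B3_module_M)
 have "B3_action braid_v f = subst_xy f (var_x - var_y) var_x"
  by (simp add: braid_v_def act_mult braid_closed B3_action_gen act1_def act2_def subst_xy_subst_xy subst_xy_hom)
 then show ?thesis
  using rat_form_subst_xy[OF assms rat_form_vars(1), of "var_x - var_y"]
  by (simp add: rat_form_hom rat_form_vars one_pCons)
qed

lemma rat_form_act_u: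
 assumes "f \<in> M_component (2 * k)"
 shows "rat_form (B3_action braid_u f) = hsubst k [:0, - 1:] (rat_form f)"
proof -
 interpret B3_module "M_component (2 * k)" B3_action by (rule B3_module_M)
 have "B3_action braid_u f = subst_xy f (- var_y) var_x"
  by (simp add: braid_u_def braid_v_def act_mult braid_closed braid_uvc_closed group.is_monoid monoid.m_closed group_B3
    B3_action_gen act1_def act2_def subst_xy_subst_xy subst_xy_hom subst_xy_diff subst_xy_uminus)
 then show ?thesis
  using rat_form_subst_xy[OF assms rat_form_vars(1), of "- var_y"]
  by (simp add: rat_form_hom rat_form_vars)
qed

lemma common_denominator:
 assumes "finite S"
 shows "\<exists>N :: nat. N > 0 \<and> (\<forall>r\<in>S. of_nat N * (r :: rat) \<in> \<int>)"
 using assms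
proof induction
 case empty
 show ?case by (intro exI[of _ 1]) simp
next
 case (insert r S)
 then obtain N :: nat where N: "N > 0" "\<forall>r\<in>S. of_nat N * r \<in> \<int>" by blast
 obtain a b :: int where ab: "b > 0" "r = of_int a / of_int b"
  using quotient_of_div[of r] quotient_of_denom_pos' by (metis prod.collapse)
 have "of_nat (N * nat b) * r \<in> \<int>"
 proof -
  have "of_nat (N * nat b) * r = of_int (int N * a)" using ab by simp
  then show ?thesis by (metis Ints_of_int)
 qed
 moreover have "of_nat (N * nat b) * s \<in> \<int>" if "s \<in> S" for s
 proof -
  have "of_nat N * s \<in> \<int>" using N(2) that by blast
  then have "of_nat (nat b) * (of_nat N * s) \<in> \<int>" by (rule Ints_mult[OF Ints_of_nat])
  then show ?thesis by (simp add: ac_simps)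
 qed
 ultimately show ?case using N(1) ab(1) by (intro exI[of _ "N * nat b"]) auto
qed

lemma clear_denominators:
 assumes "degree g \<le> k"
 obtains N f where "N > (0 :: nat)" "f \<in> M_component (2 * k)" "rat_form f = smult (of_nat N) g"
proof -
 obtain N :: nat where N: "N > 0" "\<forall>r\<in>coeff g ` {..k}. of_nat N * r \<in> \<int>"
  using common_denominator[of "coeff g ` {..k}"] by auto
 define h where "h = (\<Sum>j\<le>k. monom \<lfloor>of_nat N * coeff g j\<rfloor> j)"
 have ch: "of_int (coeff h j) = of_nat N * coeff g j" for j
 proof (cases "j \<le> k")
  case True
  then have "coeff h j = \<lfloor>of_nat N * coeff g j\<rfloor>" by (simp add: h_def coeff_sum)
  then show ?thesis using N(2) True by (simp add: of_int_floor)
 next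
  case False
  then show ?thesis using assms by (simp add: h_def coeff_sum coeff_eq_0)
 qed
 have dh: "degree h \<le> k" unfolding h_def
  by (intro degree_sum_le) (auto intro: order_trans[OF degree_monom_le])
 show ?thesis
 proof (rule that[OF N(1) homogenize_M_component])
  show "rat_form (homogenize k h) = smult (of_nat N) g"
   unfolding rat_form_def dehomogenize_homogenize[OF dh]
   by (rule poly_eqI) (simp add: coeff_map_poly ch)
 qed
qed

lemma (in group_module) derivation_add: "derivation d \<Longrightarrow> derivation d' \<Longrightarrow> derivation (\<lambda>g. d g + d' g)"
 by (auto simp: derivation_def A_closed act_add algebra_simps)

lemma hsubst_flip_flip:
 assumes g: "degree g \<le> 2 * m"
 shows "hsubst (2 * m) [:0, - 1:] (hsubst (2 * m) [:0, - 1:] g) = g"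
proof (rule poly_eqI)
 fix i
 have sgn: "(- 1 :: rat) ^ i * (- 1) ^ (2 * m - i) = 1" if "i \<le> 2 * m"
  using that by (simp flip: power_add)
 show "coeff (hsubst (2 * m) [:0, - 1:] (hsubst (2 * m) [:0, - 1:] g)) i = coeff g i"
 proof (cases "i \<le> 2 * m")
  case True
  then show ?thesis using sgn by (simp add: coeff_hsubst_flip flip: mult.assoc)
 next
  case False
  then have "coeff g i = 0" using g by (simp add: coeff_eq_0)
  moreover have "degree (hsubst (2 * m) [:0, - 1:] (hsubst (2 * m) [:0, - 1:] g)) \<le> 2 * m"
   by (rule degree_hsubst) simp
  ultimately show ?thesis using False by (simp add: coeff_eq_0)
 qed
qed

text \<open>After clearing denominators a common fixed form of u and v is invariant under the group.
  This makes u - 1 injective on the forms fixed by v, so that dimensions can be subtracted.\<close>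

lemma no_common_invariants:
 assumes m: "m > 0" and g: "g \<in> v_forms m" "hsubst (2 * m) [:0, - 1:] g = g"
 shows "g = 0"
proof -
 interpret B3_module_trivial_center "M_component (2 * (2 * m))" B3_action
  by (rule B3_module_trivial_center_M) (use m in simp_all)
 obtain N f where N: "N > (0 :: nat)" and f: "f \<in> M_component (2 * (2 * m))" "rat_form f = smult (of_nat N) g"
  using clear_denominators[of g "2 * m"] g by (auto simp: v_forms_def)
 note cl = braid_uvc_closed braid_closed
 have v: "B3_action braid_v f = f"
  by (rule rat_form_inject[OF act_closed[OF cl(1) f(1)] f(1)])
   (use g in \<open>simp add: rat_form_act_v[OF f(1)] f(2) hsubst_smult v_forms_def\<close>)
 have u: "B3_action braid_u f = f"
  by (rule rat_form_inject[OF act_closed[OF cl(2) f(1)] f(1)])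
   (use g in \<open>simp add: rat_form_act_u[OF f(1)] f(2) hsubst_smult\<close>)
 have "B3_action braid_v (B3_action s1 f) = B3_action braid_v f"
  using u v by (simp add: braid_u_def act_mult cl)
 then have 1: "B3_action s1 f = f" by (metis act_inv(2) cl(1))
 then have "B3_action s1 (B3_action s2 f) = B3_action s1 f" using v by (simp add: act_v)
 then have 2: "B3_action s2 f = f" by (metis act_inv(2) cl(4))
 have "f = 0" by (rule no_invariants[OF f(1) 1 2])
 then show ?thesis using f(2) N by (simp add: rat_form_hom)
qed

text \<open>The dimension of the forms negated by u minus that of the forms fixed by v, for m > 0;
  the truncated subtraction gives 0 at m = 0.\<close>

definition betti :: "nat \<Rightarrow> nat"
 where "betti m = m + (if odd m then 1 else 0) - (2 * (m div 3) + 1)"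

section \<open>Integer coordinates on cohomology modulo torsion\<close>

definition coordinates :: "('a, 'b) monoid_scheme \<Rightarrow> ('a \<Rightarrow> int) list \<Rightarrow> bool"
 where "coordinates L cs \<longleftrightarrow> set cs \<subseteq> hom L integer_group \<and>
  (\<forall>x\<in>carrier L. (\<forall>c\<in>set cs. c x = 0) \<longrightarrow> (\<exists>n :: nat > 0. x [^]\<^bsub>L\<^esub> n = \<one>\<^bsub>L\<^esub>)) \<and>
  (\<forall>i<length cs. \<exists>x\<in>carrier L. (cs ! i) x \<noteq> 0 \<and> (\<forall>j<i. (cs ! j) x = 0))"

lemma free_parts_coordinates:
 assumes "comm_group L" "coordinates L cs"
 shows "free_parts L \<noteq> {}" "F \<in> free_parts L \<Longrightarrow> F \<cong> product_group {..<length cs} (\<lambda>_. integer_group)"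
proof -
 interpret comm_group L by (rule assms(1))
 have 1: "c \<in> hom L integer_group" if "c \<in> set cs" for c using assms(2) that by (auto simp: coordinates_def)
 have 2: "\<exists>n :: nat > 0. x [^]\<^bsub>L\<^esub> n = \<one>\<^bsub>L\<^esub>" if "x \<in> carrier L" "\<And>c. c \<in> set cs \<Longrightarrow> c x = 0" for x
  using assms(2) that by (auto simp: coordinates_def)
 have 3: "\<exists>x\<in>carrier L. (cs ! i) x \<noteq> 0 \<and> (\<forall>j<i. (cs ! j) x = 0)" if "i < length cs" for i
  using assms(2) that by (auto simp: coordinates_def)
 show "free_parts L \<noteq> {}" by (rule free_parts_of_coordinates(1)[of cs, OF 1 2 3])
 show "F \<in> free_parts L \<Longrightarrow> F \<cong> product_group {..<length cs} (\<lambda>_. integer_group)"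
  by (rule free_parts_of_coordinates(2)[of cs, OF 1 2 3])
qed

text \<open>Rationally, \<open>H\<^sup>1\<close> is the space of forms with \<open>u f = - f\<close> modulo the forms \<open>u w - w\<close> with
 \<open>v w = w\<close>, by the map \<open>u_value\<close>.\<close>

lemma quotient_functionals:
 assumes m: "m > 0"
 obtains \<phi> :: "nat \<Rightarrow> rat poly \<Rightarrow> rat" and e :: "nat \<Rightarrow> rat poly" where
  "\<And>i p q. \<phi> i (p + q) = \<phi> i p + \<phi> i q" "\<And>i c p. \<phi> i (smult c p) = c * \<phi> i p"
  "\<And>i g. g \<in> v_forms m \<Longrightarrow> i < betti m \<Longrightarrow> \<phi> i (hsubst (2 * m) [:0, - 1:] g - g) = 0"
  "\<And>p. p \<in> u_anti_forms m \<Longrightarrow> (\<And>i. i < betti m \<Longrightarrow> \<phi> i p = 0) \<Longrightarrow>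
   \<exists>g\<in>v_forms m. p = hsubst (2 * m) [:0, - 1:] g - g"
  "\<And>i. i < betti m \<Longrightarrow> e i \<in> u_anti_forms m"
  "\<And>i j. i < betti m \<Longrightarrow> j < betti m \<Longrightarrow> \<phi> i (e j) = (if i = j then 1 else 0)"
proof -
 obtain BW where BW: "finite BW" "qp.independent BW" "qp.span BW = v_forms m"
  "card BW = 2 * (m div 3) + 1" using v_forms_basis by blast
 obtain BU where BU: "finite BU" "qp.independent BU" "qp.span BU = u_anti_forms m"
  "card BU = m + (if odd m then 1 else 0)" using u_anti_forms_basis by blast
 let ?D = "\<lambda>g. hsubst (2 * m) [:0, - 1:] g - g"
 interpret D: Vector_Spaces.linear smult smult ?D
  by (rule rat_poly_linear) (simp_all add: hsubst_add hsubst_smult smult_diff_right)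
 have inj: "inj_on ?D (qp.span BW)"
 proof (rule inj_onI)
  fix g h assume gh: "g \<in> qp.span BW" "h \<in> qp.span BW" "?D g = ?D h"
  have "g - h \<in> v_forms m"
   using gh(1,2) qp.subspace_diff[OF subspace_v_forms] unfolding BW(3) by blast
  moreover have "hsubst (2 * m) [:0, - 1:] (g - h) = g - h"
   using gh(3) unfolding hsubst_diff by (simp add: algebra_simps)
  ultimately show "g = h" using no_common_invariants[OF m, of "g - h"] by simp
 qed
 let ?BX = "?D ` BW"
 have BX: "qp.independent ?BX" "finite ?BX" "qp.span ?BX = ?D ` v_forms m"
  using D.independent_injective_image[OF BW(2) inj] BW(1) D.span_image[of BW] BW(3) by simp_all
 have card: "card ?BX = 2 * (m div 3) + 1"
  using card_image[OF inj_on_subset[OF inj qp.span_superset]] BW(4) by simp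
 have DU: "?D g \<in> u_anti_forms m" if "g \<in> v_forms m" for g
 proof -
  have d: "degree g \<le> 2 * m" using that by (simp add: v_forms_def)
  have "degree (?D g) \<le> 2 * m" by (intro degree_diff_le degree_hsubst d) simp
  moreover have "hsubst (2 * m) [:0, - 1:] (?D g) = - ?D g"
   unfolding hsubst_diff hsubst_flip_flip[OF d] by simp
  ultimately show ?thesis by (simp add: u_anti_forms_def)
 qed
 have "?BX \<subseteq> u_anti_forms m" using qp.span_superset[of BW] DU unfolding BW(3) by blast
 then obtain \<phi> :: "nat \<Rightarrow> rat poly \<Rightarrow> rat" and e :: "nat \<Rightarrow> rat poly" where \<phi>:
  "\<And>i p q. \<phi> i (p + q) = \<phi> i p + \<phi> i q" "\<And>i c p. \<phi> i (smult c p) = c * \<phi> i p"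
  "\<And>i p. p \<in> qp.span ?BX \<Longrightarrow> i < card BU - card ?BX \<Longrightarrow> \<phi> i p = 0"
  "\<And>p. p \<in> u_anti_forms m \<Longrightarrow> (\<And>i. i < card BU - card ?BX \<Longrightarrow> \<phi> i p = 0) \<Longrightarrow> p \<in> qp.span ?BX"
  "\<And>i. i < card BU - card ?BX \<Longrightarrow> e i \<in> u_anti_forms m"
  "\<And>i j. i < card BU - card ?BX \<Longrightarrow> j < card BU - card ?BX \<Longrightarrow> \<phi> i (e j) = (if i = j then 1 else 0)"
  using quotient_coordinates[OF BX(1,2) subspace_u_anti_forms _ BU(2,1,3)] by blast
 have b: "card BU - card ?BX = betti m" by (simp add: BU(4) card betti_def)
 show ?thesis
 proof (rule that[of \<phi> e])
  show "\<phi> i (?D g) = 0" if "g \<in> v_forms m" "i < betti m" for i g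
   using \<phi>(3)[unfolded b BX(3), OF imageI[OF that(1)] that(2)] .
  show "\<exists>g\<in>v_forms m. p = ?D g" if "p \<in> u_anti_forms m" "\<And>i. i < betti m \<Longrightarrow> \<phi> i p = 0" for p
   using \<phi>(4)[unfolded b BX(3), OF that] by blast
 qed (use \<phi>[unfolded b] in blast)+
qed

lemma integral_functional:
 fixes \<phi> :: "rat poly \<Rightarrow> rat"
 assumes \<phi>: "\<And>p q. \<phi> (p + q) = \<phi> p + \<phi> q" "\<And>c p. \<phi> (smult c p) = c * \<phi> p"
 obtains N :: nat where "N > 0" "\<And>f. f \<in> M_component (2 * k) \<Longrightarrow> of_nat N * \<phi> (rat_form f) \<in> \<int>"
proof -
 obtain N :: nat where N: "N > 0" "\<forall>r\<in>(\<lambda>j. \<phi> (monom 1 j)) ` {..k}. of_nat N * r \<in> \<int>"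
  using common_denominator[of "(\<lambda>j. \<phi> (monom 1 j)) ` {..k}"] by auto
 have "of_nat N * \<phi> (rat_form f) \<in> \<int>" if f: "f \<in> M_component (2 * k)" for f
 proof -
  have \<phi>0: "\<phi> 0 = 0" using \<phi>(1)[of 0 0] by simp
  have \<phi>_sum: "\<phi> (sum h I) = (\<Sum>i\<in>I. \<phi> (h i))" for h and I :: "nat set"
   by (induction I rule: infinite_finite_induct) (simp_all add: \<phi>0 \<phi>(1))
  have "rat_form f = (\<Sum>j\<le>k. smult (coeff (rat_form f) j) (monom 1 j))"
   using poly_as_sum_of_monoms'[OF degree_rat_form[OF f]] by (simp add: smult_monom)
  then have "of_nat N * \<phi> (rat_form f) = of_nat N * \<phi> (\<Sum>j\<le>k. smult (coeff (rat_form f) j) (monom 1 j))"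
   by simp
  also have "\<dots> = (\<Sum>j\<le>k. coeff (rat_form f) j * (of_nat N * \<phi> (monom 1 j)))"
   by (simp add: \<phi>_sum \<phi>(2) sum_distrib_left mult.left_commute)
  also have "\<dots> \<in> \<int>"
  proof (intro Ints_sum)
   fix j assume "j \<in> {..k}"
   then have "of_nat N * \<phi> (monom 1 j) \<in> \<int>" using N(2) by blast
   moreover have "coeff (rat_form f) j \<in> \<int>" by (simp add: rat_form_def coeff_map_poly)
   ultimately show "coeff (rat_form f) j * (of_nat N * \<phi> (monom 1 j)) \<in> \<int>" by (rule Ints_mult[rotated])
  qed
  finally show ?thesis .
 qed
 with N(1) show ?thesis by (rule that)
qed

text \<open>The functionals are integral multiples of phi i applied to the \<open>u_value\<close> of
  a cocycle. They vanish on coboundaries by \<open>u_value_principal\<close>, and a class on which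
  all vanish is torsion by \<open>torsion_of_u_value\<close>.\<close>

lemma coordinates_H_B3_1:
 assumes m: "m > 0"
 shows "\<exists>cs. coordinates (H_B3 1 (2 * (2 * m))) cs \<and> length cs = betti m"
proof -
 define n where "n = 2 * (2 * m)"
 interpret B3_module_trivial_center "M_component n" B3_action
  unfolding n_def by (rule B3_module_trivial_center_M) (use m in simp_all)
 note form_act_v = rat_form_act_v[of _ "2 * m", folded n_def] and form_act_u = rat_form_act_u[of _ "2 * m", folded n_def]
  and form_inject = rat_form_inject[of _ "2 * m", folded n_def] and form_degree = degree_rat_form[of _ "2 * m", folded n_def]
  and denominators = clear_denominators[of _ "2 * m", folded n_def]
  and integrality = integral_functional[where k = "2 * m", folded n_def]
 note cl = braid_uvc_closed
 let ?D = "\<lambda>g. hsubst (2 * m) [:0, - 1:] g - g"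
 obtain \<phi> e where \<phi>:
  "\<And>i p q. \<phi> i (p + q) = \<phi> i p + \<phi> i q" "\<And>i c p. \<phi> i (smult c p) = c * \<phi> i p"
  and \<phi>_X: "\<And>i g. g \<in> v_forms m \<Longrightarrow> i < betti m \<Longrightarrow> \<phi> i (?D g) = 0"
  and \<phi>_sep: "\<And>p. p \<in> u_anti_forms m \<Longrightarrow> (\<And>i. i < betti m \<Longrightarrow> \<phi> i p = 0) \<Longrightarrow> \<exists>g\<in>v_forms m. p = ?D g"
  and e: "\<And>i. i < betti m \<Longrightarrow> e i \<in> u_anti_forms m"
   "\<And>i j. i < betti m \<Longrightarrow> j < betti m \<Longrightarrow> \<phi> i (e j) = (if i = j then 1 else 0)"
  using quotient_functionals[OF m] by blast
 have "\<exists>N :: nat. N > 0 \<and> (\<forall>f\<in>M_component n. of_nat N * \<phi> i (rat_form f) \<in> \<int>)" for i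
  using integrality[of "\<phi> i"] \<phi> by metis
 then obtain N :: "nat \<Rightarrow> nat" where N: "\<And>i. N i > 0"
  "\<And>i f. f \<in> M_component n \<Longrightarrow> of_nat (N i) * \<phi> i (rat_form f) \<in> \<int>" by metis
 \<comment> \<open>On cocycles the number is already an integer by the choice of \<open>N i\<close>;
   the floor makes the functional integer-valued on arbitrary functions.\<close>
 define C where "C i x = \<lfloor>of_nat (N i) * \<phi> i (rat_form (u_value (\<lambda>g. x [g])))\<rfloor>"
  for i and x :: "braid_gen word set list \<Rightarrow> int poly poly"
 have uv: "u_value (\<lambda>g. cochain1 d [g]) = u_value d" for d
  by (simp add: u_value_def v_defect_def cochain1_app cl)
 have C: "of_int (C i (cochain1 d)) = of_nat (N i) * \<phi> i (rat_form (u_value d))" if "derivation d" for i d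
  unfolding C_def uv using N(2)[OF u_value_closed[OF that]] by (simp add: of_int_floor)
 have u_anti: "rat_form (u_value d) \<in> u_anti_forms m" if d: "derivation d" for d
  using form_degree[OF u_value_closed[OF d]] form_act_u[OF u_value_closed[OF d]] act_u_u_value[OF d]
  by (simp add: u_anti_forms_def rat_form_hom)
 have C_hom: "C i \<in> hom (Z 1) integer_group" for i
 proof (rule homI)
  fix x y assume "x \<in> carrier (Z 1)" "y \<in> carrier (Z 1)"
  then obtain d d' where d: "x = cochain1 d" "derivation d" and d': "y = cochain1 d'" "derivation d'"
   by (elim Z1_cases)
  have dd: "derivation (\<lambda>g. d g + d' g)"
   by (rule derivation_add[OF d(2) d'(2)])
  have xy: "x \<otimes>\<^bsub>Z 1\<^esub> y = cochain1 (\<lambda>g. d g + d' g)"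
   by (simp add: d(1) d'(1) cochain1_add)
  have "rat_of_int (C i (x \<otimes>\<^bsub>Z 1\<^esub> y)) = of_nat (N i) * \<phi> i (rat_form (u_value (\<lambda>g. d g + d' g)))"
   unfolding xy by (rule C[OF dd])
  also have "\<dots> = of_int (C i x + C i y)"
   using C[OF d(2), of i] C[OF d'(2), of i]
   by (simp add: d(1) d'(1) u_value_add rat_form_hom \<phi>(1) distrib_left)
  finally have "rat_of_int (C i (x \<otimes>\<^bsub>Z 1\<^esub> y)) = of_int (C i x + C i y)" .
  then show "C i (x \<otimes>\<^bsub>Z 1\<^esub> y) = C i x \<otimes>\<^bsub>integer_group\<^esub> C i y" by simp
 qed simp
 have C_B: "C i x = 0" if x: "x \<in> B 1" and i: "i < betti m" for i x
 proof -
  obtain a where a: "a \<in> M_component n" "x = cochain1 (\<lambda>g. B3_action g a - a)"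
   using x unfolding B_1 by blast
  obtain w where w: "w \<in> M_component n" "B3_action braid_v w = w"
   "u_value (\<lambda>g. B3_action g a - a) = B3_action braid_u w - w" using u_value_principal[OF a(1)] by blast
  have "rat_form w \<in> v_forms m"
   using form_degree[OF w(1)] form_act_v[OF w(1)] w(2) by (simp add: v_forms_def)
  then have "\<phi> i (rat_form (u_value (\<lambda>g. B3_action g a - a))) = 0"
   unfolding w(3) rat_form_hom form_act_u[OF w(1)] by (rule \<phi>_X[OF _ i])
  then show ?thesis using C[OF derivation_principal[OF a(1)], of i] a(2) by simp
 qed
 have "\<exists>c. c \<in> hom (H 1) integer_group \<and> (\<forall>x\<in>carrier (Z 1). c (B 1 #>\<^bsub>Z 1\<^esub> x) = C i x)" if i: "i < betti m" for i
 proof -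
  interpret Z1: comm_group "Z 1" by (rule comm_group_Z)
  interpret C: group_hom "Z 1" integer_group "C i"
   by (intro group_hom.intro group_hom_axioms.intro Z1.is_group group_integer_group C_hom)
  have "B 1 \<subseteq> kernel (Z 1) integer_group (C i)"
   using C_B i subgroup.subset[OF subgroup_B1] by (auto simp: kernel_def)
  then obtain c where "c \<in> hom (Z 1 Mod B 1) integer_group" "\<And>x. x \<in> carrier (Z 1) \<Longrightarrow> c (B 1 #>\<^bsub>Z 1\<^esub> x) = C i x"
   using C.FactGroup_universal_kernel[OF Z1.subgroup_imp_normal[OF subgroup_B1]] by metis
  then show ?thesis unfolding group_cohomology_def by blast
 qed
 then obtain c where c: "\<And>i. i < betti m \<Longrightarrow> c i \<in> hom (H 1) integer_group"
  "\<And>i x. i < betti m \<Longrightarrow> x \<in> carrier (Z 1) \<Longrightarrow> c i (B 1 #>\<^bsub>Z 1\<^esub> x) = C i x" by metis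
 define cs where "cs = map c [0..<betti m]"
 have "coordinates (H 1) cs"
  unfolding coordinates_def
 proof (intro conjI ballI impI allI)
  show "set cs \<subseteq> hom (H 1) integer_group" using c(1) by (auto simp: cs_def)
  fix X assume "X \<in> carrier (H 1)" and z: "\<forall>c\<in>set cs. c X = 0"
  then obtain x where x: "x \<in> carrier (Z 1)" "X = B 1 #>\<^bsub>Z 1\<^esub> x" unfolding carrier_H by blast
  obtain d where d: "x = cochain1 d" "derivation d" using x(1) by (rule Z1_cases)
  have "\<phi> i (rat_form (u_value d)) = 0" if i: "i < betti m" for i
  proof -
   have "C i x = 0" using z c(2)[OF i x(1)] i x(2) by (auto simp: cs_def)
   then show ?thesis using C[OF d(2), of i] N(1)[of i] d(1) by simp
  qed
  then obtain g where g: "g \<in> v_forms m" "rat_form (u_value d) = ?D g" using \<phi>_sep[OF u_anti[OF d(2)]] by blast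
  have dg: "degree g \<le> 2 * m" using g(1) by (simp add: v_forms_def)
  \<comment> \<open>The form g is rational; a multiple of it is an integral form w fixed by v, which
    is what exhibits the class as torsion.\<close>
  obtain K w where K: "K > (0 :: nat)" and w: "w \<in> M_component n" "rat_form w = smult (of_nat K) g"
   using denominators[OF dg] .
  have vw: "B3_action braid_v w = w"
   by (rule form_inject[OF act_closed[OF cl(1) w(1)] w(1)])
    (use g(1) in \<open>simp add: form_act_v[OF w(1)] w(2) hsubst_smult v_forms_def\<close>)
  have "of_nat K * u_value d = B3_action braid_u w - w"
   by (rule form_inject[OF A_of_nat_mult[OF u_value_closed[OF d(2)]] A_diff[OF act_closed[OF cl(2) w(1)] w(1)]])
    (simp add: rat_form_hom(5) rat_form_of_nat_mult form_act_u[OF w(1)] w(2) hsubst_smult g(2) smult_diff_right)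
  then obtain a where a: "a \<in> M_component n"
   "\<And>g. g \<in> carrier B3 \<Longrightarrow> of_nat (K * 3) * d g = B3_action g a - a"
   using torsion_of_u_value[OF d(2) w(1) vw] by blast
  have "(\<lambda>gs. of_nat (K * 3) * x gs) = cochain1 (\<lambda>g. B3_action g a - a)"
   unfolding d(1) cochain1_mult[symmetric] by (rule cochain1_cong[OF a(2)])
  then have "(\<lambda>gs. of_nat (K * 3) * x gs) \<in> B 1" using principal_in_B1[OF a(1)] by simp
  note inB = this
  have inZ: "(\<lambda>gs. of_nat (K * 3) * x gs) \<in> carrier (Z 1)"
   using inB subgroup.subset[OF subgroup_B1] by blast
  have "X [^]\<^bsub>H 1\<^esub> (K * 3) = B 1 #>\<^bsub>Z 1\<^esub> (\<lambda>gs. of_nat (K * 3) * x gs)"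
   unfolding x(2) by (rule class_pow[OF disjI1[OF HOL.refl] x(1)])
  also have "\<dots> = \<one>\<^bsub>H 1\<^esub>" using class_eq_one_iff[OF disjI1[OF HOL.refl] inZ] inB by blast
  finally have "X [^]\<^bsub>H 1\<^esub> (K * 3) = \<one>\<^bsub>H 1\<^esub>" .
  then show "\<exists>n :: nat > 0. X [^]\<^bsub>H 1\<^esub> n = \<one>\<^bsub>H 1\<^esub>" using K by (intro exI[of _ "K * 3"]) simp
 next
  fix i assume "i < length cs"
  then have i: "i < betti m" by (simp add: cs_def)
  \<comment> \<open>A multiple of \<open>e i\<close> is integral and is one third of the
    \<open>u_value\<close> of a derivation; on its class only the i-th functional is
    nonzero.\<close>
  have de: "degree (e i) \<le> 2 * m" using e(1)[OF i] by (simp add: u_anti_forms_def)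
  obtain K b where K: "K > (0 :: nat)" and b: "b \<in> M_component n" "rat_form b = smult (of_nat K) (e i)"
   using denominators[OF de] .
  have ub: "B3_action braid_u b = - b"
   by (rule form_inject[OF act_closed[OF cl(2) b(1)] A_uminus[OF b(1)]])
    (use e(1)[OF i] in \<open>simp add: form_act_u[OF b(1)] b(2) hsubst_smult rat_form_hom u_anti_forms_def\<close>)
  obtain d where d: "derivation d" "u_value d = of_nat 3 * b" using derivation_with_u_value[OF b(1) ub] by blast
  have x: "cochain1 d \<in> carrier (Z 1)" using d(1) unfolding carrier_Z1 by blast
  have val: "rat_of_int (c j (B 1 #>\<^bsub>Z 1\<^esub> cochain1 d)) = of_nat (N j) * (3 * (of_nat K * (if j = i then 1 else 0)))"
   if "j < betti m" for j
   unfolding c(2)[OF that x] C[OF d(1)] d(2) rat_form_of_nat_mult b(2) \<phi>(2) e(2)[OF that i] by simp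
  show "\<exists>x\<in>carrier (H 1). (cs ! i) x \<noteq> 0 \<and> (\<forall>j<i. (cs ! j) x = 0)"
  proof (intro bexI conjI allI impI)
   show "B 1 #>\<^bsub>Z 1\<^esub> cochain1 d \<in> carrier (H 1)" unfolding carrier_H using x by blast
   show "(cs ! i) (B 1 #>\<^bsub>Z 1\<^esub> cochain1 d) \<noteq> 0" using val[OF i] i K N(1)[of i] by (auto simp: cs_def)
   show "(cs ! j) (B 1 #>\<^bsub>Z 1\<^esub> cochain1 d) = 0" if "j < i" for j using val[of j] i that by (auto simp: cs_def)
  qed
 qed
 then show ?thesis unfolding H_B3_def n_def[symmetric] by (intro exI[of _ cs]) (simp add: cs_def)
qed

text \<open>Composition with the contraction Psi: on the image of Phi the coordinates are multiplied
  by 6, which keeps the echelon position. If Psi y has order dividing n, then y is annihilated by 36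
  n, since its sixth power comes from H^1.\<close>

lemma (in B3_module_trivial_center) coordinates_H2:
 assumes cs: "coordinates (H 1) cs"
 shows "\<exists>cs'. coordinates (H 2) cs' \<and> length cs' = length cs"
proof -
 interpret H1: comm_group "H 1" by (rule comm_group_H) simp
 interpret H2: comm_group "H 2" by (rule comm_group_H) simp
 obtain \<Phi> \<Psi> where \<Phi>: "\<Phi> \<in> hom (H 1) (H 2)" and \<Psi>: "\<Psi> \<in> hom (H 2) (H 1)"
  and \<Psi>\<Phi>: "\<And>x. x \<in> carrier (H 1) \<Longrightarrow> \<Psi> (\<Phi> x) = x [^]\<^bsub>H 1\<^esub> (6 :: nat)"
  and im: "\<And>y. y \<in> carrier (H 2) \<Longrightarrow> \<exists>x\<in>carrier (H 1). y [^]\<^bsub>H 2\<^esub> (6 :: nat) = \<Phi> x"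
  using cup_and_contraction by blast
 interpret \<Phi>: group_hom "H 1" "H 2" \<Phi> by (intro group_hom.intro group_hom_axioms.intro H1.is_group H2.is_group \<Phi>)
 interpret \<Psi>: group_hom "H 2" "H 1" \<Psi> by (intro group_hom.intro group_hom_axioms.intro H1.is_group H2.is_group \<Psi>)
 have hom: "c \<in> hom (H 1) integer_group" if "c \<in> set cs" for c using cs that by (auto simp: coordinates_def)
 have "coordinates (H 2) (map (\<lambda>c. c \<circ> \<Psi>) cs)"
  unfolding coordinates_def
 proof (intro conjI ballI impI allI)
  show "set (map (\<lambda>c. c \<circ> \<Psi>) cs) \<subseteq> hom (H 2) integer_group"
   unfolding set_map by (intro image_subsetI Group.hom_compose[OF \<Psi>] hom)
  fix y assume y: "y \<in> carrier (H 2)" and z: "\<forall>c\<in>set (map (\<lambda>c. c \<circ> \<Psi>) cs). c y = 0"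
  have "\<Psi> y \<in> carrier (H 1)" by (rule \<Psi>.hom_closed[OF y])
  moreover have "\<forall>c\<in>set cs. c (\<Psi> y) = 0" using z by simp
  ultimately obtain n :: nat where n: "n > 0" "\<Psi> y [^]\<^bsub>H 1\<^esub> n = \<one>\<^bsub>H 1\<^esub>"
   using cs unfolding coordinates_def by blast
  obtain x where x: "x \<in> carrier (H 1)" "y [^]\<^bsub>H 2\<^esub> (6 :: nat) = \<Phi> x" using im[OF y] by blast
  have "x [^]\<^bsub>H 1\<^esub> (6 :: nat) = \<Psi> (y [^]\<^bsub>H 2\<^esub> (6 :: nat))" using \<Psi>\<Phi>[OF x(1)] x(2) by simp
  also have "\<dots> = \<Psi> y [^]\<^bsub>H 1\<^esub> (6 :: nat)" by (rule \<Psi>.hom_nat_pow[OF y])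
  finally have "x [^]\<^bsub>H 1\<^esub> (6 * n) = (\<Psi> y [^]\<^bsub>H 1\<^esub> n) [^]\<^bsub>H 1\<^esub> (6 :: nat)"
   using x(1) y by (metis H1.nat_pow_pow \<Psi>.hom_closed mult.commute)
  then have "x [^]\<^bsub>H 1\<^esub> (6 * n) = \<one>\<^bsub>H 1\<^esub>" unfolding n(2) H1.nat_pow_one .
  then have "\<Phi> x [^]\<^bsub>H 2\<^esub> (6 * n) = \<one>\<^bsub>H 2\<^esub>" using \<Phi>.hom_nat_pow[OF x(1)] by (metis \<Phi>.hom_one)
  then have "y [^]\<^bsub>H 2\<^esub> (6 * (6 * n)) = \<one>\<^bsub>H 2\<^esub>" using x(2) H2.nat_pow_pow[OF y] by metis
  then show "\<exists>n :: nat > 0. y [^]\<^bsub>H 2\<^esub> n = \<one>\<^bsub>H 2\<^esub>" using n(1) by (intro exI[of _ "6 * (6 * n)"]) simp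
 next
  fix i assume i: "i < length (map (\<lambda>c. c \<circ> \<Psi>) cs)"
  then obtain x where x: "x \<in> carrier (H 1)" "(cs ! i) x \<noteq> 0" "\<forall>j<i. (cs ! j) x = 0"
   using cs unfolding coordinates_def by auto
  have "(cs ! j) (\<Psi> (\<Phi> x)) = 6 * (cs ! j) x" if "j \<le> i" for j
   using H1.hom_integer_pow(2)[OF hom x(1), of "cs ! j" 6] i that unfolding \<Psi>\<Phi>[OF x(1)] by simp
  then show "\<exists>x\<in>carrier (H 2). (map (\<lambda>c. c \<circ> \<Psi>) cs ! i) x \<noteq> 0 \<and> (\<forall>j<i. (map (\<lambda>c. c \<circ> \<Psi>) cs ! j) x = 0)"
   using x i by (intro bexI[of _ "\<Phi> x"]) simp_all
 qed
 then show ?thesis by (intro exI[of _ "map (\<lambda>c. c \<circ> \<Psi>) cs"]) simp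
qed

lemma coordinates_H_B3_2:
 assumes m: "m > 0"
 shows "\<exists>cs. coordinates (H_B3 2 (2 * (2 * m))) cs \<and> length cs = betti m"
proof -
 interpret B3_module_trivial_center "M_component (2 * (2 * m))" B3_action
  by (rule B3_module_trivial_center_M) (use m in simp_all)
 show ?thesis using coordinates_H_B3_1[OF m] coordinates_H2 unfolding H_B3_def by metis
qed

section \<open>Degrees not divisible by 4, degree 0, and the comparison of primary parts\<close>

lemma coordinates_Nil:
 assumes "\<And>x. x \<in> carrier L \<Longrightarrow> x [^]\<^bsub>L\<^esub> (2 :: nat) = \<one>\<^bsub>L\<^esub>"
 shows "coordinates L []"
 unfolding coordinates_def using assms by (auto intro!: exI[of _ "2 :: nat"])

lemma H_B3_exponent_2:
 assumes k: "k = 1 \<or> k = 2" and n: "\<not> 4 dvd n" and x: "x \<in> carrier (H_B3 k n)"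
 shows "x [^]\<^bsub>H_B3 k n\<^esub> (2 :: nat) = \<one>\<^bsub>H_B3 k n\<^esub>"
proof -
 interpret B3_module "M_component n" B3_action by (rule B3_module_M)
 have "B3_action braid_c f = - f" if f: "f \<in> M_component n" for f
 proof (cases "even n")
  case True
  then obtain j where j: "n = 2 * j" by blast
  then have "odd j" using n by auto
  then show ?thesis using act_c_M[of f j] f j by simp
 next
  case False
  then have "M_component n = {0}" by (rule M_component_odd)
  then show ?thesis using f act_zero[OF braid_uvc_closed(3)] by simp
 qed
 then show ?thesis using negative_center_torsion[OF _ k] x unfolding H_B3_def by blast
qed

definition free_rank :: "nat \<Rightarrow> nat"
 where "free_rank n = (if 4 dvd n \<and> n > 0 then betti (n div 4) else 0)"

lemma coordinates_H_B3:
 assumes k: "k = 1 \<or> k = 2" and n: "n > 0"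
 shows "\<exists>cs. coordinates (H_B3 k n) cs \<and> length cs = free_rank n"
proof (cases "4 dvd n")
 case True
 then obtain m where m: "n = 2 * (2 * m)" by (auto elim!: dvdE)
 then have "m > 0" "free_rank n = betti m" using n by (simp_all add: free_rank_def)
 then show ?thesis using coordinates_H_B3_1[of m] coordinates_H_B3_2[of m] k m by auto
next
 case False
 then show ?thesis
  using coordinates_Nil[OF H_B3_exponent_2[OF k False]] by (intro exI[of _ "[]"]) (simp add: free_rank_def)
qed

text \<open>On a trivial module, changing the lifts by a1 and a2 changes the obstruction by a2 - a1,
  which is arbitrary.\<close>

lemma H_B3_2_0: "carrier (H_B3 2 0) = {\<one>\<^bsub>H_B3 2 0\<^esub>}"
proof -
 interpret B3_module "M_component 0" B3_action by (rule B3_module_M)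
 have "X = \<one>\<^bsub>H 2\<^esub>" if X: "X \<in> carrier (H 2)" for X
 proof -
  obtain x where x: "x \<in> carrier (Z 2)" "X = B 2 #>\<^bsub>Z 2\<^esub> x" using X unfolding carrier_H by blast
  obtain f where f: "x = cochain2 f" "factor_set f" using x(1) by (rule Z2_cases)
  have fA: "f g h \<in> M_component 0" if "g \<in> carrier B3" "h \<in> carrier B3" for g h
   using f(2) that by (simp add: factor_set_def)
  have r: "braid_obstruction f \<in> M_component 0"
   unfolding braid_obstruction_def by (intro A_diff A_add act_closed fA braid_closed m_closed)
  have "x \<in> B 2"
   unfolding f(1)
   by (rule factor_set_coboundaryI[OF f(2) A_uminus[OF r] A_zero])
    (use r in \<open>simp add: B3_action_M_0 A_closed M_component_0 M_component_uminus M_component_add M_component_diff\<close>)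
  then show ?thesis unfolding x(2) using class_eq_one_iff[OF disjI2[OF HOL.refl] x(1)] by blast
 qed
 moreover have "\<one>\<^bsub>H 2\<^esub> \<in> carrier (H 2)"
  by (rule monoid.one_closed[OF comm_monoid.axioms(1)[OF comm_group.axioms(1)[OF comm_group_H]]]) simp
 ultimately show ?thesis unfolding H_B3_def by blast
qed

lemma primary_part_trivial:
 assumes L: "group L" and p: "coprime p 2" and e: "\<And>x. x \<in> carrier L \<Longrightarrow> x [^]\<^bsub>L\<^esub> (2 :: nat) = \<one>\<^bsub>L\<^esub>"
 shows "primary_part p L = {\<one>\<^bsub>L\<^esub>}"
proof -
 interpret group L by (rule L)
 have "x = \<one>\<^bsub>L\<^esub>" if x: "x \<in> carrier L" "x [^]\<^bsub>L\<^esub> (p ^ k) = \<one>\<^bsub>L\<^esub>" for x k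
  using coprime_pow_eq_one[OF x(1) x(2) e[OF x(1)]] p by simp
 then show ?thesis by (auto simp: primary_part_def)
qed

lemma primary_part_H_B3_1_0:
 assumes p: "prime p" "odd p"
 shows "primary_part p (H_B3 1 0) = {\<one>\<^bsub>H_B3 1 0\<^esub>}"
proof -
 interpret comm_group "H_B3 1 0" by (rule H_B3_comm_group) simp
 have "x = \<one>\<^bsub>H_B3 1 0\<^esub>" if "x \<in> primary_part p (H_B3 1 0)" for x
  using primary_class_cover[OF p that] H1_cover_trivial[OF p, of 0]
   weight_index_0[OF prime_ge_2_nat[OF p(1)]] by force
 moreover have "\<one>\<^bsub>H_B3 1 0\<^esub> \<in> primary_part p (H_B3 1 0)" by (rule subgroup.one_closed[OF subgroup_primary_part])
 ultimately show ?thesis by blast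
qed

lemma graded_iso_sym:
 assumes "group G" and homog: "\<And>n. homog G n \<subseteq> carrier G" and "graded_iso G H"
 shows "graded_iso H G"
proof -
 obtain h where h: "h \<in> iso G H" "\<And>n. h ` homog G n = homog H n" using assms(3) unfolding graded_iso_def by blast
 have inj: "inj_on h (carrier G)" using h(1) by (simp add: iso_def bij_betw_def)
 have "inv_into (carrier G) h ` homog H n = homog G n" for n
  unfolding h(2)[symmetric] using inv_into_image_cancel[OF inj homog] .
 then show ?thesis unfolding graded_iso_def using group.iso_set_sym[OF assms(1) h(1)] by blast
qed

lemma primary_part_H_B3_iso:
 assumes p: "prime p" "p \<noteq> 2" "p \<noteq> 3"
 shows "\<exists>h\<in>hom (H_B3 1 n) (H_B3 2 n). bij_betw h (primary_part p (H_B3 1 n)) (primary_part p (H_B3 2 n))"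
proof -
 have odd: "odd p" using p prime_odd_nat prime_ge_2_nat[of p] by force
 have c2: "coprime p 2" and c3: "coprime p 3"
  using p primes_coprime[of p 2] primes_coprime[of p 3] by (simp_all add: numeral_3_eq_3[symmetric])
 have H1: "comm_group (H_B3 1 n)" and H2: "comm_group (H_B3 2 n)" by (simp_all add: H_B3_comm_group)
 interpret H1: comm_group "H_B3 1 n" by (rule H1)
 interpret H2: comm_group "H_B3 2 n" by (rule H2)
 have triv: "?thesis" if "primary_part p (H_B3 2 n) = {\<one>\<^bsub>H_B3 2 n\<^esub>}" "primary_part p (H_B3 1 n) = {\<one>\<^bsub>H_B3 1 n\<^esub>}"
 proof (rule bexI)
  show "(\<lambda>_. \<one>\<^bsub>H_B3 2 n\<^esub>) \<in> hom (H_B3 1 n) (H_B3 2 n)"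
   by (rule homI) (simp_all del: One_nat_def)
  show "bij_betw (\<lambda>_. \<one>\<^bsub>H_B3 2 n\<^esub>) (primary_part p (H_B3 1 n)) (primary_part p (H_B3 2 n))"
   unfolding that by (simp add: bij_betw_def)
 qed
 consider "n = 0" | "n > 0" "4 dvd n" | "\<not> 4 dvd n" by (cases n) auto
 then show ?thesis
 proof cases
  case 1
  have "primary_part p (H_B3 2 n) = {\<one>\<^bsub>H_B3 2 n\<^esub>}" using H_B3_2_0 unfolding 1 by (auto simp: primary_part_def 1[symmetric])
  then show ?thesis using triv primary_part_H_B3_1_0[OF p(1) odd] 1 by simp
 next
  case 3
  show ?thesis
   by (rule triv; rule primary_part_trivial[OF _ c2 H_B3_exponent_2[OF _ 3]])
    (simp_all add: H1.is_group H2.is_group del: One_nat_def)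
 next
  case 2
  then obtain m where m: "n = 2 * (2 * m)" "m > 0" by (auto elim!: dvdE)
  interpret B3_module_trivial_center "M_component n" B3_action
   unfolding m(1) by (rule B3_module_trivial_center_M) (use m(2) in simp_all)
  obtain \<Phi> \<Psi> where \<Phi>: "\<Phi> \<in> hom (H 1) (H 2)" and \<Psi>: "\<Psi> \<in> hom (H 2) (H 1)"
   and \<Psi>\<Phi>: "\<And>x. x \<in> carrier (H 1) \<Longrightarrow> \<Psi> (\<Phi> x) = x [^]\<^bsub>H 1\<^esub> (6 :: nat)"
   and im: "\<And>y. y \<in> carrier (H 2) \<Longrightarrow> \<exists>x\<in>carrier (H 1). y [^]\<^bsub>H 2\<^esub> (6 :: nat) = \<Phi> x"
   using cup_and_contraction by blast
  have "bij_betw \<Phi> (primary_part p (H 1)) (primary_part p (H 2))"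
  proof (rule primary_transfer[OF _ _ \<Phi> \<Psi> \<Psi>\<Phi> im])
   have "coprime p (2 * 3)" using c2 c3 by (simp only: coprime_mult_right_iff)
   then show "coprime (6 :: nat) p" by (simp add: coprime_commute)
  qed (use H1 H2 in \<open>simp_all only: H_B3_def\<close>)
  then show ?thesis unfolding H_B3_def using \<Phi> by blast
 qed
qed

text \<open>With s = t^4 the denominator of the generating function is (1 - s^2) (1 - s^3) = 1 - s^2
  - s^3 + s^5. Both sides are written as sums to avoid subtraction.\<close>

lemma betti_recurrence: "betti (k + 6) + betti (k + 1) = betti (k + 4) + betti (k + 3)"
proof -
 have "(k + 6) div 3 = k div 3 + 2" "(k + 4) div 3 = (k + 1) div 3 + 1" "(k + 3) div 3 = k div 3 + 1" by simp_all
 then show ?thesis unfolding betti_def by (simp add: add.commute)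
qed

lemma free_rank_fps:
 "Abs_fps (\<lambda>n. of_nat (free_rank n) :: rat) =
  fps_X ^ 4 * (1 + fps_X ^ 4 - fps_X ^ 12 + fps_X ^ 16) / ((1 - fps_X ^ 8) * (1 - fps_X ^ 12))"
proof -
 define F where "F = Abs_fps (\<lambda>n. of_nat (free_rank n) :: rat)"
 let ?q = "(1 - fps_X ^ 8) * (1 - fps_X ^ 12) :: rat fps"
 have "F * ?q = F - F * fps_X ^ 8 - F * fps_X ^ 12 + F * fps_X ^ 20"
  by (simp add: algebra_simps flip: power_add)
 also have "\<dots> = fps_X ^ 4 + fps_X ^ 8 - fps_X ^ 16 + fps_X ^ 20"
 proof (rule fps_ext)
  fix n
  have r0: "free_rank j = 0" if "\<not> 4 dvd j" for j using that by (simp add: free_rank_def)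
  have r4: "free_rank (4 * j) = (if j = 0 then 0 else betti j)" for j by (simp add: free_rank_def)
  have nth: "fps_nth (F - F * fps_X ^ 8 - F * fps_X ^ 12 + F * fps_X ^ 20) n
    = of_nat (free_rank n) - (if n < 8 then 0 else of_nat (free_rank (n - 8)))
     - (if n < 12 then 0 else of_nat (free_rank (n - 12))) + (if n < 20 then 0 else of_nat (free_rank (n - 20)))"
   by (simp add: F_def fps_X_power_mult_right_nth)
  show "fps_nth (F - F * fps_X ^ 8 - F * fps_X ^ 12 + F * fps_X ^ 20) n
    = fps_nth (fps_X ^ 4 + fps_X ^ 8 - fps_X ^ 16 + fps_X ^ 20) n"
  proof (cases "4 dvd n")
   case False
   then have "\<not> 4 dvd n - c" if "4 dvd c" "c \<le> n" for c
    using that by (metis dvd_diffD)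
   then have "free_rank n = 0" "8 \<le> n \<Longrightarrow> free_rank (n - 8) = 0" "12 \<le> n \<Longrightarrow> free_rank (n - 12) = 0"
    "20 \<le> n \<Longrightarrow> free_rank (n - 20) = 0" using False by (auto intro!: r0)
   moreover have "n \<noteq> 4" "n \<noteq> 8" "n \<noteq> 16" "n \<noteq> 20" using False by auto
   ultimately show ?thesis unfolding nth by (simp add: fps_X_power_nth not_less)
  next
   case True
   then obtain m where n: "n = 4 * m" by blast
   have sub: "n - 8 = 4 * (m - 2)" "n - 12 = 4 * (m - 3)" "n - 20 = 4 * (m - 5)" using n by simp_all
   \<comment> \<open>The numerator has degree 5 in s = t^4: the indices up to 5 are computed, and
     from 6 on the recurrence applies.\<close>
   consider "m = 0" | "m = 1" | "m = 2" | "m = 3" | "m = 4" | "m = 5" | k where "m = k + 6"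
   proof -
    have "m = 0 \<or> m = 1 \<or> m = 2 \<or> m = 3 \<or> m = 4 \<or> m = 5 \<or> (\<exists>k. m = k + 6)" by presburger
    then show ?thesis using that by blast
   qed
   then show ?thesis
   proof cases
    case 7
    have "rat_of_nat (betti (k + 6)) + of_nat (betti (k + 1)) = of_nat (betti (k + 4)) + of_nat (betti (k + 3))"
     unfolding of_nat_add[symmetric] betti_recurrence ..
    then show ?thesis unfolding nth sub unfolding n r4 7 by (simp add: fps_X_power_nth add.commute)
   qed (unfold nth sub, unfold n r4, simp_all add: betti_def fps_X_power_nth)
  qed
 qed
 also have "\<dots> = fps_X ^ 4 * (1 + fps_X ^ 4 - fps_X ^ 12 + fps_X ^ 16)"
  by (simp add: algebra_simps flip: power_add)
 finally have eq: "F * ?q = fps_X ^ 4 * (1 + fps_X ^ 4 - fps_X ^ 12 + fps_X ^ 16)" .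
 have "fps_nth ?q 0 \<noteq> 0" by simp
 then have "?q \<noteq> 0" by fastforce
 then show ?thesis unfolding eq[symmetric] F_def[symmetric] by simp
qed

lemma free_parts_group: "comm_group L \<Longrightarrow> F \<in> free_parts L \<Longrightarrow> group F"
 using comm_group.axioms(2) group.subgroup_imp_group
 by (fastforce simp: free_parts_def free_summand_def direct_summand_def)

lemma free_parts_H_B3:
 assumes k: "k = 1 \<or> k = 2" and n: "n > 0"
 shows "free_parts (H_B3 k n) \<noteq> {}"
  and "F \<in> free_parts (H_B3 k n) \<Longrightarrow> F \<cong> product_group {..<free_rank n} (\<lambda>_. integer_group)"
 using coordinates_H_B3[OF k n] free_parts_coordinates[OF H_B3_comm_group[OF k]] by metis+

theorem theorem3p9:
  shows "(\<forall>p::nat. prime p \<and> p \<noteq> 2 \<and> p \<noteq> 3 \<longrightarrow>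
           graded_iso (graded_primary_part p (H_B3_M 2)) (graded_primary_part p (H_B3_M 1)) \<and>
           graded_iso (graded_primary_part p (H_B3_M 1))
             (Gamma_p_plus p (2 * (p + 1)) (2 * p * (p - 1))))
    \<and> (\<exists>f :: nat \<Rightarrow> nat.
         Abs_fps (\<lambda>n. of_nat (f n) :: rat) =
           fps_X ^ 4 * (1 + fps_X ^ 4 - fps_X ^ 12 + fps_X ^ 16)
             / ((1 - fps_X ^ 8) * (1 - fps_X ^ 12)) \<and>
         (\<forall>n>0.
           finitely_generated_group (H_B3 2 n) \<and> finitely_generated_group (H_B3 1 n) \<and>
           free_parts (H_B3 2 n) \<noteq> {} \<and> free_parts (H_B3 1 n) \<noteq> {} \<and>
           (\<forall>F2 \<in> free_parts (H_B3 2 n). \<forall>F1 \<in> free_parts (H_B3 1 n).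
              F2 \<cong> F1 \<and> F1 \<cong> product_group {..<f n} (\<lambda>_. integer_group))))"
proof (intro conjI allI impI exI[of _ free_rank])
 fix p :: nat assume p: "prime p \<and> p \<noteq> 2 \<and> p \<noteq> 3"
 then have odd: "odd p" using prime_odd_nat[of p] prime_ge_2_nat[of p] by fastforce
 show "graded_iso (graded_primary_part p (H_B3_M 2)) (graded_primary_part p (H_B3_M 1))"
  unfolding H_B3_M_def
 proof (rule graded_iso_sym)
  have L: "comm_group (H_B3 k n)" if "k = 1 \<or> k = 2" for k n using H_B3_comm_group[OF that] .
  show "group (graded_primary_part p (graded_direct_sum (H_B3 1)))"
   by (rule group_graded_primary_part[OF L]) simp
  show "homog (graded_primary_part p (graded_direct_sum (H_B3 1))) n
    \<subseteq> carrier (graded_primary_part p (graded_direct_sum (H_B3 1)))" for n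
   by (simp add: graded_primary_part_def)
  show "graded_iso (graded_primary_part p (graded_direct_sum (H_B3 1))) (graded_primary_part p (graded_direct_sum (H_B3 2)))"
   by (rule graded_iso_primary) (use p primary_part_H_B3_iso L in simp_all)
 qed
 show "graded_iso (graded_primary_part p (H_B3_M 1)) (Gamma_p_plus p (2 * (p + 1)) (2 * p * (p - 1)))"
  using graded_iso_H1_Gamma[OF _ odd] p by simp
next
 fix n :: nat assume n: "n > 0"
 have iso: "F \<cong> product_group {..<free_rank n} (\<lambda>_. integer_group)"
  if "F \<in> free_parts (H_B3 k n)" "k = 1 \<or> k = 2" for F k
  using free_parts_H_B3(2)[OF that(2) n that(1)] .
 show "free_parts (H_B3 2 n) \<noteq> {}" "free_parts (H_B3 1 n) \<noteq> {}"
  using free_parts_H_B3(1)[OF _ n] by simp_all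
 show "\<forall>F2\<in>free_parts (H_B3 2 n). \<forall>F1\<in>free_parts (H_B3 1 n).
   F2 \<cong> F1 \<and> F1 \<cong> product_group {..<free_rank n} (\<lambda>_. integer_group)"
 proof (intro ballI conjI)
  fix F2 F1 assume F2: "F2 \<in> free_parts (H_B3 2 n)" and F1: "F1 \<in> free_parts (H_B3 1 n)"
  show F1_iso: "F1 \<cong> product_group {..<free_rank n} (\<lambda>_. integer_group)" by (rule iso[OF F1]) simp
  have "F2 \<cong> product_group {..<free_rank n} (\<lambda>_. integer_group)" by (rule iso[OF F2]) simp
  also have "\<dots> \<cong> F1"
   using group.iso_sym[OF free_parts_group[OF H_B3_comm_group F1] F1_iso] by simp
  finally show "F2 \<cong> F1" .
 qed
qed (simp_all del: One_nat_def add: free_rank_fps finitely_generated_H_B3_1 finitely_generated_H_B3_2)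

end
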